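(* Let $X$ be a very general hypersurface of bi-degree $(d,2)$ in $\mathbb{P}^{n-1} \times \mathbb{P}^2$ (over $\mathbb{C}$). If $d \ge n \ge 3$, then $X$ is not stably rational.
   Context: The ground field is $\mathbb{C}$. A variety $X$ of dimension $n$ is stably rational if $X \times \mathbb{P}^m$ is birational to $\mathbb{P}^{n+m}$ for some $m \ge 0$. "Very general" means outside a countable union of proper closed subsets of the parameter space of such hypersurfaces. *)

theory Defs
  imports "HOL-Analysis.Analysis" "HOL-Library.Poly_Mapping"
begin

section \<open>Products of projective spaces\<close>

text \<open>
  A family \<open>J :: 'b \<Rightarrow> 'j set\<close> of finite sets, with \<open>'b\<close> a finite type, stands for the product over
  \<open>b\<close> of the complex projective spaces with homogeneous coordinates indexed by \<open>J b\<close>.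
  A point is an equivalence class of coordinate vectors \<open>x :: 'b \<Rightarrow> 'j \<Rightarrow> complex\<close>, where
  each block \<open>x b\<close> is nonzero and may be rescaled independently of the others. Vectors vanish
  outside \<open>J\<close>, so that each is determined by its coordinates.
\<close>

definition hom_vectors :: "('b \<Rightarrow> 'j set) \<Rightarrow> ('b \<Rightarrow> 'j \<Rightarrow> complex) set" where
  "hom_vectors J = {x. \<forall>b. (\<exists>j\<in>J b. x b j \<noteq> 0) \<and> (\<forall>j. j \<notin> J b \<longrightarrow> x b j = 0)}"

definition proj_point :: "('b \<Rightarrow> 'j \<Rightarrow> complex) \<Rightarrow> ('b \<Rightarrow> 'j \<Rightarrow> complex) set" where
  "proj_point x = {(\<lambda>b j. c b * x b j) | c. \<forall>b. c b \<noteq> 0}"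

definition multiproj :: "('b \<Rightarrow> 'j set) \<Rightarrow> ('b \<Rightarrow> 'j \<Rightarrow> complex) set set" where
  "multiproj J = proj_point ` hom_vectors J"

text \<open>The index family of the projective space of dimension \<open>r\<close>.\<close>

definition PP :: "nat \<Rightarrow> unit \<Rightarrow> nat set" where
  "PP r = (\<lambda>_. {..r})"

text \<open>
  The product of the ambient spaces with index families \<open>J\<close> and \<open>K\<close> has index family
  \<open>case_sum J K\<close>; the following is the product of subsets of the two ambient spaces.
\<close>

definition proj_prod :: "('b \<Rightarrow> 'j \<Rightarrow> complex) set set \<Rightarrow> ('c \<Rightarrow> 'j \<Rightarrow> complex) set set
    \<Rightarrow> ('b + 'c \<Rightarrow> 'j \<Rightarrow> complex) set set" where
  "proj_prod X Y = {proj_point (case_sum x y) | x y. x \<in> \<Union>X \<and> y \<in> \<Union>Y}"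

section \<open>Multihomogeneous polynomials\<close>

text \<open>Polynomials in variables indexed by pairs (block, coordinate), as finitely supported maps
  from exponent vectors to coefficients.\<close>

type_synonym 'v monom = "'v \<Rightarrow>\<^sub>0 nat"
type_synonym 'v mpoly = "'v monom \<Rightarrow>\<^sub>0 complex"

definition eval :: "('b \<times> 'j) mpoly \<Rightarrow> ('b \<Rightarrow> 'j \<Rightarrow> complex) \<Rightarrow> complex" where
  "eval f x = (\<Sum>m\<in>Poly_Mapping.keys f. Poly_Mapping.lookup f m *
     (\<Prod>(b, j)\<in>Poly_Mapping.keys m. x b j ^ Poly_Mapping.lookup m (b, j)))"

definition monomials :: "('b \<Rightarrow> 'j set) \<Rightarrow> ('b \<Rightarrow> nat) \<Rightarrow> ('b \<times> 'j) monom set" where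
  "monomials J \<delta> = {m. Poly_Mapping.keys m \<subseteq> Sigma UNIV J \<and>
     (\<forall>b. (\<Sum>j\<in>J b. Poly_Mapping.lookup m (b, j)) = \<delta> b)}"

text \<open>The zero polynomial is multihomogeneous of every multidegree.\<close>

definition multihom :: "('b \<Rightarrow> 'j set) \<Rightarrow> ('b \<Rightarrow> nat) \<Rightarrow> ('b \<times> 'j) mpoly \<Rightarrow> bool" where
  "multihom J \<delta> f \<longleftrightarrow> Poly_Mapping.keys f \<subseteq> monomials J \<delta>"

definition hypersurface :: "('b \<Rightarrow> 'j set) \<Rightarrow> ('b \<times> 'j) mpoly \<Rightarrow> ('b \<Rightarrow> 'j \<Rightarrow> complex) set set" where
  "hypersurface J f = {P \<in> multiproj J. \<forall>x\<in>P. eval f x = 0}"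

section \<open>Zariski topology and dimension\<close>

text \<open>The generating sets form a base of the usual Zariski topology: the complements of
  the zero loci of \<open>f\<close> and \<open>g\<close> meet in the complement of the zero locus of the product.\<close>

definition zariski :: "('b \<Rightarrow> 'j set) \<Rightarrow> ('b \<Rightarrow> 'j \<Rightarrow> complex) set topology" where
  "zariski J = topology_generated_by {multiproj J - hypersurface J f | f \<delta>. multihom J \<delta> f}"

definition irreducible_closedin :: "'a topology \<Rightarrow> 'a set \<Rightarrow> bool" where
  "irreducible_closedin T Z \<longleftrightarrow> closedin T Z \<and> Z \<noteq> {} \<and>
     (\<forall>A B. closedin T A \<and> closedin T B \<and> Z = A \<union> B \<longrightarrow> Z = A \<or> Z = B)"

text \<open>Krull dimension. The supremum over the naturals is meaningful only for bounded chain
  lengths, which is the case for nonempty closed subsets of products of projective spaces.\<close>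

definition krull_dim :: "'a topology \<Rightarrow> nat" where
  "krull_dim T = Sup {l. \<exists>Z. (\<forall>i\<le>l. irreducible_closedin T (Z i)) \<and> (\<forall>i<l. Z i \<subset> Z (Suc i))}"

section \<open>Regular maps and birational equivalence\<close>

text \<open>A regular map into a product of projective spaces is given locally, in each target
  factor \<open>c\<close>, by a tuple of multihomogeneous polynomials \<open>f c k\<close> of one common multidegree
  \<open>\<delta> c\<close> without common zero.\<close>

definition regular_on :: "('b \<Rightarrow> 'j set) \<Rightarrow> ('b \<Rightarrow> 'j \<Rightarrow> complex) set set
    \<Rightarrow> ('c \<Rightarrow> 'k set) \<Rightarrow> (('b \<Rightarrow> 'j \<Rightarrow> complex) set \<Rightarrow> ('c \<Rightarrow> 'k \<Rightarrow> complex) set) \<Rightarrow> bool" where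
  "regular_on J U K \<phi> \<longleftrightarrow> (\<forall>P\<in>U. \<exists>W f \<delta>.
     openin (subtopology (zariski J) U) W \<and> P \<in> W \<and>
     (\<forall>c. \<forall>k\<in>K c. multihom J (\<delta> c) (f c k)) \<and>
     (\<forall>Q\<in>W. \<forall>x\<in>Q. let y = (\<lambda>c k. if k \<in> K c then eval (f c k) x else 0)
        in y \<in> hom_vectors K \<and> \<phi> Q = proj_point y))"

definition isomorphic_sets :: "('b \<Rightarrow> 'j set) \<Rightarrow> ('b \<Rightarrow> 'j \<Rightarrow> complex) set set
    \<Rightarrow> ('c \<Rightarrow> 'k set) \<Rightarrow> ('c \<Rightarrow> 'k \<Rightarrow> complex) set set \<Rightarrow> bool" where
  "isomorphic_sets J U K V \<longleftrightarrow> (\<exists>\<phi> \<psi>. regular_on J U K \<phi> \<and> regular_on K V J \<psi> \<and>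
     \<phi> ` U \<subseteq> V \<and> \<psi> ` V \<subseteq> U \<and> (\<forall>P\<in>U. \<psi> (\<phi> P) = P) \<and> (\<forall>Q\<in>V. \<phi> (\<psi> Q) = Q))"

definition dense_open :: "('b \<Rightarrow> 'j set) \<Rightarrow> ('b \<Rightarrow> 'j \<Rightarrow> complex) set set
    \<Rightarrow> ('b \<Rightarrow> 'j \<Rightarrow> complex) set set \<Rightarrow> bool" where
  "dense_open J X U \<longleftrightarrow> openin (subtopology (zariski J) X) U \<and>
     subtopology (zariski J) X closure_of U = X"

definition birational :: "('b \<Rightarrow> 'j set) \<Rightarrow> ('b \<Rightarrow> 'j \<Rightarrow> complex) set set
    \<Rightarrow> ('c \<Rightarrow> 'k set) \<Rightarrow> ('c \<Rightarrow> 'k \<Rightarrow> complex) set set \<Rightarrow> bool" where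
  "birational J X K Y \<longleftrightarrow>
     (\<exists>U V. dense_open J X U \<and> dense_open K Y V \<and> isomorphic_sets J U K V)"

text \<open>Irreducibility of \<open>X\<close> need not be required separately: a space with a dense open subset
  isomorphic to a nonempty open subset of a projective space is irreducible, and then so is
  its factor \<open>X\<close>.\<close>

definition stably_rational :: "('b \<Rightarrow> nat set) \<Rightarrow> ('b \<Rightarrow> nat \<Rightarrow> complex) set set \<Rightarrow> bool" where
  "stably_rational J X \<longleftrightarrow> (\<exists>m.
     birational (case_sum J (PP m)) (proj_prod X (multiproj (PP m)))
       (PP (krull_dim (subtopology (zariski J) X) + m))
       (multiproj (PP (krull_dim (subtopology (zariski J) X) + m))))"

section \<open>Very general hypersurfaces\<close>

text \<open>The hypersurfaces of multidegree \<open>\<delta>\<close> are parametrized by the projective space of nonzero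
  forms, whose homogeneous coordinates are the coefficients, indexed by the monomials.\<close>

definition coeff_space :: "('b \<Rightarrow> 'j set) \<Rightarrow> ('b \<Rightarrow> nat) \<Rightarrow> unit \<Rightarrow> ('b \<times> 'j) monom set" where
  "coeff_space J \<delta> = (\<lambda>_. monomials J \<delta>)"

definition param_point :: "('b \<times> 'j) mpoly \<Rightarrow> (unit \<Rightarrow> ('b \<times> 'j) monom \<Rightarrow> complex) set" where
  "param_point f = proj_point (\<lambda>_. Poly_Mapping.lookup f)"

definition for_very_general_hypersurface :: "('b \<Rightarrow> 'j set) \<Rightarrow> ('b \<Rightarrow> nat)
    \<Rightarrow> (('b \<Rightarrow> 'j \<Rightarrow> complex) set set \<Rightarrow> bool) \<Rightarrow> bool" where
  "for_very_general_hypersurface J \<delta> Q \<longleftrightarrow> (\<exists>\<Z>. countable \<Z> \<and>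
     (\<forall>Z\<in>\<Z>. closedin (zariski (coeff_space J \<delta>)) Z \<and> Z \<noteq> multiproj (coeff_space J \<delta>)) \<and>
     (\<forall>f. multihom J \<delta> f \<and> f \<noteq> 0 \<and> param_point f \<notin> \<Union>\<Z> \<longrightarrow> Q (hypersurface J f)))"

end

theory Submission
  imports Defs "Jordan_Normal_Form.Determinant" "HOL-Algebra.Algebraic_Closure_Type" "HOL-Library.Z2"
    "HOL-Library.Countable_Set" "HOL-Computational_Algebra.Polynomial_FPS"
    "HOL-Computational_Algebra.Fundamental_Theorem_Algebra"
begin

hide_const (open) up_ring.coeff up_ring.monom Module.smult Ideal.primeideal UnivPoly.eval Polynomials.degree
no_notation Polynomials.var (\<open>X\<index>\<close>)

text \<open>
  Degeneration to characteristic 2. Over a place of \<open>\<complex>\<close> with residue field the algebraic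
  closure of \<open>\<F>\<^sub>2\<close>, the hypersurface specialises to the conic bundle
  \<open>\<Sum>\<^sub>j x\<^bsup>K\<^esup> (x\<^sub>j\<^bsup>2r\<^esup> y\<^sub>1\<^sup>2 + x\<^bsub>j+1\<^esub>\<^bsup>2r\<^esup> y\<^sub>0\<^sup>2) + x\<^sup>\<gamma> (y\<^sub>1 y\<^sub>2 + y\<^sub>2\<^sup>2) = 0\<close>, with \<open>K\<close> and \<open>r\<close> depending on \<open>j\<close>.
  On it the form \<open>dlog (x\<^sub>1/x\<^sub>0) \<and> \<dots> \<and> dlog (x\<^bsub>n-1\<^esub>/x\<^sub>0)\<close> has no poles, because in characteristic 2 the
  equation forces enough linear relations between the logarithmic derivatives at every discrete
  valuation. Hence its coefficient, the determinant of the logarithmic derivatives, is constant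
  along a rational curve, and in particular agrees at the two ends of the curve. A
  stable birational parametrisation would give a rational curve over \<open>\<complex>\<close> that joins the generic point
  to a fixed point; the edges of its Newton polygon specialise it to a chain of rational curves in
  the special fibre, again with the generic point and a constant point at its ends. But the
  determinant is nonzero at the generic point and zero at a constant point.

  A suitable place exists as soon as every integer form in the coefficients that vanishes at the given
  hypersurface also vanishes, modulo 2, at the special one; this excludes countably many
  hypersurfaces in the parameter space.
\<close>

section \<open>Relations compatible with ring operations\<close>

text \<open>Poles are tested only along curves in a parameter \<open>s\<close>, with derivations
  that act on coefficients and kill \<open>s\<close>, so the determinant becomes an element of a
  rational function field. The special equation is shaped by this test. A monomial times a square
  has the logarithmic derivative of the monomial, so each summand contributes through its class
  \<open>cls j\<close> only; all classes have size congruent to \<open>d\<close> mod 2, hence the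
  coefficients of the differentiated equation add up to zero and only the ratios
  \<open>x i / x 0\<close> enter. The cyclic shift puts unit and nonunit coordinates side by side,
  which rules out the case in which the differentiated equation says nothing. The obstacle in
  lifting is that the place on the complex numbers is not discrete: all roots exist there, so
  \<open>s\<close> has to be rescaled by a suitable constant for every edge. Reducing the curve then
  requires that every nonzero value at the generic point has a nonzero reduction after scaling by a
  complex constant. This Gauss-type property rests on the irreducibility of the special fibre, that
  is, on \<open>y2\<close> not being a rational function of the other coordinates.\<close>

locale ring_rel =
  fixes R :: "'a::comm_ring_1 \<Rightarrow> 'b::comm_ring_1 \<Rightarrow> bool"
  assumes rel_zero: "R 0 0" and rel_one: "R 1 1"
    and rel_add: "R a a' \<Longrightarrow> R b b' \<Longrightarrow> R (a + b) (a' + b')"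
    and rel_mult: "R a a' \<Longrightarrow> R b b' \<Longrightarrow> R (a * b) (a' * b')"
    and rel_uminus: "R a a' \<Longrightarrow> R (- a) (- a')"
begin

lemma rel_diff: "R a a' \<Longrightarrow> R b b' \<Longrightarrow> R (a - b) (a' - b')"
  using rel_add[OF _ rel_uminus] by fastforce

lemma rel_sum: "(\<And>x. x \<in> A \<Longrightarrow> R (f x) (g x)) \<Longrightarrow> R (sum f A) (sum g A)"
  by (induction A rule: infinite_finite_induct) (auto intro: rel_zero rel_add)

lemma rel_prod: "(\<And>x. x \<in> A \<Longrightarrow> R (f x) (g x)) \<Longrightarrow> R (prod f A) (prod g A)"
  by (induction A rule: infinite_finite_induct) (auto intro: rel_one rel_mult)

lemma rel_power: "R a b \<Longrightarrow> R (a ^ n) (b ^ n)"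
  by (induction n) (auto intro: rel_one rel_mult)

lemma rel_of_nat: "R (of_nat n) (of_nat n)"
  by (induction n) (auto intro: rel_zero rel_one rel_add)

lemma rel_of_int: "R (of_int n) (of_int n)"
  by (cases n) (auto intro: rel_of_nat rel_uminus simp del: of_nat_Suc)

text \<open>A determinant is a polynomial in its entries. With an idle second argument this gives
  integrality, with two arguments in one ring it gives congruence modulo a maximal ideal.\<close>

lemma rel_det:
  assumes "A \<in> carrier_mat n n" "B \<in> carrier_mat n n"
    and "\<And>i j. i < n \<Longrightarrow> j < n \<Longrightarrow> R (A $$ (i, j)) (B $$ (i, j))"
  shows "R (det A) (det B)"
proof -
  have "p i < n" if "p permutes {0..<n}" "i < n" for p i
    using permutes_in_image[OF that(1)] that(2) by auto
  moreover have "R (signof p) (signof p)" for p :: "nat \<Rightarrow> nat"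
    by (simp add: sign_def rel_one rel_uminus)
  ultimately show ?thesis
    unfolding det_def'[OF assms(1)] det_def'[OF assms(2)]
    by (intro rel_sum rel_mult rel_prod assms) auto
qed

lemma rel_fps: "ring_rel (\<lambda>f g. \<forall>n. R (fps_nth f n) (fps_nth g n))"
  by unfold_locales
    (auto simp: fps_mult_nth intro: rel_zero rel_one rel_add rel_uminus intro!: rel_sum rel_mult)

lemma rel_poly: "ring_rel (\<lambda>f g. \<forall>n. R (coeff f n) (coeff g n))"
  by unfold_locales
    (auto simp: coeff_mult coeff_1 intro: rel_zero rel_one rel_add rel_uminus intro!: rel_sum rel_mult)

end

section \<open>Evaluation of polynomials\<close>

definition monom_val :: "('v \<Rightarrow> 'b::comm_ring_1) \<Rightarrow> ('v \<Rightarrow>\<^sub>0 nat) \<Rightarrow> 'b" where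
  "monom_val v m = (\<Prod>i\<in>Poly_Mapping.keys m. v i ^ Poly_Mapping.lookup m i)"

lemma monom_val_superset:
  assumes "finite V" "Poly_Mapping.keys m \<subseteq> V"
  shows "monom_val v m = (\<Prod>i\<in>V. v i ^ Poly_Mapping.lookup m i)"
  unfolding monom_val_def using assms
  by (intro prod.mono_neutral_left) (auto simp: in_keys_iff)

lemma monom_val_0 [simp]: "monom_val v 0 = 1"
  by (simp add: monom_val_def)

lemma monom_val_add: "monom_val v (m + m') = monom_val v m * monom_val v m'"
proof -
  let ?V = "Poly_Mapping.keys m \<union> Poly_Mapping.keys m'"
  have "Poly_Mapping.keys (m + m') \<subseteq> ?V"
    by (rule keys_add)
  then show ?thesis
    by (simp add: monom_val_superset[of ?V] lookup_add power_add prod.distrib)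
qed

lemma monom_val_single [simp]: "monom_val v (Poly_Mapping.single i k) = v i ^ k"
  by (cases "k = 0") (auto simp: monom_val_def)

text \<open>The coefficient map \<open>\<iota>\<close> lets one polynomial over the integers or the
  complex numbers be evaluated in the residue field and in all polynomial, series and fraction rings
  of the proof.\<close>

definition ev :: "('a::comm_ring_1 \<Rightarrow> 'b::comm_ring_1) \<Rightarrow> (('v \<Rightarrow>\<^sub>0 nat) \<Rightarrow>\<^sub>0 'a) \<Rightarrow> ('v \<Rightarrow> 'b) \<Rightarrow> 'b" where
  "ev \<iota> p v = (\<Sum>m\<in>Poly_Mapping.keys p. \<iota> (Poly_Mapping.lookup p m) * monom_val v m)"

lemma ev_superset:
  assumes "finite S" "Poly_Mapping.keys p \<subseteq> S" "\<iota> 0 = 0"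
  shows "ev \<iota> p v = (\<Sum>m\<in>S. \<iota> (Poly_Mapping.lookup p m) * monom_val v m)"
  unfolding ev_def using assms
  by (intro sum.mono_neutral_left) (auto simp: in_keys_iff)

lemma poly_mapping_sum_superset:
  assumes "finite S" "Poly_Mapping.keys p \<subseteq> S"
  shows "p = (\<Sum>m\<in>S. Poly_Mapping.single m (Poly_Mapping.lookup p m))"
proof (rule poly_mapping_eqI)
  fix k
  have "(\<Sum>m\<in>S. Poly_Mapping.lookup (Poly_Mapping.single m (Poly_Mapping.lookup p m)) k)
      = (\<Sum>m\<in>S. if m = k then Poly_Mapping.lookup p k else 0)"
    by (intro sum.cong) (auto simp: lookup_single when_def)
  also have "\<dots> = Poly_Mapping.lookup p k"
    using assms by (auto simp: in_keys_iff)
  finally show "Poly_Mapping.lookup p k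
      = Poly_Mapping.lookup (\<Sum>m\<in>S. Poly_Mapping.single m (Poly_Mapping.lookup p m)) k"
    by (simp add: lookup_sum)
qed

lemma lookup_mult_superset:
  fixes p q :: "'m::monoid_add \<Rightarrow>\<^sub>0 'a::semiring_0"
  assumes "finite S" "Poly_Mapping.keys p \<subseteq> S" "finite T" "Poly_Mapping.keys q \<subseteq> T"
  shows "Poly_Mapping.lookup (p * q) k =
    (\<Sum>m\<in>S. \<Sum>m'\<in>T. Poly_Mapping.lookup p m * Poly_Mapping.lookup q m' when m + m' = k)"
proof -
  have "p * q = (\<Sum>m\<in>S. Poly_Mapping.single m (Poly_Mapping.lookup p m))
      * (\<Sum>m'\<in>T. Poly_Mapping.single m' (Poly_Mapping.lookup q m'))"
    using poly_mapping_sum_superset[OF assms(1,2)] poly_mapping_sum_superset[OF assms(3,4)] by metis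
  also have "\<dots> = (\<Sum>m\<in>S. \<Sum>m'\<in>T. Poly_Mapping.single (m + m') (Poly_Mapping.lookup p m * Poly_Mapping.lookup q m'))"
    by (simp add: sum_product mult_single)
  finally show ?thesis
    by (simp add: lookup_sum lookup_single when_def)
qed

lemma ev_0 [simp]: "ev \<iota> 0 v = 0"
  by (simp add: ev_def)

context comm_ring_hom
begin

lemma ev_single [simp]: "ev hom (Poly_Mapping.single m c) v = hom c * monom_val v m"
  by (cases "c = 0") (auto simp: ev_def)

lemma ev_add: "ev hom (p + q) v = ev hom p v + ev hom q v"
proof -
  let ?S = "Poly_Mapping.keys p \<union> Poly_Mapping.keys q"
  have "Poly_Mapping.keys (p + q) \<subseteq> ?S"
    by (rule keys_add)
  then show ?thesis
    by (simp add: ev_superset[of ?S] lookup_add hom_add algebra_simps sum.distrib)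
qed

lemma ev_sum: "ev hom (sum p A) v = (\<Sum>x\<in>A. ev hom (p x) v)"
  by (induction A rule: infinite_finite_induct) (auto simp: ev_add)

lemma ev_mult: "ev hom (p * q) v = ev hom p v * ev hom q v"
proof -
  have p: "p = (\<Sum>m\<in>Poly_Mapping.keys p. Poly_Mapping.single m (Poly_Mapping.lookup p m))"
    and q: "q = (\<Sum>m\<in>Poly_Mapping.keys q. Poly_Mapping.single m (Poly_Mapping.lookup q m))"
    by (intro poly_mapping_sum_superset; simp)+
  have "p * q = (\<Sum>m\<in>Poly_Mapping.keys p. \<Sum>m'\<in>Poly_Mapping.keys q.
      Poly_Mapping.single (m + m') (Poly_Mapping.lookup p m * Poly_Mapping.lookup q m'))"
    by (subst p, subst q) (simp add: sum_product mult_single)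
  then have "ev hom (p * q) v = (\<Sum>m\<in>Poly_Mapping.keys p. \<Sum>m'\<in>Poly_Mapping.keys q.
      hom (Poly_Mapping.lookup p m * Poly_Mapping.lookup q m') * monom_val v (m + m'))"
    by (simp only: ev_sum ev_single)
  also have "\<dots> = ev hom p v * ev hom q v"
    by (simp add: monom_val_add hom_mult ev_def sum_product mult_ac)
  finally show ?thesis .
qed

lemma ev_hom: "comm_ring_hom (\<lambda>p. ev hom p v)"
  by unfold_locales (auto simp: ev_add ev_mult simp flip: single_one)

lemma monom_val_commute: "hom (monom_val v m) = monom_val (\<lambda>i. hom (v i)) m"
  by (simp add: monom_val_def hom_distribs)

lemma ev_commute: "hom (ev \<iota> p v) = ev (\<lambda>c. hom (\<iota> c)) p (\<lambda>i. hom (v i))"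
  by (simp add: ev_def hom_distribs monom_val_commute)

end

lemma comm_ring_hom_id: "comm_ring_hom (\<lambda>x. x)"
  by unfold_locales auto

lemma comm_ring_hom_comp: "comm_ring_hom f \<Longrightarrow> comm_ring_hom g \<Longrightarrow> comm_ring_hom (\<lambda>x. f (g x))"
proof -
  assume "comm_ring_hom f" "comm_ring_hom g"
  then interpret f: comm_ring_hom f + g: comm_ring_hom g .
  show ?thesis by unfold_locales (auto simp: hom_distribs)
qed

lemma eval_eq_ev: "Defs.eval f x = ev (\<lambda>c. c) f (\<lambda>(b, j). x b j)"
  unfolding Defs.eval_def ev_def monom_val_def
  by (intro sum.cong refl arg_cong2[of _ _ _ _ "(*)"] prod.cong) (auto split: prod.splits)

lemma (in ring_rel) rel_monom_val:
  "(\<And>i. i \<in> Poly_Mapping.keys m \<Longrightarrow> R (v i) (w i)) \<Longrightarrow> R (monom_val v m) (monom_val w m)"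
  unfolding monom_val_def by (intro rel_prod rel_power)

lemma (in ring_rel) rel_ev:
  assumes "\<And>m. R (\<iota> (Poly_Mapping.lookup p m)) (\<iota>' (Poly_Mapping.lookup q m))" "\<iota> 0 = 0" "\<iota>' 0 = 0"
    and "\<And>i. R (v i) (w i)"
  shows "R (ev \<iota> p v) (ev \<iota>' q w)"
proof -
  let ?S = "Poly_Mapping.keys p \<union> Poly_Mapping.keys q"
  show ?thesis
    using assms by (simp add: ev_superset[of ?S] rel_sum rel_mult rel_monom_val)
qed

lemma (in ring_rel) rel_mpoly:
  fixes dummy :: "'m::comm_monoid_add"
  shows "ring_rel (\<lambda>(f::'m \<Rightarrow>\<^sub>0 'a) g. \<forall>n. R (Poly_Mapping.lookup f n) (Poly_Mapping.lookup g n))"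
proof unfold_locales
  fix p q :: "'m \<Rightarrow>\<^sub>0 'a" and p' q' :: "'m \<Rightarrow>\<^sub>0 'b"
  assume *: "\<forall>n. R (Poly_Mapping.lookup p n) (Poly_Mapping.lookup p' n)"
    "\<forall>n. R (Poly_Mapping.lookup q n) (Poly_Mapping.lookup q' n)"
  let ?S = "Poly_Mapping.keys p \<union> Poly_Mapping.keys p'"
  let ?T = "Poly_Mapping.keys q \<union> Poly_Mapping.keys q'"
  show "\<forall>n. R (Poly_Mapping.lookup (p * q) n) (Poly_Mapping.lookup (p' * q') n)"
    using * by (auto simp: lookup_mult_superset[of ?S _ ?T] when_def intro!: rel_sum rel_mult rel_zero)
qed (auto simp: lookup_add lookup_one when_def intro: rel_zero rel_one rel_add rel_uminus)

section \<open>Derivations\<close>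

locale derivation =
  fixes D :: "'a::comm_ring_1 \<Rightarrow> 'a"
  assumes D_add: "D (a + b) = D a + D b" and D_mult: "D (a * b) = a * D b + D a * b"
begin

lemma D_0 [simp]: "D 0 = 0"
  using D_add[of 0 0] by simp

lemma D_1 [simp]: "D 1 = 0"
  using D_mult[of 1 1] by simp

lemma D_sum: "D (sum f A) = (\<Sum>x\<in>A. D (f x))"
  by (induction A rule: infinite_finite_induct) (auto simp: D_add)

text \<open>In characteristic 2 squares are constants for derivations. Hence \<open>tau\<close> will
  differentiate like its squarefree monomial, and the square of \<open>y2\<close> contributes
  nothing.\<close>

lemma D_square: "(1::'a) + 1 = 0 \<Longrightarrow> D (a\<^sup>2) = 0"
proof -
  assume "(1::'a) + 1 = 0"
  then have "(1 + 1) * (a * D a) = 0"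
    by simp
  then show ?thesis
    by (simp add: power2_eq_square D_mult algebra_simps)
qed

end

definition dlog :: "('a::field \<Rightarrow> 'a) \<Rightarrow> 'a \<Rightarrow> 'a" where
  "dlog D a = D a / a"

locale field_derivation = derivation D for D :: "'a::field \<Rightarrow> 'a"
begin

lemma dlog_1 [simp]: "dlog D 1 = 0"
  by (simp add: dlog_def)

lemma dlog_mult: "a \<noteq> 0 \<Longrightarrow> b \<noteq> 0 \<Longrightarrow> dlog D (a * b) = dlog D a + dlog D b"
  by (simp add: dlog_def D_mult field_simps)

lemma dlog_inverse: "a \<noteq> 0 \<Longrightarrow> dlog D (inverse a) = - dlog D a"
  using dlog_mult[of a "inverse a"] by (simp add: eq_neg_iff_add_eq_0 add.commute)

lemma dlog_divide: "a \<noteq> 0 \<Longrightarrow> b \<noteq> 0 \<Longrightarrow> dlog D (a / b) = dlog D a - dlog D b"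
  using dlog_mult[of a "inverse b"] by (simp add: dlog_inverse divide_inverse)

lemma dlog_power: "a \<noteq> 0 \<Longrightarrow> dlog D (a ^ n) = of_nat n * dlog D a"
  by (induction n) (auto simp: dlog_mult algebra_simps)

lemma dlog_power_int: "a \<noteq> 0 \<Longrightarrow> dlog D (a powi n) = of_int n * dlog D a"
  by (cases n rule: int_cases4) (auto simp: power_int_minus dlog_power dlog_inverse)

lemma dlog_prod: "(\<And>x. x \<in> A \<Longrightarrow> f x \<noteq> 0) \<Longrightarrow> dlog D (prod f A) = (\<Sum>x\<in>A. dlog D (f x))"
  by (induction A rule: infinite_finite_induct) (auto simp: dlog_mult)

lemma D_eq_dlog: "a \<noteq> 0 \<Longrightarrow> D a = a * dlog D a"
  by (simp add: dlog_def)

end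

definition deriv_fps :: "('a::comm_ring_1 \<Rightarrow> 'a) \<Rightarrow> 'a fps \<Rightarrow> 'a fps" where
  "deriv_fps D f = Abs_fps (\<lambda>n. D (fps_nth f n))"

lemma derivation_fps: "derivation D \<Longrightarrow> derivation (deriv_fps D)"
proof -
  assume "derivation D"
  then interpret derivation D .
  show ?thesis
    by unfold_locales
      (auto simp: deriv_fps_def fps_eq_iff fps_mult_nth D_add D_mult D_sum sum.distrib)
qed

definition deriv_poly :: "('a::comm_ring_1 \<Rightarrow> 'a) \<Rightarrow> 'a poly \<Rightarrow> 'a poly" where
  "deriv_poly D p = map_poly D p"

lemma coeff_deriv_poly: "derivation D \<Longrightarrow> coeff (deriv_poly D p) n = D (coeff p n)"
  by (simp add: deriv_poly_def coeff_map_poly derivation.D_0)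

lemma derivation_poly: "derivation D \<Longrightarrow> derivation (deriv_poly D)"
proof -
  assume *: "derivation D"
  then interpret derivation D .
  show ?thesis
    by unfold_locales
      (auto simp: coeff_deriv_poly[OF *] poly_eq_iff coeff_mult D_add D_mult D_sum sum.distrib)
qed

definition deriv_fract :: "('a::idom \<Rightarrow> 'a) \<Rightarrow> 'a fract \<Rightarrow> 'a fract" where
  "deriv_fract D q = (SOME z. \<exists>a b. b \<noteq> 0 \<and> q = Fract a b \<and> z = Fract (D a * b - a * D b) (b * b))"

text \<open>Independence of the representative: both numerators are compared after multiplication by
  \<open>b * b'\<close>, where differentiating the equation \<open>a * b' = a' * b\<close>
  identifies them.\<close>

lemma deriv_fract_Fract:
  assumes "derivation D" "b \<noteq> 0"
  shows "deriv_fract D (Fract a b) = Fract (D a * b - a * D b) (b * b)"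
proof -
  interpret derivation D by fact
  have "Fract (D a' * b' - a' * D b') (b' * b') = Fract (D a * b - a * D b) (b * b)"
    if "b' \<noteq> 0" "Fract a b = Fract a' b'" for a' b'
  proof -
    have eq: "a * b' = a' * b"
      using that assms(2) by (simp add: eq_fract)
    then have "D (a * b') = D (a' * b)"
      by simp
    then have "D a * b' - a' * D b = D a' * b - a * D b'"
      by (simp add: D_mult algebra_simps)
    then have "(D a * b' - a' * D b) * (b * b') = (D a' * b - a * D b') * (b * b')"
      by simp
    moreover have "(D a' * b' - a' * D b') * (b * b) = D a' * b * (b * b') - (a' * b) * D b' * b"
      by (simp add: algebra_simps)
    then have "(D a' * b' - a' * D b') * (b * b) = (D a' * b - a * D b') * (b * b')"
      by (simp add: algebra_simps flip: eq)
    moreover have "(D a * b - a * D b) * (b' * b') = D a * b' * (b * b') - (a * b') * D b * b'"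
      by (simp add: algebra_simps)
    then have "(D a * b - a * D b) * (b' * b') = (D a * b' - a' * D b) * (b * b')"
      by (simp add: eq algebra_simps)
    ultimately have "(D a' * b' - a' * D b') * (b * b) = (D a * b - a * D b) * (b' * b')"
      by metis
    then show ?thesis
      using that assms(2) by (simp add: eq_fract)
  qed
  then show ?thesis
    unfolding deriv_fract_def using assms(2) by (intro some_equality) blast+
qed

lemma derivation_fract: "derivation D \<Longrightarrow> field_derivation (deriv_fract D)"
proof -
  assume *: "derivation D"
  then interpret derivation D .
  show ?thesis
  proof unfold_locales
    fix p q :: "'a fract"
    obtain a b where p: "p = Fract a b" "b \<noteq> 0"
      by (cases p)
    obtain c d where q: "q = Fract c d" "d \<noteq> 0"
      by (cases q)
    show "deriv_fract D (p + q) = deriv_fract D p + deriv_fract D q"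
      using p q by (simp add: deriv_fract_Fract[OF *] eq_fract D_mult D_add algebra_simps)
    show "deriv_fract D (p * q) = p * deriv_fract D q + deriv_fract D p * q"
      using p q by (simp add: deriv_fract_Fract[OF *] eq_fract D_mult D_add algebra_simps)
  qed
qed

lemma deriv_fract_to_fract: "derivation D \<Longrightarrow> deriv_fract D (to_fract a) = to_fract (D a)"
  by (simp add: to_fract_def deriv_fract_Fract derivation.D_1)

text \<open>The Euler operator X_i d/dX_i rather than the partial derivative: it multiplies each
  monomial by its exponent, so that the product rule is just additivity of exponents.\<close>

definition deriv_mpoly :: "'v \<Rightarrow> (('v \<Rightarrow>\<^sub>0 nat) \<Rightarrow>\<^sub>0 'a::comm_ring_1) \<Rightarrow> ('v \<Rightarrow>\<^sub>0 nat) \<Rightarrow>\<^sub>0 'a" where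
  "deriv_mpoly i p = Poly_Mapping.mapp (\<lambda>m c. of_nat (Poly_Mapping.lookup m i) * c) p"

lemma lookup_deriv_mpoly:
  "Poly_Mapping.lookup (deriv_mpoly i p) m = of_nat (Poly_Mapping.lookup m i) * Poly_Mapping.lookup p m"
  by (auto simp: deriv_mpoly_def lookup_mapp when_def in_keys_iff)

lemma derivation_mpoly: "derivation (deriv_mpoly i :: (('v \<Rightarrow>\<^sub>0 nat) \<Rightarrow>\<^sub>0 'a::comm_ring_1) \<Rightarrow> _)"
proof unfold_locales
  fix p q :: "('v \<Rightarrow>\<^sub>0 nat) \<Rightarrow>\<^sub>0 'a"
  show "deriv_mpoly i (p + q) = deriv_mpoly i p + deriv_mpoly i q"
    by (rule poly_mapping_eqI) (simp add: lookup_deriv_mpoly lookup_add algebra_simps)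
  let ?S = "Poly_Mapping.keys p" and ?T = "Poly_Mapping.keys q"
  have sub: "Poly_Mapping.keys (deriv_mpoly i p) \<subseteq> ?S" "Poly_Mapping.keys (deriv_mpoly i q) \<subseteq> ?T"
    by (auto simp: in_keys_iff lookup_deriv_mpoly)
  show "deriv_mpoly i (p * q) = p * deriv_mpoly i q + deriv_mpoly i p * q"
  proof (rule poly_mapping_eqI)
    fix k
    note l = lookup_mult_superset[of ?S _ ?T, OF finite_keys _ finite_keys]
    show "Poly_Mapping.lookup (deriv_mpoly i (p * q)) k =
        Poly_Mapping.lookup (p * deriv_mpoly i q + deriv_mpoly i p * q) k"
      unfolding lookup_add lookup_deriv_mpoly l[OF subset_refl subset_refl]
        l[OF sub(1) subset_refl] l[OF subset_refl sub(2)]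
      by (auto simp: sum_distrib_left when_def lookup_deriv_mpoly lookup_add algebra_simps
          simp flip: sum.distrib intro!: sum.cong)
  qed
qed

text \<open>\<open>val_curve\<close> factors polynomials over its field into primes and therefore
  asks for \<open>field_gcd\<close>; it is applied over the fraction field of a power series
  ring.\<close>

instantiation fract :: (idom)
  "{unique_euclidean_ring, normalization_euclidean_semiring, normalization_semidom_multiplicative}"
begin

definition [simp]: "normalize_fract = (normalize_field :: 'a fract \<Rightarrow> _)"
definition [simp]: "unit_factor_fract = (unit_factor_field :: 'a fract \<Rightarrow> _)"
definition [simp]: "modulo_fract = (mod_field :: 'a fract \<Rightarrow> _)"
definition [simp]: "euclidean_size_fract = (euclidean_size_field :: 'a fract \<Rightarrow> _)"
definition [simp]: "division_segment (x :: 'a fract) = 1"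

instance
  by standard (simp_all add: dvd_field_iff field_split_simps split: if_splits)

end

instantiation fract :: (idom) euclidean_ring_gcd
begin

definition gcd_fract :: "'a fract \<Rightarrow> 'a fract \<Rightarrow> 'a fract" where
  "gcd_fract = Euclidean_Algorithm.gcd"
definition lcm_fract :: "'a fract \<Rightarrow> 'a fract \<Rightarrow> 'a fract" where
  "lcm_fract = Euclidean_Algorithm.lcm"
definition Gcd_fract :: "'a fract set \<Rightarrow> 'a fract" where
  "Gcd_fract = Euclidean_Algorithm.Gcd"
definition Lcm_fract :: "'a fract set \<Rightarrow> 'a fract" where
  "Lcm_fract = Euclidean_Algorithm.Lcm"

instance
  by standard (simp_all add: gcd_fract_def lcm_fract_def Gcd_fract_def Lcm_fract_def)

end

instance fract :: (idom) field_gcd ..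

section \<open>Discrete valuations stable under derivations\<close>

locale discrete_valuation =
  fixes v :: "'k::field \<Rightarrow> int" and \<pi> :: 'k
  assumes v_mult: "a \<noteq> 0 \<Longrightarrow> b \<noteq> 0 \<Longrightarrow> v (a * b) = v a + v b"
    and v_add: "a \<noteq> 0 \<Longrightarrow> b \<noteq> 0 \<Longrightarrow> a + b \<noteq> 0 \<Longrightarrow> min (v a) (v b) \<le> v (a + b)"
    and pi_nonzero [simp]: "\<pi> \<noteq> 0" and v_pi [simp]: "v \<pi> = 1"
begin

text \<open>\<open>ge 0\<close> is the valuation ring and \<open>ge 1\<close> its maximal ideal.
  Zero is listed separately because \<open>v 0\<close> is unspecified.\<close>

definition ge :: "int \<Rightarrow> 'k \<Rightarrow> bool" where
  "ge m a \<longleftrightarrow> a = 0 \<or> m \<le> v a"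

lemma ge_0 [simp]: "ge m 0"
  by (simp add: ge_def)

lemma v_1 [simp]: "v 1 = 0"
  using v_mult[of 1 1] by simp

lemma v_neg_1: "v (- 1) = 0"
  using v_mult[of "- 1" "- 1"] by simp

lemma v_uminus [simp]: "v (- a) = v a"
  using v_mult[of "- 1" a] by (cases "a = 0") (auto simp: v_neg_1)

lemma v_inverse: "a \<noteq> 0 \<Longrightarrow> v (inverse a) = - v a"
  using v_mult[of a "inverse a"] by simp

lemma v_divide: "a \<noteq> 0 \<Longrightarrow> b \<noteq> 0 \<Longrightarrow> v (a / b) = v a - v b"
  by (simp add: divide_inverse v_mult v_inverse)

lemma v_power: "a \<noteq> 0 \<Longrightarrow> v (a ^ n) = of_nat n * v a"
  by (induction n) (auto simp: v_mult algebra_simps)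

lemma v_power_int: "a \<noteq> 0 \<Longrightarrow> v (a powi n) = n * v a"
  by (cases n rule: int_cases4) (auto simp: power_int_minus v_power v_inverse)

lemma v_prod: "(\<And>x. x \<in> A \<Longrightarrow> f x \<noteq> 0) \<Longrightarrow> v (prod f A) = (\<Sum>x\<in>A. v (f x))"
  by (induction A rule: infinite_finite_induct) (auto simp: v_mult)

lemma ge_mono: "ge m a \<Longrightarrow> m' \<le> m \<Longrightarrow> ge m' a"
  by (auto simp: ge_def)

lemma ge_add: "ge m a \<Longrightarrow> ge m b \<Longrightarrow> ge m (a + b)"
  using v_add[of a b] by (cases "a = 0"; cases "b = 0"; cases "a + b = 0") (auto simp: ge_def)

lemma ge_uminus: "ge m a \<Longrightarrow> ge m (- a)"
  by (simp add: ge_def)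

lemma ge_diff: "ge m a \<Longrightarrow> ge m b \<Longrightarrow> ge m (a - b)"
  using ge_add[of m a "- b"] by (simp add: ge_uminus)

lemma ge_mult: "ge m a \<Longrightarrow> ge m' b \<Longrightarrow> ge (m + m') (a * b)"
  by (cases "a = 0"; cases "b = 0") (auto simp: ge_def v_mult)

lemma ge_sum: "(\<And>x. x \<in> A \<Longrightarrow> ge m (f x)) \<Longrightarrow> ge m (sum f A)"
  by (induction A rule: infinite_finite_induct) (auto simp: ge_add)

lemma ge_1: "ge 0 1"
  by (simp add: ge_def)

lemma ge_rel: "ring_rel (\<lambda>a (b::'k). ge 0 a)"
  using ge_mult[of 0 _ 0] by unfold_locales (auto simp: ge_1 ge_add ge_uminus)

lemma ge_of_int: "ge 0 (of_int n)"
  using ring_rel.rel_of_int[OF ge_rel] .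

lemma ge_power: "ge 0 a \<Longrightarrow> ge 0 (a ^ n)"
  using ring_rel.rel_power[OF ge_rel, of a] .

lemma ge_1_power: "ge 1 a \<Longrightarrow> 0 < n \<Longrightarrow> ge 1 (a ^ n)"
  using ge_mult[of 1 a 0 "a ^ (n - 1)"] ge_power[of a "n - 1"] ge_mono[of 1 a 0]
  by (cases n) auto

lemma ge_det:
  assumes "A \<in> carrier_mat n n" "\<And>i j. i < n \<Longrightarrow> j < n \<Longrightarrow> ge 0 (A $$ (i, j))"
  shows "ge 0 (det A)"
  using ring_rel.rel_det[OF ge_rel, of A n A] assms by auto

lemma ge_1_unit_add: "ge 1 a \<Longrightarrow> 1 + a \<noteq> 0 \<and> v (1 + a) = 0"
proof -
  assume a: "ge 1 a"
  have nz: "1 + a \<noteq> 0"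
  proof
    assume "1 + a = 0"
    then have "a = - 1"
      by (simp add: eq_neg_iff_add_eq_0 add.commute)
    then show False
      using a by (simp add: ge_def)
  qed
  have "v (1 + a) = 0" if "a \<noteq> 0"
    using v_add[of 1 a] v_add[of "1 + a" "- a"] nz a that by (auto simp: ge_def)
  then show ?thesis
    using nz by (cases "a = 0") auto
qed

lemma ge_cancel: "a \<noteq> 0 \<Longrightarrow> ge m (a * b) \<longleftrightarrow> ge (m - v a) b"
  by (cases "b = 0") (auto simp: ge_def v_mult)

end

locale valuation_deriv = discrete_valuation v \<pi>
  for v :: "'k::field \<Rightarrow> int" and \<pi> +
  fixes D :: "nat \<Rightarrow> 'k \<Rightarrow> 'k"
  assumes deriv: "field_derivation (D k)"
    and D_integral: "a = 0 \<or> 0 \<le> v a \<Longrightarrow> D k a = 0 \<or> 0 \<le> v (D k a)"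
begin

sublocale field_derivation "D k" for k
  by (rule deriv)

lemma ge_D: "ge 0 a \<Longrightarrow> ge 0 (D k a)"
  using D_integral unfolding ge_def by blast

lemma ge_dlog_unit: "a \<noteq> 0 \<Longrightarrow> v a = 0 \<Longrightarrow> ge 0 (dlog (D k) a)"
  using ge_D[of a k] ge_mult[of 0 "D k a" 0 "inverse a"]
  by (simp add: ge_def dlog_def divide_inverse v_inverse)

text \<open>A unit times a power of \<open>\<pi>\<close>: the polar parts of all logarithmic
  derivatives are multiples of the one vector \<open>dlog (D k) \<pi>\<close>, and in characteristic
  2 only the parity of \<open>v a\<close> counts.\<close>

lemma dlog_decomp:
  assumes "a \<noteq> 0"
  obtains a' where "a' \<noteq> 0" "v a' = 0"
    "\<And>k. dlog (D k) a = dlog (D k) a' + of_int (v a) * dlog (D k) \<pi>"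
    "\<And>k. ge 0 (dlog (D k) a')"
proof
  let ?a' = "a / \<pi> powi v a"
  show *: "?a' \<noteq> 0" "v ?a' = 0"
    using assms by (auto simp: v_divide v_power_int)
  show "ge 0 (dlog (D k) ?a')" for k
    using ge_dlog_unit[OF *] .
  show "dlog (D k) a = dlog (D k) ?a' + of_int (v a) * dlog (D k) \<pi>" for k
    using assms by (simp add: dlog_divide dlog_power_int)
qed

lemma ge_dlog: "a \<noteq> 0 \<Longrightarrow> ge (- 1) (dlog (D k) a)"
proof -
  assume "a \<noteq> 0"
  then obtain a' where a': "dlog (D k) a = dlog (D k) a' + of_int (v a) * dlog (D k) \<pi>"
    "ge 0 (dlog (D k) a')"
    using dlog_decomp by metis
  have "ge (- 1) (dlog (D k) \<pi>)"
    using ge_D[of \<pi> k] by (cases "D k \<pi> = 0") (auto simp: dlog_def ge_def v_divide)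
  then have "ge (0 + - 1) (of_int (v a) * dlog (D k) \<pi>)"
    by (intro ge_mult ge_of_int)
  then show ?thesis
    using a' ge_mono[OF a'(2), of "- 1"] by (auto intro: ge_add)
qed

end

section \<open>The special fibre\<close>

definition cyc_suc :: "nat \<Rightarrow> nat \<Rightarrow> nat" where
  "cyc_suc n j = (if Suc j = n then 0 else Suc j)"

definition cyc_pred :: "nat \<Rightarrow> nat \<Rightarrow> nat" where
  "cyc_pred n j = (if j = 0 then n - 1 else j - 1)"

lemma cyc_suc_less: "j < n \<Longrightarrow> cyc_suc n j < n"
  by (auto simp: cyc_suc_def)

lemma cyc_pred_suc: "j < n \<Longrightarrow> cyc_pred n (cyc_suc n j) = j"
  by (auto simp: cyc_suc_def cyc_pred_def)

lemma cyc_closed: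
  assumes "J \<subseteq> {..<n}" "J \<noteq> {}" "\<And>j. j \<in> J \<Longrightarrow> cyc_suc n j \<in> J"
  shows "J = {..<n}"
proof -
  obtain j0 where j0: "j0 \<in> J" "j0 < n"
    using assms by auto
  have up: "j0 + k \<in> J" if "j0 + k < n" for k
    using that
  proof (induction k)
    case (Suc k)
    then have "cyc_suc n (j0 + k) \<in> J"
      by (intro assms) simp
    then show ?case
      using Suc.prems by (simp add: cyc_suc_def)
  qed (use j0 in simp)
  have "cyc_suc n (n - 1) \<in> J"
    using up[of "n - 1 - j0"] j0 by (intro assms) simp
  then have "0 \<in> J"
    using j0 by (simp add: cyc_suc_def)
  have "k \<in> J" if "k < n" for k
    using that
  proof (induction k)
    case (Suc k)
    then have "cyc_suc n k \<in> J"
      by (intro assms) simp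
    then show ?case
      using Suc.prems by (simp add: cyc_suc_def)
  qed (use \<open>0 \<in> J\<close> in simp)
  then show ?thesis
    using assms(1) by auto
qed

locale conic_params =
  fixes n d :: nat
  assumes n_ge: "3 \<le> n" and d_ge: "n \<le> d"
begin

text \<open>The exponents are positive and add up to \<open>d\<close>, which is where
  \<open>n \<le> d\<close> enters; the surplus sits on index 0. Positivity makes \<open>xgam\<close>
  divisible by every class monomial.\<close>

definition gam :: "nat \<Rightarrow> nat" where
  "gam i = (if i = 0 then d - n + 1 else 1)"

text \<open>In characteristic 2 a derivation sees only the part \<open>\<Prod>i\<in>cls j. x i\<close> of the monomial
  \<open>(\<Prod>i\<in>cls j. x i) * x j ^ (2 * rad j)\<close> of degree \<open>d\<close>. The parity of \<open>d\<close> forces the case distinction.\<close>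

definition cls :: "nat \<Rightarrow> nat set" where
  "cls j = (if odd d then {j} else if n = 3 then (if j = 0 then {} else {0, j})
     else {cyc_pred n j, j})"

definition rad :: "nat \<Rightarrow> nat" where
  "rad j = (d - card (cls j)) div 2"

text \<open>With \<open>J\<close> the set of unit coordinates, some nonunit coordinate still divides
  \<open>xgam\<close> after division by the class monomial of \<open>j\<close>. In the critical case
  this forces \<open>lform\<close> at \<open>j\<close> into the maximal ideal.\<close>

definition active :: "nat set \<Rightarrow> nat \<Rightarrow> bool" where
  "active J j \<longleftrightarrow> (\<exists>i<n. i \<notin> J \<and> (i \<notin> cls j \<or> 2 \<le> gam i))"

lemma gam_pos: "1 \<le> gam i"
  by (simp add: gam_def)

lemma sum_gam: "(\<Sum>i<n. gam i) = d"
proof -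
  have "(\<Sum>i<n. gam i) = (\<Sum>i<n. 1 + (if i = 0 then d - n else 0))"
    by (intro sum.cong) (auto simp: gam_def)
  also have "\<dots> = n + (\<Sum>i<n. if i = 0 then d - n else 0)"
    by (subst sum.distrib) simp
  also have "\<dots> = d"
    using n_ge d_ge by simp
  finally show ?thesis .
qed

lemma cls_sub: "j < n \<Longrightarrow> cls j \<subseteq> {..<n}"
  using n_ge by (auto simp: cls_def cyc_pred_def)

lemma finite_cls [simp]: "finite (cls j)"
  by (simp add: cls_def)

lemma card_cls: "j < n \<Longrightarrow> card (cls j) \<le> 2 \<and> even (d - card (cls j)) \<and> card (cls j) + 2 \<le> d"
proof -
  assume j: "j < n"
  have "4 \<le> d" if "even d"
    using that n_ge d_ge by presburger
  moreover have "card {cyc_pred n j, j} = 2"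
    using j n_ge by (simp add: cyc_pred_def)
  ultimately show ?thesis
    using n_ge d_ge by (auto simp: cls_def)
qed

lemma deg_rad: "j < n \<Longrightarrow> card (cls j) + 2 * rad j = d"
  using card_cls[of j] by (auto simp: rad_def)

lemma rad_pos: "j < n \<Longrightarrow> 1 \<le> rad j"
  using card_cls[of j] by (auto simp: rad_def)

lemma ex_leaving:
  assumes "J \<subseteq> {..<n}" "J \<noteq> {}" "J \<noteq> {..<n}"
  obtains j where "j \<in> J" "cyc_suc n j \<notin> J"
  using cyc_closed[OF assms(1,2)] assms(3) by blast

text \<open>The exceptional classes are {}, {0,1} and {0,2}. Here \<open>d\<close> is at least 4, so
  \<open>gam 0\<close> is at least 2 and index 0 can witness activity even for the classes that
  contain it.\<close>

lemma three_case:
  assumes "J \<subseteq> {..<n}" "J \<noteq> {}" "J \<noteq> {..<n}" "even d" "n = 3"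
  shows "active J 0" "0 \<notin> J \<or> 2 \<notin> J \<Longrightarrow> active J 1" "0 \<notin> J \<or> 1 \<notin> J \<Longrightarrow> active J 2"
    "cyc_suc n 0 = 1" "cyc_suc n 1 = 2" "cyc_suc n 2 = 0" "(0::nat) < n" "1 < n" "2 < n"
    "0 \<notin> J \<or> 1 \<notin> J \<or> 2 \<notin> J" "0 \<in> J \<or> 1 \<in> J \<or> 2 \<in> J"
proof -
  have "4 \<le> d"
    using assms d_ge by presburger
  then have g: "2 \<le> gam 0"
    unfolding gam_def using assms by simp
  have three: "{..<n} = {0, 1, 2}"
    using assms by auto
  show lt: "(0::nat) < n" "1 < n" "2 < n"
    using assms by auto
  show mem: "0 \<notin> J \<or> 1 \<notin> J \<or> 2 \<notin> J" "0 \<in> J \<or> 1 \<in> J \<or> 2 \<in> J"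
    using assms(1-3) unfolding three by blast+
  have cls: "cls 0 = {}" "cls 1 = {0, 1}" "cls 2 = {0, 2}"
    unfolding cls_def using assms by auto
  show "active J 0"
    unfolding active_def cls using mem(1) lt by blast
  show "active J 1" if "0 \<notin> J \<or> 2 \<notin> J"
    unfolding active_def cls using that lt g by (auto intro: exI[of _ 2] exI[of _ 0])
  show "active J 2" if "0 \<notin> J \<or> 1 \<notin> J"
    unfolding active_def cls using that lt g by (auto intro: exI[of _ 1] exI[of _ 0])
  show "cyc_suc n 0 = 1" "cyc_suc n 1 = 2" "cyc_suc n 2 = 0"
    unfolding cyc_suc_def using assms by auto
qed

text \<open>At the found \<open>j\<close> the \<open>y0\<close> term of \<open>lform\<close> is
  small and \<open>y1\<close> has a unit coefficient, so \<open>y1\<close> becomes small. Outside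
  the exceptional case the successor of \<open>j\<close> lies neither in \<open>J\<close> nor in
  \<open>cls j\<close> and is itself the witness.\<close>

lemma comb1:
  assumes "J \<subseteq> {..<n}" "J \<noteq> {}" "J \<noteq> {..<n}"
  shows "\<exists>j\<in>J. cyc_suc n j \<notin> J \<and> active J j"
proof (cases "even d \<and> n = 3")
  case False
  obtain j where j: "j \<in> J" "cyc_suc n j \<notin> J"
    using ex_leaving[OF assms] .
  have "cyc_suc n j < n" "cyc_suc n j \<notin> cls j"
    using j(1) assms(1) n_ge False
    by (auto simp: cyc_suc_def cls_def cyc_pred_def split: if_splits)
  then show ?thesis
    using j by (auto simp: active_def)
next
  case True
  note t = three_case[OF assms]
  show ?thesis
    using True t by metis
qed

text \<open>Once \<open>y1\<close> is known to be small, an active \<open>j\<close> with a unit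
  coefficient at \<open>y0\<close> makes \<open>y0\<close> small as well.\<close>

lemma comb2:
  assumes "J \<subseteq> {..<n}" "J \<noteq> {}" "J \<noteq> {..<n}"
  shows "\<exists>j<n. cyc_suc n j \<in> J \<and> active J j"
proof -
  consider "odd d" | "even d" "n = 3" | "even d" "4 \<le> n"
    using n_ge by fastforce
  then show ?thesis
  proof cases
    case 1
    show ?thesis
    \<comment> \<open>Classes are singletons here. If two neighbours lie in \<open>J\<close>, any
      index outside \<open>J\<close> activates the first. Otherwise both neighbours of an element of
      \<open>J\<close> lie outside \<open>J\<close>, and they are distinct because \<open>n\<close>
      is at least 3.\<close>
    proof (cases "\<exists>j\<in>J. cyc_suc n j \<in> J")
      case True
      then obtain j where j: "j \<in> J" "cyc_suc n j \<in> J"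
        by auto
      moreover obtain i where "i < n" "i \<notin> J"
        using assms by auto
      ultimately show ?thesis
        using assms(1) 1 by (intro exI[of _ j]) (auto simp: active_def cls_def)
    next
      case False
      obtain q where q: "q \<in> J"
        using assms by auto
      then have "q < n"
        using assms(1) by auto
      then have "cyc_suc n q \<noteq> cyc_pred n q" "cyc_suc n (cyc_pred n q) = q" "cyc_pred n q < n" "cyc_suc n q < n"
        using n_ge by (auto simp: cyc_suc_def cyc_pred_def)
      moreover from this have "cyc_suc n q \<notin> J" "cyc_pred n q \<notin> J"
        using False q by auto
      ultimately show ?thesis
        using q 1 by (intro exI[of _ "cyc_pred n q"]) (auto simp: active_def cls_def)
    qed
  next
    case 2
    note t = three_case[OF assms 2]
    show ?thesis
      using t by metis
  next
    case 3
    obtain p where p: "p \<in> {..<n} - J" "cyc_suc n p \<notin> {..<n} - J"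
      using ex_leaving[of "{..<n} - J"] assms by auto
    then have p': "p < n" "p \<notin> J" "cyc_suc n p \<in> J"
      by (auto simp: cyc_suc_def split: if_splits)
    define p1 where "p1 = cyc_suc n p"
    define p2 where "p2 = cyc_suc n p1"
    define p3 where "p3 = cyc_suc n p2"
    define p0 where "p0 = cyc_pred n p"
    have lt: "p0 < n" "p1 < n" "p2 < n" "p3 < n"
      using 3 p'(1) by (simp_all add: p0_def p1_def p2_def p3_def cyc_suc_def cyc_pred_def less_imp_diff_less)
    have ne: "p1 \<noteq> p" "p2 \<noteq> p" "p3 \<noteq> p" "p2 \<noteq> p0" "p1 \<noteq> p0" "p0 \<noteq> p"
      using 3 p'(1) by (simp_all add: p0_def p1_def p2_def p3_def cyc_suc_def cyc_pred_def) linarith+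
    have "cyc_pred n p1 = p" "cyc_pred n p2 = p1"
      using p'(1) by (simp_all add: p1_def p2_def cyc_pred_suc cyc_suc_less)
    moreover have "cls j = {cyc_pred n j, j}" for j
      using 3 by (simp add: cls_def)
    ultimately have cls: "cls p = {p0, p}" "cls p1 = {p, p1}" "cls p2 = {p1, p2}"
      by (simp_all add: p0_def)
    have suc: "cyc_suc n p = p1" "cyc_suc n p1 = p2" "cyc_suc n p2 = p3"
      by (simp_all add: p1_def p2_def p3_def)
    have p1: "p1 \<in> J"
      using p' by (simp add: p1_def)
    show ?thesis
    \<comment> \<open>Such an index avoids the class of \<open>p\<close> and activates
      \<open>p\<close>. Without it, \<open>J\<close> misses at most \<open>p0\<close> and
      \<open>p\<close>, and a position one or two steps further works.\<close>
    proof (cases "\<exists>i<n. i \<notin> J \<and> i \<noteq> p0 \<and> i \<noteq> p")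
      case True
      then have "active J p"
        unfolding active_def cls by blast
      then show ?thesis
        using p'(1) p1 suc by metis
    next
      case False
      then have J: "i \<in> J" if "i < n" "i \<noteq> p0" "i \<noteq> p" for i
        using that by blast
      show ?thesis
      proof (cases "p0 \<in> J")
        case True
        then have "p3 \<in> J"
          using J lt ne by blast
        moreover have "active J p2"
          unfolding active_def cls using p' ne by blast
        ultimately show ?thesis
          using lt suc by metis
      next
        case False
        have "p2 \<in> J"
          using J lt ne by blast
        moreover have "active J p1"
          unfolding active_def cls using False lt ne by blast
        ultimately show ?thesis
          using lt suc by metis
      qed
    qed
  qed
qed

text \<open>\<open>Z\<close> will be the set of multiples of \<open>xgam x * y1 * y2\<close>, and
  the hypotheses express that no other part of the differentiated equation exceeds this term. The
  equations at \<open>i \<ge> 1\<close> chain the \<open>\<tau> j\<close> together modulo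
  \<open>Z\<close>: either enough of them lie in \<open>Z\<close>, and then all do, or two of them
  with different classes agree modulo \<open>Z\<close> without lying in it.\<close>

lemma linear_alternative:
  fixes \<tau> :: "nat \<Rightarrow> 'a::comm_ring_1"
  assumes char2: "(1::'a) + 1 = 0" and Z0: "Z 0" and Z_add: "\<And>a b. Z a \<Longrightarrow> Z b \<Longrightarrow> Z (a + b)"
    and L: "\<And>i. i < n \<Longrightarrow> Z ((\<Sum>j\<in>{j. j < n \<and> i \<in> cls j}. \<tau> j) + of_nat (gam i) * \<tau>e)"
    and S: "Z ((\<Sum>j<n. \<tau> j) + \<tau>e)"
  shows "(\<forall>j<n. Z (\<tau> j)) \<and> Z \<tau>e \<or> (\<exists>i<n. \<exists>j<n. cls i \<noteq> cls j \<and> Z (\<tau> i + \<tau> j) \<and> \<not> Z (\<tau> i))"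
proof -
  have dbl: "a + a = 0" for a :: 'a
    using char2 by (metis distrib_left mult.right_neutral mult_zero_right)
  have trans: "Z (a + c)" if "Z (a + b)" "Z (b + c)" for a b c
  proof -
    have "a + b + (b + c) = a + c + (b + b)"
      by (simp add: algebra_simps)
    then show ?thesis
      using Z_add[OF that] by (simp add: dbl)
  qed
  have tr0: "Z b" if "Z (a + b)" "Z a" for a b
    using trans[of 0 a b] that by simp
  have comm: "Z (b + a)" if "Z (a + b)" for a b
    using that by (simp add: add.commute)
  consider (A) "odd d \<or> n = 3" | (B) "even d" "4 \<le> n"
    using n_ge by fastforce
  then show ?thesis
  proof cases
    case A
    \<comment> \<open>An index \<open>i \<ge> 1\<close> lies in the class of \<open>i\<close> and in
      no other.\<close>
    have ti: "Z (\<tau>e + \<tau> i)" if "1 \<le> i" "i < n" for i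
    proof -
      have "{j. j < n \<and> i \<in> cls j} = {i}"
        using A that by (auto simp: cls_def)
      then show ?thesis
        using L[of i] that by (simp add: gam_def add.commute)
    qed
    show ?thesis
    proof (cases "Z (\<tau> 1)")
      case True
      then have e: "Z \<tau>e"
        using tr0[of "\<tau> 1" \<tau>e] comm[OF ti[of 1]] n_ge by auto
      have pos: "Z (\<tau> i)" if "1 \<le> i" "i < n" for i
        using tr0[OF ti[OF that] e] .
      have "Z (\<Sum>j\<in>A. \<tau> j)" if "A \<subseteq> {1..<n}" "finite A" for A
        using that(2,1) by (induction A rule: finite_induct) (auto intro!: Z0 Z_add pos)
      then have "Z (\<Sum>j\<in>{1..<n}. \<tau> j)"
        by auto
      moreover have "(\<Sum>j<n. \<tau> j) = (\<Sum>j\<in>{1..<n}. \<tau> j) + \<tau> 0"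
        using n_ge by (simp add: sum.atLeast1_atMost_eq lessThan_atLeast0 sum.atLeast_Suc_lessThan add.commute)
      ultimately have "Z (\<tau> 0 + \<tau>e)"
        using S tr0[of "\<Sum>j\<in>{1..<n}. \<tau> j" "\<tau> 0 + \<tau>e"] by (simp add: algebra_simps)
      then have "Z (\<tau> 0)"
        using tr0[OF comm e] by blast
      then show ?thesis
        using pos e by (metis One_nat_def Suc_leI not_gr_zero)
    next
      case False
      have "Z (\<tau>e + \<tau> 1)" "Z (\<tau>e + \<tau> 2)"
        using ti[of 1] ti[of 2] n_ge by simp_all
      then have "Z (\<tau> 1 + \<tau> 2)"
        using trans comm by blast
      moreover have "1 \<in> cls 1" "1 \<notin> cls 2"
        unfolding cls_def using A by auto
      then have "cls 1 \<noteq> cls 2"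
        by blast
      moreover have "1 < n" "2 < n"
        using n_ge by auto
      ultimately show ?thesis
        using False by blast
    qed
  next
    case B
    have cls: "cls j = {cyc_pred n j, j}" for j
      using B by (simp add: cls_def)
    let ?s = "cyc_suc n"
    \<comment> \<open>Now \<open>i\<close> lies exactly in the classes of \<open>i\<close> and of
      its successor. Two consecutive equations therefore compare \<open>i\<close> with the index two
      steps further, whose class is different.\<close>
    have ti: "Z (\<tau>e + (\<tau> i + \<tau> (?s i)))" if "1 \<le> i" "i < n" for i
    proof -
      have "i = cyc_pred n j \<longleftrightarrow> j = ?s i" if "j < n" for j
        using B \<open>i < n\<close> that by (simp add: cyc_suc_def cyc_pred_def) linarith
      moreover have "?s i < n" "i \<noteq> ?s i"
        using B that by (simp_all add: cyc_suc_def)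
      ultimately have "{j. j < n \<and> i \<in> cls j} = {i, ?s i}" "i \<noteq> ?s i"
        using \<open>i < n\<close> unfolding cls by blast+
      then show ?thesis
        using L[of i] that by (simp add: gam_def algebra_simps)
    qed
    have two: "Z (\<tau> i + \<tau> (?s (?s i)))" if "1 \<le> i" "i < n" "1 \<le> ?s i" for i
    proof -
      have "?s i < n"
        using that by (auto simp: cyc_suc_def)
      then have "Z ((\<tau> i + \<tau> (?s i)) + (\<tau> (?s i) + \<tau> (?s (?s i))))"
        using trans[OF comm[OF ti[OF that(1,2)]] ti[OF that(3)]] by blast
      moreover have "\<tau> i + \<tau> (?s i) + (\<tau> (?s i) + \<tau> (?s (?s i))) =
          \<tau> i + \<tau> (?s (?s i)) + (\<tau> (?s i) + \<tau> (?s i))"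
        by (simp add: algebra_simps)
      ultimately show ?thesis
        by (simp only: dbl add_0_right)
    qed
    have ncls: "cls i \<noteq> cls (?s (?s i))" "?s (?s i) < n" if "i < n" for i
    proof -
      have "cyc_pred n (?s (?s i)) = ?s i" "?s i \<noteq> i" "?s (?s i) \<noteq> i"
        using B that by (simp_all add: cyc_pred_suc cyc_suc_less) (simp_all add: cyc_suc_def)
      then have "i \<notin> cls (?s (?s i))" "i \<in> cls i"
        unfolding cls by auto
      then show "cls i \<noteq> cls (?s (?s i))"
        by blast
      show "?s (?s i) < n"
        using B that by (simp add: cyc_suc_def)
    qed
    show ?thesis
    proof (cases "Z (\<tau> 1) \<and> Z (\<tau> 2)")
      case True
      have s1: "?s 1 = 2"
        using B by (simp add: cyc_suc_def)
      then have "Z (\<tau>e + (\<tau> 1 + \<tau> 2))"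
        using ti[of 1] B by (simp add: s1)
      then have e: "Z \<tau>e"
        using tr0[OF comm, of \<tau>e "\<tau> 1 + \<tau> 2"] True Z_add by blast
      have pos: "Z (\<tau> i)" if "1 \<le> i" "i < n" for i
        using that
      proof (induction i)
        case (Suc i)
        show ?case
        proof (cases "i = 0")
          case False
          then have "Z (\<tau> i)" "?s i = Suc i"
            using Suc by (auto simp: cyc_suc_def)
          moreover have "Z (\<tau> i + \<tau> (?s i))"
            using tr0[OF ti[of i] e] False Suc.prems by simp
          ultimately show ?thesis
            using tr0 by metis
        qed (use True in simp)
      qed simp
      have "?s (n - 1) = 0"
        using B by (simp add: cyc_suc_def)
      moreover have "Z (\<tau> (n - 1) + \<tau> (?s (n - 1)))"
        using tr0[OF ti[of "n - 1"] e] B by simp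
      moreover have "Z (\<tau> (n - 1))"
        using pos[of "n - 1"] B by simp
      ultimately have "Z (\<tau> 0)"
        using tr0 by metis
      then show ?thesis
        using pos e by (metis One_nat_def Suc_leI not_gr_zero)
    next
      case False
      then obtain i where i: "i = 1 \<or> i = 2" "\<not> Z (\<tau> i)"
        by auto
      then have "1 \<le> i" "i < n" "1 \<le> ?s i"
        using B by (auto simp: cyc_suc_def)
      then show ?thesis
        using i(2) two[of i] ncls[of i] by blast
    qed
  qed
qed

end

lemma ex_min_on_finite:
  fixes f :: "'a \<Rightarrow> 'b::linorder"
  assumes "finite A" "A \<noteq> {}"
  shows "\<exists>a\<in>A. \<forall>b\<in>A. f a \<le> f b"
proof -
  have "Min (f ` A) \<in> f ` A"
    using assms by (intro Min_in) auto
  then obtain a where "a \<in> A" "f a = Min (f ` A)"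
    by auto
  then show ?thesis
    using assms(1) by (intro bexI[of _ a]) auto
qed

context conic_params
begin

definition lform :: "(nat \<Rightarrow> 'a::comm_ring_1) \<Rightarrow> 'a \<Rightarrow> 'a \<Rightarrow> nat \<Rightarrow> 'a" where
  "lform x y0 y1 j = x j ^ rad j * y1 + x (cyc_suc n j) ^ rad j * y0"

definition tau :: "(nat \<Rightarrow> 'a::comm_ring_1) \<Rightarrow> 'a \<Rightarrow> 'a \<Rightarrow> nat \<Rightarrow> 'a" where
  "tau x y0 y1 j = (\<Prod>i\<in>cls j. x i) * (lform x y0 y1 j)\<^sup>2"

definition xgam :: "(nat \<Rightarrow> 'a::comm_ring_1) \<Rightarrow> 'a" where
  "xgam x = (\<Prod>i<n. x i ^ gam i)"

text \<open>Only pure squares of \<open>y0\<close> and \<open>y1\<close> occur, and modulo 2 they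
  combine to the squares in \<open>tau\<close>. The Artin-Schreier term
  \<open>y1 * y2 + y2\<^sup>2\<close> keeps the equation separable in \<open>y2\<close>.\<close>

definition special :: "(nat \<Rightarrow> 'a::comm_ring_1) \<Rightarrow> 'a \<Rightarrow> 'a \<Rightarrow> 'a \<Rightarrow> 'a" where
  "special x y0 y1 y2 =
     (\<Sum>j<n. (\<Prod>i\<in>cls j. x i) * (x j ^ (2 * rad j) * y1\<^sup>2 + x (cyc_suc n j) ^ (2 * rad j) * y0\<^sup>2))
     + xgam x * (y1 * y2 + y2\<^sup>2)"

lemma special_char2:
  fixes x :: "nat \<Rightarrow> 'a::comm_ring_1"
  assumes "(1::'a) + 1 = 0"
  shows "special x y0 y1 y2 = (\<Sum>j<n. tau x y0 y1 j) + xgam x * y2\<^sup>2 + xgam x * y1 * y2"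
proof -
  have "(a + b)\<^sup>2 = a\<^sup>2 + b\<^sup>2" for a b :: 'a
  proof -
    have "(a + b)\<^sup>2 = a\<^sup>2 + b\<^sup>2 + (1 + 1) * (a * b)"
      by (simp add: power2_eq_square algebra_simps)
    then show ?thesis
      using assms by simp
  qed
  then have "tau x y0 y1 j = (\<Prod>i\<in>cls j. x i) *
      (x j ^ (2 * rad j) * y1\<^sup>2 + x (cyc_suc n j) ^ (2 * rad j) * y0\<^sup>2)" for j
    by (simp add: tau_def lform_def power_mult_distrib mult.commute[of 2] flip: power_mult)
  then show ?thesis
    by (simp add: special_def algebra_simps)
qed

lemma xgam_scale: "xgam (\<lambda>i. c * x i) = c ^ d * xgam x"
proof -
  have "(\<Prod>i<n. c ^ gam i) = c ^ d"
    by (simp add: sum_gam flip: power_sum)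
  then show ?thesis
    by (simp add: xgam_def power_mult_distrib prod.distrib)
qed

end

locale conic_local = conic_params n d + valuation_deriv v \<pi> D
  for n d :: nat and v :: "'k::field \<Rightarrow> int" and \<pi> D +
  assumes char2: "(1::'k) + 1 = 0"
begin

lemma dbl: "a + a = (0::'k)"
  using char2 by (metis distrib_left mult.right_neutral mult_zero_right)

lemma minus_eq: "- a = (a::'k)"
  using dbl[of a] by (simp add: eq_neg_iff_add_eq_0 flip: minus_equation_iff)

lemma move: "a + b = (c::'k) \<Longrightarrow> a = b + c"
  using dbl[of b] by (metis add.assoc add.commute add_0_right)

lemma of_nat_parity: "(of_nat m :: 'k) = (if even m then 0 else 1)"
  using char2 by (induction m) auto

lemma of_int_parity: "(of_int m :: 'k) = (if even m then 0 else 1)"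
  by (cases m) (auto simp: of_nat_parity minus_eq simp del: of_nat_Suc)

text \<open>The three conditions serve the determinant: sum zero passes to the ratios
  \<open>x i / x 0\<close>, a unit coefficient allows a row to be exchanged, and \<open>u\<close> in
  the maximal ideal offsets the pole, at most simple, of \<open>dlog (D k) g\<close>.\<close>

definition relation :: "(nat \<Rightarrow> 'k) \<Rightarrow> bool" where
  "relation x \<longleftrightarrow> (\<exists>w u g. (\<forall>i<n. ge 0 (w i)) \<and> (\<Sum>i<n. w i) = 0 \<and> (\<exists>i<n. w i \<noteq> 0 \<and> v (w i) = 0)
     \<and> ge 1 u \<and> g \<noteq> 0 \<and> (\<forall>k. (\<Sum>i<n. w i * dlog (D k) (x i)) = u * dlog (D k) g))"

lemma relationI:
  assumes "\<forall>i<n. ge 0 (w i)" "(\<Sum>i<n. w i) = 0" "\<exists>i<n. w i \<noteq> 0 \<and> v (w i) = 0"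
    and "\<And>k. (\<Sum>i<n. w i * dlog (D k) (x i)) = h k"
    and "\<exists>u g. ge 1 u \<and> g \<noteq> 0 \<and> (\<forall>k. h k = u * dlog (D k) g)"
  shows "relation x"
proof -
  obtain u g where "ge 1 u" "g \<noteq> 0" "\<forall>k. h k = u * dlog (D k) g"
    using assms(5) by blast
  then show ?thesis
    unfolding relation_def using assms(1-4)
    by (intro exI[of _ w] exI[of _ u] exI[of _ g]) simp
qed

lemma D_tau:
  assumes "\<And>i. i < n \<Longrightarrow> x i \<noteq> 0" "j < n"
  shows "D k (tau x y0 y1 j) = tau x y0 y1 j * (\<Sum>i\<in>cls j. dlog (D k) (x i))"
proof -
  have nz: "x i \<noteq> 0" if "i \<in> cls j" for i
    using cls_sub[OF assms(2)] that assms(1) by auto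
  then have "(\<Prod>i\<in>cls j. x i) \<noteq> 0"
    by simp
  then show ?thesis
    using dlog_prod[of "cls j" x k] nz
    by (simp add: tau_def D_mult D_square[OF char2] D_eq_dlog)
qed

lemma dlog_xgam:
  assumes "\<And>i. i < n \<Longrightarrow> x i \<noteq> 0"
  shows "dlog (D k) (xgam x) = (\<Sum>i<n. of_nat (gam i) * dlog (D k) (x i))"
  using assms unfolding xgam_def by (subst dlog_prod) (auto simp: dlog_power)

text \<open>The summands \<open>tau\<close> and the term with the square of \<open>y2\<close> are
  monomials in \<open>x\<close> times squares, so they contribute combinations of logarithmic
  derivatives of \<open>x\<close>. Only the product \<open>y1 * y2\<close> keeps a derivative of its
  own, which becomes the right-hand side.\<close>

lemma relation_deriv:
  assumes nz: "\<And>i. i < n \<Longrightarrow> x i \<noteq> 0" and eq: "special x y0 y1 y2 = 0"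
  defines "\<Lambda> \<equiv> \<lambda>i. (\<Sum>j\<in>{j. j < n \<and> i \<in> cls j}. tau x y0 y1 j) + of_nat (gam i) * (xgam x * y2\<^sup>2)"
  shows "(\<Sum>i<n. (\<Lambda> i + of_nat (gam i) * (xgam x * y1 * y2)) * dlog (D k) (x i)) = xgam x * D k (y1 * y2)"
    and "(\<Sum>i<n. \<Lambda> i + of_nat (gam i) * (xgam x * y1 * y2)) = 0"
proof -
  have S: "(\<Sum>j<n. tau x y0 y1 j) + xgam x * y2\<^sup>2 + xgam x * (y1 * y2) = 0"
    using eq by (simp add: special_char2[OF char2] mult.assoc)
  have swap: "(\<Sum>i<n. (\<Sum>j\<in>{j. j < n \<and> i \<in> cls j}. tau x y0 y1 j) * f i) = (\<Sum>j<n. tau x y0 y1 j * (\<Sum>i\<in>cls j. f i))"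
    for f :: "nat \<Rightarrow> 'k"
  proof -
    have "(\<Sum>i<n. (\<Sum>j\<in>{j. j < n \<and> i \<in> cls j}. tau x y0 y1 j) * f i)
        = (\<Sum>i<n. \<Sum>j\<in>{j\<in>{..<n}. i \<in> cls j}. tau x y0 y1 j * f i)"
      by (simp add: sum_distrib_right)
    also have "\<dots> = (\<Sum>j<n. \<Sum>i\<in>{i\<in>{..<n}. i \<in> cls j}. tau x y0 y1 j * f i)"
      by (rule sum.swap_restrict) auto
    also have "\<dots> = (\<Sum>j<n. tau x y0 y1 j * (\<Sum>i\<in>cls j. f i))"
    proof (intro sum.cong refl)
      fix j assume "j \<in> {..<n}"
      then have "{i\<in>{..<n}. i \<in> cls j} = cls j"
        using cls_sub[of j] by auto
      then show "(\<Sum>i\<in>{i\<in>{..<n}. i \<in> cls j}. tau x y0 y1 j * f i) = tau x y0 y1 j * (\<Sum>i\<in>cls j. f i)"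
        by (simp add: sum_distrib_left)
    qed
    finally show ?thesis .
  qed
  have expand: "(\<Sum>i<n. (\<Lambda> i + of_nat (gam i) * (xgam x * y1 * y2)) * f i)
      = (\<Sum>j<n. tau x y0 y1 j * (\<Sum>i\<in>cls j. f i))
        + (xgam x * y2\<^sup>2 + xgam x * (y1 * y2)) * (\<Sum>i<n. of_nat (gam i) * f i)" for f :: "nat \<Rightarrow> 'k"
    unfolding \<Lambda>_def distrib_right sum.distrib swap by (simp add: sum_distrib_left mult_ac)
  let ?l = "\<lambda>i. dlog (D k) (x i)"
  have xg: "xgam x \<noteq> 0"
    using nz by (simp add: xgam_def)
  have "D k ((\<Sum>j<n. tau x y0 y1 j) + xgam x * y2\<^sup>2 + xgam x * (y1 * y2)) = 0"
    by (simp add: S)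
  then have "(\<Sum>j<n. tau x y0 y1 j * (\<Sum>i\<in>cls j. ?l i)) + D k (xgam x) * y2\<^sup>2
      + (D k (xgam x) * (y1 * y2) + xgam x * D k (y1 * y2)) = 0"
    by (simp add: D_add D_sum D_tau[OF nz] D_mult[of k "xgam x"] D_square[OF char2] add.commute)
  then have "(\<Sum>j<n. tau x y0 y1 j * (\<Sum>i\<in>cls j. ?l i))
      + (xgam x * y2\<^sup>2 + xgam x * (y1 * y2)) * dlog (D k) (xgam x) + xgam x * D k (y1 * y2) = 0"
    by (simp add: D_eq_dlog[OF xg] algebra_simps)
  from move[OF this]
  show "(\<Sum>i<n. (\<Lambda> i + of_nat (gam i) * (xgam x * y1 * y2)) * ?l i) = xgam x * D k (y1 * y2)"
    using dlog_xgam[OF nz] by (simp add: expand)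
  \<comment> \<open>An Euler relation modulo 2: class sizes have the parity of \<open>d\<close> and
    the exponents \<open>gam\<close> add up to \<open>d\<close>, so the sum of all coefficients is
    \<open>d\<close> times the equation.\<close>
  have card: "(of_nat (card (cls j)) :: 'k) = of_nat d" if "j < n" for j
  proof -
    have "even (card (cls j)) = even d"
      using deg_rad[OF that] by presburger
    then show ?thesis
      by (simp add: of_nat_parity)
  qed
  have "(\<Sum>i<n. \<Lambda> i + of_nat (gam i) * (xgam x * y1 * y2))
      = (\<Sum>j<n. tau x y0 y1 j * of_nat d) + (xgam x * y2\<^sup>2 + xgam x * (y1 * y2)) * of_nat d"
    using expand[of "\<lambda>_. 1"] by (simp add: card sum_gam flip: of_nat_sum)
  also have "\<dots> = ((\<Sum>j<n. tau x y0 y1 j) + xgam x * y2\<^sup>2 + xgam x * (y1 * y2)) * of_nat d"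
    by (simp add: sum_distrib_right distrib_right add.assoc)
  finally show "(\<Sum>i<n. \<Lambda> i + of_nat (gam i) * (xgam x * y1 * y2)) = 0"
    by (simp add: S)
qed

text \<open>If \<open>xgam x * y1 * y2\<close> divides all other terms, then \<open>y2\<close> is a
  multiple of \<open>y1\<close>, and \<open>lform\<close> is small at every active index. So
  \<open>comb1\<close> makes \<open>y1\<close> small, \<open>comb2\<close> then makes
  \<open>y0\<close> small, and \<open>y2\<close> follows \<open>y1\<close>, against the primitivity
  of the vector \<open>y\<close>.\<close>

lemma primitive_contradiction:
  assumes nz: "\<And>i. i < n \<Longrightarrow> x i \<noteq> 0" and xint: "\<And>i. i < n \<Longrightarrow> 0 \<le> v (x i)"
    and i0: "i0 < n" "v (x i0) = 0" and i1: "i1 < n" "v (x i1) \<noteq> 0"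
    and yint: "ge 0 y0" "ge 0 y1" "ge 0 y2" and yprim: "\<not> (ge 1 y0 \<and> ge 1 y1 \<and> ge 1 y2)"
    and te: "xgam x * y2\<^sup>2 = 0 \<or> xgam x * y1 * y2 \<noteq> 0 \<and> v (xgam x * y1 * y2) \<le> v (xgam x * y2\<^sup>2)"
    and tj: "\<And>j. j < n \<Longrightarrow> tau x y0 y1 j = 0 \<or>
      xgam x * y1 * y2 \<noteq> 0 \<and> v (xgam x * y1 * y2) \<le> v (tau x y0 y1 j)"
  shows False
proof -
  define J where "J = {i. i < n \<and> v (x i) = 0}"
  have J: "J \<subseteq> {..<n}" "J \<noteq> {}" "J \<noteq> {..<n}"
    using i0 i1 by (auto simp: J_def)
  have xg: "xgam x \<noteq> 0"
    using nz by (simp add: xgam_def)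
  have vxg: "v (xgam x) = (\<Sum>i<n. int (gam i) * v (x i))"
    using nz unfolding xgam_def by (subst v_prod) (auto simp: v_power)
  have y21: "y2 = 0 \<or> y1 \<noteq> 0 \<and> v y1 \<le> v y2"
    using te xg by (auto simp: v_mult v_power)
  have small: "ge 1 (lform x y0 y1 j)" if j: "j < n" "active J j" for j
  proof (cases "lform x y0 y1 j = 0")
    case False
    have px: "(\<Prod>i\<in>cls j. x i) \<noteq> 0"
      using cls_sub[OF j(1)] nz by (simp add: subset_iff)
    have vp: "v (\<Prod>i\<in>cls j. x i) = (\<Sum>i<n. (if i \<in> cls j then 1 else 0) * v (x i))"
    proof -
      have "v (\<Prod>i\<in>cls j. x i) = (\<Sum>i\<in>cls j. v (x i))"
        using cls_sub[OF j(1)] nz by (subst v_prod) auto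
      also have "\<dots> = (\<Sum>i<n. if i \<in> cls j then v (x i) else 0)"
        using cls_sub[OF j(1)] by (simp add: sum.If_cases Int_absorb1 Int_commute)
      finally show ?thesis
        by (simp add: if_distrib if_distribR cong: if_cong)
    qed
    have tnz: "tau x y0 y1 j \<noteq> 0"
      using px False by (simp add: tau_def)
    then have k: "y1 \<noteq> 0" "y2 \<noteq> 0" "v (xgam x * y1 * y2) \<le> v (tau x y0 y1 j)"
      using tj[OF j(1)] by auto
    have "v (tau x y0 y1 j) = v (\<Prod>i\<in>cls j. x i) + 2 * v (lform x y0 y1 j)"
      using px False by (simp add: tau_def v_mult v_power)
    then have "v (xgam x) - v (\<Prod>i\<in>cls j. x i) + v y1 + v y2 \<le> 2 * v (lform x y0 y1 j)"
      using k xg by (simp add: v_mult)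
    moreover have "0 < v (xgam x) - v (\<Prod>i\<in>cls j. x i)"
    proof -
      obtain i where i: "i < n" "i \<notin> J" "i \<notin> cls j \<or> 2 \<le> gam i"
        using j(2) by (auto simp: active_def)
      have "v (xgam x) - v (\<Prod>i\<in>cls j. x i) = (\<Sum>i<n. (int (gam i) - (if i \<in> cls j then 1 else 0)) * v (x i))"
        by (simp add: vxg vp sum_subtractf left_diff_distrib)
      also have "\<dots> \<ge> (\<Sum>i'\<in>{i}. (int (gam i') - (if i' \<in> cls j then 1 else 0)) * v (x i'))"
        using i gam_pos xint by (intro sum_mono2) (auto intro!: mult_nonneg_nonneg simp: of_nat_le_iff[of 1, symmetric] simp del: of_nat_le_iff)
      moreover have "0 < (int (gam i) - (if i \<in> cls j then 1 else 0)) * v (x i)"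
        using i gam_pos[of i] xint[of i] by (intro mult_pos_pos) (auto simp: J_def)
      ultimately show ?thesis
        by simp
    qed
    moreover have "0 \<le> v y1" "0 \<le> v y2"
      using yint k by (auto simp: ge_def)
    ultimately show ?thesis
      by (simp add: ge_def)
  qed simp
  obtain j where j: "j \<in> J" "cyc_suc n j \<notin> J" "active J j"
    using comb1[OF J] by blast
  have jn: "j < n" "v (x j) = 0" "x j \<noteq> 0"
    using j nz by (auto simp: J_def)
  have sn: "ge 1 (x (cyc_suc n j))"
    using j(2) cyc_suc_less[OF jn(1)] xint[of "cyc_suc n j"] by (auto simp: J_def ge_def)
  have "ge 1 (x j ^ rad j * y1)"
  proof -
    have "ge 1 (x (cyc_suc n j) ^ rad j * y0)"
      using ge_mult[OF ge_1_power[OF sn] yint(1), of "rad j"] rad_pos[OF jn(1)] by simp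
    then show ?thesis
      using ge_diff[OF small[OF jn(1) j(3)]] by (fastforce simp: lform_def)
  qed
  then have y1: "ge 1 y1"
    using jn by (simp add: ge_cancel v_power)
  obtain j' where j': "j' < n" "cyc_suc n j' \<in> J" "active J j'"
    using comb2[OF J] by blast
  have s': "v (x (cyc_suc n j')) = 0" "x (cyc_suc n j') \<noteq> 0"
    using j' nz by (auto simp: J_def)
  have "ge 1 (x (cyc_suc n j') ^ rad j' * y0)"
  proof -
    have "ge 0 (x j')"
      using xint[OF j'(1)] by (simp add: ge_def)
    then have "ge 1 (x j' ^ rad j' * y1)"
      using ge_mult[OF ge_power y1, of "x j'" "rad j'"] by simp
    then show ?thesis
      using ge_diff[OF small[OF j'(1,3)]] by (fastforce simp: lform_def)
  qed
  then have y0: "ge 1 y0"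
    using s' by (simp add: ge_cancel v_power)
  show False
    using y0 y1 y21 yprim by (auto simp: ge_def)
qed

text \<open>Everything is measured against \<open>\<kappa>\<close>, the term that carries the
  derivative of \<open>y1 * y2\<close>. If a coefficient dominates it, the differentiated equation
  is already the relation. Otherwise two summands \<open>\<tau>\<close> agree up to a smaller error,
  or \<open>primitive_contradiction\<close> applies.\<close>

lemma relation_normalized:
  assumes nz: "\<And>i. i < n \<Longrightarrow> x i \<noteq> 0" and xint: "\<And>i. i < n \<Longrightarrow> 0 \<le> v (x i)"
    and i0: "i0 < n" "v (x i0) = 0" and i1: "i1 < n" "v (x i1) \<noteq> 0"
    and yint: "ge 0 y0" "ge 0 y1" "ge 0 y2" and yprim: "\<not> (ge 1 y0 \<and> ge 1 y1 \<and> ge 1 y2)"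
    and eq: "special x y0 y1 y2 = 0"
  shows "relation x"
proof -
  define \<tau> where "\<tau> = tau x y0 y1"
  define te where "te = xgam x * y2\<^sup>2"
  define \<kappa> where "\<kappa> = xgam x * y1 * y2"
  define \<Lambda> where "\<Lambda> i = (\<Sum>j\<in>{j. j < n \<and> i \<in> cls j}. \<tau> j) + of_nat (gam i) * te" for i
  define Z where "Z a \<longleftrightarrow> a = 0 \<or> \<kappa> \<noteq> 0 \<and> v \<kappa> \<le> v a" for a
  have Z_ge: "Z a \<longleftrightarrow> a = 0 \<or> \<kappa> \<noteq> 0 \<and> ge (v \<kappa>) a" for a
    by (auto simp: Z_def ge_def)
  have Z0: "Z 0"
    by (simp add: Z_def)
  have Z_add: "Z (a + b)" if "Z a" "Z b" for a b
    using that ge_add by (auto simp: Z_ge)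
  have Z_kappa: "Z (of_nat m * \<kappa>)" for m
    by (auto simp: of_nat_parity Z_def)
  have xg: "xgam x \<noteq> 0"
    using nz by (simp add: xgam_def)
  have S: "(\<Sum>j<n. \<tau> j) + te = \<kappa>"
    using eq move[of "(\<Sum>j<n. \<tau> j) + te" \<kappa> 0]
    by (simp add: special_char2[OF char2] \<tau>_def te_def \<kappa>_def)
  define w where "w i = \<Lambda> i + of_nat (gam i) * \<kappa>" for i
  have w_deriv: "(\<Sum>i<n. w i * dlog (D k) (x i)) = xgam x * D k (y1 * y2)" for k
    using relation_deriv(1)[OF nz eq] by (simp add: w_def \<Lambda>_def \<tau>_def te_def \<kappa>_def)
  have w_sum: "(\<Sum>i<n. w i) = 0"
    using relation_deriv(2)[OF nz eq] by (simp add: w_def \<Lambda>_def \<tau>_def te_def \<kappa>_def)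
  show ?thesis
  proof (cases "\<forall>i<n. Z (\<Lambda> i)")
    case False
    then obtain i2 where i2: "i2 < n" "\<not> Z (\<Lambda> i2)"
      by auto
    have "\<not> Z (w i2)"
    proof
      assume "Z (w i2)"
      then have "Z (w i2 + of_nat (gam i2) * \<kappa>)"
        using Z_kappa Z_add by blast
      then show False
        using i2(2) dbl[of "of_nat (gam i2) * \<kappa>"] by (simp add: w_def add.assoc)
    qed
    then have i2': "w i2 \<noteq> 0" "\<kappa> \<noteq> 0 \<Longrightarrow> v (w i2) < v \<kappa>"
      by (auto simp: Z_def)
    let ?A = "{i. i < n \<and> w i \<noteq> 0}"
    have "finite ?A" "?A \<noteq> {}"
      using i2(1) i2'(1) by auto
    then have "\<exists>i\<in>?A. \<forall>i'\<in>?A. v (w i) \<le> v (w i')"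
      by (rule ex_min_on_finite)
    then obtain i3 where i3: "i3 < n" "w i3 \<noteq> 0" "\<And>i. i < n \<Longrightarrow> w i \<noteq> 0 \<Longrightarrow> v (w i3) \<le> v (w i)"
      by blast
    \<comment> \<open>Division by a coefficient of least valuation makes all of them integral and
      one equal to 1. Since \<open>v (w i3) < v \<kappa>\<close> for nonzero
      \<open>\<kappa>\<close>, the right-hand side acquires a factor in the maximal ideal.\<close>
    define w' where "w' i = w i / w i3" for i
    have w'_eq: "(\<Sum>i<n. w' i * f i) = (\<Sum>i<n. w i * f i) / w i3" for f :: "nat \<Rightarrow> 'k"
      by (simp add: w'_def sum_divide_distrib)
    have "\<forall>i<n. ge 0 (w' i)"
    proof (intro allI impI)
      fix i assume "i < n"
      then show "ge 0 (w' i)"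
        using i3 by (cases "w i = 0") (simp_all add: w'_def ge_def v_divide)
    qed
    moreover have "(\<Sum>i<n. w' i) = 0"
      using w'_eq[of "\<lambda>_. 1"] w_sum by simp
    moreover have "w' i3 \<noteq> 0 \<and> v (w' i3) = 0"
      using i3(2) by (simp add: w'_def)
    then have "\<exists>i<n. w' i \<noteq> 0 \<and> v (w' i) = 0"
      using i3(1) by blast
    moreover have "(\<Sum>i<n. w' i * dlog (D k) (x i)) = xgam x * D k (y1 * y2) / w i3" for k
      by (simp only: w'_eq w_deriv)
    moreover have "\<exists>u g. ge 1 u \<and> g \<noteq> 0 \<and> (\<forall>k. xgam x * D k (y1 * y2) / w i3 = u * dlog (D k) g)"
    proof (cases "\<kappa> = 0")
      case True
      then have "y1 * y2 = 0"
        using xg by (auto simp: \<kappa>_def)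
      then show ?thesis
        by (intro exI[of _ 0] exI[of _ 1]) auto
    next
      case False
      then have "y1 * y2 \<noteq> 0"
        by (auto simp: \<kappa>_def)
      moreover have "v (w i3) < v \<kappa>"
        using i3(3)[OF i2(1) i2'(1)] i2'(2)[OF False] by simp
      then have "ge 1 (\<kappa> / w i3)"
        using i3(2) False by (simp add: ge_def v_divide)
      moreover have "xgam x * D k (y1 * y2) / w i3 = \<kappa> / w i3 * dlog (D k) (y1 * y2)" for k
        using \<open>y1 * y2 \<noteq> 0\<close> by (simp add: \<kappa>_def dlog_def)
      ultimately show ?thesis
        by blast
    qed
    ultimately show ?thesis
      by (rule relationI)
  next
    case True
    have "Z ((\<Sum>j<n. \<tau> j) + te)"
      by (simp add: S Z_def)
    moreover have "Z ((\<Sum>j\<in>{j. j < n \<and> i \<in> cls j}. \<tau> j) + of_nat (gam i) * te)" if "i < n" for i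
      using True that by (simp add: \<Lambda>_def)
    ultimately have "(\<forall>j<n. Z (\<tau> j)) \<and> Z te \<or>
        (\<exists>i<n. \<exists>j<n. cls i \<noteq> cls j \<and> Z (\<tau> i + \<tau> j) \<and> \<not> Z (\<tau> i))"
      using linear_alternative[OF char2 Z0 Z_add, where \<tau> = \<tau>] by blast
    then show ?thesis
    proof
      assume *: "(\<forall>j<n. Z (\<tau> j)) \<and> Z te"
      have False
        using * by (intro primitive_contradiction[OF nz xint i0 i1 yint yprim])
          (auto simp: Z_def \<tau>_def te_def \<kappa>_def)
      then show ?thesis ..
    next
      assume "\<exists>i<n. \<exists>j<n. cls i \<noteq> cls j \<and> Z (\<tau> i + \<tau> j) \<and> \<not> Z (\<tau> i)"
      then obtain i j where ij: "i < n" "j < n" "cls i \<noteq> cls j" "Z (\<tau> i + \<tau> j)" "\<not> Z (\<tau> i)"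
        by blast
      \<comment> \<open>Here \<open>\<tau> j = \<tau> i * (1 + \<epsilon>)\<close> with
        \<open>\<epsilon>\<close> in the maximal ideal, and the logarithmic derivative of
        \<open>1 + \<epsilon>\<close> is \<open>\<epsilon> / (1 + \<epsilon>)\<close> times that of
        \<open>\<epsilon>\<close>: the required kind of right-hand side.\<close>
      define \<epsilon> where "\<epsilon> = (\<tau> i + \<tau> j) / \<tau> i"
      have ti: "\<tau> i \<noteq> 0"
        using ij(5) Z0 by auto
      have e: "ge 1 \<epsilon>"
      proof (cases "\<tau> i + \<tau> j = 0")
        case False
        then show ?thesis
          using ij ti by (auto simp: \<epsilon>_def ge_def v_divide Z_def)
      qed (simp add: \<epsilon>_def)
      have e1: "1 + \<epsilon> \<noteq> 0" "v (1 + \<epsilon>) = 0"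
        using ge_1_unit_add[OF e] by auto
      have tj: "\<tau> j = \<tau> i * (1 + \<epsilon>)"
      proof -
        have "\<tau> i * (1 + \<epsilon>) = \<tau> j + (\<tau> i + \<tau> i)"
          using ti by (simp add: \<epsilon>_def field_simps)
        then show ?thesis
          by (simp add: dbl)
      qed
      then have tj0: "\<tau> j \<noteq> 0"
        using ti e1 by simp
      have dl: "dlog (D k) (\<tau> j') = (\<Sum>i\<in>cls j'. dlog (D k) (x i))" if "j' < n" "\<tau> j' \<noteq> 0" for j' k
        using D_tau[OF nz that(1), where ?y0.0 = y0 and ?y1.0 = y1] that(2) by (simp add: dlog_def \<tau>_def)
      \<comment> \<open>In characteristic 2 this is the indicator of the symmetric difference of the
        two classes, which is nonempty and has even size.\<close>
      define w' where "w' l = (if l \<in> cls j then 1 else 0) + (if l \<in> cls i then 1 else (0::'k))" for l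
      have sum_w': "(\<Sum>l<n. w' l * f l) = (\<Sum>l\<in>cls j. f l) + (\<Sum>l\<in>cls i. f l)" for f :: "nat \<Rightarrow> 'k"
      proof -
        have "(\<Sum>l<n. (if l \<in> cls j' then 1 else 0) * f l) = (\<Sum>l\<in>cls j'. f l)" if "j' < n" for j'
        proof -
          have "(\<Sum>l<n. (if l \<in> cls j' then 1 else 0) * f l) = (\<Sum>l<n. if l \<in> cls j' then f l else 0)"
            by (intro sum.cong) auto
          also have "\<dots> = (\<Sum>l\<in>cls j'. f l)"
            using cls_sub[OF that] by (simp add: sum.If_cases Int_absorb1 Int_commute)
          finally show ?thesis .
        qed
        then show ?thesis
          using ij(1,2) by (simp add: w'_def distrib_right sum.distrib)
      qed
      have "\<forall>l<n. ge 0 (w' l)"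
        by (auto simp: w'_def ge_1 dbl)
      moreover have "(\<Sum>l<n. w' l) = 0"
      proof -
        have "even (card (cls j) + card (cls i))"
          using deg_rad[OF ij(1)] deg_rad[OF ij(2)] by presburger
        then show ?thesis
          using sum_w'[of "\<lambda>_. 1"] of_nat_parity[of "card (cls j) + card (cls i)"] by simp
      qed
      moreover have "\<exists>l<n. w' l \<noteq> 0 \<and> v (w' l) = 0"
      proof -
        obtain l where "l \<in> cls i \<longleftrightarrow> l \<notin> cls j"
          using ij(3) by blast
        moreover from this have "l < n"
          using cls_sub[OF ij(1)] cls_sub[OF ij(2)] by auto
        ultimately show ?thesis
          by (intro exI[of _ l]) (auto simp: w'_def)
      qed
      moreover have dsum: "(\<Sum>l<n. w' l * dlog (D k) (x l)) = D k \<epsilon> / (1 + \<epsilon>)" for k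
      proof -
        have "(\<Sum>l<n. w' l * dlog (D k) (x l)) = dlog (D k) (\<tau> j) + dlog (D k) (\<tau> i)"
          using ij(1,2) ti tj0 by (simp add: sum_w' dl)
        also have "\<dots> = dlog (D k) (1 + \<epsilon>) + (dlog (D k) (\<tau> i) + dlog (D k) (\<tau> i))"
          unfolding tj dlog_mult[OF ti e1(1)] by (simp only: add_ac)
        finally show ?thesis
          by (simp add: dbl) (simp add: dlog_def D_add)
      qed
      moreover have "\<exists>u g. ge 1 u \<and> g \<noteq> 0 \<and> (\<forall>k. D k \<epsilon> / (1 + \<epsilon>) = u * dlog (D k) g)"
      proof (cases "\<epsilon> = 0")
        case True
        then show ?thesis
          by (intro exI[of _ 0] exI[of _ 1]) auto
      next
        case False
        moreover have "ge 1 (\<epsilon> / (1 + \<epsilon>))"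
          using e e1 False by (auto simp: ge_def v_divide)
        ultimately show ?thesis
          by (intro exI[of _ "\<epsilon> / (1 + \<epsilon>)"] exI[of _ \<epsilon>]) (auto simp: dlog_def)
      qed
      ultimately show ?thesis
        by (rule relationI)
    qed
  qed
qed

end

section \<open>Determinants of logarithmic derivatives\<close>

lemma det_row_combination:
  fixes A :: "'a::comm_ring_1 mat"
  assumes A: "A \<in> carrier_mat N N" and p: "p < N" and I: "finite I" "I \<subseteq> {..<N} - {p}"
  shows "det (mat N N (\<lambda>(i, k). if i = p then a * A $$ (p, k) + (\<Sum>j\<in>I. c j * A $$ (j, k)) else A $$ (i, k)))
    = a * det A"
  using I
proof (induction I rule: finite_induct)
  case empty
  have "mat N N (\<lambda>(i, k). if i = p then a * A $$ (p, k) + (\<Sum>j\<in>{}. c j * A $$ (j, k)) else A $$ (i, k)) = multrow p a A"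
    using A by (intro eq_matI) auto
  then show ?case
    using det_multrow[OF p A] by simp
next
  case (insert j I)
  let ?B = "mat N N (\<lambda>(i, k). if i = p then a * A $$ (p, k) + (\<Sum>j\<in>I. c j * A $$ (j, k)) else A $$ (i, k))"
  have j: "j < N" "p \<noteq> j"
    using insert.prems by auto
  have "mat N N (\<lambda>(i, k). if i = p then a * A $$ (p, k) + (\<Sum>j\<in>insert j I. c j * A $$ (j, k)) else A $$ (i, k))
      = addrow (c j) p j ?B"
    using insert.hyps j p by (intro eq_matI) (auto simp: algebra_simps)
  then show ?case
    using det_addrow[OF j, of ?B "c j"] insert by simp
qed

lemma det_row_clear:
  fixes A :: "'a::comm_ring_1 mat"
  assumes A: "A \<in> carrier_mat N N" and q: "q < N" and I: "finite I" "I \<subseteq> {..<N} - {q}"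
  shows "det (mat N N (\<lambda>(i, k). if i \<in> I then A $$ (i, k) + c i * A $$ (q, k) else A $$ (i, k))) = det A"
  using I
proof (induction I rule: finite_induct)
  case empty
  have "mat N N (\<lambda>(i, k). if i \<in> {} then A $$ (i, k) + c i * A $$ (q, k) else A $$ (i, k)) = A"
    using A by (intro eq_matI) auto
  then show ?case
    by simp
next
  case (insert j I)
  let ?B = "mat N N (\<lambda>(i, k). if i \<in> I then A $$ (i, k) + c i * A $$ (q, k) else A $$ (i, k))"
  have j: "j < N" "j \<noteq> q"
    using insert.prems by auto
  have "mat N N (\<lambda>(i, k). if i \<in> insert j I then A $$ (i, k) + c i * A $$ (q, k) else A $$ (i, k))
      = addrow (c j) j q ?B"
    using insert.hyps insert.prems j q by (intro eq_matI) (auto simp: algebra_simps)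
  then show ?case
    using det_addrow[OF q j(2), of ?B "c j"] insert by simp
qed

text \<open>Rows are the functions \<open>x i / x 0\<close>, columns the derivations. The
  determinant is the value of the wedge product of the logarithmic differentials on these
  derivations.\<close>

definition logmat :: "nat \<Rightarrow> (nat \<Rightarrow> 'a::field \<Rightarrow> 'a) \<Rightarrow> (nat \<Rightarrow> 'a) \<Rightarrow> 'a mat" where
  "logmat n D x = mat (n - 1) (n - 1) (\<lambda>(i, k). dlog (D k) (x (Suc i) / x 0))"

context conic_params
begin

lemma special_scale:
  "special (\<lambda>i. c * x i) (e * y0) (e * y1) (e * y2) = c ^ d * e\<^sup>2 * special x y0 y1 y2"
proof -
  have "(\<Prod>i\<in>cls j. c * x i) * ((c * x j) ^ (2 * rad j) * (e * y1)\<^sup>2 + (c * x (cyc_suc n j)) ^ (2 * rad j) * (e * y0)\<^sup>2)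
      = c ^ d * e\<^sup>2 * ((\<Prod>i\<in>cls j. x i) * (x j ^ (2 * rad j) * y1\<^sup>2 + x (cyc_suc n j) ^ (2 * rad j) * y0\<^sup>2))"
    if "j < n" for j
  proof -
    have "c ^ d = c ^ card (cls j) * c ^ (2 * rad j)"
      using deg_rad[OF that] by (metis power_add)
    then show ?thesis
      by (simp add: prod.distrib power_mult_distrib algebra_simps)
  qed
  then have "(\<Sum>j<n. (\<Prod>i\<in>cls j. c * x i) * ((c * x j) ^ (2 * rad j) * (e * y1)\<^sup>2 + (c * x (cyc_suc n j)) ^ (2 * rad j) * (e * y0)\<^sup>2))
      = c ^ d * e\<^sup>2 * (\<Sum>j<n. (\<Prod>i\<in>cls j. x i) * (x j ^ (2 * rad j) * y1\<^sup>2 + x (cyc_suc n j) ^ (2 * rad j) * y0\<^sup>2))"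
    by (simp add: sum_distrib_left)
  moreover have "xgam (\<lambda>i. c * x i) * (e * y1 * (e * y2) + (e * y2)\<^sup>2)
      = c ^ d * e\<^sup>2 * (xgam x * (y1 * y2 + y2\<^sup>2))"
    by (simp add: xgam_scale power2_eq_square algebra_simps)
  ultimately show ?thesis
    by (simp add: special_def distrib_left)
qed

end

context conic_local
begin

text \<open>At the cost of a unit factor, one row is replaced by \<open>u * dlog (D k) g\<close>.
  All polar parts are multiples of one vector, so a single row can absorb the poles of the others,
  and the factor \<open>u\<close> compensates for it. If the derivations kill \<open>\<pi>\<close>,
  there are no poles at all and \<open>u\<close> remains as a zero.\<close>

lemma relation_det:
  assumes nz: "\<And>i. i < n \<Longrightarrow> x i \<noteq> 0" and rel: "relation x"
  shows "ge 0 (det (logmat n D x))"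
    and "(\<And>k. D k \<pi> = 0) \<Longrightarrow> ge 1 (det (logmat n D x))"
proof -
  obtain w u g where w: "\<And>i. i < n \<Longrightarrow> ge 0 (w i)" "(\<Sum>i<n. w i) = 0" "\<exists>i<n. w i \<noteq> 0 \<and> v (w i) = 0"
    and u: "ge 1 u" and g: "g \<noteq> 0" and dw: "\<And>k. (\<Sum>i<n. w i * dlog (D k) (x i)) = u * dlog (D k) g"
    using rel unfolding relation_def by metis
  define N where "N = n - 1"
  have N: "n = Suc N"
    using n_ge by (simp add: N_def)
  \<comment> \<open>The unit coefficient may sit at index 0, which has no row. As the coefficients
    add up to zero, a second one is then a unit too.\<close>
  have "\<exists>p<N. \<not> ge 1 (w (Suc p))"
  proof (rule ccontr)
    assume "\<not> (\<exists>p<N. \<not> ge 1 (w (Suc p)))"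
    then have all: "ge 1 (w (Suc p))" if "p < N" for p
      using that by blast
    then have "ge 1 (\<Sum>p<N. w (Suc p))"
      by (intro ge_sum) auto
    moreover have "w 0 = - (\<Sum>p<N. w (Suc p))"
      using w(2) unfolding N sum.lessThan_Suc_shift by (simp add: eq_neg_iff_add_eq_0)
    ultimately have "ge 1 (w 0)"
      using ge_uminus by metis
    then have "ge 1 (w i)" if "i < n" for i
      using all that unfolding N by (cases i) auto
    then show False
      using w(3) by (force simp: ge_def)
  qed
  then obtain p where p: "p < N" "\<not> ge 1 (w (Suc p))"
    by blast
  then have wp: "w (Suc p) \<noteq> 0" "v (w (Suc p)) = 0"
    using w(1)[of "Suc p"] unfolding N by (auto simp: ge_def)
  let ?A = "logmat n D x"
  have A: "?A \<in> carrier_mat N N"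
    by (simp add: logmat_def N_def)
  have A_entry: "?A $$ (i, k) = dlog (D k) (x (Suc i) / x 0)" if "i < N" "k < N" for i k
    using that by (simp add: logmat_def N_def)
  define B where "B = mat N N (\<lambda>(i, k). if i = p then u * dlog (D k) g else ?A $$ (i, k))"
  have B: "B \<in> carrier_mat N N"
    by (simp add: B_def)
  have B_p: "B $$ (p, k) = u * dlog (D k) g" and B_i: "i \<noteq> p \<Longrightarrow> i < N \<Longrightarrow> B $$ (i, k) = dlog (D k) (x (Suc i) / x 0)"
    if "k < N" for i k
    using that p by (auto simp: B_def A_entry)
  have detB: "det B = w (Suc p) * det ?A"
  proof -
    let ?I = "{..<N} - {p}"
    have "w (Suc p) * ?A $$ (p, k) + (\<Sum>j\<in>?I. w (Suc j) * ?A $$ (j, k)) = u * dlog (D k) g" if k: "k < N" for k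
    proof -
      have "w (Suc p) * ?A $$ (p, k) + (\<Sum>j\<in>?I. w (Suc j) * ?A $$ (j, k)) = (\<Sum>j<N. w (Suc j) * ?A $$ (j, k))"
        using p by (simp add: sum.remove)
      also have "\<dots> = (\<Sum>j<N. w (Suc j) * dlog (D k) (x (Suc j))) - (\<Sum>j<N. w (Suc j)) * dlog (D k) (x 0)"
        using nz k unfolding N
        by (simp add: A_entry[unfolded N] dlog_divide sum_distrib_right right_diff_distrib flip: sum_subtractf)
      also have "\<dots> = (\<Sum>i<n. w i * dlog (D k) (x i))"
        using w(2) unfolding N sum.lessThan_Suc_shift
        by (simp add: add_eq_0_iff2 sum_distrib_right algebra_simps)
      finally show ?thesis
        by (simp add: dw)
    qed
    then have "B = mat N N (\<lambda>(i, k). if i = p then w (Suc p) * ?A $$ (p, k) + (\<Sum>j\<in>?I. w (Suc j) * ?A $$ (j, k)) else ?A $$ (i, k))"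
      unfolding B_def by (intro eq_matI) auto
    then show ?thesis
      using det_row_combination[OF A p(1), of ?I "w (Suc p)" "\<lambda>j. w (Suc j)"] by simp
  qed
  then have reduce: "ge m (det ?A)" if "ge m (det B)" for m
    using that wp by (simp add: ge_cancel)
  define \<theta> where "\<theta> k = dlog (D k) \<pi>" for k
  define m where "m i = v (x (Suc i) / x 0)" for i
  define \<alpha> where "\<alpha> i k = dlog (D k) (x (Suc i) / x 0) - of_int (m i) * \<theta> k" for i k
  define \<beta> where "\<beta> k = dlog (D k) g - of_int (v g) * \<theta> k" for k
  have q_nz: "x (Suc i) / x 0 \<noteq> 0" if "i < N" for i
    using nz that unfolding N by simp
  have \<alpha>: "ge 0 (\<alpha> i k)" if "i < N" for i k
    using dlog_decomp[OF q_nz[OF that]] unfolding \<alpha>_def \<theta>_def m_def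
    by (metis add_diff_cancel_right')
  have \<beta>: "ge 0 (\<beta> k)" for k
    using dlog_decomp[OF g] unfolding \<beta>_def \<theta>_def
    by (metis add_diff_cancel_right')
  have x_dec: "dlog (D k) (x (Suc i) / x 0) = \<alpha> i k + of_int (m i) * \<theta> k" for i k
    by (simp add: \<alpha>_def)
  have g_dec: "dlog (D k) g = \<beta> k + of_int (v g) * \<theta> k" for k
    by (simp add: \<beta>_def)
  show "ge 0 (det ?A)"
  \<comment> \<open>An even multiple of the logarithmic derivative of \<open>\<pi>\<close> vanishes
    in characteristic 2, so besides row \<open>p\<close> only rows of odd order can have a
    pole.\<close>
  proof (cases "\<exists>q<N. q \<noteq> p \<and> odd (m q)")
    case False
    have "ge 0 (B $$ (i, k))" if "i < N" "k < N" for i k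
    proof (cases "i = p")
      case True
      then show ?thesis
        using ge_mult[OF u ge_dlog[OF g]] that by (simp add: B_p)
    next
      case i: False
      then have "even (m i)"
        using False that by blast
      then show ?thesis
        using i that \<alpha> by (simp add: B_i x_dec of_int_parity)
    qed
    then show ?thesis
      by (intro reduce ge_det[OF B])
  next
    case True
    then obtain q where q: "q < N" "q \<noteq> p" "odd (m q)"
      by blast
    define I where "I = {i. i < N \<and> i \<noteq> q \<and> (i = p \<or> odd (m i))}"
    define c where "c i = (if i = p then - (u * of_int (v g)) else - 1)" for i
    define C where "C = mat N N (\<lambda>(i, k). if i \<in> I then B $$ (i, k) + c i * B $$ (q, k) else B $$ (i, k))"
    have C: "C \<in> carrier_mat N N"
      by (simp add: C_def)
    have detC: "det C = det B"
      unfolding C_def by (rule det_row_clear[OF B q(1)]) (auto simp: I_def)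
    have Bq: "B $$ (q, k) = \<alpha> q k + \<theta> k" if "k < N" for k
      using q that by (simp add: B_i x_dec of_int_parity)
    have C_p: "ge 1 (C $$ (p, k))" if "k < N" for k
    proof -
      have "C $$ (p, k) = u * (\<beta> k - of_int (v g) * \<alpha> q k)"
        using p(1) q(2) that by (simp add: C_def I_def c_def B_p Bq g_dec algebra_simps)
      moreover have "ge 0 (\<beta> k - of_int (v g) * \<alpha> q k)"
        using ge_diff[OF \<beta> ge_mult[OF ge_of_int \<alpha>[OF q(1)], simplified]] .
      ultimately show ?thesis
        using ge_mult[OF u] by fastforce
    qed
    have C_q: "ge (- 1) (C $$ (q, k))" if "k < N" for k
      using q that ge_dlog[OF q_nz[OF q(1)]] by (simp add: C_def I_def B_i)
    have C_i: "ge 0 (C $$ (i, k))" if "i < N" "k < N" "i \<noteq> p" "i \<noteq> q" for i k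
    proof (cases "odd (m i)")
      case True
      then have "C $$ (i, k) = \<alpha> i k - \<alpha> q k"
        using that by (simp add: C_def I_def c_def Bq B_i x_dec of_int_parity)
      then show ?thesis
        using ge_diff[OF \<alpha> \<alpha>] that q by simp
    next
      case False
      then have "C $$ (i, k) = \<alpha> i k"
        using that by (simp add: C_def I_def B_i x_dec of_int_parity)
      then show ?thesis
        using \<alpha> that by simp
    qed
    \<comment> \<open>The cleared row \<open>p\<close> is divisible by \<open>\<pi>\<close> and row
      \<open>q\<close> has at most a simple pole, so a factor \<open>\<pi>\<close> is moved from one
      to the other without changing the determinant.\<close>
    define E where "E = multrow p (inverse \<pi>) (multrow q \<pi> C)"
    have "E \<in> carrier_mat N N"
      using C by (simp add: E_def)
    moreover have "ge 0 (E $$ (i, k))" if "i < N" "k < N" for i k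
    proof -
      have "ge 0 (\<pi> * C $$ (q, k))" "ge 0 (inverse \<pi> * C $$ (p, k))"
        using C_p[OF that(2)] C_q[OF that(2)] by (auto simp: ge_cancel v_inverse)
      then show ?thesis
        using C_i[OF that] C that q p by (auto simp: E_def)
    qed
    ultimately have "ge 0 (det E)"
      by (rule ge_det)
    moreover have "det E = det C"
      using C p(1) q(1) by (simp add: E_def det_multrow[of _ N])
    ultimately show ?thesis
      by (intro reduce) (simp add: detC)
  qed
  assume "\<And>k. D k \<pi> = 0"
  then have \<theta>0: "\<theta> k = 0" for k
    by (simp add: \<theta>_def dlog_def)
  define E where "E = multrow p (inverse \<pi>) B"
  have "E \<in> carrier_mat N N"
    using B by (simp add: E_def)
  moreover have "ge 0 (E $$ (i, k))" if "i < N" "k < N" for i k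
  proof (cases "i = p")
    case True
    have "ge 1 (B $$ (p, k))"
      using ge_mult[OF u \<beta>[of k]] that by (simp add: B_p g_dec \<theta>0)
    then have "ge 0 (inverse \<pi> * B $$ (p, k))"
      by (simp add: ge_cancel v_inverse)
    then show ?thesis
      using that B True by (simp add: E_def)
  next
    case False
    then show ?thesis
      using that B \<alpha> by (simp add: E_def B_i x_dec \<theta>0)
  qed
  ultimately have "ge 0 (det E)"
    by (rule ge_det)
  moreover have "det E = inverse \<pi> * det B"
    using det_multrow[OF p(1) B] by (simp add: E_def)
  ultimately have "ge 1 (det B)"
    by (simp add: ge_cancel v_inverse)
  then show "ge 1 (det ?A)"
    by (rule reduce)
qed

lemma relation_scale:
  assumes nz: "\<And>i. i < n \<Longrightarrow> x i \<noteq> 0" and c: "c \<noteq> 0" and rel: "relation (\<lambda>i. c * x i)"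
  shows "relation x"
proof -
  have "(\<Sum>i<n. w i * dlog (D k) (c * x i)) = (\<Sum>i<n. w i * dlog (D k) (x i))" if "(\<Sum>i<n. w i) = 0" for w k
  proof -
    have "(\<Sum>i<n. w i * dlog (D k) (c * x i)) = (\<Sum>i<n. w i) * dlog (D k) c + (\<Sum>i<n. w i * dlog (D k) (x i))"
      using nz c by (simp add: dlog_mult distrib_left sum.distrib sum_distrib_right)
    then show ?thesis
      by (simp add: that)
  qed
  then show ?thesis
    using rel unfolding relation_def by (smt (verit, best))
qed

text \<open>If all coordinates have the same valuation, their ratios are units and the matrix is
  integral. Otherwise \<open>x\<close> and \<open>y\<close> are normalised separately by an entry of
  least valuation; the relation survives the rescaling of \<open>x\<close> because its coefficients
  add up to zero.\<close>

theorem regular_det: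
  assumes nz: "\<And>i. i < n \<Longrightarrow> x i \<noteq> 0" and y: "y0 \<noteq> 0 \<or> y1 \<noteq> 0 \<or> y2 \<noteq> 0"
    and eq: "special x y0 y1 y2 = 0"
  shows "ge 0 (det (logmat n D x))"
    and "(\<And>k. D k \<pi> = 0) \<Longrightarrow> \<exists>i<n. v (x i) \<noteq> v (x 0) \<Longrightarrow> ge 1 (det (logmat n D x))"
proof -
  have rel: "relation x" if ne: "\<exists>i<n. v (x i) \<noteq> v (x 0)"
  proof -
    have "\<exists>i\<in>{..<n}. \<forall>j\<in>{..<n}. v (x i) \<le> v (x j)"
      using n_ge by (intro ex_min_on_finite) (simp_all add: lessThan_empty_iff)
    then obtain i0 where i0: "i0 < n" "\<And>j. j < n \<Longrightarrow> v (x i0) \<le> v (x j)"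
      by blast
    let ?Y = "{y \<in> {y0, y1, y2}. y \<noteq> 0}"
    have "finite ?Y" "?Y \<noteq> {}"
      using y by auto
    then have "\<exists>a\<in>?Y. \<forall>b\<in>?Y. v a \<le> v b"
      by (rule ex_min_on_finite)
    then obtain y' where y': "y' \<in> {y0, y1, y2}" "y' \<noteq> 0"
        "\<And>b. b \<in> {y0, y1, y2} \<Longrightarrow> b \<noteq> 0 \<Longrightarrow> v y' \<le> v b"
      by blast
    define c where "c = inverse (x i0)"
    define e where "e = inverse y'"
    have c: "c \<noteq> 0" "v c = - v (x i0)" and e: "e \<noteq> 0" "v e = - v y'"
      using nz i0 y' by (auto simp: c_def e_def v_inverse)
    have "0 < n"
      using n_ge by simp
    then obtain i1 where i1: "i1 < n" "v (x i1) \<noteq> v (x i0)"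
      using ne by metis
    have int: "ge 0 (e * b)" if "b \<in> {y0, y1, y2}" for b
      using y'(3)[OF that] e by (cases "b = 0") (simp_all add: ge_def v_mult)
    have "relation (\<lambda>i. c * x i)"
    proof (rule relation_normalized)
      show "c * x i \<noteq> 0" if "i < n" for i
        using nz c that by simp
      show "0 \<le> v (c * x i)" if "i < n" for i
        using nz c i0(2) that by (simp add: v_mult)
      show "i0 < n" "v (c * x i0) = 0" "i1 < n" "v (c * x i1) \<noteq> 0"
        using nz c i0(1) i1 by (auto simp: v_mult)
      show "ge 0 (e * y0)" "ge 0 (e * y1)" "ge 0 (e * y2)"
        by (simp_all add: int)
      have "e * y' = 1"
        using y' by (simp add: e_def)
      then have "\<not> ge 1 (e * y')"
        by (simp add: ge_def)
      then show "\<not> (ge 1 (e * y0) \<and> ge 1 (e * y1) \<and> ge 1 (e * y2))"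
        using y'(1) by auto
      show "special (\<lambda>i. c * x i) (e * y0) (e * y1) (e * y2) = 0"
        by (simp add: special_scale eq)
    qed
    then show ?thesis
      using relation_scale[of x c] nz c(1) by blast
  qed
  show "ge 1 (det (logmat n D x))" if "\<And>k. D k \<pi> = 0" "\<exists>i<n. v (x i) \<noteq> v (x 0)"
    using relation_det(2)[OF nz rel[OF that(2)] that(1)] .
  show "ge 0 (det (logmat n D x))"
  proof (cases "\<exists>i<n. v (x i) \<noteq> v (x 0)")
    case True
    then show ?thesis
      by (intro relation_det(1) nz rel)
  next
    case False
    have "ge 0 (dlog (D k) (x (Suc i) / x 0))" if "i < n - 1" for i k
    proof -
      have "Suc i < n" "0 < n"
        using that by auto
      then have "x (Suc i) \<noteq> 0" "x 0 \<noteq> 0" "v (x (Suc i)) = v (x 0)"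
        using nz False by blast+
      then show ?thesis
        by (intro ge_dlog_unit) (auto simp: v_divide)
    qed
    then show ?thesis
      by (intro ge_det[where n = "n - 1"]) (auto simp: logmat_def)
  qed
qed

end

section \<open>Rational curves in the special fibre\<close>

definition fract_val :: "('a::idom \<Rightarrow> int) \<Rightarrow> 'a fract \<Rightarrow> int" where
  "fract_val \<mu> q = (SOME z. \<exists>a b. a \<noteq> 0 \<and> b \<noteq> 0 \<and> q = Fract a b \<and> z = \<mu> a - \<mu> b)"

lemma fract_nonzeroE:
  assumes "q \<noteq> 0"
  obtains a b where "q = Fract a b" "b \<noteq> 0" "a \<noteq> 0"
proof -
  obtain a b where ab: "q = Fract a b" "b \<noteq> 0"
    by (cases q)
  then have "a \<noteq> 0"
    using assms by (auto simp: fract_collapse)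
  then show thesis
    using ab that by blast
qed

locale idom_valuation =
  fixes \<mu> :: "'a::idom \<Rightarrow> int"
  assumes mu_mult: "a \<noteq> 0 \<Longrightarrow> b \<noteq> 0 \<Longrightarrow> \<mu> (a * b) = \<mu> a + \<mu> b"
    and mu_add: "a \<noteq> 0 \<Longrightarrow> b \<noteq> 0 \<Longrightarrow> a + b \<noteq> 0 \<Longrightarrow> min (\<mu> a) (\<mu> b) \<le> \<mu> (a + b)"
begin

lemma fract_val_Fract:
  assumes "a \<noteq> 0" "b \<noteq> 0"
  shows "fract_val \<mu> (Fract a b) = \<mu> a - \<mu> b"
proof -
  have "\<mu> c - \<mu> d = \<mu> a - \<mu> b" if "c \<noteq> 0" "d \<noteq> 0" "Fract a b = Fract c d" for c d
  proof -
    have "a * d = c * b"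
      using that assms by (simp add: eq_fract)
    then show ?thesis
      using mu_mult[of a d] mu_mult[of c b] that assms by simp
  qed
  then show ?thesis
    unfolding fract_val_def using assms by (intro some_equality) blast+
qed

lemma mu_1: "\<mu> 1 = 0"
  using mu_mult[of 1 1] by simp

lemma fract_val_to_fract: "a \<noteq> 0 \<Longrightarrow> fract_val \<mu> (to_fract a) = \<mu> a"
  by (simp add: to_fract_def fract_val_Fract mu_1)

lemma discrete_valuation_fract:
  assumes "\<pi> \<noteq> 0" "fract_val \<mu> \<pi> = 1"
  shows "discrete_valuation (fract_val \<mu>) \<pi>"
proof
  fix p q :: "'a fract"
  assume nz: "p \<noteq> 0" "q \<noteq> 0"
  obtain a b where p: "p = Fract a b" "b \<noteq> 0" "a \<noteq> 0"
    using nz fract_nonzeroE by metis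
  obtain c d where q: "q = Fract c d" "d \<noteq> 0" "c \<noteq> 0"
    using nz fract_nonzeroE by metis
  show "fract_val \<mu> (p * q) = fract_val \<mu> p + fract_val \<mu> q"
    using p q by (simp add: fract_val_Fract mu_mult)
  assume "p + q \<noteq> 0"
  then have "a * d + c * b \<noteq> 0"
    using p q by (auto simp: fract_collapse)
  moreover have "a * d \<noteq> 0" "c * b \<noteq> 0"
    using p q by auto
  ultimately have "min (\<mu> (a * d)) (\<mu> (c * b)) \<le> \<mu> (a * d + c * b)"
    by (intro mu_add)
  then show "min (fract_val \<mu> p) (fract_val \<mu> q) \<le> fract_val \<mu> (p + q)"
    using p q \<open>a * d + c * b \<noteq> 0\<close> by (simp add: fract_val_Fract mu_mult min_def split: if_splits)
qed (use assms in auto)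

end

lemma idom_valuation_multiplicity:
  fixes p :: "'a::{factorial_semiring,idom}"
  assumes "prime_elem p"
  shows "idom_valuation (\<lambda>a. int (multiplicity p a))"
proof
  fix a b :: 'a
  assume nz: "a \<noteq> 0" "b \<noteq> 0"
  show "int (multiplicity p (a * b)) = int (multiplicity p a) + int (multiplicity p b)"
    using nz assms by (simp add: prime_elem_multiplicity_mult_distrib)
  assume "a + b \<noteq> 0"
  let ?m = "min (multiplicity p a) (multiplicity p b)"
  have "p ^ ?m dvd a" "p ^ ?m dvd b"
    by (auto intro: multiplicity_dvd')
  then have "p ^ ?m dvd a + b"
    by (rule dvd_add)
  then have "?m \<le> multiplicity p (a + b)"
    using \<open>a + b \<noteq> 0\<close> assms by (intro multiplicity_geI) auto
  then show "min (int (multiplicity p a)) (int (multiplicity p b)) \<le> int (multiplicity p (a + b))"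
    by linarith
qed

lemma idom_valuation_degree: "idom_valuation (\<lambda>a::'a::idom poly. - int (degree a))"
proof
  fix a b :: "'a poly"
  assume nz: "a \<noteq> 0" "b \<noteq> 0"
  show "- int (degree (a * b)) = - int (degree a) + - int (degree b)"
    using nz by (simp add: degree_mult_eq)
  show "min (- int (degree a)) (- int (degree b)) \<le> - int (degree (a + b))"
    using degree_add_le_max[of a b] by linarith
qed

text \<open>After cancellation of the powers of \<open>p\<close> the denominator is prime to
  \<open>p\<close>, and the quotient rule only squares it.\<close>

lemma valuation_deriv_multiplicity:
  fixes p :: "'a::{factorial_semiring,idom}"
  assumes p: "prime_elem p" and D: "\<And>k. derivation (D k)"
  shows "valuation_deriv (fract_val (\<lambda>a. int (multiplicity p a))) (to_fract p) (\<lambda>k. deriv_fract (D k))"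
proof -
  let ?v = "fract_val (\<lambda>a. int (multiplicity p a))"
  interpret idom_valuation "\<lambda>a. int (multiplicity p a)"
    by (rule idom_valuation_multiplicity[OF p])
  have p0: "p \<noteq> 0" "\<not> is_unit p"
    using p by auto
  interpret discrete_valuation ?v "to_fract p"
    using p0 by (intro discrete_valuation_fract) (auto simp: fract_val_to_fract multiplicity_self)
  show ?thesis
  proof (intro valuation_deriv.intro valuation_deriv_axioms.intro discrete_valuation_axioms)
    show "field_derivation (deriv_fract (D k))" for k
      by (rule derivation_fract[OF D])
    fix q k
    assume q: "q = 0 \<or> 0 \<le> ?v q"
    show "deriv_fract (D k) q = 0 \<or> 0 \<le> ?v (deriv_fract (D k) q)"
    proof (cases "q = 0")
      case True
      have "q = to_fract 0"
        using True by simp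
      then show ?thesis
        by (simp only: deriv_fract_to_fract[OF D] derivation.D_0[OF D]) simp
    next
      case False
      obtain a b where ab: "q = Fract a b" "b \<noteq> 0" "a \<noteq> 0"
        using False fract_nonzeroE by metis
      let ?k = "multiplicity p b"
      have le: "?k \<le> multiplicity p a"
        using q False ab by (simp add: fract_val_Fract)
      obtain a' where a': "a = p ^ ?k * a'"
        using multiplicity_dvd'[OF le] by (auto elim: dvdE)
      obtain b' where b': "b = p ^ ?k * b'" "\<not> p dvd b'"
        using multiplicity_decompose'[of b p] ab p0 by auto
      have b'0: "b' \<noteq> 0"
        using b' by auto
      have pk: "p ^ ?k \<noteq> 0"
        using p0 by simp
      have q': "q = Fract a' b'"
        unfolding ab(1) using ab(2) b'0 a' b'(1) by (simp add: eq_fract)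
      have "multiplicity p (b' * b') = 0"
        using b' p by (intro not_dvd_imp_multiplicity_0) (simp add: prime_elem_dvd_mult_iff)
      then have "fract_val (\<lambda>a. int (multiplicity p a)) (Fract c (b' * b')) \<ge> 0" if "c \<noteq> 0" for c
        using that b'0 by (simp add: fract_val_Fract)
      then show ?thesis
        unfolding q' deriv_fract_Fract[OF D b'0] using b'0
        by (cases "D k a' * b' - a' * D k b' = 0") (auto simp: fract_collapse)
    qed
  qed
qed

text \<open>The point at infinity of the line. A derivation acting on coefficients cannot raise
  degrees, so the quotient rule keeps numerators below denominators.\<close>

lemma valuation_deriv_degree:
  fixes D :: "nat \<Rightarrow> 'a::field \<Rightarrow> 'a"
  assumes D: "\<And>k. derivation (D k)"
  shows "valuation_deriv (fract_val (\<lambda>a::'a poly. - int (degree a))) (inverse (to_fract [:0, 1:]))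
    (\<lambda>k. deriv_fract (deriv_poly (D k)))"
proof -
  let ?v = "fract_val (\<lambda>a::'a poly. - int (degree a))"
  interpret idom_valuation "\<lambda>a::'a poly. - int (degree a)"
    by (rule idom_valuation_degree)
  have inv: "inverse (to_fract [:0, 1:]) = Fract 1 [:0, 1::'a:]"
    by (simp add: to_fract_def)
  interpret discrete_valuation ?v "inverse (to_fract [:0, 1:])"
    by (intro discrete_valuation_fract) (auto simp: inv fract_val_Fract, simp flip: inv)
  show ?thesis
  proof (intro valuation_deriv.intro valuation_deriv_axioms.intro discrete_valuation_axioms)
    show "field_derivation (deriv_fract (deriv_poly (D k)))" for k
      by (rule derivation_fract[OF derivation_poly[OF D]])
    fix q k
    assume q: "q = 0 \<or> 0 \<le> ?v q"
    interpret Dp: derivation "deriv_poly (D k)"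
      by (rule derivation_poly[OF D])
    have deg: "degree (deriv_poly (D k) a) \<le> degree a" for a
      by (intro degree_le) (simp add: coeff_deriv_poly[OF D] coeff_eq_0 derivation.D_0[OF D])
    show "deriv_fract (deriv_poly (D k)) q = 0 \<or> 0 \<le> ?v (deriv_fract (deriv_poly (D k)) q)"
    proof (cases "q = 0")
      case True
      have "q = to_fract 0"
        using True by simp
      then show ?thesis
        by (simp only: deriv_fract_to_fract[OF derivation_poly[OF D]] Dp.D_0) simp
    next
      case False
      obtain a b where ab: "q = Fract a b" "b \<noteq> 0" "a \<noteq> 0"
        using False fract_nonzeroE by metis
      have le: "degree a \<le> degree b"
        using q False ab by (simp add: fract_val_Fract)
      let ?c = "deriv_poly (D k) a * b - a * deriv_poly (D k) b"
      have "degree ?c \<le> degree b + degree b"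
      proof (rule degree_diff_le)
        show "degree (deriv_poly (D k) a * b) \<le> degree b + degree b"
          using degree_mult_le[of "deriv_poly (D k) a" b] deg[of a] le by linarith
        show "degree (a * deriv_poly (D k) b) \<le> degree b + degree b"
          using degree_mult_le[of a "deriv_poly (D k) b"] deg[of b] le by linarith
      qed
      then have "0 \<le> ?v (Fract ?c (b * b))" if "?c \<noteq> 0"
        using that ab(2) by (simp add: fract_val_Fract degree_mult_eq)
      then show ?thesis
        unfolding ab(1) deriv_fract_Fract[OF derivation_poly[OF D] ab(2)] using ab(2)
        by (cases "?c = 0") (auto simp: fract_collapse)
    qed
  qed
qed

text \<open>Primes are removed from the denominator one at a time: each divides the numerator, since
  the order of \<open>h\<close> at it is nonnegative.\<close>

lemma integral_fract:
  fixes h :: "'a::{factorial_semiring,idom} fract"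
  assumes "\<And>p. prime_elem p \<Longrightarrow> h = 0 \<or> 0 \<le> fract_val (\<lambda>a. int (multiplicity p a)) h"
  shows "\<exists>a. h = to_fract a"
proof (cases "h = 0")
  case True
  then show ?thesis
    by (intro exI[of _ 0]) simp
next
  case False
  obtain a b where ab: "h = Fract a b" "b \<noteq> 0" "a \<noteq> 0"
    using False fract_nonzeroE by metis
  from ab show ?thesis
  proof (induction b arbitrary: a rule: prime_divisors_induct)
    case (unit b)
    then obtain c where c: "b * c = 1"
      by (auto elim!: dvdE)
    then have "h = to_fract (a * c)"
      using unit by (simp add: to_fract_def eq_fract mult_ac)
    then show ?case
      by blast
  next
    case (factor p b)
    then have p: "prime_elem p"
      by simp
    interpret idom_valuation "\<lambda>a. int (multiplicity p a)"
      by (rule idom_valuation_multiplicity[OF p])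
    have "multiplicity p (p * b) \<le> multiplicity p a"
      using assms[OF p] False factor by (simp add: fract_val_Fract)
    moreover have "1 \<le> multiplicity p (p * b)"
      using factor p by (intro multiplicity_geI) auto
    ultimately have "p dvd a"
      using multiplicity_dvd'[of 1 p a] by simp
    then obtain a' where a': "a = p * a'"
      by (auto elim: dvdE)
    then have "h = Fract a' b"
      using factor by (simp add: eq_fract)
    then show ?case
      using factor a' by auto
  qed simp
qed

text \<open>The value 0 on the coordinate hyperplanes is the limit of the determinant there.\<close>

definition val :: "nat \<Rightarrow> (nat \<Rightarrow> 'a::field \<Rightarrow> 'a) \<Rightarrow> (nat \<Rightarrow> 'a) \<Rightarrow> 'a" where
  "val n D l = (if \<forall>i<n. l i \<noteq> 0 then det (logmat n D l) else 0)"

context valuation_deriv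
begin

lemma ge_1_D: "ge 1 a \<Longrightarrow> D k \<pi> = 0 \<Longrightarrow> ge 1 (D k a)"
proof -
  assume a: "ge 1 a" and "D k \<pi> = 0"
  have "ge 0 (inverse \<pi> * a)"
    using a by (simp add: ge_cancel v_inverse)
  then have "ge 1 (\<pi> * D k (inverse \<pi> * a))"
    using ge_D by (simp add: ge_cancel)
  moreover have "D k (\<pi> * (inverse \<pi> * a)) = \<pi> * D k (inverse \<pi> * a)"
    using \<open>D k \<pi> = 0\<close> by (simp add: D_mult[of k \<pi>])
  moreover have "\<pi> * (inverse \<pi> * a) = a"
    by simp
  ultimately show ?thesis
    by simp
qed

text \<open>Derivations that kill \<open>\<pi>\<close> preserve the maximal ideal and so act on
  residues. Each \<open>U i\<close> is \<open>l i\<close> times a factor congruent to 1, whose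
  logarithmic derivative is small; the rest is \<open>rel_det\<close> for congruence modulo
  \<open>\<pi>\<close>.\<close>

lemma det_logmat_reduction:
  assumes n: "1 \<le> n" and pi: "\<And>k. D k \<pi> = 0" and e: "e \<noteq> 0"
    and l: "\<And>i. i < n \<Longrightarrow> l i \<noteq> 0" "\<And>i. i < n \<Longrightarrow> v (l i) = 0"
    and x: "\<And>i. i < n \<Longrightarrow> x i = e * U i" "\<And>i. i < n \<Longrightarrow> ge 1 (U i - l i)"
  shows "ge 1 (det (logmat n D x) - det (logmat n D l))"
proof -
  interpret R: ring_rel "\<lambda>a b. ge 0 a \<and> ge 0 b \<and> ge 1 (a - b)"
  proof
    fix a a' b b'
    assume *: "ge 0 a \<and> ge 0 a' \<and> ge 1 (a - a')" "ge 0 b \<and> ge 0 b' \<and> ge 1 (b - b')"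
    have "ge 1 ((a - a') + (b - b'))"
      using * ge_add by blast
    then show "ge 0 (a + b) \<and> ge 0 (a' + b') \<and> ge 1 (a + b - (a' + b'))"
      using * ge_add by (auto simp: algebra_simps)
    have "ge 1 ((a - a') * b)" "ge 1 (a' * (b - b'))" "ge 0 (a * b)" "ge 0 (a' * b')"
      using * ge_mult[of 1 "a - a'" 0 b] ge_mult[of 0 a' 1 "b - b'"] ge_mult[of 0 a 0 b] ge_mult[of 0 a' 0 b'] by auto
    moreover have "a * b - a' * b' = (a - a') * b + a' * (b - b')"
      by (simp add: algebra_simps)
    ultimately show "ge 0 (a * b) \<and> ge 0 (a' * b') \<and> ge 1 (a * b - a' * b')"
      using ge_add by metis
    have "ge 1 (- (a - a'))"
      using * ge_uminus by blast
    then show "ge 0 (- a) \<and> ge 0 (- a') \<and> ge 1 (- a - - a')"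
      using * ge_uminus by auto
  qed (auto simp: ge_1)
  define z where "z i = (U i - l i) / l i" for i
  have z: "ge 1 (z i)" if "i < n" for i
    using ge_cancel[OF l(1)[OF that], of 1 "z i"] x(2) l that by (simp add: z_def)
  have U: "U i = l i * (1 + z i)" "1 + z i \<noteq> 0" "v (1 + z i) = 0" if "i < n" for i
    using l(1)[OF that] ge_1_unit_add[OF z[OF that]] by (auto simp: z_def field_simps)
  have dz: "ge 1 (dlog (D k) (1 + z i))" if "i < n" for i k
    using ge_cancel[OF U(2)[OF that], of 1 "dlog (D k) (1 + z i)"] ge_1_D[OF z[OF that] pi] U(2,3)[OF that]
    by (simp add: dlog_def D_add)
  have split: "dlog (D k) (x (Suc i) / x 0) =
      dlog (D k) (l (Suc i) / l 0) + (dlog (D k) (1 + z (Suc i)) - dlog (D k) (1 + z 0))" if "i < n - 1" for i k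
  proof -
    have "Suc i < n" "0 < n"
      using that by auto
    then show ?thesis
      using l e U x(1) by (simp add: dlog_divide dlog_mult)
  qed
  have dl: "ge 0 (dlog (D k) (l (Suc i) / l 0))" if "i < n - 1" for i k
    using l[of "Suc i"] l[of 0] that by (intro ge_dlog_unit) (auto simp: v_divide)
  have "ge 0 (dlog (D k) (x (Suc i) / x 0)) \<and> ge 0 (dlog (D k) (l (Suc i) / l 0)) \<and>
      ge 1 (dlog (D k) (x (Suc i) / x 0) - dlog (D k) (l (Suc i) / l 0))" if "i < n - 1" for i k
  proof -
    have "ge 1 (dlog (D k) (1 + z (Suc i)) - dlog (D k) (1 + z 0))"
      using dz[of "Suc i"] dz[of 0] that by (intro ge_diff) auto
    then show ?thesis
      using dl[OF that, of k] ge_add[OF dl[OF that, of k] ge_mono[of 1 _ 0]] by (simp add: split[OF that])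
  qed
  then show ?thesis
    using R.rel_det[of "logmat n D x" "n - 1" "logmat n D l"] by (simp add: logmat_def)
qed

end

context conic_local
begin

text \<open>If the limit \<open>l\<close> lies on a coordinate hyperplane, the coordinates have
  different valuations and \<open>regular_det\<close> makes the determinant vanish in the limit.
  This is why \<open>val\<close> is 0 there.\<close>

lemma det_endpoint:
  assumes pi: "\<And>k. D k \<pi> = 0" and e: "e \<noteq> 0" and nz: "\<And>i. i < n \<Longrightarrow> x i \<noteq> 0"
    and y: "y0 \<noteq> 0 \<or> y1 \<noteq> 0 \<or> y2 \<noteq> 0" and eq: "special x y0 y1 y2 = 0"
    and l: "\<And>i. i < n \<Longrightarrow> l i = 0 \<or> v (l i) = 0" "\<exists>i<n. l i \<noteq> 0"
    and x: "\<And>i. i < n \<Longrightarrow> ge 1 (x i / e - l i)"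
  shows "ge 1 (det (logmat n D x) - val n D l)"
proof (cases "\<forall>i<n. l i \<noteq> 0")
  case True
  then have "ge 1 (det (logmat n D x) - det (logmat n D l))"
    using n_ge e l x by (intro det_logmat_reduction[OF _ pi e, where U = "\<lambda>i. x i / e"]) auto
  then show ?thesis
    using True by (simp add: val_def)
next
  case False
  then obtain i0 where i0: "i0 < n" "l i0 = 0"
    by blast
  obtain i1 where i1: "i1 < n" "l i1 \<noteq> 0"
    using l(2) by blast
  have "1 \<le> v (x i0 / e)"
    using x[OF i0(1)] i0(2) nz[OF i0(1)] e by (simp add: ge_def)
  moreover have "v (x i1 / e) = 0"
  proof -
    have "ge 1 ((x i1 / e - l i1) / l i1)"
      using ge_cancel[OF i1(2), of 1 "(x i1 / e - l i1) / l i1"] x[OF i1(1)] l(1)[OF i1(1)] i1(2) by simp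
    then have "v (1 + (x i1 / e - l i1) / l i1) = 0" "1 + (x i1 / e - l i1) / l i1 \<noteq> 0"
      using ge_1_unit_add by blast+
    moreover have "x i1 / e = l i1 * (1 + (x i1 / e - l i1) / l i1)"
      using i1(2) by (simp add: field_simps)
    ultimately show ?thesis
      using l(1)[OF i1(1)] i1(2) v_mult[of "l i1" "1 + (x i1 / e - l i1) / l i1"] by simp
  qed
  ultimately have "v (x i0) \<noteq> v (x i1)"
    using nz i0 i1 e by (simp add: v_divide)
  then have "\<exists>i<n. v (x i) \<noteq> v (x 0)"
    using i0 i1 by metis
  then have "ge 1 (det (logmat n D x))"
    using regular_det(2)[of x y0 y1 y2] nz y eq pi by blast
  moreover have "val n D l = 0"
    using False by (auto simp: val_def)
  ultimately show ?thesis
    by simp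
qed

end

lemma to_fract_hom: "comm_ring_hom (to_fract :: 'a::idom \<Rightarrow> 'a fract)"
  by unfold_locales auto

lemma to_fract_const_divide:
  fixes a b :: "'a::field"
  assumes "b \<noteq> 0"
  shows "to_fract [:a / b:] = to_fract [:a:] / to_fract [:b:]"
proof -
  have "[:a / b:] * [:b:] = [:a:]" "to_fract [:b:] \<noteq> 0"
    using assms by simp_all
  then show ?thesis
    by (metis eq_divide_eq to_fract_mult)
qed

context conic_params
begin

lemma special_hom:
  assumes "comm_ring_hom h"
  shows "h (special x y0 y1 y2) = special (\<lambda>i. h (x i)) (h y0) (h y1) (h y2)"
proof -
  interpret comm_ring_hom h by fact
  show ?thesis
    by (simp add: special_def xgam_def hom_distribs)
qed

text \<open>The determinant along the curve has no pole at any prime of the polynomial ring nor at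
  infinity, so it is a constant. The parameter is killed by the derivations, hence
  \<open>det_endpoint\<close> applies at 0 and at infinity, where the limit points of the curve are
  its lowest and highest coefficient vectors.\<close>

theorem val_curve:
  fixes D :: "nat \<Rightarrow> 'f::field_gcd \<Rightarrow> 'f" and x :: "nat \<Rightarrow> 'f poly"
  assumes D: "\<And>k. field_derivation (D k)" and char2: "(1::'f) + 1 = 0"
    and eq: "special x y0 y1 y2 = 0" and y: "y0 \<noteq> 0 \<or> y1 \<noteq> 0 \<or> y2 \<noteq> 0"
    and low: "\<And>i j. i < n \<Longrightarrow> j < j0 \<Longrightarrow> coeff (x i) j = 0" "\<exists>i<n. coeff (x i) j0 \<noteq> 0"
    and high: "\<And>i j. i < n \<Longrightarrow> j1 < j \<Longrightarrow> coeff (x i) j = 0" "\<exists>i<n. coeff (x i) j1 \<noteq> 0"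
  shows "val n D (\<lambda>i. coeff (x i) j0) = val n D (\<lambda>i. coeff (x i) j1)"
proof (cases "\<forall>i<n. x i \<noteq> 0")
  case False
  then show ?thesis
    by (auto simp: val_def)
next
  case True
  have d: "derivation (D k)" for k
    using D[of k] by (simp add: field_derivation_def)
  note dp = derivation_poly[OF d]
  let ?D = "\<lambda>k. deriv_fract (deriv_poly (D k))"
  let ?X = "\<lambda>i. to_fract (x i)"
  let ?K = "\<lambda>c::'f. to_fract [:c:]"
  let ?s = "to_fract [:0, 1::'f:]"
  let ?h = "det (logmat n ?D ?X)"
  have X: "?X i \<noteq> 0" if "i < n" for i
    using True that by simp
  have Y: "to_fract y0 \<noteq> 0 \<or> to_fract y1 \<noteq> 0 \<or> to_fract y2 \<noteq> 0"
    using y by simp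
  have E: "special ?X (to_fract y0) (to_fract y1) (to_fract y2) = 0"
    using special_hom[OF to_fract_hom, of x y0 y1 y2] eq by simp
  have c2: "(1 :: 'f poly fract) + 1 = 0"
  proof -
    have "(1 :: 'f poly) + 1 = [:1 + 1:]"
      by (simp add: one_pCons del: one_add_one)
    then have "(1 :: 'f poly) + 1 = 0"
      by (simp only: char2) simp
    then show ?thesis
      by (metis to_fract_0 to_fract_1 to_fract_add)
  qed
  have K: "val n ?D (\<lambda>i. ?K (c i)) = ?K (val n D c)" for c :: "nat \<Rightarrow> 'f"
  proof (cases "\<forall>i<n. c i \<noteq> 0")
    case True
    interpret K: comm_ring_hom ?K
      by unfold_locales (simp_all flip: one_pCons to_fract_add to_fract_mult)
    have "dlog (?D k) (?K (c (Suc i)) / ?K (c 0)) = ?K (dlog (D k) (c (Suc i) / c 0))" if "i < n - 1" for i k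
    proof -
      have nz: "c (Suc i) \<noteq> 0" "c 0 \<noteq> 0"
        using True that by auto
      have "deriv_poly (D k) [:a:] = [:D k a:]" for a
        by (simp add: deriv_poly_def derivation.D_0[OF d] map_poly_pCons)
      then show ?thesis
        using nz unfolding dlog_def
        by (simp add: deriv_fract_to_fract[OF dp] to_fract_const_divide[symmetric])
    qed
    then have "logmat n ?D (\<lambda>i. ?K (c i)) = map_mat ?K (logmat n D c)"
      by (intro eq_matI) (auto simp: logmat_def)
    then show ?thesis
      using True by (simp add: val_def)
  qed (auto simp: val_def)
  have "\<exists>a. ?h = to_fract a"
  proof (rule integral_fract)
    fix p :: "'f poly"
    assume "prime_elem p"
    then interpret conic_local n d "fract_val (\<lambda>a. int (multiplicity p a))" "to_fract p" ?D
      by (intro conic_local.intro conic_local_axioms.intro conic_params_axioms valuation_deriv_multiplicity dp c2)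
    show "?h = 0 \<or> 0 \<le> fract_val (\<lambda>a. int (multiplicity p a)) ?h"
      using regular_det(1)[OF X Y E] by (simp add: ge_def)
  qed
  then obtain a where a: "?h = to_fract a"
    by blast
  interpret inf: conic_local n d "fract_val (\<lambda>a::'f poly. - int (degree a))" "inverse ?s" ?D
    by (intro conic_local.intro conic_local_axioms.intro conic_params_axioms valuation_deriv_degree d c2)
  interpret idom_inf: idom_valuation "\<lambda>a::'f poly. - int (degree a)"
    by (rule idom_valuation_degree)
  have "a = 0 \<or> degree a = 0"
    using inf.regular_det(1)[OF X Y E] unfolding a inf.ge_def
    by (cases "a = 0") (simp_all add: idom_inf.fract_val_to_fract)
  then obtain c where c: "?h = ?K c"
    unfolding a by (metis degree_0 degree_eq_zeroE)
  have ps: "prime_elem [:0, 1::'f:]"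
    using prime_elem_linear_field_poly[of 1 0] by simp
  interpret zero: conic_local n d "fract_val (\<lambda>a. int (multiplicity [:0, 1::'f:] a))" ?s ?D
    by (intro conic_local.intro conic_local_axioms.intro conic_params_axioms valuation_deriv_multiplicity ps dp c2)
  interpret idom_zero: idom_valuation "\<lambda>a. int (multiplicity [:0, 1::'f:] a)"
    by (rule idom_valuation_multiplicity[OF ps])
  have Ds: "?D k ?s = 0" for k
    by (simp add: deriv_fract_to_fract[OF dp] deriv_poly_def derivation.D_0[OF d] derivation.D_1[OF d] map_poly_pCons)
  have Dinv: "?D k (inverse ?s) = 0" for k
    using inf.dlog_inverse[of ?s k] Ds by (simp add: dlog_def)
  have zero_const: "fract_val (\<lambda>a. int (multiplicity [:0, 1::'f:] a)) (?K b) = 0" if "b \<noteq> 0" for b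
  proof -
    have "\<not> [:0, 1:] dvd [:b:]"
      using that by (auto dest: dvd_imp_degree_le)
    then show ?thesis
      using that by (simp add: idom_zero.fract_val_to_fract not_dvd_imp_multiplicity_0)
  qed
  have inf_const: "fract_val (\<lambda>a::'f poly. - int (degree a)) (?K b) = 0" if "b \<noteq> 0" for b
    using that by (simp add: idom_inf.fract_val_to_fract)
  have diff: "?X i / to_fract (monom 1 j) - ?K b = to_fract (x i - monom b j) / to_fract (monom 1 j)" for i j b
  proof -
    have "monom b j = [:b:] * monom 1 j"
      by (simp add: smult_monom)
    then have "to_fract (x i - monom b j) = ?X i - ?K b * to_fract (monom 1 j)"
      by (metis to_fract_diff to_fract_mult)
    then show ?thesis
      by (simp add: diff_divide_distrib del: to_fract_diff)
  qed
  have "zero.ge 1 (?h - val n ?D (\<lambda>i. ?K (coeff (x i) j0)))"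
  proof (rule zero.det_endpoint[OF Ds _ X Y E, where e = "to_fract (monom 1 j0)"])
    show "?K (coeff (x i) j0) = 0 \<or> fract_val (\<lambda>a. int (multiplicity [:0, 1::'f:] a)) (?K (coeff (x i) j0)) = 0" for i
      using zero_const[of "coeff (x i) j0"] by (cases "coeff (x i) j0 = 0") simp_all
    fix i assume i: "i < n"
    let ?p = "x i - monom (coeff (x i) j0) j0"
    have "coeff ?p j = 0" if "j \<le> j0" for j
      using low(1)[OF i, of j] that by (cases "j = j0") auto
    then have "\<forall>j<Suc j0. coeff ?p j = 0"
      unfolding less_Suc_eq_le by blast
    then have "monom 1 (Suc j0) dvd ?p"
      unfolding monom_1_dvd_iff' .
    moreover have "monom 1 (Suc j0) = [:0, 1::'f:] ^ Suc j0"
      by (simp add: monom_altdef)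
    ultimately have "?p \<noteq> 0 \<Longrightarrow> Suc j0 \<le> multiplicity [:0, 1:] ?p"
      using ps by (intro multiplicity_geI) auto
    moreover have "fract_val (\<lambda>a. int (multiplicity [:0, 1::'f:] a)) (to_fract (monom 1 j0)) = j0"
      using multiplicity_same_power[of "[:0, 1::'f:]" j0] prime_elem_not_unit[OF ps]
      by (simp add: idom_zero.fract_val_to_fract monom_altdef)
    ultimately show "zero.ge 1 (?X i / to_fract (monom 1 j0) - ?K (coeff (x i) j0))"
      unfolding diff by (cases "?p = 0") (simp_all add: zero.ge_def zero.v_divide idom_zero.fract_val_to_fract del: to_fract_diff)
  qed (use low(2) in auto)
  then have z: "c = val n D (\<lambda>i. coeff (x i) j0)"
  proof -
    assume "zero.ge 1 (?h - val n ?D (\<lambda>i. ?K (coeff (x i) j0)))"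
    moreover have "?h - val n ?D (\<lambda>i. ?K (coeff (x i) j0)) = ?K (c - val n D (\<lambda>i. coeff (x i) j0))"
      by (simp add: c K flip: to_fract_diff)
    ultimately have ge: "zero.ge 1 (?K (c - val n D (\<lambda>i. coeff (x i) j0)))"
      by simp
    have "c - val n D (\<lambda>i. coeff (x i) j0) = 0"
    proof (rule ccontr)
      assume *: "c - val n D (\<lambda>i. coeff (x i) j0) \<noteq> 0"
      show False
        using ge * zero_const[OF *] unfolding zero.ge_def to_fract_eq_0_iff by simp
    qed
    then show ?thesis
      by simp
  qed
  have "inf.ge 1 (?h - val n ?D (\<lambda>i. ?K (coeff (x i) j1)))"
  proof (rule inf.det_endpoint[OF Dinv _ X Y E, where e = "to_fract (monom 1 j1)"])
    show "?K (coeff (x i) j1) = 0 \<or> fract_val (\<lambda>a::'f poly. - int (degree a)) (?K (coeff (x i) j1)) = 0" for i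
      using inf_const[of "coeff (x i) j1"] by (cases "coeff (x i) j1 = 0") simp_all
    fix i assume i: "i < n"
    let ?p = "x i - monom (coeff (x i) j1) j1"
    have 0: "coeff ?p j = 0" if "j1 \<le> j" for j
      using high(1)[OF i, of j] that by (cases "j = j1") auto
    have "degree ?p < j1" if "?p \<noteq> 0"
      using 0[of "degree ?p"] that by (metis leading_coeff_0_iff not_le)
    moreover have "fract_val (\<lambda>a::'f poly. - int (degree a)) (to_fract (monom 1 j1)) = - int j1"
      by (simp add: idom_inf.fract_val_to_fract degree_monom_eq)
    ultimately show "inf.ge 1 (?X i / to_fract (monom 1 j1) - ?K (coeff (x i) j1))"
      unfolding diff by (cases "?p = 0") (simp_all add: inf.ge_def inf.v_divide idom_inf.fract_val_to_fract degree_monom_eq del: to_fract_diff)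
  qed (use high(2) in auto)
  then have "c = val n D (\<lambda>i. coeff (x i) j1)"
  proof -
    assume "inf.ge 1 (?h - val n ?D (\<lambda>i. ?K (coeff (x i) j1)))"
    moreover have "?h - val n ?D (\<lambda>i. ?K (coeff (x i) j1)) = ?K (c - val n D (\<lambda>i. coeff (x i) j1))"
      by (simp add: c K flip: to_fract_diff)
    ultimately have ge: "inf.ge 1 (?K (c - val n D (\<lambda>i. coeff (x i) j1)))"
      by simp
    have "c - val n D (\<lambda>i. coeff (x i) j1) = 0"
    proof (rule ccontr)
      assume *: "c - val n D (\<lambda>i. coeff (x i) j1) \<noteq> 0"
      show False
        using ge * inf_const[OF *] unfolding inf.ge_def to_fract_eq_0_iff by simp
    qed
    then show ?thesis
      by simp
  qed
  then show ?thesis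
    using z by simp
qed

end

section \<open>Newton polygons over a place\<close>

text \<open>A place in the classical sense, the values of \<open>h\<close> outside \<open>Ov\<close>
  being irrelevant. The last condition says both that \<open>Ov\<close> is a valuation ring and that
  nonunits have residue 0.\<close>

locale place =
  fixes Ov :: "'c::field set" and h :: "'c \<Rightarrow> 'k::field"
  assumes one_O: "1 \<in> Ov" "h 1 = 1"
    and add_O: "a \<in> Ov \<Longrightarrow> b \<in> Ov \<Longrightarrow> a + b \<in> Ov \<and> h (a + b) = h a + h b"
    and mult_O: "a \<in> Ov \<Longrightarrow> b \<in> Ov \<Longrightarrow> a * b \<in> Ov \<and> h (a * b) = h a * h b"
    and uminus_O: "a \<in> Ov \<Longrightarrow> - a \<in> Ov \<and> h (- a) = - h a"
    and valuation_ring: "a \<notin> Ov \<Longrightarrow> inverse a \<in> Ov \<and> h (inverse a) = 0"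
begin

lemma zero_O: "0 \<in> Ov" "h 0 = 0"
  using add_O[OF one_O(1) uminus_O[THEN conjunct1, OF one_O(1)]] uminus_O[OF one_O(1)] one_O by auto

lemma place_rel: "ring_rel (\<lambda>a b. a \<in> Ov \<and> b = h a)"
  using zero_O one_O add_O mult_O uminus_O by unfold_locales auto

definition mx :: "'c \<Rightarrow> bool" where
  "mx a \<longleftrightarrow> a \<in> Ov \<and> h a = 0"

lemma mx_mult: "mx a \<Longrightarrow> b \<in> Ov \<Longrightarrow> mx (a * b)"
  using mult_O by (auto simp: mx_def)

lemma power_O: "a \<in> Ov \<Longrightarrow> a ^ m \<in> Ov \<and> h (a ^ m) = h a ^ m"
  using one_O mult_O by (induction m) auto

lemma mx_power: "mx a \<Longrightarrow> 0 < m \<Longrightarrow> mx (a ^ m)"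
  using power_O by (auto simp: mx_def)

lemma not_mx_1: "\<not> mx 1"
  using one_O by (simp add: mx_def)

lemma unit_O: "a \<in> Ov \<Longrightarrow> h a \<noteq> 0 \<Longrightarrow> inverse a \<in> Ov"
  using valuation_ring[of "inverse a"] by fastforce

lemma power_O_imp: "a ^ m \<in> Ov \<Longrightarrow> 0 < m \<Longrightarrow> a \<in> Ov"
proof (rule ccontr)
  assume a: "a ^ m \<in> Ov" "0 < m" "a \<notin> Ov"
  then have "a \<noteq> 0"
    using zero_O by auto
  have "mx (inverse a ^ m)"
    using a valuation_ring[of a] by (intro mx_power) (auto simp: mx_def)
  then have "mx (inverse a ^ m * a ^ m)"
    using a by (intro mx_mult)
  then show False
    using \<open>a \<noteq> 0\<close> not_mx_1 by (simp add: power_inverse)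
qed

lemma mx_power_imp: "mx (a ^ m) \<Longrightarrow> 0 < m \<Longrightarrow> mx a"
  using power_O_imp[of a m] power_O[of a m] by (auto simp: mx_def)

text \<open>Divisibility in a valuation ring is total, so a finite family has a member that is a
  multiple of all others; in terms of size it is the smallest.\<close>

lemma ex_divisor_on_finite:
  assumes "finite S" "S \<noteq> {}" "\<And>s. s \<in> S \<Longrightarrow> f s \<noteq> 0"
  shows "\<exists>s\<in>S. \<forall>t\<in>S. f s / f t \<in> Ov"
  using assms
proof (induction S rule: finite_ne_induct)
  case (singleton s)
  then show ?case
    using one_O by simp
next
  case (insert s S)
  then obtain u where u: "u \<in> S" "\<And>t. t \<in> S \<Longrightarrow> f u / f t \<in> Ov"
    by auto
  have nz: "f s \<noteq> 0" "f u \<noteq> 0"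
    using insert.prems u by auto
  show ?case
  proof (cases "f u / f s \<in> Ov")
    case True
    then show ?thesis
      using u by blast
  next
    case False
    then have "f s / f u \<in> Ov"
      using valuation_ring[of "f u / f s"] by (simp add: inverse_eq_divide)
    moreover have "f s / f t = f s / f u * (f u / f t)" for t
      using nz by simp
    ultimately have "f s / f t \<in> Ov" if "t \<in> S" for t
      using u(2)[OF that] mult_O by metis
    then show ?thesis
      using one_O nz by auto
  qed
qed

text \<open>\<open>\<sigma> b i\<close> stands for the size of the \<open>i\<close>-th coefficient of the family \<open>b\<close>, and \<open>1 / \<rho>\<close> for the
  slope of an edge of the Newton polygons; both families must be scaled by the same \<open>\<rho>\<close>.\<close>

definition edge_start :: "(bool \<Rightarrow> nat set) \<Rightarrow> (bool \<Rightarrow> nat \<Rightarrow> 'c) \<Rightarrow> (bool \<Rightarrow> nat) \<Rightarrow> bool" where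
  "edge_start J \<sigma> j \<longleftrightarrow> (\<forall>b. j b \<in> J b) \<and> ((\<forall>b. \<forall>i\<in>J b. j b \<le> i) \<or>
     (\<exists>\<rho>. \<rho> \<noteq> 0 \<and> (\<forall>b. \<forall>i\<in>J b. (i < j b \<longrightarrow> \<sigma> b i * \<rho> ^ i / (\<sigma> b (j b) * \<rho> ^ j b) \<in> Ov) \<and>
        (j b < i \<longrightarrow> mx (\<sigma> b i * \<rho> ^ i / (\<sigma> b (j b) * \<rho> ^ j b))))))"

text \<open>The next edge belongs to the smallest \<open>\<rho>\<close> at which a later term of one
  of the two families catches up with its vertex term, and its far end \<open>j'\<close> is the last
  index whose term is not small. Both families advance under the same \<open>\<rho>\<close>, and one
  of them may stay at its vertex.\<close>

lemma newton_edge: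
  assumes roots: "\<And>z m. 0 < m \<Longrightarrow> \<exists>w::'c. w ^ m = z"
    and fin: "\<And>b. finite (J b)" and nz: "\<And>b i. i \<in> J b \<Longrightarrow> \<sigma> b i \<noteq> 0"
    and start: "edge_start J \<sigma> j" and more: "\<exists>b. \<exists>i\<in>J b. j b < i"
  obtains \<rho> j' where "\<rho> \<noteq> 0" "\<And>b. j' b \<in> J b" "\<And>b. j b \<le> j' b" "\<exists>b. j b < j' b"
    "\<And>b i. i \<in> J b \<Longrightarrow> \<sigma> b i * \<rho> ^ i / (\<sigma> b (j b) * \<rho> ^ j b) \<in> Ov"
    "\<And>b i. i \<in> J b \<Longrightarrow> i < j b \<or> j' b < i \<Longrightarrow> mx (\<sigma> b i * \<rho> ^ i / (\<sigma> b (j b) * \<rho> ^ j b))"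
    "\<And>b. \<not> mx (\<sigma> b (j' b) * \<rho> ^ j' b / (\<sigma> b (j b) * \<rho> ^ j b))"
    "edge_start J \<sigma> j'"
proof -
  have jJ: "j b \<in> J b" for b
    using start by (simp add: edge_start_def)
  define S where "S = (SIGMA b:UNIV. {i \<in> J b. j b < i})"
  have "finite S" "S \<noteq> {}"
    using fin more by (auto simp: S_def)
  \<comment> \<open>The value of \<open>\<rho>\<close> at which the term \<open>i\<close> of family
    \<open>b\<close> equals its vertex term; slopes are fractional, so roots are extracted.\<close>
  define r where "r = (\<lambda>(b, i). SOME w. w ^ (i - j b) = \<sigma> b (j b) / \<sigma> b i)"
  have r: "r (b, i) ^ (i - j b) = \<sigma> b (j b) / \<sigma> b i" if "(b, i) \<in> S" for b i
    unfolding r_def using that roots[of "i - j b" "\<sigma> b (j b) / \<sigma> b i"]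
    by (auto simp: S_def intro: someI_ex)
  have r_nz: "r s \<noteq> 0" if "s \<in> S" for s
  proof
    obtain b i where s: "s = (b, i)"
      by (cases s)
    assume "r s = 0"
    then have "\<sigma> b (j b) / \<sigma> b i = 0"
      using r[of b i] that unfolding s by (auto simp: S_def power_0_left)
    then show False
      using nz jJ that unfolding s by (auto simp: S_def)
  qed
  obtain s where s: "s \<in> S" "\<And>t. t \<in> S \<Longrightarrow> r s / r t \<in> Ov"
    using ex_divisor_on_finite[OF \<open>finite S\<close> \<open>S \<noteq> {}\<close>, of r] r_nz by blast
  define \<rho> where "\<rho> = r s"
  have rho: "\<rho> \<noteq> 0"
    using r_nz s by (simp add: \<rho>_def)
  define q where "q b i = \<sigma> b i * \<rho> ^ i / (\<sigma> b (j b) * \<rho> ^ j b)" for b i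
  have above: "q b i = (\<rho> / r (b, i)) ^ (i - j b)" if "(b, i) \<in> S" for b i
  proof -
    have i: "j b < i" "i \<in> J b"
      using that by (auto simp: S_def)
    then have "\<rho> ^ i = \<rho> ^ j b * \<rho> ^ (i - j b)"
      by (simp flip: power_add)
    then show ?thesis
      unfolding q_def power_divide r[OF that] using rho nz[OF i(2)] nz[OF jJ[of b]] by simp
  qed
  have below: "mx (q b i)" if "i \<in> J b" "i < j b" for b i
  proof -
    have no: "\<not> (\<forall>b. \<forall>i\<in>J b. j b \<le> i)"
      using that not_le by blast
    have "\<exists>\<rho>. \<rho> \<noteq> 0 \<and> (\<forall>b. \<forall>i\<in>J b. (i < j b \<longrightarrow> \<sigma> b i * \<rho> ^ i / (\<sigma> b (j b) * \<rho> ^ j b) \<in> Ov) \<and>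
        (j b < i \<longrightarrow> mx (\<sigma> b i * \<rho> ^ i / (\<sigma> b (j b) * \<rho> ^ j b))))"
      using start[unfolded edge_start_def, THEN conjunct2] by (rule disjE) (rule notE[OF no], assumption+)
    then obtain \<rho>0 where r0: "\<rho>0 \<noteq> 0" "\<And>b i. i \<in> J b \<Longrightarrow> i < j b \<Longrightarrow> \<sigma> b i * \<rho>0 ^ i / (\<sigma> b (j b) * \<rho>0 ^ j b) \<in> Ov"
        "\<And>b i. i \<in> J b \<Longrightarrow> j b < i \<Longrightarrow> mx (\<sigma> b i * \<rho>0 ^ i / (\<sigma> b (j b) * \<rho>0 ^ j b))"
      by blast
    obtain b' i' where s': "s = (b', i')" "i' \<in> J b'" "j b' < i'"
      using s(1) by (auto simp: S_def)
    \<comment> \<open>Convexity of the polygon: with the previous \<open>\<rho>0\<close> the term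
      \<open>i'\<close> was small, with \<open>\<rho>\<close> it equals the vertex term. Hence
      \<open>\<rho>0 / \<rho>\<close> is small, which makes all terms before the vertices
      small.\<close>
    have "mx ((\<rho>0 / \<rho>) ^ (i' - j b'))"
    proof -
      have "\<rho>0 ^ i' = \<rho>0 ^ j b' * \<rho>0 ^ (i' - j b')"
        using s'(3) by (simp flip: power_add)
      then have "(\<rho>0 / \<rho>) ^ (i' - j b') = \<sigma> b' i' * \<rho>0 ^ i' / (\<sigma> b' (j b') * \<rho>0 ^ j b')"
        using r[of b' i'] s(1) nz[OF s'(2)] nz[OF jJ[of b']] r0(1) unfolding \<rho>_def s'(1) power_divide by simp
      then show ?thesis
        using r0(3)[OF s'(2,3)] by simp
    qed
    then have "mx (\<rho>0 / \<rho>)"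
      by (rule mx_power_imp) (use s'(3) in simp)
    then have "mx ((\<rho>0 / \<rho>) ^ (j b - i))"
      using that by (intro mx_power) auto
    then have "mx ((\<rho>0 / \<rho>) ^ (j b - i) * (\<sigma> b i * \<rho>0 ^ i / (\<sigma> b (j b) * \<rho>0 ^ j b)))"
      using r0(2)[OF that] by (intro mx_mult)
    moreover have "(\<rho>0 / \<rho>) ^ (j b - i) * (\<sigma> b i * \<rho>0 ^ i / (\<sigma> b (j b) * \<rho>0 ^ j b)) = q b i"
    proof -
      have "\<rho>0 ^ j b = \<rho>0 ^ i * \<rho>0 ^ (j b - i)" "\<rho> ^ j b = \<rho> ^ i * \<rho> ^ (j b - i)"
        using that by (simp_all flip: power_add)
      then show ?thesis
        unfolding q_def power_divide using rho r0(1) nz[OF that(1)] nz[OF jJ[of b]] by simp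
    qed
    ultimately show ?thesis
      by simp
  qed
  have q_j: "q b (j b) = 1" for b
    using rho nz[OF jJ[of b]] by (simp add: q_def)
  have q_O: "q b i \<in> Ov" if "i \<in> J b" for b i
  proof (cases i "j b" rule: linorder_cases)
    case less
    then show ?thesis
      using below[OF that] by (simp add: mx_def)
  next
    case equal
    then show ?thesis
      using q_j one_O by simp
  next
    case greater
    then have "(b, i) \<in> S"
      using that by (simp add: S_def)
    then show ?thesis
      using above s(2)[of "(b, i)"] power_O by (simp add: \<rho>_def)
  qed
  define j' where "j' b = Max {i \<in> J b. \<not> mx (q b i)}" for b
  have fin': "finite {i \<in> J b. \<not> mx (q b i)}" and mem: "j b \<in> {i \<in> J b. \<not> mx (q b i)}" for b
    using fin jJ q_j not_mx_1 by auto
  have j'J: "j' b \<in> J b" "\<not> mx (q b (j' b))" for b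
    using Max_in[OF fin'[of b]] mem[of b] unfolding j'_def by blast+
  have le: "j b \<le> j' b" for b
    unfolding j'_def using fin' mem by (rule Max_ge)
  have beyond: "mx (q b i)" if "i \<in> J b" "j' b < i" for b i
  proof (rule ccontr)
    assume "\<not> mx (q b i)"
    then have "i \<le> j' b"
      unfolding j'_def using that(1) fin' by (intro Max_ge) auto
    then show False
      using that(2) by simp
  qed
  obtain b0 i0 where s0: "s = (b0, i0)" "i0 \<in> J b0" "j b0 < i0"
    using s(1) by (auto simp: S_def)
  have "q b0 i0 = 1"
    using above[of b0 i0] s(1) rho by (simp add: s0(1) \<rho>_def)
  then have "i0 \<le> j' b0"
    unfolding j'_def using fin' s0 not_mx_1 by (intro Max_ge) auto
  then have lt: "\<exists>b. j b < j' b"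
    using s0 by (intro exI[of _ b0]) simp
  have "edge_start J \<sigma> j'"
  proof -
    have inv: "inverse (q b (j' b)) \<in> Ov" for b
      using j'J(2)[of b] q_O[OF j'J(1)[of b]] unfolding mx_def by (intro unit_O) auto
    have eq: "\<sigma> b i * \<rho> ^ i / (\<sigma> b (j' b) * \<rho> ^ j' b) = q b i * inverse (q b (j' b))" for b i
      using rho nz[OF jJ[of b]] nz[OF j'J(1)[of b]] by (simp add: q_def)
    have "\<sigma> b i * \<rho> ^ i / (\<sigma> b (j' b) * \<rho> ^ j' b) \<in> Ov" if "i \<in> J b" for b i
      unfolding eq using mult_O[OF q_O[OF that] inv] by blast
    moreover have "mx (\<sigma> b i * \<rho> ^ i / (\<sigma> b (j' b) * \<rho> ^ j' b))" if "i \<in> J b" "j' b < i" for b i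
      unfolding eq using mx_mult[OF beyond[OF that] inv] .
    ultimately show ?thesis
      unfolding edge_start_def by (intro conjI allI disjI2 exI[of _ \<rho>] ballI impI j'J(1) rho)
  qed
  note start' = this
  have 1: "\<sigma> b i * \<rho> ^ i / (\<sigma> b (j b) * \<rho> ^ j b) \<in> Ov" if "i \<in> J b" for b i
    using q_O[OF that] unfolding q_def .
  have 2: "mx (\<sigma> b i * \<rho> ^ i / (\<sigma> b (j b) * \<rho> ^ j b))" if "i \<in> J b" "i < j b \<or> j' b < i" for b i
    using that(2)
  proof
    assume "i < j b" then show ?thesis
      by (rule below[OF that(1), unfolded q_def])
  next
    assume "j' b < i" then show ?thesis
      by (rule beyond[OF that(1), unfolded q_def])
  qed
  have 3: "\<not> mx (\<sigma> b (j' b) * \<rho> ^ j' b / (\<sigma> b (j b) * \<rho> ^ j b))" for b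
    using j'J(2)[of b] unfolding q_def .
  show thesis
    by (rule that[of \<rho> j', OF rho j'J(1) le lt 1 2 3 start'])
qed

end

lemma val_cong: "(\<And>i. i < n \<Longrightarrow> l i = l' i) \<Longrightarrow> 0 < n \<Longrightarrow> val n D l = val n D l'"
  by (auto simp: val_def logmat_def intro!: arg_cong[where f = det] cong_mat)

lemma val_scale:
  assumes "u \<noteq> 0"
  shows "val n D (\<lambda>i. u * l i) = val n D l"
  using assms by (auto simp: val_def logmat_def)

lemma field_hom_0_iff:
  fixes h :: "'a::field \<Rightarrow> 'b::field"
  assumes "comm_ring_hom h"
  shows "h a = 0 \<longleftrightarrow> a = 0"
proof -
  interpret comm_ring_hom h by fact
  have "a = 0" if "h a = 0"
  proof (rule ccontr)
    assume "a \<noteq> 0"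
    then have "h (a * inverse a) = 1"
      by simp
    then show False
      by (simp add: hom_mult that del: right_inverse)
  qed
  then show ?thesis
    by auto
qed

context conic_params
begin

text \<open>The scalar \<open>c b k\<close> brings the k-th coefficient vector to a nonzero
  reduction \<open>B b k\<close>. On each edge the rescaled curve reduces to a curve in the special
  fibre that has these vectors, up to constants, at its two ends, so \<open>val_curve\<close>
  transports the value from vertex to vertex. The induction is on the length of polygon that remains
  in both families.\<close>

lemma val_chain:
  fixes h :: "'c::field \<Rightarrow> 'k::field" and \<iota> :: "'c \<Rightarrow> 'a::comm_ring_1" and \<kappa> :: "'k \<Rightarrow> 'f::field_gcd"
    and g :: "bool \<Rightarrow> nat \<Rightarrow> 'a poly" and B :: "bool \<Rightarrow> nat \<Rightarrow> nat \<Rightarrow> 'f" and c :: "bool \<Rightarrow> nat \<Rightarrow> 'c"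
  assumes "place Ov h" and S: "ring_rel S" and \<iota>: "comm_ring_hom \<iota>" and \<kappa>: "comm_ring_hom \<kappa>"
    and const: "\<And>a. a \<in> Ov \<Longrightarrow> S (\<iota> a) (\<kappa> (h a))"
    and roots: "\<And>z m. 0 < m \<Longrightarrow> \<exists>w::'c. w ^ m = z"
    and D: "\<And>k. field_derivation (D k)" and char2: "(1::'f) + 1 = 0"
  defines "N \<equiv> (\<lambda>b. if b then n else 3)"
  defines "J \<equiv> (\<lambda>b. {k. \<exists>i<N b. coeff (g b i) k \<noteq> 0})"
  assumes ne: "\<And>b. J b \<noteq> {}"
    and B: "\<And>b k. k \<in> J b \<Longrightarrow> c b k \<noteq> 0 \<and> (\<exists>i<N b. B b k i \<noteq> 0)"
      "\<And>b k i. k \<in> J b \<Longrightarrow> i < N b \<Longrightarrow> S (\<iota> (c b k) * coeff (g b i) k) (B b k i)"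
    and H: "\<And>Z u \<rho>. \<rho> \<noteq> 0 \<Longrightarrow> (\<And>b. u b \<noteq> 0) \<Longrightarrow>
      (\<And>b i k. i < N b \<Longrightarrow> S (\<iota> (u b * \<rho> ^ k) * coeff (g b i) k) (coeff (Z b i) k)) \<Longrightarrow>
      special (Z True) (Z False 0) (Z False 1) (Z False 2) = 0"
  shows "val n D (B True (Min (J True))) = val n D (B True (Max (J True)))"
proof -
  interpret place Ov h by fact
  interpret S: ring_rel S by fact
  interpret \<iota>: comm_ring_hom \<iota> by fact
  interpret \<kappa>: comm_ring_hom \<kappa> by fact
  have n0: "0 < n"
    using n_ge by simp
  have fin: "finite (J b)" for b
  proof -
    have "J b \<subseteq> (\<Union>i<N b. {..degree (g b i)})"
      unfolding J_def using le_degree by fastforce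
    then show ?thesis
      by (rule finite_subset) auto
  qed
  define \<sigma> where "\<sigma> b k = inverse (c b k)" for b k
  have nz: "\<sigma> b k \<noteq> 0" if "k \<in> J b" for b k
    using B(1)[OF that] by (simp add: \<sigma>_def)
  have main: "val n D (B True (j True)) = val n D (B True (Max (J True)))"
    if "edge_start J \<sigma> j" for j
    using that
  proof (induction "\<Sum>b\<in>UNIV. Max (J b) - j b" arbitrary: j rule: less_induct)
    case less
    have jJ: "j b \<in> J b" for b
      using less.prems by (simp add: edge_start_def)
    show ?case
    proof (cases "\<exists>b. \<exists>i\<in>J b. j b < i")
      case False
      then have "Max (J True) \<le> j True"
        using Max_in[OF fin ne, of True] not_le by blast
      then have "j True = Max (J True)"
        using Max_ge[OF fin jJ, of True] by simp
      then show ?thesis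
        by simp
    next
      case True
      obtain \<rho> j' where rho: "\<rho> \<noteq> 0" and j': "\<And>b. j' b \<in> J b" "\<And>b. j b \<le> j' b" "\<exists>b. j b < j' b"
        and q_O: "\<And>b i. i \<in> J b \<Longrightarrow> \<sigma> b i * \<rho> ^ i / (\<sigma> b (j b) * \<rho> ^ j b) \<in> Ov"
        and q_mx: "\<And>b i. i \<in> J b \<Longrightarrow> i < j b \<or> j' b < i \<Longrightarrow> mx (\<sigma> b i * \<rho> ^ i / (\<sigma> b (j b) * \<rho> ^ j b))"
        and q_end: "\<And>b. \<not> mx (\<sigma> b (j' b) * \<rho> ^ j' b / (\<sigma> b (j b) * \<rho> ^ j b))"
        and start': "edge_start J \<sigma> j'"
        using newton_edge[OF roots fin nz less.prems True] by blast
      define q where "q b i = \<sigma> b i * \<rho> ^ i / (\<sigma> b (j b) * \<rho> ^ j b)" for b i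
      \<comment> \<open>Terms off the edge have residue 0, so the reduced curve runs exactly from
        index \<open>j b\<close> to index \<open>j' b\<close>.\<close>
      define Z where "Z b i = (\<Sum>k\<in>J b. monom (\<kappa> (h (q b k)) * B b k i) k)" for b i
      have coeff_X: "coeff (Z b i) k = (if k \<in> J b then \<kappa> (h (q b k)) * B b k i else 0)" for b i k
        unfolding Z_def coeff_sum coeff_monom using fin by (simp add: sum.delta)
      define u where "u b = inverse (\<sigma> b (j b) * \<rho> ^ j b)" for b
      have u: "u b \<noteq> 0" for b
        using nz[OF jJ] rho by (simp add: u_def)
      have rel: "S (\<iota> (u b * \<rho> ^ k) * coeff (g b i) k) (coeff (Z b i) k)" if "i < N b" for b i k
      proof (cases "k \<in> J b")
        case True
        have "u b * \<rho> ^ k = q b k * c b k"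
          using B(1)[OF True] by (simp add: u_def q_def \<sigma>_def field_simps)
        then have "\<iota> (u b * \<rho> ^ k) * coeff (g b i) k = \<iota> (q b k) * (\<iota> (c b k) * coeff (g b i) k)"
          by (simp add: \<iota>.hom_mult mult.assoc)
        moreover have "S (\<iota> (q b k) * (\<iota> (c b k) * coeff (g b i) k)) (\<kappa> (h (q b k)) * B b k i)"
          using const[OF q_O[OF True]] B(2)[OF True that] unfolding q_def by (rule S.rel_mult)
        ultimately show ?thesis
          using True by (simp add: coeff_X)
      next
        case False
        then have "coeff (g b i) k = 0"
          using that by (auto simp: J_def)
        then show ?thesis
          using False S.rel_zero by (simp add: coeff_X)
      qed
      have eq: "special (Z True) (Z False 0) (Z False 1) (Z False 2) = 0"
        using H[OF rho u rel] .
      have q_j: "q b (j b) = 1" for b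
        using rho nz[OF jJ[of b]] by (simp add: q_def)
      have low: "coeff (Z b i) (j b) = B b (j b) i" for b i
        using jJ[of b] one_O by (simp add: coeff_X q_j)
      have hi: "coeff (Z b i) (j' b) = \<kappa> (h (q b (j' b))) * B b (j' b) i" for b i
        using j'(1)[of b] by (simp add: coeff_X)
      have hq: "\<kappa> (h (q b (j' b))) \<noteq> 0" for b
        using q_end[of b] q_O[OF j'(1)[of b]] unfolding mx_def q_def by (auto simp: field_hom_0_iff[OF \<kappa>])
      have out: "coeff (Z b i) k = 0" if "k < j b \<or> j' b < k" for b i k
        using q_mx[OF _ that] by (auto simp: coeff_X q_def mx_def)
      have Y: "Z False 0 \<noteq> 0 \<or> Z False 1 \<noteq> 0 \<or> Z False 2 \<noteq> 0"
      proof -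
        obtain i where i: "i < 3" "B False (j False) i \<noteq> 0"
          using B(1)[OF jJ[of False]] by (auto simp: N_def)
        then have "Z False i \<noteq> 0"
          using low[of False i] by auto
        moreover have "i = 0 \<or> i = 1 \<or> i = 2"
          using i by auto
        ultimately show ?thesis
          by blast
      qed
      have "val n D (\<lambda>i. coeff (Z True i) (j True)) = val n D (\<lambda>i. coeff (Z True i) (j' True))"
      proof (rule val_curve[OF D char2 eq Y])
        show "\<exists>i<n. coeff (Z True i) (j True) \<noteq> 0"
          using B(1)[OF jJ[of True]] by (simp add: low N_def)
        show "\<exists>i<n. coeff (Z True i) (j' True) \<noteq> 0"
          using B(1)[OF j'(1)[of True]] hq[of True] by (simp add: hi N_def)
      qed (simp_all add: out)
      then have "val n D (B True (j True)) = val n D (B True (j' True))"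
        unfolding low hi val_scale[OF hq] .
      also have "\<dots> = val n D (B True (Max (J True)))"
      proof (rule less.hyps[OF _ start'])
        show "(\<Sum>b\<in>UNIV. Max (J b) - j' b) < (\<Sum>b\<in>UNIV. Max (J b) - j b)"
        proof (rule sum_strict_mono_ex1)
          show "\<forall>b\<in>UNIV. Max (J b) - j' b \<le> Max (J b) - j b"
            using j'(2) diff_le_mono2 by blast
          obtain b where b: "j b < j' b"
            using j'(3) by blast
          then have "Max (J b) - j' b < Max (J b) - j b"
            using Max_ge[OF fin j'(1)[of b]] by simp
          then show "\<exists>b\<in>UNIV. Max (J b) - j' b < Max (J b) - j b"
            by blast
        qed simp
      qed
      finally show ?thesis .
    qed
  qed
  have "edge_start J \<sigma> (\<lambda>b. Min (J b))"
    unfolding edge_start_def using Min_in[OF fin ne] Min_le[OF fin] by blast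
  from main[OF this] show ?thesis .
qed

end

section \<open>Existence of places\<close>

text \<open>By subtraction the assumption makes \<open>R\<close> single-valued: the graph of a
  homomorphism defined on a subring. As a relation, domain and map are extended together.\<close>

locale partial_hom = ring_rel R for R :: "'c::field \<Rightarrow> 'k::field \<Rightarrow> bool" +
  assumes rel_zero_imp: "R 0 b \<Longrightarrow> b = 0"
begin

lemma rel_unique: "R a b \<Longrightarrow> R a b' \<Longrightarrow> b = b'"
  using rel_diff[of a b a b'] rel_zero_imp[of "b - b'"] by simp

lemma partial_hom_localize:
  assumes "R a b" "b \<noteq> 0"
  shows "partial_hom (\<lambda>x y. \<exists>m s t. R s t \<and> x = s / a ^ m \<and> y = t / b ^ m)"
proof unfold_locales
  have a: "a \<noteq> 0"
    using assms rel_zero_imp by blast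
  note p = rel_power[OF assms(1)]
  show "\<exists>m s t. R s t \<and> 0 = s / a ^ m \<and> 0 = t / b ^ m"
    by (rule exI[of _ 0], rule exI[of _ 0], rule exI[of _ 0]) (simp add: rel_zero)
  show "\<exists>m s t. R s t \<and> 1 = s / a ^ m \<and> 1 = t / b ^ m"
    by (rule exI[of _ 0], rule exI[of _ 1], rule exI[of _ 1]) (simp add: rel_one)
  fix x y
  assume "\<exists>m s t. R s t \<and> x = s / a ^ m \<and> y = t / b ^ m"
  then obtain m s t where 1: "R s t" "x = s / a ^ m" "y = t / b ^ m"
    by blast
  show "\<exists>m s t. R s t \<and> - x = s / a ^ m \<and> - y = t / b ^ m"
    using 1 by (intro exI[of _ m] exI[of _ "- s"] exI[of _ "- t"]) (simp add: rel_uminus)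
  fix x' y'
  assume "\<exists>m s t. R s t \<and> x' = s / a ^ m \<and> y' = t / b ^ m"
  then obtain m' s' t' where 2: "R s' t'" "x' = s' / a ^ m'" "y' = t' / b ^ m'"
    by blast
  show "\<exists>m s t. R s t \<and> x * x' = s / a ^ m \<and> y * y' = t / b ^ m"
    using 1 2 by (intro exI[of _ "m + m'"] exI[of _ "s * s'"] exI[of _ "t * t'"])
      (simp add: rel_mult power_add)
  have "R (s * a ^ m' + s' * a ^ m) (t * b ^ m' + t' * b ^ m)"
    using 1 2 p by (intro rel_add rel_mult) auto
  then show "\<exists>m s t. R s t \<and> x + x' = s / a ^ m \<and> y + y' = t / b ^ m"
    using 1 2 a assms(2)
    by (intro exI[of _ "m + m'"] exI[of _ "s * a ^ m' + s' * a ^ m"] exI[of _ "t * b ^ m' + t' * b ^ m"])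
      (simp add: power_add add_divide_distrib)
next
  fix y
  assume "\<exists>m s t. R s t \<and> 0 = s / a ^ m \<and> y = t / b ^ m"
  then obtain m s t where 1: "R s t" "0 = s / a ^ m" "y = t / b ^ m"
    by blast
  have "a \<noteq> 0"
    using assms rel_zero_imp by blast
  then show "y = 0"
    using 1 rel_zero_imp by auto
qed

text \<open>When units of the image can be inverted, this says that 1 lies in the ideal generated by
  the kernel of the reduction in the ring obtained by adjoining \<open>x\<close>.\<close>

definition integral_eq :: "'c \<Rightarrow> 'c poly \<Rightarrow> bool" where
  "integral_eq x f \<longleftrightarrow> poly f x = 0 \<and> (\<exists>b. b \<noteq> 0 \<and> R (coeff f 0) b) \<and> (\<forall>i>0. R (coeff f i) 0)"

end

locale maximal_partial_hom = partial_hom R for R :: "'c::field \<Rightarrow> 'k::alg_closed_field \<Rightarrow> bool" +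
  assumes maximal: "partial_hom R' \<Longrightarrow> (\<And>a b. R a b \<Longrightarrow> R' a b) \<Longrightarrow> R' a b \<Longrightarrow> R a b"
begin

lemma rel_inverse:
  assumes "R a b" "b \<noteq> 0"
  shows "R (inverse a) (inverse b)"
proof (rule maximal[OF partial_hom_localize[OF assms]])
  show "\<exists>m s t. R s t \<and> x = s / a ^ m \<and> y = t / b ^ m" if "R x y" for x y
    using that by (intro exI[of _ 0] exI[of _ x] exI[of _ y]) simp
  show "\<exists>m s t. R s t \<and> inverse a = s / a ^ m \<and> inverse b = t / b ^ m"
    by (rule exI[of _ 1], rule exI[of _ 1], rule exI[of _ 1]) (simp add: rel_one inverse_eq_divide)
qed

text \<open>Otherwise evaluating polynomials at \<open>x\<close> on one side and at \<open>c\<close>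
  on the other would extend \<open>R\<close>, against maximality.\<close>

lemma ex_relation_nonzero:
  assumes x: "\<not> (\<exists>b. R x b)"
  shows "\<exists>f g. (\<forall>i. R (coeff f i) (coeff g i)) \<and> poly f x = 0 \<and> poly g c \<noteq> 0"
proof (rule ccontr)
  assume no: "\<not> ?thesis"
  interpret P: ring_rel "\<lambda>f g. \<forall>i. R (coeff f i) (coeff g i)"
    by (rule rel_poly)
  let ?R = "\<lambda>y b. \<exists>f g. (\<forall>i. R (coeff f i) (coeff g i)) \<and> y = poly f x \<and> b = poly g c"
  have "partial_hom ?R"
  proof unfold_locales
    show "?R 0 0"
      using P.rel_zero by (intro exI[of _ 0]) simp
    show "?R 1 1"
      using P.rel_one by (intro exI[of _ 1]) simp
    show "?R (a + b) (a' + b')" if "?R a a'" "?R b b'" for a a' b b'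
      using that P.rel_add by (metis poly_add)
    show "?R (a * b) (a' * b')" if "?R a a'" "?R b b'" for a a' b b'
      using that P.rel_mult by (metis poly_mult)
    show "?R (- a) (- a')" if "?R a a'" for a a'
      using that P.rel_uminus by (metis poly_minus)
    show "b = 0" if "?R 0 b" for b
      using that no by metis
  qed
  moreover have "?R a b" if "R a b" for a b
    using that rel_zero by (intro exI[of _ "[:a:]"] exI[of _ "[:b:]"]) (auto simp: coeff_pCons split: nat.split)
  moreover have "?R x c"
    using rel_zero rel_one
    by (intro exI[of _ "[:0, 1:]"] exI[of _ "[:0, 1:]"]) (auto simp: coeff_pCons split: nat.split)
  ultimately have "R x c"
    by (rule maximal)
  then show False
    using x by blast
qed

text \<open>The reductions of polynomials that vanish at \<open>x\<close> form an ideal over the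
  image of \<open>R\<close>, which is a field by \<open>rel_inverse\<close>. If a member of least
  degree were nonconstant, it would have a root \<open>c\<close>, and by division all members would
  vanish there, contrary to \<open>ex_relation_nonzero\<close>. So a nonzero constant is such a
  reduction.\<close>

lemma ex_integral_eq:
  assumes x: "\<not> (\<exists>b. R x b)"
  shows "\<exists>f. integral_eq x f"
proof -
  interpret P: ring_rel "\<lambda>f g. \<forall>i. R (coeff f i) (coeff g i)"
    by (rule rel_poly)
  define I where "I = (\<lambda>g. \<exists>f. (\<forall>i. R (coeff f i) (coeff g i)) \<and> poly f x = 0)"
  have I_diff: "I (g - g')" if "I g" "I g'" for g g'
    using that P.rel_diff unfolding I_def by (metis poly_diff diff_self)
  have I_mult: "I (u * g)" if "I g" "\<forall>i. R (coeff w i) (coeff u i)" for g u w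
    using that P.rel_mult unfolding I_def by (metis poly_mult mult_zero_right)
  have "\<exists>g. I g \<and> g \<noteq> 0"
    using ex_relation_nonzero[OF x, of 0] unfolding I_def by (metis poly_0)
  then obtain g0 where g0: "I g0" "g0 \<noteq> 0" "\<And>g. I g \<Longrightarrow> g \<noteq> 0 \<Longrightarrow> degree g0 \<le> degree g"
    using exists_least_iff[of "\<lambda>m. \<exists>g. I g \<and> g \<noteq> 0 \<and> degree g = m"] not_le by metis
  show ?thesis
  proof (cases "degree g0 = 0")
    case True
    then obtain b where b: "g0 = [:b:]" "b \<noteq> 0"
      using g0(2) by (metis degree_eq_zeroE pCons_0_0)
    obtain f where f: "\<forall>i. R (coeff f i) (coeff g0 i)" "poly f x = 0"
      using g0(1) by (auto simp: I_def)
    have "R (coeff f 0) b" "\<forall>i>0. R (coeff f i) 0"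
      using f(1) b by (auto simp: coeff_pCons dest: spec[of _ "0::nat"] split: nat.splits)
        (metis gr0_conv_Suc nat.case(2))
    then show ?thesis
      using f(2) b unfolding integral_eq_def by blast
  next
    case False
    then obtain c where c: "poly g0 c = 0"
      using alg_closed_imp_poly_has_root[of g0] by auto
    have rep: "\<exists>a. R a (coeff g i)" if "I g" for g i
      using that by (auto simp: I_def)
    obtain a0 where a0: "R a0 (coeff g0 (degree g0))"
      using rep[OF g0(1)] by blast
    have lc0: "coeff g0 (degree g0) \<noteq> 0"
      using g0(2) by simp
    have "poly g c = 0" if "I g" for g
      using that
    proof (induction "degree g" arbitrary: g rule: less_induct)
      case less
      show ?case
      proof (cases "g = 0")
        case False
        obtain a where a: "R a (coeff g (degree g))"
          using rep[OF less.prems] by blast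
        let ?e = "degree g - degree g0"
        let ?l = "coeff g (degree g) * inverse (coeff g0 (degree g0))"
        let ?u = "monom ?l ?e"
        have "\<forall>i. R (coeff (monom (a * inverse a0) ?e) i) (coeff ?u i)"
          using rel_mult[OF a rel_inverse[OF a0 lc0]] rel_zero by simp
        then have I: "I (g - ?u * g0)"
          using I_diff[OF less.prems I_mult[OF g0(1)]] by blast
        have le: "degree g0 \<le> degree g"
          using g0(3)[OF less.prems False] .
        have "?l \<noteq> 0"
          using False lc0 by simp
        have "poly (g - ?u * g0) c = 0"
        proof (cases "degree g = 0")
          case True
          then show ?thesis
            using le \<open>degree g0 \<noteq> 0\<close> by simp
        next
          case False
          have "degree (g - ?u * g0) < degree g"
          proof (rule degree_lessI)
            show "g - ?u * g0 \<noteq> 0 \<or> 0 < degree g"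
              using False by simp
            show "\<forall>k\<ge>degree g. coeff (g - ?u * g0) k = 0"
            proof (intro allI impI)
              fix k assume k: "degree g \<le> k"
              show "coeff (g - ?u * g0) k = 0"
              proof (cases "k = degree g")
                case True
                then show ?thesis
                  using le lc0 by (simp add: coeff_monom_mult)
              next
                case False
                then have "degree g < k" "degree g0 < k - ?e"
                  using k le by auto
                then show ?thesis
                  using le by (simp add: coeff_monom_mult coeff_eq_0)
              qed
            qed
          qed
          then show ?thesis
            using less.hyps I by blast
        qed
        then show ?thesis
          using c by simp
      qed simp
    qed
    then show ?thesis
      using ex_relation_nonzero[OF x, of c] unfolding I_def by blast
  qed
qed

text \<open>The descent of Chevalley's theorem: the leading term of \<open>f\<close> is cancelled
  against the reversal of \<open>f'\<close>, whose leading coefficient has nonzero residue. The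
  multiplier has residue 0, so the residues of the coefficients are unchanged.\<close>

lemma integral_eq_descent:
  assumes f: "integral_eq x f" and f': "integral_eq (inverse x) f'"
    and x: "x \<noteq> 0" and le: "degree f' \<le> degree f"
  shows "\<exists>F. integral_eq x F \<and> degree F < degree f"
proof -
  let ?m = "degree f"
  obtain b b' where b: "b \<noteq> 0" "R (coeff f 0) b" "\<And>i. 0 < i \<Longrightarrow> R (coeff f i) 0"
      and b': "b' \<noteq> 0" "R (coeff f' 0) b'" "\<And>i. 0 < i \<Longrightarrow> R (coeff f' i) 0"
    using f f' by (auto simp: integral_eq_def)
  have f'0: "coeff f' 0 \<noteq> 0"
    using b' rel_zero_imp by metis
  have m: "0 < ?m"
  proof (rule ccontr)
    assume "\<not> 0 < ?m"
    then obtain a where "f = [:a:]"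
      by (metis degree_eq_zeroE gr0I)
    then show False
      using f b rel_zero_imp by (auto simp: integral_eq_def)
  qed
  \<comment> \<open>The polynomial \<open>f'\<close> evaluated at the inverse and multiplied by the
    power \<open>?m\<close> of the variable, hence reversed and shifted up to degree
    \<open>?m\<close>.\<close>
  define r where "r = (\<Sum>j\<le>?m. monom (coeff f' j) (?m - j))"
  have coeff_r: "coeff r i = (if i \<le> ?m then coeff f' (?m - i) else 0)" for i
  proof -
    have "coeff r i = (\<Sum>j\<le>?m. if j = ?m - i \<and> i \<le> ?m then coeff f' j else 0)"
      unfolding r_def coeff_sum coeff_monom by (intro sum.cong) auto
    also have "\<dots> = (if i \<le> ?m then coeff f' (?m - i) else 0)"
      by (cases "i \<le> ?m") (simp_all add: sum.delta)
    finally show ?thesis .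
  qed
  have "poly r x = x ^ ?m * poly f' (inverse x)"
  proof -
    have "poly f' (inverse x) = (\<Sum>j\<le>?m. coeff f' j * inverse x ^ j)"
      unfolding poly_altdef using le by (intro sum.mono_neutral_left) (auto simp: coeff_eq_0)
    moreover have *: "coeff f' j * x ^ (?m - j) = x ^ ?m * (coeff f' j * inverse x ^ j)" if "j \<le> ?m" for j
      using x that by (simp add: power_diff field_simps)
    ultimately show ?thesis
      unfolding r_def poly_sum poly_monom by (simp only: sum_distrib_left) (rule sum.cong[OF refl], rule *, simp)
  qed
  then have r_x: "poly r x = 0"
    using f' by (simp add: integral_eq_def)
  let ?e = "coeff f ?m * inverse (coeff f' 0)"
  have e: "R ?e 0"
    using rel_mult[OF b(3)[OF m] rel_inverse[OF b'(2,1)]] by simp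
  define F where "F = f - smult ?e r"
  have er: "R (?e * coeff r i) 0" for i
  proof -
    have "\<exists>t. R (coeff r i) t"
      unfolding coeff_r using b'(2,3) rel_zero by (cases "i \<le> ?m"; cases "?m - i") auto
    then show ?thesis
      using rel_mult[OF e] by fastforce
  qed
  have "integral_eq x F"
    unfolding integral_eq_def
  proof (intro conjI allI impI exI[of _ b])
    show "poly F x = 0"
      using f r_x by (simp add: F_def integral_eq_def)
    show "b \<noteq> 0"
      by (rule b)
    show "R (coeff F 0) b"
      using rel_diff[OF b(2) er[of 0]] by (simp add: F_def)
    show "R (coeff F i) 0" if "0 < i" for i
      using rel_diff[OF b(3)[OF that] er[of i]] by (simp add: F_def)
  qed
  moreover have "degree F < ?m"
  proof (rule degree_lessI)
    show "F \<noteq> 0 \<or> 0 < ?m"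
      using m by simp
    show "\<forall>k\<ge>?m. coeff F k = 0"
      using f'0 by (auto simp: F_def coeff_r coeff_eq_0)
  qed
  ultimately show ?thesis
    by blast
qed

lemma rel_or_inverse:
  assumes "\<not> (\<exists>b. R x b)"
  shows "R (inverse x) 0"
proof -
  have x: "x \<noteq> 0"
    using assms rel_zero by blast
  have "\<exists>b. R (inverse x) b"
  proof (rule ccontr)
    assume no: "\<not> ?thesis"
    have False if "integral_eq x f" "integral_eq (inverse x) f'" for f f'
      using that
    proof (induction "degree f + degree f'" arbitrary: f f' rule: less_induct)
      case less
      show ?case
      proof (cases "degree f' \<le> degree f")
        case True
        then show ?thesis
          using integral_eq_descent[OF less.prems x True] less.hyps less.prems by fastforce
      next
        case False
        then obtain F where "integral_eq (inverse x) F" "degree F < degree f'"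
          using integral_eq_descent[of "inverse x" f' f] less.prems x by auto
        then show ?thesis
          using less.hyps[of f F] less.prems by simp
      qed
    qed
    then show False
      using ex_integral_eq[OF assms] ex_integral_eq[OF no] by blast
  qed
  then obtain b where b: "R (inverse x) b"
    by blast
  have "b = 0"
  proof (rule ccontr)
    assume "b \<noteq> 0"
    then show False
      using rel_inverse[OF b] assms by auto
  qed
  then show ?thesis
    using b by simp
qed

lemma place_of_maximal: "place {a. \<exists>b. R a b} (\<lambda>a. THE b. R a b)"
proof -
  have the: "(THE b. R a b) = b" if "R a b" for a b
    using that rel_unique by blast
  show ?thesis
  proof unfold_locales
    show "inverse a \<in> {a. \<exists>b. R a b} \<and> (THE b. R (inverse a) b) = 0" if "a \<notin> {a. \<exists>b. R a b}" for a
      using rel_or_inverse[of a] the[of "inverse a"] that by auto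
    show "1 \<in> {a. \<exists>b. R a b}" "(THE b. R 1 b) = 1"
      using rel_one the[OF rel_one] by auto
    fix a
    assume "a \<in> {a. \<exists>b. R a b}"
    then obtain a' where a: "R a a'"
      by blast
    show "- a \<in> {a. \<exists>b. R a b} \<and> (THE b. R (- a) b) = - (THE b. R a b)"
      using rel_uminus[OF a] the[OF a] the[OF rel_uminus[OF a]] by auto
    fix b
    assume "b \<in> {a. \<exists>b. R a b}"
    then obtain b' where b: "R b b'"
      by blast
    show "a + b \<in> {a. \<exists>b. R a b} \<and> (THE c. R (a + b) c) = (THE b. R a b) + (THE c. R b c)"
      using rel_add[OF a b] the[OF a] the[OF b] the[OF rel_add[OF a b]] by auto
    show "a * b \<in> {a. \<exists>b. R a b} \<and> (THE c. R (a * b) c) = (THE b. R a b) * (THE c. R b c)"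
      using rel_mult[OF a b] the[OF a] the[OF b] the[OF rel_mult[OF a b]] by auto
  qed
qed

end

text \<open>Chevalley's extension theorem: Zorn's lemma on graphs of partial homomorphisms, ordered
  by inclusion, gives a maximal one, which is a place.\<close>

theorem ex_place:
  fixes R :: "'c::field \<Rightarrow> 'k::alg_closed_field \<Rightarrow> bool"
  assumes "partial_hom R"
  shows "\<exists>Ov h. place Ov h \<and> (\<forall>a b. R a b \<longrightarrow> a \<in> Ov \<and> h a = b)"
proof -
  define rel where "rel M = (\<lambda>a b. (a, b) \<in> M)" for M :: "('c \<times> 'k) set"
  define \<A> where "\<A> = {M. partial_hom (rel M) \<and> (\<forall>a b. R a b \<longrightarrow> (a, b) \<in> M)}"
  have "{(a, b). R a b} \<in> \<A>"
    using assms by (simp add: \<A>_def rel_def)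
  moreover have "\<Union>\<C> \<in> \<A>" if C: "\<C> \<noteq> {}" "subset.chain \<A> \<C>" for \<C>
  proof -
    have mem: "partial_hom (rel M)" "R a b \<Longrightarrow> (a, b) \<in> M" if "M \<in> \<C>" for M a b
      using that C(2) by (auto simp: subset.chain_def \<A>_def)
    obtain M0 where M0: "M0 \<in> \<C>"
      using C(1) by blast
    have two: "\<exists>M\<in>\<C>. rel M a a' \<and> rel M b b'" if "rel (\<Union>\<C>) a a'" "rel (\<Union>\<C>) b b'" for a a' b b'
    proof -
      have "\<exists>M\<in>\<C>. (a, a') \<in> M" "\<exists>N\<in>\<C>. (b, b') \<in> N"
        using that by (auto simp: rel_def)
      then obtain M N where "M \<in> \<C>" "(a, a') \<in> M" "N \<in> \<C>" "(b, b') \<in> N"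
        by blast
      moreover from this have "M \<subseteq> N \<or> N \<subseteq> M"
        using C(2) by (auto simp: subset.chain_def)
      ultimately show ?thesis
        by (auto simp: rel_def)
    qed
    have sub: "rel (\<Union>\<C>) a b" if "M \<in> \<C>" "rel M a b" for M a b
      using that by (auto simp: rel_def)
    have rr: "ring_rel (rel M)" if "M \<in> \<C>" for M
      using mem(1)[OF that] by (simp add: partial_hom_def)
    have "partial_hom (rel (\<Union>\<C>))"
    proof unfold_locales
      show "rel (\<Union>\<C>) 0 0" "rel (\<Union>\<C>) 1 1"
        using sub[OF M0] ring_rel.rel_zero[OF rr[OF M0]] ring_rel.rel_one[OF rr[OF M0]] by blast+
      show "rel (\<Union>\<C>) (a + b) (a' + b')" if "rel (\<Union>\<C>) a a'" "rel (\<Union>\<C>) b b'" for a a' b b'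
        using two[OF that] ring_rel.rel_add[OF rr] sub by blast
      show "rel (\<Union>\<C>) (a * b) (a' * b')" if "rel (\<Union>\<C>) a a'" "rel (\<Union>\<C>) b b'" for a a' b b'
        using two[OF that] ring_rel.rel_mult[OF rr] sub by blast
      show "rel (\<Union>\<C>) (- a) (- a')" if "rel (\<Union>\<C>) a a'" for a a'
        using two[OF that that] ring_rel.rel_uminus[OF rr] sub by blast
      show "b = 0" if "rel (\<Union>\<C>) 0 b" for b
        using two[OF that that] partial_hom.rel_zero_imp[OF mem(1)] by blast
    qed
    then show ?thesis
      using mem(2) M0 by (auto simp: \<A>_def)
  qed
  ultimately obtain M where M: "M \<in> \<A>" and max: "\<And>N. N \<in> \<A> \<Longrightarrow> M \<subseteq> N \<Longrightarrow> N = M"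
    using subset_Zorn_nonempty[of \<A>] by blast
  interpret partial_hom "rel M"
    using M by (simp add: \<A>_def)
  interpret maximal_partial_hom "rel M"
  proof unfold_locales
    fix R' :: "'c \<Rightarrow> 'k \<Rightarrow> bool" and a b
    assume *: "partial_hom R'" "\<And>a b. rel M a b \<Longrightarrow> R' a b" "R' a b"
    have "rel {(a, b). R' a b} = R'"
      by (simp add: rel_def)
    then have "{(a, b). R' a b} = M"
      using * M by (intro max) (auto simp: \<A>_def rel_def)
    then show "rel M a b"
      using *(3) by (auto simp: rel_def)
  qed
  show ?thesis
  proof (intro exI conjI allI impI)
    show "place {a. \<exists>b. rel M a b} (\<lambda>a. THE b. rel M a b)"
      by (rule place_of_maximal)
    fix a b assume "R a b"
    then have "rel M a b"
      using M by (simp add: \<A>_def rel_def)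
    then show "a \<in> {a. \<exists>b. rel M a b}" "(THE b. rel M a b) = b"
      using rel_unique by blast+
  qed
qed

section \<open>Graded embeddings into power series\<close>

definition mvar :: "'v \<Rightarrow> ('v \<Rightarrow>\<^sub>0 nat) \<Rightarrow>\<^sub>0 'a::comm_ring_1" where
  "mvar i = Poly_Mapping.single (Poly_Mapping.single i 1) 1"

definition mconst :: "'a::comm_ring_1 \<Rightarrow> ('v \<Rightarrow>\<^sub>0 nat) \<Rightarrow>\<^sub>0 'a" where
  "mconst c = Poly_Mapping.single 0 c"

lemma mconst_hom: "comm_ring_hom mconst"
  unfolding mconst_def by unfold_locales (simp_all add: single_add mult_single)

lemma mconst_0 [simp]: "mconst 0 = 0" and mconst_1 [simp]: "mconst 1 = 1"
  by (simp_all add: mconst_def)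

lemma monom_val_mvar:
  fixes m :: "'v \<Rightarrow>\<^sub>0 nat"
  shows "monom_val mvar m = Poly_Mapping.single m (1::'a::comm_ring_1)"
proof -
  have power: "Poly_Mapping.single a (1::'a) ^ k = Poly_Mapping.single (\<Sum>_<k. a) 1" for a :: "'v \<Rightarrow>\<^sub>0 nat" and k
    by (induction k) (simp_all add: mult_single add.commute)
  have "monom_val mvar m = (\<Prod>i\<in>Poly_Mapping.keys m. Poly_Mapping.single (Poly_Mapping.single i (Poly_Mapping.lookup m i)) (1::'a))"
  proof -
    have "(\<Sum>_<k. Poly_Mapping.single i (1::nat)) = Poly_Mapping.single i k" for i :: 'v and k
      by (induction k) (simp_all flip: single_add)
    then show ?thesis
      by (simp add: monom_val_def mvar_def power del: One_nat_def)
  qed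
  also have "\<dots> = Poly_Mapping.single (\<Sum>i\<in>Poly_Mapping.keys m. Poly_Mapping.single i (Poly_Mapping.lookup m i)) 1"
  proof -
    have "(\<Prod>i\<in>A. Poly_Mapping.single (f i) (1::'a)) = Poly_Mapping.single (\<Sum>i\<in>A. f i) 1"
      for A :: "'v set" and f :: "'v \<Rightarrow> 'v \<Rightarrow>\<^sub>0 nat"
      by (induction A rule: infinite_finite_induct) (simp_all add: mult_single)
    then show ?thesis .
  qed
  also have "(\<Sum>i\<in>Poly_Mapping.keys m. Poly_Mapping.single i (Poly_Mapping.lookup m i)) = m"
    using poly_mapping_sum_superset[of "Poly_Mapping.keys m" m] by simp
  finally show ?thesis .
qed

lemma ev_mvar: "ev mconst p mvar = p"
  using poly_mapping_sum_superset[of "Poly_Mapping.keys p" p]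
  by (simp add: ev_def monom_val_mvar mconst_def mult_single)

text \<open>The new variable records the weighted degree, and setting it to 1 gives \<open>p\<close>
  back. Weights 1 produce the homogeneous components; a weight on index 0 alone produces the degree
  in X_0.\<close>

definition grade :: "('v \<Rightarrow> nat) \<Rightarrow> (('v \<Rightarrow>\<^sub>0 nat) \<Rightarrow>\<^sub>0 'a::comm_ring_1) \<Rightarrow> (('v \<Rightarrow>\<^sub>0 nat) \<Rightarrow>\<^sub>0 'a) poly" where
  "grade \<omega> p = ev (\<lambda>c. [:mconst c:]) p (\<lambda>i. monom (mvar i) (\<omega> i))"

lemma pCons_hom: "comm_ring_hom (\<lambda>c::'a::comm_ring_1. [:c:])"
  by unfold_locales (auto simp: one_pCons)

lemma poly_hom: "comm_ring_hom (\<lambda>p. poly p a)"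
  by unfold_locales auto

lemma fps_of_poly_hom: "comm_ring_hom (fps_of_poly :: 'a::comm_ring_1 poly \<Rightarrow> _)"
  by unfold_locales (auto simp: fps_of_poly_add fps_of_poly_mult)

lemma grade_hom: "comm_ring_hom (grade \<omega>)"
  unfolding grade_def
  by (rule comm_ring_hom.ev_hom[OF comm_ring_hom_comp[OF pCons_hom mconst_hom]])

lemma poly_grade: "poly (grade \<omega> p) 1 = p"
  unfolding grade_def comm_ring_hom.ev_commute[OF poly_hom] by (simp add: poly_monom ev_mvar)

lemma grade_mconst: "grade \<omega> (mconst c) = [:mconst c:]"
  unfolding grade_def mconst_def[of c]
    comm_ring_hom.ev_single[OF comm_ring_hom_comp[OF pCons_hom mconst_hom]]
  by (simp add: mconst_def)

lemma grade_mvar: "grade \<omega> (mvar i) = monom (mvar i) (\<omega> i)"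
  unfolding grade_def mvar_def[of i]
    comm_ring_hom.ev_single[OF comm_ring_hom_comp[OF pCons_hom mconst_hom]]
  by (simp add: mvar_def)

text \<open>The completion at the origin: the coefficients of the power series are the homogeneous components.\<close>

definition em :: "(('v \<Rightarrow>\<^sub>0 nat) \<Rightarrow>\<^sub>0 'a::comm_ring_1) \<Rightarrow> (('v \<Rightarrow>\<^sub>0 nat) \<Rightarrow>\<^sub>0 'a) fps" where
  "em p = fps_of_poly (grade (\<lambda>_. 1) p)"

lemma em_hom: "comm_ring_hom em"
  unfolding em_def by (rule comm_ring_hom_comp[OF fps_of_poly_hom grade_hom])

lemma em_inj: "em p = em q \<longleftrightarrow> p = q"
  unfolding em_def fps_of_poly_eq_iff by (metis poly_grade)

lemma em_mconst: "em (mconst c) = fps_const (mconst c)"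
  by (simp add: em_def grade_mconst fps_of_poly_const)

lemma em_mvar: "em (mvar i) = fps_const (mvar i) * fps_X"
  by (simp add: em_def grade_mvar fps_of_poly_monom del: One_nat_def)

lemma em_nth_0: "fps_nth (em p) 0 = mconst (ev (\<lambda>c. c) p (\<lambda>_. 0))"
proof -
  have "fps_nth (em p) 0 = poly (grade (\<lambda>_. 1) p) 0"
    by (simp add: em_def poly_0_coeff_0)
  also have "\<dots> = ev mconst p (\<lambda>_. 0)"
    unfolding grade_def comm_ring_hom.ev_commute[OF poly_hom] by (simp add: poly_monom)
  also have "\<dots> = mconst (ev (\<lambda>c. c) p (\<lambda>_. 0))"
    unfolding comm_ring_hom.ev_commute[OF mconst_hom] by simp
  finally show ?thesis .
qed

locale coeff_rel = ring_rel R for R :: "'a::comm_ring_1 \<Rightarrow> 'b::comm_ring_1 \<Rightarrow> bool"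
begin

abbreviation Rm :: "(('v \<Rightarrow>\<^sub>0 nat) \<Rightarrow>\<^sub>0 'a) \<Rightarrow> (('v \<Rightarrow>\<^sub>0 nat) \<Rightarrow>\<^sub>0 'b) \<Rightarrow> bool" where
  "Rm p q \<equiv> \<forall>m. R (Poly_Mapping.lookup p m) (Poly_Mapping.lookup q m)"

abbreviation Rs :: "(('v \<Rightarrow>\<^sub>0 nat) \<Rightarrow>\<^sub>0 'a) fps \<Rightarrow> (('v \<Rightarrow>\<^sub>0 nat) \<Rightarrow>\<^sub>0 'b) fps \<Rightarrow> bool" where
  "Rs f g \<equiv> \<forall>k. Rm (fps_nth f k) (fps_nth g k)"

lemma rel_Rm: "ring_rel Rm"
  using rel_mpoly by (simp add: case_prod_beta)

lemma rel_Rs: "ring_rel Rs"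
  by (rule ring_rel.rel_fps[OF rel_Rm])

lemma Rm_mconst: "R a b \<Longrightarrow> Rm (mconst a) (mconst b)"
  by (simp add: mconst_def lookup_single when_def rel_zero)

lemma Rm_mvar: "Rm (mvar i) (mvar i)"
  by (simp add: mvar_def lookup_single when_def rel_zero rel_one)

lemma Rs_em:
  assumes "Rm p q"
  shows "Rs (em p) (em q)"
proof -
  interpret P: ring_rel "\<lambda>f g. \<forall>n. Rm (coeff f n) (coeff g n)"
    by (rule ring_rel.rel_poly[OF rel_Rm])
  have "\<forall>n. Rm (coeff (grade (\<lambda>_. 1) p) n) (coeff (grade (\<lambda>_. 1) q) n)"
    unfolding grade_def
  proof (rule P.rel_ev)
    show "\<forall>n. Rm (coeff [:mconst (Poly_Mapping.lookup p m):] n) (coeff [:mconst (Poly_Mapping.lookup q m):] n)" for m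
      using assms rel_zero by (auto simp: coeff_pCons Rm_mconst split: nat.splits)
    show "\<forall>n. Rm (coeff (monom (mvar i) 1) n) (coeff (monom (mvar i) 1) n)" for i
      using rel_zero by (auto simp: Rm_mvar)
  qed simp_all
  then show ?thesis
    by (simp add: em_def)
qed

end

section \<open>Hensel's lemma for quadratic equations\<close>

text \<open>Newton's method with the derivative inverted once, at the origin. Each step gains only
  one coefficient, but the iteration uses ring operations alone and therefore commutes with
  reduction at a place.\<close>

fun newton_iter :: "'a::comm_ring_1 \<Rightarrow> 'a fps \<Rightarrow> 'a fps \<Rightarrow> 'a fps \<Rightarrow> 'a \<Rightarrow> nat \<Rightarrow> 'a fps" where
  "newton_iter u q0 q1 q2 r 0 = fps_const r"
| "newton_iter u q0 q1 q2 r (Suc N) =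
    (let w = newton_iter u q0 q1 q2 r N in w - fps_const u * (q0 + q1 * w + q2 * w\<^sup>2))"

definition newton_lim :: "'a::comm_ring_1 \<Rightarrow> 'a fps \<Rightarrow> 'a fps \<Rightarrow> 'a fps \<Rightarrow> 'a \<Rightarrow> 'a fps" where
  "newton_lim u q0 q1 q2 r = Abs_fps (\<lambda>k. fps_nth (newton_iter u q0 q1 q2 r k) k)"

lemma fps_mult_cutoff:
  fixes a b :: "'a::comm_ring_1 fps"
  assumes "\<And>i. i < M \<Longrightarrow> fps_nth a i = 0" "\<And>i. i < N \<Longrightarrow> fps_nth b i = 0" "k < M + N"
  shows "fps_nth (a * b) k = 0"
  unfolding fps_mult_nth
proof (rule sum.neutral, rule ballI)
  fix i assume "i \<in> {0..k}"
  then have "i < M \<or> k - i < N"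
    using assms(3) by auto
  then show "fps_nth a i * fps_nth b (k - i) = 0"
    using assms(1,2) by fastforce
qed

text \<open>Taylor expansion. If \<open>u\<close> inverts the derivative at the origin and
  \<open>Q\<close> vanishes there, the second factor has constant term 0, so the error gains an
  order.\<close>

lemma quadratic_step:
  fixes w u :: "'a::comm_ring_1"
  assumes "Q = q0 + q1 * w + q2 * w\<^sup>2"
  shows "q0 + q1 * (w - u * Q) + q2 * (w - u * Q)\<^sup>2 = Q * (1 - u * (q1 + 2 * q2 * w) + u\<^sup>2 * Q * q2)"
proof -
  have "q0 + q1 * (w - u * Q) + q2 * (w - u * Q)\<^sup>2
      = (q0 + q1 * w + q2 * w\<^sup>2) - Q * (u * (q1 + 2 * q2 * w)) + Q * (u\<^sup>2 * Q * q2)"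
    by (simp add: power2_eq_square algebra_simps)
  also have "\<dots> = Q * (1 - u * (q1 + 2 * q2 * w) + u\<^sup>2 * Q * q2)"
    unfolding assms[symmetric] by (simp only: distrib_left right_diff_distrib mult_1_right)
  finally show ?thesis .
qed

lemma newton_lim_root:
  fixes r :: "'a::comm_ring_1"
  assumes root: "fps_nth q0 0 + fps_nth q1 0 * r + fps_nth q2 0 * r\<^sup>2 = 0"
    and u: "u * (fps_nth q1 0 + 2 * fps_nth q2 0 * r) = 1"
  defines "w \<equiv> newton_lim u q0 q1 q2 r"
  shows "q0 + q1 * w + q2 * w\<^sup>2 = 0"
proof -
  let ?w = "newton_iter u q0 q1 q2 r"
  define Q where "Q x = q0 + q1 * x + q2 * x\<^sup>2" for x
  have w0: "fps_nth (?w N) 0 = r" and Q0: "\<And>k. k < Suc N \<Longrightarrow> fps_nth (Q (?w N)) k = 0" for N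
  proof (induction N)
    case 0
    {
      case 1
      show ?case by simp
    next
      case 2
      then show ?case
        using root by (simp add: Q_def power2_eq_square)
    }
  next
    case (Suc N)
    have Q: "fps_nth (Q (?w N)) 0 = 0"
      using Suc(2) by simp
    have step: "?w (Suc N) = ?w N - fps_const u * Q (?w N)"
      by (simp add: Q_def Let_def)
    {
      case 1
      show ?case
        unfolding step using Suc(1) Q by simp
    next
      case (2 k)
      have "Q (?w (Suc N)) = Q (?w N) * (1 - fps_const u * (q1 + 2 * q2 * ?w N) + (fps_const u)\<^sup>2 * Q (?w N) * q2)"
        unfolding step Q_def by (rule quadratic_step[OF refl])
      moreover have "fps_nth \<dots> k = 0"
        unfolding Q_def[symmetric]
      proof (rule fps_mult_cutoff[where M = "Suc N" and N = 1])
        show "fps_nth (1 - fps_const u * (q1 + 2 * q2 * ?w N) + (fps_const u)\<^sup>2 * Q (?w N) * q2) i = 0"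
          if "i < 1" for i
          using that u Suc(1) Q by (simp add: numeral_fps_const power2_eq_square)
      qed (use Suc(2) 2 in auto)
      ultimately show ?case
        by simp
    }
  qed
  have stab: "fps_nth (?w (N + l)) k = fps_nth (?w N) k" if "k \<le> N" for N l k
  proof (induction l)
    case (Suc l)
    have "fps_nth (Q (?w (N + l))) k = 0"
      using that by (intro Q0) simp
    then show ?case
      using Suc by (simp add: Q_def[symmetric] Let_def)
  qed simp
  have agree: "fps_nth w k = fps_nth (?w N) k" if "k \<le> N" for k N
    using stab[of k k "N - k"] that by (simp add: w_def newton_lim_def)
  show ?thesis
  proof (rule fps_ext)
    fix k
    let ?d = "w - ?w k"
    have "q0 + q1 * w + q2 * w\<^sup>2 = Q (?w k) + ?d * (q1 + q2 * (w + ?w k))"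
      by (simp add: Q_def power2_eq_square algebra_simps)
    moreover have "fps_nth (?d * (q1 + q2 * (w + ?w k))) k = 0"
      by (rule fps_mult_cutoff[where M = "Suc k" and N = 0]) (use agree in auto)
    ultimately show "fps_nth (q0 + q1 * w + q2 * w\<^sup>2) k = fps_nth 0 k"
      using Q0[of k k] by simp
  qed
qed

lemma (in ring_rel) rel_newton_lim:
  assumes "R u u'" "R r r'" "\<And>k. R (fps_nth q0 k) (fps_nth q0' k)"
    "\<And>k. R (fps_nth q1 k) (fps_nth q1' k)" "\<And>k. R (fps_nth q2 k) (fps_nth q2' k)"
  shows "\<forall>k. R (fps_nth (newton_lim u q0 q1 q2 r) k) (fps_nth (newton_lim u' q0' q1' q2' r') k)"
proof -
  interpret F: ring_rel "\<lambda>f g. \<forall>k. R (fps_nth f k) (fps_nth g k)"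
    by (rule rel_fps)
  have const: "\<forall>k. R (fps_nth (fps_const a) k) (fps_nth (fps_const b) k)" if "R a b" for a b
    using that rel_zero by simp
  have "\<forall>k. R (fps_nth (newton_iter u q0 q1 q2 r N) k) (fps_nth (newton_iter u' q0' q1' q2' r' N) k)" for N
  proof (induction N)
    case 0
    then show ?case
      using const[OF assms(2)] by simp
  next
    case (Suc N)
    show ?case
      unfolding newton_iter.simps Let_def
      by (intro F.rel_diff F.rel_mult F.rel_add F.rel_power Suc const assms allI)
  qed
  then show ?thesis
    by (simp add: newton_lim_def)
qed

type_synonym 'a gpoly = "(nat \<Rightarrow>\<^sub>0 nat) \<Rightarrow>\<^sub>0 'a"

text \<open>Doubling one variable multiplies every monomial by a power of 2. Subtracting a multiple
  of the original identity from the substituted one removes \<open>m0\<close>, while a monomial with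
  another exponent at that variable keeps a nonzero factor in characteristic 0.\<close>

lemma mpoly_identity:
  fixes p :: "('v \<Rightarrow>\<^sub>0 nat) \<Rightarrow>\<^sub>0 'a::field_char_0"
  assumes "\<And>x. ev (\<lambda>c. c) p x = 0"
  shows "p = 0"
proof -
  have zero: "\<forall>m\<in>S. c m = 0"
    if "finite S" "\<And>x. (\<Sum>m\<in>S. c m * monom_val x m) = 0" for S :: "('v \<Rightarrow>\<^sub>0 nat) set" and c :: "_ \<Rightarrow> 'a"
    using that
  proof (induction S arbitrary: c rule: finite_induct)
    case (insert m0 S)
    have S: "c m = 0" if m: "m \<in> S" for m
    proof -
      have "m \<noteq> m0"
        using m insert.hyps by blast
      then obtain i where i: "Poly_Mapping.lookup m i \<noteq> Poly_Mapping.lookup m0 i"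
        by (metis poly_mapping_eqI)
      define x0 where "x0 = (\<lambda>_. 1)(i := (2::'a))"
      have x0: "monom_val x0 m' = 2 ^ Poly_Mapping.lookup m' i" for m'
      proof -
        have "monom_val x0 m' = (\<Prod>k\<in>insert i (Poly_Mapping.keys m'). x0 k ^ Poly_Mapping.lookup m' k)"
          by (rule monom_val_superset) auto
        also have "\<dots> = 2 ^ Poly_Mapping.lookup m' i"
          by (simp add: prod.insert_remove x0_def)
        finally show ?thesis .
      qed
      have mult: "monom_val (\<lambda>k. x0 k * x k) m' = monom_val x0 m' * monom_val x m'" for x m'
        by (simp add: monom_val_def power_mult_distrib prod.distrib)
      have "(\<Sum>m\<in>S. (c m * (monom_val x0 m - monom_val x0 m0)) * monom_val x m) = 0" for x
      proof -
        have "(\<Sum>m\<in>S. (c m * (monom_val x0 m - monom_val x0 m0)) * monom_val x m)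
            = (\<Sum>m\<in>insert m0 S. c m * (monom_val x0 m - monom_val x0 m0) * monom_val x m)"
          using insert.hyps by simp
        also have "\<dots> = (\<Sum>m\<in>insert m0 S. c m * monom_val (\<lambda>k. x0 k * x k) m)
            - monom_val x0 m0 * (\<Sum>m\<in>insert m0 S. c m * monom_val x m)"
          unfolding sum_distrib_left sum_subtractf[symmetric] mult
          by (intro sum.cong refl) (simp add: algebra_simps)
        also have "\<dots> = 0"
          by (simp only: insert.prems mult_zero_right diff_self)
        finally show ?thesis .
      qed
      then have "c m * (monom_val x0 m - monom_val x0 m0) = 0"
        using insert.IH[of "\<lambda>m. c m * (monom_val x0 m - monom_val x0 m0)"] m by blast
      moreover have "monom_val x0 m \<noteq> monom_val x0 m0"
      proof -
        have "(of_nat (2 ^ Poly_Mapping.lookup m i) :: 'a) \<noteq> of_nat (2 ^ Poly_Mapping.lookup m0 i)"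
          unfolding of_nat_eq_iff using i by simp
        then show ?thesis
          by (simp add: x0)
      qed
      ultimately show ?thesis
        by simp
    qed
    moreover have "c m0 = 0"
      using insert.prems[of "\<lambda>_. 1"] insert.hyps S by (simp add: monom_val_def)
    ultimately show ?case
      by blast
  qed simp
  have "\<forall>m\<in>Poly_Mapping.keys p. Poly_Mapping.lookup p m = 0"
    using zero[OF finite_keys assms[unfolded ev_def]] .
  then have "Poly_Mapping.lookup p m = 0" for m
    by (auto simp: in_keys_iff)
  then show ?thesis
    by (simp add: poly_mapping_eqI)
qed

lemma lookup_mconst_mult: "Poly_Mapping.lookup (mconst c * p) m = c * Poly_Mapping.lookup p m"
proof -
  have "mconst c * p = (\<Sum>k\<in>Poly_Mapping.keys p. Poly_Mapping.single k (c * Poly_Mapping.lookup p k))"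
  proof -
    have "mconst c * p = mconst c * (\<Sum>k\<in>Poly_Mapping.keys p. Poly_Mapping.single k (Poly_Mapping.lookup p k))"
      by (intro arg_cong[where f = "\<lambda>p. mconst c * p"] poly_mapping_sum_superset) auto
    then show ?thesis
      by (simp add: mconst_def sum_distrib_left mult_single)
  qed
  then show ?thesis
    by (simp add: lookup_sum lookup_single when_def in_keys_iff)
qed

context place
begin

text \<open>Entries that can be scaled one by one are scaled together by the smallest of their
  scalars, which belongs to the largest entry: its reduction stays nonzero and the others stay
  integral.\<close>

lemma vec_scale:
  fixes \<iota> :: "'c \<Rightarrow> 'a::comm_ring_1" and \<kappa> :: "'k \<Rightarrow> 'b::idom"
  assumes S: "ring_rel S" and \<iota>: "comm_ring_hom \<iota>"
    and const: "\<And>a. a \<in> Ov \<Longrightarrow> S (\<iota> a) (\<kappa> (h a))" and \<kappa>: "\<kappa> 1 = 1"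
    and I: "finite I" "\<exists>i\<in>I. v i \<noteq> 0"
    and sc: "\<And>i. i \<in> I \<Longrightarrow> v i \<noteq> 0 \<Longrightarrow> \<exists>c b. c \<noteq> 0 \<and> b \<noteq> 0 \<and> S (\<iota> c * v i) b"
  shows "\<exists>c b. c \<noteq> 0 \<and> (\<forall>i\<in>I. S (\<iota> c * v i) (b i)) \<and> (\<exists>i\<in>I. b i \<noteq> 0)"
proof -
  interpret S: ring_rel S by fact
  interpret \<iota>: comm_ring_hom \<iota> by fact
  define I' where "I' = {i \<in> I. v i \<noteq> 0}"
  have "\<forall>i\<in>I'. \<exists>c b. c \<noteq> 0 \<and> b \<noteq> 0 \<and> S (\<iota> c * v i) b"
    using sc by (simp add: I'_def)
  then obtain c b where cb: "\<And>i. i \<in> I' \<Longrightarrow> c i \<noteq> 0 \<and> b i \<noteq> 0 \<and> S (\<iota> (c i) * v i) (b i)"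
    by metis
  obtain s where s: "s \<in> I'" "\<And>t. t \<in> I' \<Longrightarrow> c s / c t \<in> Ov"
    using ex_divisor_on_finite[of I' c] I cb by (auto simp: I'_def)
  define b' where "b' i = (if i \<in> I' then \<kappa> (h (c s / c i)) * b i else 0)" for i
  show ?thesis
  proof (intro exI conjI ballI bexI)
    show "c s \<noteq> 0"
      using cb s by blast
    show "S (\<iota> (c s) * v i) (b' i)" if "i \<in> I" for i
    proof (cases "i \<in> I'")
      case True
      have "\<iota> (c s) * v i = \<iota> (c s / c i) * (\<iota> (c i) * v i)"
        using cb[OF True] by (simp flip: \<iota>.hom_mult mult.assoc)
      then show ?thesis
        using S.rel_mult[OF const[OF s(2)[OF True]]] cb[OF True] True by (simp add: b'_def)
    next
      case False
      then show ?thesis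
        using that S.rel_zero by (simp add: I'_def b'_def)
    qed
    show "b' s \<noteq> 0"
      using cb[OF s(1)] s(1) one_O \<kappa> by (simp add: b'_def)
    show "s \<in> I"
      using s(1) by (simp add: I'_def)
  qed
qed

sublocale coeff_rel "\<lambda>a b. a \<in> Ov \<and> b = h a"
  unfolding coeff_rel_def by (rule place_rel)

lemma mpoly_scale:
  assumes "p \<noteq> 0"
  shows "\<exists>c q. c \<noteq> 0 \<and> q \<noteq> 0 \<and> Rm (mconst c * p) q"
proof -
  have ne: "\<exists>m\<in>Poly_Mapping.keys p. Poly_Mapping.lookup p m \<noteq> 0"
  proof -
    obtain m where "m \<in> Poly_Mapping.keys p"
      using assms by (metis keys_eq_empty ex_in_conv)
    then show ?thesis
      by (auto simp: in_keys_iff)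
  qed
  have sc: "\<exists>c b. c \<noteq> 0 \<and> b \<noteq> 0 \<and> c * a \<in> Ov \<and> b = h (c * a)" if "a \<noteq> 0" for a
    using that one_O by (intro exI[of _ "inverse a"] exI[of _ 1]) simp
  have "\<exists>c b. c \<noteq> 0 \<and> (\<forall>m\<in>Poly_Mapping.keys p. c * Poly_Mapping.lookup p m \<in> Ov \<and> b m = h (c * Poly_Mapping.lookup p m))
      \<and> (\<exists>m\<in>Poly_Mapping.keys p. b m \<noteq> 0)"
    by (rule vec_scale[OF place_rel comm_ring_hom_id, where \<kappa> = "\<lambda>x. x"])
      (use ne sc in \<open>simp_all del: split_paired_Ex\<close>)
  then obtain c b where c: "c \<noteq> 0"
    "\<And>m. m \<in> Poly_Mapping.keys p \<Longrightarrow> c * Poly_Mapping.lookup p m \<in> Ov \<and> b m = h (c * Poly_Mapping.lookup p m)"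
    "\<exists>m\<in>Poly_Mapping.keys p. b m \<noteq> 0"
    by blast
  define q where "q = (\<Sum>m\<in>Poly_Mapping.keys p. Poly_Mapping.single m (b m))"
  have q: "Poly_Mapping.lookup q m = (if m \<in> Poly_Mapping.keys p then b m else 0)" for m
    by (simp add: q_def lookup_sum lookup_single when_def)
  have "q \<noteq> 0"
  proof
    assume "q = 0"
    then have "b m = 0" if "m \<in> Poly_Mapping.keys p" for m
      using q[of m] that by simp
    then show False
      using c(3) by blast
  qed
  moreover have "Rm (mconst c * p) q"
    using c(2) zero_O by (auto simp: lookup_mconst_mult q in_keys_iff)
  ultimately show ?thesis
    using c(1) by blast
qed

end

section \<open>Irreducibility of the special conic bundle\<close>

text \<open>The right-hand side has zero derivative in characteristic 2, while \<open>p * q\<close> has odd degree.\<close>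

lemma odd_degree_obstruction:
  fixes p q :: "'a::idom poly"
  assumes char2: "(1::'a) + 1 = 0" and nz: "q \<noteq> 0" "g \<noteq> 0" "a \<noteq> 0" "y \<noteq> 0"
    and eq: "smult g (p\<^sup>2 + p * q) = (smult a ([:1, y:]\<^sup>2) + [:b:]) * q\<^sup>2"
  shows False
proof -
  have two: "(2::'a) = 0" "x + x = 0" for x :: 'a
    using char2 by (simp_all flip: mult_2)
  have two': "r + r = 0" for r :: "'a poly"
    by (rule poly_eqI) (simp only: coeff_add two coeff_0)
  let ?c = "[:a + b, 0, a * y\<^sup>2:]"
  have c: "smult a ([:1, y:]\<^sup>2) + [:b:] = ?c"
    by (simp add: power2_eq_square distrib_left[symmetric] two)
  have "degree ?c = 2" "?c \<noteq> 0"
    using nz by auto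
  then have rhs: "degree (?c * q\<^sup>2) = 2 + 2 * degree q" "?c * q\<^sup>2 \<noteq> 0"
    using nz degree_mult_eq[of ?c "q\<^sup>2"] by (simp_all only: degree_power_eq no_zero_divisors power_not_zero simp_thms)
  have p: "p \<noteq> 0"
  proof
    assume "p = 0"
    then show False
      using eq rhs(2) unfolding c by simp
  qed
  have "degree q < degree p"
  proof (rule ccontr)
    assume "\<not> degree q < degree p"
    then have "degree (p\<^sup>2 + p * q) \<le> 2 * degree q"
      using p nz by (intro degree_add_le) (simp_all add: degree_mult_eq degree_power_eq)
    then have "degree (smult g (p\<^sup>2 + p * q)) \<le> 2 * degree q"
      using nz by simp
    then show False
      using rhs(1) unfolding eq c by simp
  qed
  then have "degree (p\<^sup>2 + p * q) = 2 * degree p"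
    using p nz by (subst degree_add_eq_left) (simp_all add: degree_mult_eq degree_power_eq)
  then have "degree (smult g (p\<^sup>2 + p * q)) = 2 * degree p"
    using nz by simp
  then have deg: "degree p = degree q + 1"
    using rhs(1) unfolding eq c by simp
  have sq: "pderiv (r\<^sup>2) = 0" for r :: "'a poly"
    by (simp add: power2_eq_square pderiv_mult mult.commute two')
  have "pderiv (?c * q\<^sup>2) = 0"
    unfolding pderiv_mult sq by (simp add: pderiv_pCons two)
  then have "smult g (pderiv (p * q)) = 0"
    using arg_cong[OF eq, of pderiv] unfolding c by (simp add: pderiv_smult pderiv_add sq)
  then have "pderiv (p * q) = 0"
    using nz by simp
  then have "coeff (pderiv (p * q)) (2 * degree q) = 0"
    by simp
  moreover have "coeff (p * q) (Suc (2 * degree q)) = coeff p (degree p) * coeff q (degree q)"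
    using coeff_mult_degree_sum[of p q] deg by (simp add: mult_2)
  moreover have "of_nat (Suc (2 * degree q)) = (1::'a)"
    by (simp add: two)
  ultimately have "coeff p (degree p) * coeff q (degree q) = 0"
    by (simp only: coeff_pderiv mult_1)
  then show False
    using p nz by simp
qed

lemma ev_mvar_val:
  assumes "comm_ring_hom \<iota>"
  shows "ev \<iota> (mvar i) v = v i"
proof -
  interpret comm_ring_hom \<iota> by fact
  show ?thesis
    by (simp add: mvar_def)
qed

context conic_params
begin

definition alpha :: "(nat \<Rightarrow> 'a::comm_ring_1) \<Rightarrow> 'a" where
  "alpha x = (\<Sum>j<n. (\<Prod>i\<in>cls j. x i) * x (cyc_suc n j) ^ (2 * rad j))"

definition beta :: "(nat \<Rightarrow> 'a::comm_ring_1) \<Rightarrow> 'a" where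
  "beta x = (\<Sum>j<n. (\<Prod>i\<in>cls j. x i) * x j ^ (2 * rad j))"

lemma special_alpha_beta:
  "special x y0 y1 y2 = alpha x * y0\<^sup>2 + beta x * y1\<^sup>2 + xgam x * (y1 * y2 + y2\<^sup>2)"
  unfolding special_def alpha_def beta_def
  by (simp add: sum_distrib_left sum_distrib_right sum.distrib distrib_left mult_ac add.commute)

lemma alpha_hom: "comm_ring_hom h \<Longrightarrow> h (alpha x) = alpha (\<lambda>i. h (x i))"
proof -
  assume "comm_ring_hom h"
  then interpret comm_ring_hom h .
  show ?thesis
    by (simp add: alpha_def hom_distribs)
qed

lemma beta_hom: "comm_ring_hom h \<Longrightarrow> h (beta x) = beta (\<lambda>i. h (x i))"
proof -
  assume "comm_ring_hom h"
  then interpret comm_ring_hom h .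
  show ?thesis
    by (simp add: beta_def hom_distribs)
qed

lemma xgam_hom: "comm_ring_hom h \<Longrightarrow> h (xgam x) = xgam (\<lambda>i. h (x i))"
proof -
  assume "comm_ring_hom h"
  then interpret comm_ring_hom h .
  show ?thesis
    by (simp add: xgam_def hom_distribs)
qed

text \<open>A point at which exactly one summand of \<open>alpha\<close> survives. The condition
  \<open>x 0 = 1\<close> is there because the generic point has this coordinate fixed.\<close>

lemma ex_alpha_eq_1: "\<exists>x. x 0 = 1 \<and> alpha x = (1::'a::comm_ring_1)"
proof -
  \<comment> \<open>Chosen such that \<open>cls j\<close> and the successor of \<open>j\<close> both
    fit into the initial segment \<open>A\<close> for \<open>j = j0\<close> only.\<close>
  define j0 :: nat where "j0 = (if odd d \<or> n = 3 then 0 else 1)"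
  define A where "A = {..Suc j0}"
  define x where "x i = (if i \<in> A then 1 else 0 :: 'a)" for i
  have j0: "j0 < n"
    using n_ge by (simp add: j0_def)
  have val: "(\<Prod>i\<in>cls j. x i) * x (cyc_suc n j) ^ (2 * rad j) = (if cls j \<union> {cyc_suc n j} \<subseteq> A then 1 else 0)"
    if "j < n" for j
  proof -
    have "(\<Prod>i\<in>cls j. x i) = (if cls j \<subseteq> A then 1 else 0)"
    proof (cases "cls j \<subseteq> A")
      case True
      then have "(\<Prod>i\<in>cls j. x i) = 1"
        by (intro prod.neutral) (auto simp: x_def)
      then show ?thesis
        using True by simp
    next
      case False
      then have "(\<Prod>i\<in>cls j. x i) = 0"
        using finite_cls[of j] by (intro prod_zero) (auto simp: x_def)
      then show ?thesis
        using False by simp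
    qed
    moreover have "x (cyc_suc n j) ^ (2 * rad j) = (if cyc_suc n j \<in> A then 1 else 0)"
      using rad_pos[OF that] by (simp add: x_def power_0_left)
    ultimately show ?thesis
      by simp
  qed
  have "cls j \<union> {cyc_suc n j} \<subseteq> A \<longleftrightarrow> j = j0" if "j < n" for j
    using that n_ge by (auto simp: A_def j0_def cls_def cyc_suc_def cyc_pred_def split: if_splits)
  then have "alpha x = (\<Sum>j<n. if j = j0 then 1 else 0)"
    unfolding alpha_def by (intro sum.cong refl) (simp add: val)
  also have "\<dots> = 1"
    using j0 by simp
  finally show ?thesis
    by (intro exI[of _ x]) (simp add: x_def A_def)
qed

text \<open>The generic point is \<open>x\<^sub>0 = y\<^sub>1 = 1\<close>, \<open>x\<^sub>j = 1 + X\<^sub>j\<close>, \<open>y\<^sub>0 = 1 + X\<^sub>0\<close>, with \<open>y\<^sub>2\<close> a root of a quadratic equation. The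
  shift by 1 makes this equation split at the origin with distinct roots modulo 2, so that Hensel's lemma applies.\<close>

definition xgen :: "nat \<Rightarrow> (nat \<Rightarrow>\<^sub>0 nat) \<Rightarrow>\<^sub>0 'a::comm_ring_1" where
  "xgen i = (if i = 0 then 1 else 1 + mvar i)"

definition ygen :: "(nat \<Rightarrow>\<^sub>0 nat) \<Rightarrow>\<^sub>0 'a::comm_ring_1" where
  "ygen = 1 + mvar 0"

lemma ev_xgen:
  assumes "comm_ring_hom \<iota>"
  shows "ev \<iota> (xgen i) v = (if i = 0 then 1 else 1 + v i)" "ev \<iota> ygen v = 1 + v 0"
proof -
  interpret E: comm_ring_hom "\<lambda>p. ev \<iota> p v"
    by (rule comm_ring_hom.ev_hom[OF assms])
  show "ev \<iota> (xgen i) v = (if i = 0 then 1 else 1 + v i)" "ev \<iota> ygen v = 1 + v 0"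
    by (simp_all add: xgen_def ygen_def E.hom_add ev_mvar_val[OF assms])
qed

lemma alpha_xgen_nonzero: "alpha (xgen :: nat \<Rightarrow> _ \<Rightarrow>\<^sub>0 'a::comm_ring_1) \<noteq> 0"
proof
  assume 0: "alpha (xgen :: nat \<Rightarrow> _ \<Rightarrow>\<^sub>0 'a) = 0"
  obtain x where x: "x 0 = 1" "alpha x = (1::'a)"
    using ex_alpha_eq_1 by blast
  have "ev (\<lambda>c::'a. c) (alpha xgen) (\<lambda>i. x i - 1) = alpha x"
    unfolding alpha_hom[OF comm_ring_hom.ev_hom[OF comm_ring_hom_id]] ev_xgen[OF comm_ring_hom_id]
    using x(1) by (auto simp: if_distrib intro!: arg_cong[where f = alpha])
  then show False
    using x(2) by (simp add: 0)
qed

lemma xgam_xgen_nonzero: "xgam (xgen :: nat \<Rightarrow> _ \<Rightarrow>\<^sub>0 'a::comm_ring_1) \<noteq> 0"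
proof
  assume 0: "xgam (xgen :: nat \<Rightarrow> _ \<Rightarrow>\<^sub>0 'a) = 0"
  have "ev (\<lambda>c::'a. c) (xgam xgen) (\<lambda>i. 0) = 1"
    unfolding xgam_hom[OF comm_ring_hom.ev_hom[OF comm_ring_hom_id]] ev_xgen[OF comm_ring_hom_id]
    unfolding xgam_def by (rule prod.neutral) simp
  then show False
    by (simp add: 0)
qed

lemma mpoly_char2:
  assumes "(1::'k::comm_ring_1) + 1 = 0"
  shows "(1 :: 'k gpoly) + 1 = 0"
proof -
  have "(mconst (1 + 1) :: 'k gpoly) = mconst 1 + mconst 1"
    by (simp add: mconst_def single_add del: one_add_one)
  then show ?thesis
    by (simp add: assms del: one_add_one)
qed

text \<open>If \<open>w\<close> were a quotient of polynomials, clearing denominators in its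
  quadratic equation would give an identity of the form excluded by
  \<open>odd_degree_obstruction\<close>. The degree to consider is the one in X_0, on which only
  \<open>ygen\<close> depends among the coefficients of the equation.\<close>

lemma special_irreducible:
  fixes p q :: "(nat \<Rightarrow>\<^sub>0 nat) \<Rightarrow>\<^sub>0 'k::field"
  assumes char2: "(1::'k) + 1 = 0"
    and w: "special (\<lambda>i. em (xgen i)) (em ygen) 1 w = 0"
    and pq: "em p + em q * w = 0"
  shows "p = 0 \<and> q = 0"
proof -
  interpret em: comm_ring_hom "em :: 'k gpoly \<Rightarrow> _"
    by (rule em_hom)
  have "q = 0"
  proof (rule ccontr)
    assume q: "q \<noteq> 0"
    define \<omega> :: "nat \<Rightarrow> nat" where "\<omega> i = (if i = 0 then 1 else 0)" for i
    interpret G: comm_ring_hom "grade \<omega> :: 'k gpoly \<Rightarrow> _"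
      by (rule grade_hom)
    let ?g = "xgam (xgen :: nat \<Rightarrow> 'k gpoly)" and ?a = "alpha (xgen :: nat \<Rightarrow> 'k gpoly)"
      and ?b = "beta (xgen :: nat \<Rightarrow> 'k gpoly)"
    have w': "em (?a * ygen\<^sup>2 + ?b) + em ?g * (w + w\<^sup>2) = 0"
      using w unfolding special_alpha_beta alpha_hom[OF em_hom, symmetric] beta_hom[OF em_hom, symmetric]
        xgam_hom[OF em_hom, symmetric] by (simp add: em.hom_add em.hom_mult em.hom_power)
    have p: "em p = - (em q * w)"
      using pq by (simp add: eq_neg_iff_add_eq_0)
    have "em (?g * (p\<^sup>2 - p * q) + (?a * ygen\<^sup>2 + ?b) * q\<^sup>2) = (em q)\<^sup>2 * (em (?a * ygen\<^sup>2 + ?b) + em ?g * (w + w\<^sup>2))"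
      unfolding em.hom_add em.hom_mult em.hom_power em.hom_minus p
      by (simp add: power2_eq_square algebra_simps)
    then have "?g * (p\<^sup>2 - p * q) + (?a * ygen\<^sup>2 + ?b) * q\<^sup>2 = 0"
      unfolding w' by (metis em_inj em.hom_zero mult_zero_right)
    then have "grade \<omega> (?g * (p\<^sup>2 - p * q) + (?a * ygen\<^sup>2 + ?b) * q\<^sup>2) = 0"
      by simp
    moreover have x: "grade \<omega> (xgen i :: 'k gpoly) = [:xgen i:]" for i
      by (simp add: xgen_def G.hom_add grade_mvar \<omega>_def one_pCons monom_0)
    moreover have "grade \<omega> ?g = [:?g:]" "grade \<omega> ?a = [:?a:]" "grade \<omega> ?b = [:?b:]"
      unfolding xgam_hom[OF grade_hom] alpha_hom[OF grade_hom] beta_hom[OF grade_hom] x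
        xgam_hom[OF pCons_hom] alpha_hom[OF pCons_hom] beta_hom[OF pCons_hom] by (rule refl)+
    moreover have "grade \<omega> (ygen :: 'k gpoly) = [:1, mvar 0:]"
      by (simp add: ygen_def G.hom_add grade_mvar \<omega>_def one_pCons monom_Suc monom_0)
    ultimately have eq: "smult ?g ((grade \<omega> p)\<^sup>2 - grade \<omega> p * grade \<omega> q)
        + (smult ?a ([:1, mvar 0:]\<^sup>2) + [:?b:]) * (grade \<omega> q)\<^sup>2 = 0"
      by (simp add: G.hom_add G.hom_mult G.hom_power G.hom_minus)
    note char2' = mpoly_char2[OF char2]
    have neg: "r = - r" for r :: "'k gpoly poly"
    proof -
      have "(1 :: 'k gpoly) = - 1"
        using char2' by (simp add: eq_neg_iff_add_eq_0)
      then have "smult 1 r = smult (- 1) r"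
        by argo
      then show ?thesis
        by simp
    qed
    show False
    proof (rule odd_degree_obstruction[OF char2' _ xgam_xgen_nonzero alpha_xgen_nonzero])
      show "grade \<omega> q \<noteq> 0"
        using q poly_grade[of \<omega> q] by auto
      show "(mvar 0 :: 'k gpoly) \<noteq> 0"
        unfolding mvar_def by (metis lookup_single_eq lookup_zero zero_neq_one)
      have "(grade \<omega> p)\<^sup>2 + grade \<omega> p * grade \<omega> q = (grade \<omega> p)\<^sup>2 + - (grade \<omega> p * grade \<omega> q)"
        by (rule arg_cong[OF neg])
      also have "\<dots> = (grade \<omega> p)\<^sup>2 - grade \<omega> p * grade \<omega> q"
        by (rule add_uminus_conv_diff)
      finally have "smult ?g ((grade \<omega> p)\<^sup>2 + grade \<omega> p * grade \<omega> q)
          = smult ?g ((grade \<omega> p)\<^sup>2 - grade \<omega> p * grade \<omega> q)"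
        by (rule arg_cong)
      also have "\<dots> = - ((smult ?a ([:1, mvar 0:]\<^sup>2) + [:?b:]) * (grade \<omega> q)\<^sup>2)"
        unfolding eq_neg_iff_add_eq_0 by (rule eq)
      also have "\<dots> = (smult ?a ([:1, mvar 0:]\<^sup>2) + [:?b:]) * (grade \<omega> q)\<^sup>2"
        by (rule neg[symmetric])
      finally show "smult ?g ((grade \<omega> p)\<^sup>2 + grade \<omega> p * grade \<omega> q)
          = (smult ?a ([:1, mvar 0:]\<^sup>2) + [:?b:]) * (grade \<omega> q)\<^sup>2" .
    qed
  qed
  then have "em p = em 0"
    using pq by simp
  then show ?thesis
    using \<open>q = 0\<close> em_inj by blast
qed

end

section \<open>The generic point of the degenerating conic bundle\<close>

lemma map_poly_hom:
  assumes "comm_ring_hom h"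
  shows "comm_ring_hom (map_poly h)"
proof -
  interpret comm_ring_hom h by fact
  show ?thesis
    by unfold_locales (auto simp: poly_eq_iff coeff_map_poly coeff_mult hom_distribs)
qed

lemma of_int_hom: "comm_ring_hom (of_int :: int \<Rightarrow> 'a::comm_ring_1)"
  by unfold_locales auto

lemma hom_of_int:
  assumes "comm_ring_hom g"
  shows "g (of_int i) = of_int i"
proof -
  interpret comm_ring_hom g by fact
  have "g (of_nat m) = of_nat m" for m
    by (induction m) (simp_all add: hom_add)
  then show ?thesis
    by (cases i) (simp_all add: hom_uminus del: of_nat_Suc)
qed

definition pt :: "(nat \<Rightarrow> 'r) \<Rightarrow> (nat \<Rightarrow> 'r) \<Rightarrow> (unit + unit) \<times> nat \<Rightarrow> 'r" where
  "pt x y = (\<lambda>(b, j). case b of Inl _ \<Rightarrow> x j | Inr _ \<Rightarrow> y j)"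

lemma pt_simps [simp]: "pt x y (Inl u, j) = x j" "pt x y (Inr u, j) = y j"
  by (simp_all add: pt_def)

lemma pt_comp: "(\<lambda>i. g (pt x y i)) = pt (\<lambda>j. g (x j)) (\<lambda>j. g (y j))"
  by (auto simp: pt_def fun_eq_iff split: sum.split)

definition yvec :: "'r \<Rightarrow> 'r \<Rightarrow> nat \<Rightarrow> 'r::one" where
  "yvec y0 y2 j = (if j = 0 then y0 else if j = 1 then 1 else y2)"

lemma yvec_simps [simp]: "yvec y0 y2 0 = y0" "yvec y0 y2 (Suc 0) = 1" "yvec y0 y2 2 = y2"
  by (simp_all add: yvec_def)

text \<open>The leading coefficient \<open>q2\<close> is not invertible among polynomials, so a
  power of it is paid; it is removed later, in power series by the inverse of \<open>q2\<close>, at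
  closed points by assuming \<open>q2\<close> nonzero.\<close>

lemma quadratic_pseudo_division:
  fixes p :: "'a::comm_ring_1 poly"
  shows "\<exists>k q r0 r1. smult (q2 ^ k) p = q * [:q0, q1, q2:] + [:r0, r1:]"
proof (induction p)
  case 0
  show ?case
    by (rule exI[of _ 0], rule exI[of _ 0], rule exI[of _ 0], rule exI[of _ 0]) simp
next
  case (pCons a p)
  then obtain k q r0 r1 where IH: "smult (q2 ^ k) p = q * [:q0, q1, q2:] + [:r0, r1:]"
    by blast
  have "smult (q2 ^ Suc k) (pCons a p) = smult q2 ([:q2 ^ k * a:] + [:0, 1:] * smult (q2 ^ k) p)"
    by (simp add: mult_ac)
  also have "\<dots> = (smult q2 ([:0, 1:] * q) + [:r1:]) * [:q0, q1, q2:] + [:q2 ^ Suc k * a - r1 * q0, q2 * r0 - r1 * q1:]"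
    unfolding IH by (simp add: algebra_simps smult_add_right)
  finally show ?case
    by blast
qed

lemma field_quadratic_root:
  fixes c0 c1 c2 :: complex
  assumes "c2 \<noteq> 0"
  shows "\<exists>r. c0 + c1 * r + c2 * r\<^sup>2 = 0"
proof -
  have "\<not> constant (poly [:c0, c1, c2:])"
    using assms constant_degree[of "[:c0, c1, c2:]"] by simp
  then obtain r where "poly [:c0, c1, c2:] r = 0"
    using fundamental_theorem_of_algebra by blast
  then show ?thesis
    by (intro exI[of _ r]) (simp add: power2_eq_square algebra_simps)
qed

context conic_params
begin

definition special_poly :: "((unit + unit) \<times> nat \<Rightarrow>\<^sub>0 nat) \<Rightarrow>\<^sub>0 int" where
  "special_poly = special (\<lambda>i. mvar (Inl (), i)) (mvar (Inr (), 0)) (mvar (Inr (), 1)) (mvar (Inr (), 2))"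

lemma ev_special_poly:
  "ev of_int special_poly v = special (\<lambda>i. v (Inl (), i)) (v (Inr (), 0)) (v (Inr (), 1)) (v (Inr (), 2))"
  unfolding special_poly_def special_hom[OF comm_ring_hom.ev_hom[OF of_int_hom]] ev_mvar_val[OF of_int_hom] ..

end

locale conic_degeneration = conic_params n d + place Ov h
  for n d :: nat and Ov and h :: "complex \<Rightarrow> 'k::field" +
  fixes f :: "((unit + unit) \<times> nat) mpoly"
  assumes char2: "(1::'k) + 1 = 0"
    and red: "Poly_Mapping.lookup f m \<in> Ov \<and> h (Poly_Mapping.lookup f m) = of_int (Poly_Mapping.lookup special_poly m)"
    and f: "multihom (case_sum (PP (n - 1)) (PP 2)) (case_sum (\<lambda>_. d) (\<lambda>_. 2)) f"
begin

text \<open>Only \<open>y2\<close> remains a variable, so \<open>pgen f\<close> is the quadratic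
  equation of \<open>y2\<close> over the polynomial ring of the other coordinates.\<close>

definition pgen :: "((unit + unit) \<times> nat) mpoly \<Rightarrow> complex gpoly poly" where
  "pgen G = ev (\<lambda>c. [:mconst c:]) G (pt (\<lambda>i. [:xgen i:]) (yvec [:ygen:] [:0, 1:]))"

lemma pconst_hom: "comm_ring_hom (\<lambda>c::'a::comm_ring_1. [:mconst c:])"
  by (rule comm_ring_hom_comp[OF pCons_hom mconst_hom])

definition q0 where "q0 = coeff (pgen f) 0"
definition q1 where "q1 = coeff (pgen f) 1"
definition q2 where "q2 = coeff (pgen f) 2"

lemma degree_pgen_f: "degree (pgen f) \<le> 2"
  unfolding pgen_def ev_def
proof (rule degree_sum_le)
  fix m assume "m \<in> Poly_Mapping.keys f"
  then have m: "m \<in> monomials (case_sum (PP (n - 1)) (PP 2)) (case_sum (\<lambda>_. d) (\<lambda>_. 2))"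
    using f by (auto simp: multihom_def)
  let ?v = "pt (\<lambda>i. [:xgen i:]) (yvec [:ygen:] [:0, 1:]) :: _ \<Rightarrow> complex gpoly poly"
  let ?w = "\<lambda>i::(unit + unit) \<times> nat. case fst i of Inl _ \<Rightarrow> 0 | Inr _ \<Rightarrow> Poly_Mapping.lookup m i"
  have deg: "degree (?v i ^ Poly_Mapping.lookup m i) \<le> ?w i" for i
  proof -
    have "degree (?v i) \<le> (case fst i of Inl _ \<Rightarrow> 0 | Inr _ \<Rightarrow> 1)"
      by (cases i; cases "fst i") (auto simp: yvec_def)
    then have "degree (?v i) * Poly_Mapping.lookup m i \<le> ?w i"
      by (cases "fst i") auto
    then show ?thesis
      using degree_power_le[of "?v i" "Poly_Mapping.lookup m i"] by linarith
  qed
  have keys: "Poly_Mapping.keys m \<subseteq> Sigma UNIV (case_sum (PP (n - 1)) (PP 2))"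
    and two: "(\<Sum>j\<le>2. Poly_Mapping.lookup m (Inr (), j)) = 2"
    using m by (auto simp: monomials_def PP_def dest: spec[of _ "Inr ()"])
  have "degree (monom_val ?v m) \<le> (\<Sum>i\<in>Poly_Mapping.keys m. degree (?v i ^ Poly_Mapping.lookup m i))"
    unfolding monom_val_def by (rule degree_prod_sum_le[unfolded comp_def]) simp
  also have "\<dots> \<le> (\<Sum>i\<in>Poly_Mapping.keys m. ?w i)"
    by (intro sum_mono deg)
  also have "\<dots> \<le> (\<Sum>i\<in>Sigma UNIV (case_sum (PP (n - 1)) (PP 2)). ?w i)"
    using keys by (intro sum_mono2) (auto simp: PP_def split: sum.splits)
  also have "\<dots> = (\<Sum>b\<in>UNIV. \<Sum>j\<in>case_sum (PP (n - 1)) (PP 2) b. ?w (b, j))"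
    by (subst sum.Sigma) (auto simp: PP_def split: sum.splits intro!: sum.cong)
  also have "\<dots> = 2"
    using two by (simp add: UNIV_Plus_UNIV[symmetric] Plus_def UNIV_unit PP_def)
  finally show "degree ([:mconst (Poly_Mapping.lookup f m):] * monom_val ?v m) \<le> 2"
    using degree_mult_le[of "[:mconst (Poly_Mapping.lookup f m):]" "monom_val ?v m"] by simp
qed simp

lemma pgen_f: "pgen f = [:q0, q1, q2:]"
proof (rule poly_eqI)
  fix i :: nat
  show "coeff (pgen f) i = coeff [:q0, q1, q2:] i"
  proof (cases "i \<le> 2")
    case True
    then have "i = 0 \<or> i = 1 \<or> i = 2"
      by auto
    then show ?thesis
      by (auto simp: q0_def q1_def q2_def numeral_2_eq_2)
  next
    case False
    then have "coeff (pgen f) i = 0"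
      using degree_pgen_f by (intro coeff_eq_0) simp
    moreover obtain l where "i = Suc (Suc (Suc l))"
      using False by (metis not_less_eq_eq numeral_2_eq_2 old.nat.exhaust le0)
    ultimately show ?thesis
      by simp
  qed
qed

abbreviation (input) gk :: "'k gpoly" where "gk \<equiv> xgam xgen"
abbreviation (input) rk :: "'k gpoly" where "rk \<equiv> alpha xgen * ygen\<^sup>2 + beta xgen"

interpretation M: ring_rel "Rm :: complex gpoly \<Rightarrow> 'k gpoly \<Rightarrow> bool"
  by (rule rel_Rm)

lemma Rm_gen: "Rm (xgen i) (xgen i)" "Rm ygen ygen"
proof -
  show "Rm (xgen i) (xgen i)"
    unfolding xgen_def
    by (cases "i = 0"; simp only: if_True if_False simp_thms; intro M.rel_add[OF M.rel_one Rm_mvar] M.rel_one)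
  show "Rm ygen ygen"
    unfolding ygen_def by (rule M.rel_add[OF M.rel_one Rm_mvar])
qed

lemma Rm_q: "Rm q0 rk" "Rm q1 gk" "Rm q2 gk"
proof -
  interpret P: ring_rel "\<lambda>p q. \<forall>i. Rm (coeff (p :: complex gpoly poly) i)
      (coeff (q :: 'k gpoly poly) i)"
    by (rule M.rel_poly)
  let ?v = "pt (\<lambda>i. [:xgen i:]) (yvec [:ygen:] [:0, 1:]) :: _ \<Rightarrow> 'k gpoly poly"
  have const: "\<forall>i. Rm (coeff [:a:] i) (coeff [:b:] i)" if "Rm a b"
    for a :: "complex gpoly" and b :: "'k gpoly"
    using that M.rel_zero by (auto simp: coeff_pCons split: nat.split)
  have "\<forall>i. Rm (coeff (pgen f) i) (coeff (ev of_int special_poly ?v) i)"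
    unfolding pgen_def
  proof (rule P.rel_ev)
    show "\<forall>i. Rm (coeff [:mconst (Poly_Mapping.lookup f m):] i)
        (coeff (of_int (Poly_Mapping.lookup special_poly m) :: 'k gpoly poly) i)" for m
    proof -
      have eq: "of_int (Poly_Mapping.lookup special_poly m) = [:mconst (of_int (Poly_Mapping.lookup special_poly m) :: 'k) :: 'k gpoly:]"
        by (rule hom_of_int[OF pconst_hom, symmetric])
      have "Rm (mconst (Poly_Mapping.lookup f m) :: complex gpoly) (mconst (of_int (Poly_Mapping.lookup special_poly m) :: 'k) :: 'k gpoly)"
        by (rule Rm_mconst) (simp add: red)
      then show ?thesis
        unfolding eq by (rule const)
    qed
    show "\<forall>j. Rm (coeff (pt (\<lambda>i. [:xgen i:]) (yvec [:ygen:] [:0, 1:]) i) j) (coeff (?v i) j)" for i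
    proof -
      obtain b j where i: "i = (b, j)"
        by (cases i)
      have "\<forall>j. Rm (coeff [:0, 1 :: complex gpoly:] j) (coeff [:0, 1 :: 'k gpoly:] j)"
        using M.rel_zero M.rel_one by (auto simp: coeff_pCons split: nat.split)
      note X = this
      show ?thesis
      proof (cases b)
        case (Inl u)
        then show ?thesis
          unfolding i pt_simps Inl by (intro const Rm_gen)
      next
        case (Inr u)
        consider "j = 0" | "j = 1" | "j \<noteq> 0" "j \<noteq> 1"
          by blast
        then show ?thesis
        proof cases
          case 1
          show ?thesis
            unfolding i pt_simps Inr yvec_def 1 if_True simp_thms by (intro const Rm_gen)
        next
          case 2
          show ?thesis
            unfolding i pt_simps Inr 2 One_nat_def yvec_simps by (rule P.rel_one)
        next
          case 3
          show ?thesis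
            unfolding i pt_simps Inr yvec_def if_not_P[OF 3(1)] if_not_P[OF 3(2)] by (rule X)
        qed
      qed
    qed
  qed simp_all
  moreover have "ev of_int special_poly ?v = [:rk, gk, gk:]"
    unfolding ev_special_poly pt_simps yvec_simps special_alpha_beta
      alpha_hom[OF pCons_hom, symmetric] beta_hom[OF pCons_hom, symmetric] xgam_hom[OF pCons_hom, symmetric]
    by (simp add: power2_eq_square numeral_2_eq_2 yvec_def)
  ultimately have "\<forall>i. Rm (coeff [:q0, q1, q2:] i) (coeff [:rk, gk, gk:] i)"
    unfolding pgen_f by simp
  from this[rule_format, of 0] this[rule_format, of 1] this[rule_format, of 2]
  show "Rm q0 rk" "Rm q1 gk" "Rm q2 gk"
    by (simp_all add: numeral_2_eq_2)
qed

definition c0 where "c0 = ev (\<lambda>c. c) q0 (\<lambda>_. 0)"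
definition c1 where "c1 = ev (\<lambda>c. c) q1 (\<lambda>_. 0)"
definition c2 where "c2 = ev (\<lambda>c. c) q2 (\<lambda>_. 0)"

text \<open>At the origin all remaining coordinates are 1. There \<open>alpha\<close> and
  \<open>beta\<close> both count \<open>n\<close> summands and cancel in characteristic 2, while
  \<open>xgam\<close> is 1: the quadratic reduces to r + r^2, with distinct roots.\<close>

lemma c_red: "c0 \<in> Ov" "h c0 = 0" "c1 \<in> Ov" "h c1 = 1" "c2 \<in> Ov" "h c2 = 1"
proof -
  have ev: "ev (\<lambda>c. c) p (\<lambda>_. 0) \<in> Ov \<and> ev (\<lambda>c. c) q (\<lambda>_. 0) = h (ev (\<lambda>c. c) p (\<lambda>_. 0))"
    if "Rm p q" for p :: "complex gpoly" and q
    by (rule ring_rel.rel_ev[OF place_rel]) (use that zero_O in auto)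
  interpret E: comm_ring_hom "\<lambda>p. ev (\<lambda>c::'k. c) p (\<lambda>_::nat. 0)"
    by (rule comm_ring_hom.ev_hom[OF comm_ring_hom_id])
  have g: "ev (\<lambda>c::'k. c) gk (\<lambda>_. 0) = 1"
    unfolding xgam_hom[OF E.comm_ring_hom_axioms] ev_xgen[OF comm_ring_hom_id]
    unfolding xgam_def by (rule prod.neutral) simp
  have a: "ev (\<lambda>c::'k. c) (alpha xgen) (\<lambda>_. 0) = of_nat n" "ev (\<lambda>c::'k. c) (beta xgen) (\<lambda>_. 0) = of_nat n"
    unfolding alpha_hom[OF E.comm_ring_hom_axioms] beta_hom[OF E.comm_ring_hom_axioms] ev_xgen[OF comm_ring_hom_id]
    by (simp_all add: alpha_def beta_def cong: if_cong)
  have nn: "of_nat n + of_nat n = (0 :: 'k)"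
  proof -
    have "of_nat n + of_nat n = of_nat n * (1 + 1 :: 'k)"
      by (simp only: distrib_left mult_1_right)
    then show ?thesis
      unfolding char2 by simp
  qed
  then have "ev (\<lambda>c::'k. c) rk (\<lambda>_. 0) = 0"
    using nn
    by (simp only: E.hom_add E.hom_mult E.hom_power a ev_xgen[OF comm_ring_hom_id] add_0_right power_one mult_1_right)
  then show "c0 \<in> Ov" "h c0 = 0" "c1 \<in> Ov" "h c1 = 1" "c2 \<in> Ov" "h c2 = 1"
    using ev[OF Rm_q(1)] ev[OF Rm_q(2)] ev[OF Rm_q(3)] g by (auto simp: c0_def c1_def c2_def)
qed

lemma c2_nonzero: "c2 \<noteq> 0"
  using c_red zero_O by auto

definition r0 where "r0 = (SOME r. c0 + c1 * r + c2 * r\<^sup>2 = 0)"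

lemma r0: "c0 + c1 * r0 + c2 * r0\<^sup>2 = 0"
  unfolding r0_def using someI_ex[OF field_quadratic_root[OF c2_nonzero]] .

text \<open>Any complex root will do: a root outside \<open>Ov\<close>, divided out twice, would
  give \<open>c2\<close> the residue 0, whereas its residue is 1.\<close>

lemma r0_O: "r0 \<in> Ov" "h r0 + (h r0)\<^sup>2 = 0"
proof -
  show O: "r0 \<in> Ov"
  proof (rule ccontr)
    assume no: "r0 \<notin> Ov"
    then have i: "inverse r0 \<in> Ov" "h (inverse r0) = 0" and "r0 \<noteq> 0"
      using valuation_ring zero_O by auto
    then have "c2 = - (c1 * inverse r0 + c0 * (inverse r0 * inverse r0))"
      using r0 by (simp add: field_simps power2_eq_square) (metis add.commute add.inverse_inverse minus_add_cancel add_eq_0_iff)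
    moreover have "h (- (c1 * inverse r0 + c0 * (inverse r0 * inverse r0))) = 0"
    proof -
      have 1: "c1 * inverse r0 \<in> Ov" "h (c1 * inverse r0) = 0"
        using mult_O[OF c_red(3) i(1)] i(2) by simp_all
      have 2: "c0 * (inverse r0 * inverse r0) \<in> Ov" "h (c0 * (inverse r0 * inverse r0)) = 0"
        using mult_O[OF c_red(1) mult_O[THEN conjunct1, OF i(1) i(1)]] c_red(2) by simp_all
      show ?thesis
        using uminus_O[OF add_O[THEN conjunct1, OF 1(1) 2(1)]] add_O[OF 1(1) 2(1)] 1 2 by simp
    qed
    ultimately show False
      using c_red by simp
  qed
  have "h (c0 + c1 * r0 + c2 * r0\<^sup>2) = h r0 + (h r0)\<^sup>2"
    using O c_red mult_O add_O power_O by simp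
  then show "h r0 + (h r0)\<^sup>2 = 0"
    using r0 zero_O by simp
qed

definition u0 where "u0 = inverse (c1 + 2 * c2 * r0)"

text \<open>The derivative of the quadratic has residue 1 whichever root was chosen, because 2 has
  residue 0.\<close>

lemma u0: "u0 * (c1 + 2 * c2 * r0) = 1" "u0 \<in> Ov" "h u0 = 1"
proof -
  have eq: "c1 + 2 * c2 * r0 = c1 + (c2 * r0 + c2 * r0)"
    by simp
  have m: "c2 * r0 \<in> Ov" "h (c2 * r0) = h r0"
    using mult_O[OF c_red(5) r0_O(1)] c_red(6) by simp_all
  have *: "c1 + 2 * c2 * r0 \<in> Ov" "h (c1 + 2 * c2 * r0) = 1 + (h r0 + h r0)"
    unfolding eq using add_O[OF c_red(3) add_O[THEN conjunct1, OF m(1) m(1)]] add_O[OF m(1) m(1)] m c_red(4)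
    by (simp_all only:)
  moreover have "h r0 + h r0 = 0"
    using char2 by (metis distrib_right mult_1 mult_zero_left)
  ultimately have **: "h (c1 + 2 * c2 * r0) = 1"
    by simp
  then have nz: "c1 + 2 * c2 * r0 \<noteq> 0"
    using zero_O by auto
  then show 1: "u0 * (c1 + 2 * c2 * r0) = 1"
    by (simp add: u0_def)
  show 2: "u0 \<in> Ov"
    unfolding u0_def using * ** by (intro unit_O) auto
  show "h u0 = 1"
    using mult_O[OF 2 *(1)] 1 ** one_O by simp
qed

definition w where "w = newton_lim (mconst u0) (em q0) (em q1) (em q2) (mconst r0)"
definition wk where "wk = newton_lim 1 (em rk) (em gk) (em gk) (mconst (h r0))"
text \<open>The inverse series of \<open>em q2\<close>, as a root of a quadratic with leading
  coefficient 0; in this form its reduction is obtained in the same way as that of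
  \<open>w\<close>.\<close>

definition z where "z = newton_lim (mconst (inverse c2)) (- 1) (em q2) 0 (mconst (inverse c2))"
definition zk where "zk = newton_lim 1 (- 1) (em gk) 0 1"

lemma inverse_c2: "inverse c2 \<in> Ov" "h (inverse c2) = 1"
proof -
  show 1: "inverse c2 \<in> Ov"
    using c_red by (intro unit_O) auto
  show "h (inverse c2) = 1"
    using mult_O[OF 1 c_red(5)] c_red c2_nonzero one_O by simp
qed

lemma w_root: "em q0 + em q1 * w + em q2 * w\<^sup>2 = 0"
proof -
  interpret mc: comm_ring_hom mconst
    by (rule mconst_hom)
  show ?thesis
    unfolding w_def
  proof (rule newton_lim_root)
    show "fps_nth (em q0) 0 + fps_nth (em q1) 0 * mconst r0 + fps_nth (em q2) 0 * (mconst r0)\<^sup>2 = 0"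
      using arg_cong[OF r0, of mconst]
      by (simp add: em_nth_0 c0_def c1_def c2_def mc.hom_add mc.hom_mult mc.hom_power)
    have "fps_nth (em q1) 0 + 2 * fps_nth (em q2) 0 * mconst r0
        = fps_nth (em q1) 0 + (fps_nth (em q2) 0 * mconst r0 + fps_nth (em q2) 0 * mconst r0)"
      by (simp only: mult_2 distrib_right)
    also have "\<dots> = mconst (c1 + (c2 * r0 + c2 * r0))"
      by (simp only: em_nth_0 c1_def c2_def mc.hom_add mc.hom_mult)
    also have "\<dots> = mconst (c1 + 2 * c2 * r0)"
      by (simp only: mult_2 distrib_right)
    finally show "mconst u0 * (fps_nth (em q1) 0 + 2 * fps_nth (em q2) 0 * mconst r0) = 1"
      using u0(1) by (simp flip: mc.hom_mult)
  qed
qed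

lemma z_inverse: "em q2 * z = 1"
proof -
  interpret mc: comm_ring_hom mconst
    by (rule mconst_hom)
  have "- 1 + em q2 * z + 0 * z\<^sup>2 = 0"
    unfolding z_def using c2_nonzero
    by (intro newton_lim_root) (simp_all add: em_nth_0 flip: c2_def mc.hom_mult)
  then show ?thesis
    by simp
qed

lemma gk_0: "fps_nth (em gk) 0 = 1" "fps_nth (em rk) 0 = 0"
proof -
  interpret S: ring_rel Rs
    by (rule rel_Rs)
  have "\<forall>m. (Poly_Mapping.lookup (mconst c2) m \<in> Ov \<and> Poly_Mapping.lookup (fps_nth (em gk) 0) m = h (Poly_Mapping.lookup (mconst c2) m))"
    using Rs_em[OF Rm_q(3)] by (metis c2_def em_nth_0)
  moreover have "\<forall>m. (Poly_Mapping.lookup (mconst c0) m \<in> Ov \<and> Poly_Mapping.lookup (fps_nth (em rk) 0) m = h (Poly_Mapping.lookup (mconst c0) m))"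
    using Rs_em[OF Rm_q(1)] by (metis c0_def em_nth_0)
  ultimately show "fps_nth (em gk) 0 = 1" "fps_nth (em rk) 0 = 0"
    using c_red zero_O by (auto intro!: poly_mapping_eqI simp: mconst_def lookup_single lookup_one when_def)
qed

lemma wk_root: "special (\<lambda>i. em (xgen i)) (em ygen) 1 wk = 0"
proof -
  interpret mc: comm_ring_hom "mconst :: 'k \<Rightarrow> 'k gpoly"
    by (rule mconst_hom)
  interpret em: comm_ring_hom "em :: 'k gpoly \<Rightarrow> _"
    by (rule em_hom)
  have two: "(2 :: 'k gpoly) = 0"
    using mpoly_char2[OF char2] by simp
  have "em rk + em gk * wk + em gk * wk\<^sup>2 = 0"
    unfolding wk_def
  proof (rule newton_lim_root)
    show "fps_nth (em rk) 0 + fps_nth (em gk) 0 * mconst (h r0) + fps_nth (em gk) 0 * (mconst (h r0))\<^sup>2 = 0"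
      using arg_cong[OF r0_O(2), of "mconst :: 'k \<Rightarrow> 'k gpoly"]
      by (simp add: gk_0 mc.hom_add mc.hom_power)
    show "1 * (fps_nth (em gk) 0 + 2 * fps_nth (em gk) 0 * mconst (h r0)) = 1"
      by (simp add: gk_0 two)
  qed
  then show ?thesis
    unfolding special_alpha_beta alpha_hom[OF em_hom, symmetric] beta_hom[OF em_hom, symmetric]
        xgam_hom[OF em_hom, symmetric] by (simp add: em.hom_add em.hom_mult em.hom_power algebra_simps)
qed

lemma zk_inverse: "em gk * zk = 1"
proof -
  have "- 1 + em gk * zk + 0 * zk\<^sup>2 = 0"
    unfolding zk_def by (intro newton_lim_root) (simp_all add: gk_0)
  then show ?thesis
    by simp
qed

lemma Rs_w: "Rs w wk" and Rs_z: "Rs z zk"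
proof -
  have one: "Rm (mconst a) 1" if "a \<in> Ov" "h a = 1" for a
    using Rm_mconst[of a 1] that by simp
  show "Rs w wk"
    unfolding w_def wk_def
    using one[OF u0(2,3)] Rm_mconst[of r0 "h r0"] r0_O(1) Rs_em[OF Rm_q(1)] Rs_em[OF Rm_q(2)] Rs_em[OF Rm_q(3)]
    by (intro M.rel_newton_lim) auto
  interpret S: ring_rel Rs
    by (rule rel_Rs)
  show "Rs z zk"
    unfolding z_def zk_def
    using one[OF inverse_c2] S.rel_uminus[OF S.rel_one] Rs_em[OF Rm_q(3)] S.rel_zero
    by (intro M.rel_newton_lim) blast+
qed

end

lemma pcompose_hom: "comm_ring_hom (\<lambda>p::'a::comm_ring_1 poly. pcompose p q)"
  by unfold_locales (auto simp: pcompose_add pcompose_mult pcompose_1)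

lemma fps_const_hom: "comm_ring_hom (fps_const :: 'a::comm_ring_1 \<Rightarrow> 'a fps)"
  by unfold_locales auto

lemma ev_cong:
  assumes "\<And>i m. m \<in> Poly_Mapping.keys p \<Longrightarrow> i \<in> Poly_Mapping.keys m \<Longrightarrow> v i = v' i"
  shows "ev \<iota> p v = ev \<iota> p v'"
  unfolding ev_def monom_val_def using assms by (intro sum.cong arg_cong2[of _ _ _ _ "(*)"] prod.cong) auto

lemma monom_val_scale:
  fixes m :: "('b::finite \<times> 'j) \<Rightarrow>\<^sub>0 nat" and v :: "'b \<times> 'j \<Rightarrow> 'r::comm_ring_1"
  assumes m: "m \<in> monomials J \<delta>" and J: "\<And>b. finite (J b)"
  shows "monom_val (\<lambda>i. c (fst i) * v i) m = (\<Prod>b\<in>UNIV. c b ^ \<delta> b) * monom_val v m"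
proof -
  let ?S = "Sigma UNIV J"
  have S: "finite ?S" "Poly_Mapping.keys m \<subseteq> ?S"
    using J m by (auto simp: monomials_def)
  have "(\<Prod>i\<in>?S. c (fst i) ^ Poly_Mapping.lookup m i) = (\<Prod>b\<in>UNIV. \<Prod>j\<in>J b. c b ^ Poly_Mapping.lookup m (b, j))"
    by (subst prod.Sigma) (use J in \<open>auto intro!: prod.cong\<close>)
  also have "\<dots> = (\<Prod>b\<in>UNIV. c b ^ \<delta> b)"
    using m by (simp add: monomials_def flip: power_sum)
  finally show ?thesis
    unfolding monom_val_superset[OF S] by (simp add: power_mult_distrib prod.distrib)
qed

lemma ev_scale:
  fixes v :: "'b::finite \<times> 'j \<Rightarrow> 'r::comm_ring_1"
  assumes p: "Poly_Mapping.keys p \<subseteq> monomials J \<delta>" and J: "\<And>b. finite (J b)"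
  shows "ev \<iota> p (\<lambda>i. c (fst i) * v i) = (\<Prod>b\<in>UNIV. c b ^ \<delta> b) * ev \<iota> p v"
proof -
  have "ev \<iota> p (\<lambda>i. c (fst i) * v i)
      = (\<Sum>m\<in>Poly_Mapping.keys p. \<iota> (Poly_Mapping.lookup p m) * ((\<Prod>b\<in>UNIV. c b ^ \<delta> b) * monom_val v m))"
    unfolding ev_def by (intro sum.cong refl) (simp add: monom_val_scale[OF subsetD[OF p] J])
  then show ?thesis
    by (simp add: ev_def sum_distrib_left mult_ac)
qed

context conic_params
begin

lemma special_cong:
  assumes "\<And>i. i < n \<Longrightarrow> x i = x' i"
  shows "special x y0 y1 y2 = special x' y0 y1 y2"
proof -
  have "(\<Prod>i\<in>cls j. x i) = (\<Prod>i\<in>cls j. x' i)" if "j < n" for j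
    using cls_sub[OF that] assms by (intro prod.cong) auto
  moreover have "xgam x = xgam x'"
    unfolding xgam_def using assms by (intro prod.cong) auto
  ultimately show ?thesis
    unfolding special_def using assms cyc_suc_less
    by (intro arg_cong2[of _ _ _ _ "(+)"] sum.cong) auto
qed

end

lemma em_0: "em 0 = 0"
proof -
  interpret comm_ring_hom em
    by (rule em_hom)
  show ?thesis
    by (rule hom_zero)
qed

context conic_degeneration
begin

text \<open>Evaluation at the generic point. Power series contain the root \<open>w\<close>, and
  they stand in for the function field of the hypersurface.\<close>

definition gev :: "((unit + unit) \<times> nat) mpoly \<Rightarrow> complex gpoly fps" where
  "gev G = ev (\<lambda>c. fps_const (mconst c)) G (pt (\<lambda>i. em (xgen i)) (yvec (em ygen) w))"

lemma fconst_hom: "comm_ring_hom (\<lambda>c::'a::comm_ring_1. fps_const (mconst c))"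
  by (rule comm_ring_hom_comp[OF fps_const_hom mconst_hom])

lemma gev_hom: "comm_ring_hom gev"
  unfolding gev_def by (rule comm_ring_hom.ev_hom[OF fconst_hom])

lemma subst_hom:
  assumes "comm_ring_hom g"
  shows "comm_ring_hom (\<lambda>p. poly (map_poly g p) a)"
  by (rule comm_ring_hom_comp[OF poly_hom map_poly_hom[OF assms]])

lemma map_poly_simps:
  assumes "comm_ring_hom g"
  shows "map_poly g [:a:] = [:g a:]" "map_poly g [:0, 1:] = [:0, 1:]" "map_poly g 1 = 1"
    "map_poly g [:a, b:] = [:g a, g b:]" "map_poly g [:a, b, c:] = [:g a, g b, g c:]"
proof -
  interpret comm_ring_hom g by fact
  show "map_poly g [:a:] = [:g a:]" "map_poly g [:0, 1:] = [:0, 1:]" "map_poly g 1 = 1"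
    "map_poly g [:a, b:] = [:g a, g b:]" "map_poly g [:a, b, c:] = [:g a, g b, g c:]"
    by (auto simp: poly_eq_iff coeff_map_poly coeff_pCons coeff_1 split: nat.splits)
qed

lemma pgen_subst:
  assumes g: "comm_ring_hom g"
  shows "poly (map_poly g (pgen G)) y = ev (\<lambda>c. g (mconst c)) G (pt (\<lambda>i. g (xgen i)) (yvec (g ygen) y))"
proof -
  have "(\<lambda>i. poly (map_poly g (pt (\<lambda>i. [:xgen i:]) (yvec [:ygen:] [:0, 1:]) i)) y)
      = pt (\<lambda>i. g (xgen i)) (yvec (g ygen) y)"
  proof
    fix i :: "(unit + unit) \<times> nat"
    obtain b j where i: "i = (b, j)"
      by (cases i)
    show "poly (map_poly g (pt (\<lambda>i. [:xgen i:]) (yvec [:ygen:] [:0, 1:]) i)) y = pt (\<lambda>i. g (xgen i)) (yvec (g ygen) y) i"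
      unfolding i by (cases b) (auto simp: yvec_def map_poly_simps(1-3)[OF g])
  qed
  then show ?thesis
    unfolding pgen_def comm_ring_hom.ev_commute[OF subst_hom[OF g]] by (simp add: map_poly_simps[OF g])
qed

lemma gev_eq: "gev G = poly (map_poly em (pgen G)) w"
  unfolding pgen_subst[OF em_hom] gev_def em_mconst ..

lemma gev_f: "gev f = 0"
  unfolding gev_eq pgen_f map_poly_simps[OF em_hom]
  using w_root by (simp add: power2_eq_square algebra_simps)

lemma Rs_0: "Rs 0 b \<Longrightarrow> b = 0"
  using zero_O by (auto intro!: fps_ext poly_mapping_eqI)

interpretation S: ring_rel "Rs :: complex gpoly fps \<Rightarrow> 'k gpoly fps \<Rightarrow> bool"
  by (rule rel_Rs)

text \<open>The pair \<open>a\<close>, \<open>b\<close> is scaled to have a nonzero reduction, and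
  by \<open>special_irreducible\<close> the reduced linear expression in \<open>wk\<close> does not
  vanish.\<close>

lemma ex_reduction:
  assumes "a \<noteq> 0 \<or> b \<noteq> 0"
  shows "\<exists>c B. c \<noteq> 0 \<and> B \<noteq> 0 \<and> Rs (fps_const (mconst c) * (em a + em b * w)) B"
proof -
  interpret em: comm_ring_hom "em :: complex gpoly \<Rightarrow> _"
    by (rule em_hom)
  let ?v = "\<lambda>i::bool. if i then a else b"
  have "\<exists>c B. c \<noteq> 0 \<and> (\<forall>i\<in>UNIV. Rm (mconst c * ?v i) (B i)) \<and> (\<exists>i\<in>UNIV. B i \<noteq> 0)"
  proof (rule vec_scale[OF rel_Rm mconst_hom, where \<kappa> = mconst])
    show "Rm (mconst x) (mconst (h x))" if "x \<in> Ov" for x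
      by (rule Rm_mconst) (use that in simp)
    show "\<exists>i\<in>UNIV. ?v i \<noteq> 0"
      using assms by (auto intro: bexI[of _ True] bexI[of _ False])
    show "\<exists>c B. c \<noteq> 0 \<and> B \<noteq> 0 \<and> Rm (mconst c * ?v i) B" if "?v i \<noteq> 0" for i
      using mpoly_scale[OF that] .
  qed simp_all
  then obtain c B where c: "c \<noteq> 0" "\<And>i. Rm (mconst c * ?v i) (B i)" "\<exists>i. B i \<noteq> 0"
    by blast
  have "em (B True) + em (B False) * wk \<noteq> 0"
  proof
    assume "em (B True) + em (B False) * wk = 0"
    then have "B True = 0 \<and> B False = 0"
      by (rule special_irreducible[OF char2 wk_root])
    then show False
      using c(3) by (metis (full_types))
  qed
  moreover have r: "Rs (em (mconst c * ?v True) + em (mconst c * ?v False) * w) (em (B True) + em (B False) * wk)"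
    by (intro S.rel_add S.rel_mult Rs_em c Rs_w)
  moreover have e: "em (mconst c * ?v True) + em (mconst c * ?v False) * w = fps_const (mconst c) * (em a + em b * w)"
    by (simp add: em.hom_mult em_mconst algebra_simps)
  ultimately show ?thesis
    using c(1) r[unfolded e] by (intro exI[of _ c] exI[of _ "em (B True) + em (B False) * wk"] conjI)
qed

text \<open>Irreducibility is inherited from the special fibre: an expression that is zero cannot
  have a nonzero reduction.\<close>

lemma generic_irreducible:
  assumes "em a + em b * w = 0"
  shows "a = 0 \<and> b = 0"
proof (rule ccontr)
  assume "\<not> ?thesis"
  then obtain c B where "B \<noteq> 0" "Rs (fps_const (mconst c) * (em a + em b * w)) B"
    using ex_reduction[of a b] by blast
  then show False
    using Rs_0[of B] unfolding assms by simp
qed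

lemma gev_reduce:
  obtains k q a b where "smult (q2 ^ k) (pgen G) = q * pgen f + [:a, b:]" "em q2 ^ k * gev G = em a + em b * w"
proof -
  interpret em: comm_ring_hom "em :: complex gpoly \<Rightarrow> _"
    by (rule em_hom)
  interpret E: comm_ring_hom "\<lambda>p. poly (map_poly em p) w"
    by (rule subst_hom[OF em_hom])
  obtain k q a b where 1: "smult (q2 ^ k) (pgen G) = q * pgen f + [:a, b:]"
    using quadratic_pseudo_division[of q2 "pgen G" q0 q1] unfolding pgen_f by blast
  have "poly (map_poly em ([:q2 ^ k:] * pgen G)) w = poly (map_poly em q) w * gev f + poly (map_poly em [:a, b:]) w"
    using arg_cong[OF 1, of "\<lambda>p. poly (map_poly em p) w"] by (simp add: E.hom_add E.hom_mult gev_eq)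
  then have 2: "em q2 ^ k * gev G = em a + em b * w"
    unfolding E.hom_mult gev_f by (simp add: map_poly_simps[OF em_hom] em.hom_power gev_eq mult.commute)
  show thesis
    using that[OF 1 2] .
qed

text \<open>Complex constants suffice to give every nonzero value at the generic point a nonzero
  reduction. Pseudo-division leads back to a linear expression in \<open>w\<close>, and the power of
  \<open>em q2\<close> is a unit whose reduction is a unit as well.\<close>

lemma gev_scale:
  assumes "gev G \<noteq> 0"
  shows "\<exists>c B. c \<noteq> 0 \<and> B \<noteq> 0 \<and> Rs (fps_const (mconst c) * gev G) B"
proof -
  obtain k q a b where 2: "em q2 ^ k * gev G = em a + em b * w"
    using gev_reduce[of G] by metis
  have eq: "gev G = z ^ k * (em a + em b * w)"
  proof -
    have "z ^ k * (em q2 ^ k * gev G) = (em q2 * z) ^ k * gev G"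
      by (simp add: power_mult_distrib mult_ac)
    then show ?thesis
      by (simp add: z_inverse 2)
  qed
  have "a \<noteq> 0 \<or> b \<noteq> 0"
  proof (rule ccontr)
    assume "\<not> ?thesis"
    then have "gev G = 0"
      unfolding eq by (simp add: em_0)
    then show False
      using assms by contradiction
  qed
  from ex_reduction[OF this]
  obtain c B where c: "c \<noteq> 0" "B \<noteq> 0" "Rs (fps_const (mconst c) * (em a + em b * w)) B"
    by (elim exE conjE) (rule that)
  have "zk ^ k * B \<noteq> 0"
    using zk_inverse c(2) by auto
  moreover have r: "Rs (z ^ k * (fps_const (mconst c) * (em a + em b * w))) (zk ^ k * B)"
    by (intro S.rel_mult S.rel_power Rs_z c)
  moreover have e: "z ^ k * (fps_const (mconst c) * (em a + em b * w)) = fps_const (mconst c) * gev G"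
    unfolding eq by (simp only: mult_ac)
  ultimately show ?thesis
    using c(1) r[unfolded e] by (intro exI[of _ c] exI[of _ "zk ^ k * B"] conjI)
qed

text \<open>Closed points of the chart in which the coordinates \<open>x\<close> at 0 and
  \<open>y\<close> at 1 are both 1, with the same shift by 1 as at the generic point.\<close>

definition cpt :: "(nat \<Rightarrow> complex) \<Rightarrow> complex \<Rightarrow> (unit + unit) \<times> nat \<Rightarrow> complex" where
  "cpt \<xi> y = pt (\<lambda>i. if i = 0 then 1 else 1 + \<xi> i) (yvec (1 + \<xi> 0) y)"

lemma pgen_at: "poly (map_poly (\<lambda>p. ev (\<lambda>c. c) p \<xi>) (pgen G)) y = ev (\<lambda>c. c) G (cpt \<xi> y)"
  unfolding pgen_subst[OF comm_ring_hom.ev_hom[OF comm_ring_hom_id]] cpt_def ev_xgen[OF comm_ring_hom_id]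
  by (simp add: mconst_def comm_ring_hom.ev_single[OF comm_ring_hom_id])

lemma quadric_at: "ev (\<lambda>c. c) f (cpt \<xi> y) = ev (\<lambda>c. c) q0 \<xi> + ev (\<lambda>c. c) q1 \<xi> * y + ev (\<lambda>c. c) q2 \<xi> * y\<^sup>2"
  unfolding pgen_at[symmetric] pgen_f map_poly_simps[OF comm_ring_hom.ev_hom[OF comm_ring_hom_id]]
  by (simp add: power2_eq_square algebra_simps)

lemma reduce_at:
  assumes "smult (q2 ^ k) (pgen G) = q * pgen f + [:a, b:]" and "ev (\<lambda>c. c) f (cpt \<xi> y) = 0"
  shows "ev (\<lambda>c. c) q2 \<xi> ^ k * ev (\<lambda>c. c) G (cpt \<xi> y) = ev (\<lambda>c. c) a \<xi> + ev (\<lambda>c. c) b \<xi> * y"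
proof -
  let ?e = "\<lambda>p. ev (\<lambda>c. c) p \<xi>"
  interpret e: comm_ring_hom ?e
    by (rule comm_ring_hom.ev_hom[OF comm_ring_hom_id])
  interpret E: comm_ring_hom "\<lambda>p. poly (map_poly ?e p) y"
    by (rule subst_hom[OF e.comm_ring_hom_axioms])
  have "poly (map_poly ?e ([:q2 ^ k:] * pgen G)) y
      = poly (map_poly ?e q) y * ev (\<lambda>c. c) f (cpt \<xi> y) + poly (map_poly ?e [:a, b:]) y"
    using arg_cong[OF assms(1), of "\<lambda>p. poly (map_poly ?e p) y"] by (simp add: E.hom_add E.hom_mult pgen_at)
  then show ?thesis
    unfolding E.hom_mult assms(2) pgen_at map_poly_simps[OF e.comm_ring_hom_axioms]
    by (simp add: e.hom_power mult.commute)
qed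

text \<open>The linear remainder of pseudo-division is zero by \<open>generic_irreducible\<close>,
  and at a point where \<open>q2\<close> does not vanish its power can be cancelled.\<close>

lemma gev_zero_at:
  assumes "gev G = 0" and "ev (\<lambda>c. c) f (cpt \<xi> y) = 0" and "ev (\<lambda>c. c) q2 \<xi> \<noteq> 0"
  shows "ev (\<lambda>c. c) G (cpt \<xi> y) = 0"
proof -
  obtain k q a b where 1: "smult (q2 ^ k) (pgen G) = q * pgen f + [:a, b:]" "em q2 ^ k * gev G = em a + em b * w"
    by (rule gev_reduce)
  then have "a = 0 \<and> b = 0"
    using generic_irreducible[of a b] assms(1) by simp
  then show ?thesis
    using reduce_at[OF 1(1) assms(2)] assms(3) by simp
qed

lemma q2_nonzero: "q2 \<noteq> 0"
proof
  assume "q2 = 0"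
  then show False
    using z_inverse by (simp add: em_0)
qed

text \<open>The norm of the linear remainder modulo the quadratic equation vanishes at all points, hence identically.\<close>

lemma gev_zero_if:
  assumes zero: "\<And>\<xi> y. ev (\<lambda>c. c) f (cpt \<xi> y) = 0 \<Longrightarrow> ev (\<lambda>c. c) q2 \<xi> \<noteq> 0 \<Longrightarrow> ev (\<lambda>c. c) G (cpt \<xi> y) = 0"
  shows "gev G = 0"
proof -
  interpret em: comm_ring_hom "em :: complex gpoly \<Rightarrow> _"
    by (rule em_hom)
  obtain k q a b where 1: "smult (q2 ^ k) (pgen G) = q * pgen f + [:a, b:]" and 2: "em q2 ^ k * gev G = em a + em b * w"
    by (rule gev_reduce)
  define N where "N = q2 * a\<^sup>2 - q1 * a * b + q0 * b\<^sup>2"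
  have "ev (\<lambda>c. c) (q2 * N) \<xi> = 0" for \<xi>
  proof -
    let ?e = "\<lambda>p. ev (\<lambda>c. c) p \<xi>"
    interpret e: comm_ring_hom ?e
      by (rule comm_ring_hom.ev_hom[OF comm_ring_hom_id])
    show ?thesis
    proof (cases "?e q2 = 0")
      case False
      obtain y where y: "?e q0 + ?e q1 * y + ?e q2 * y\<^sup>2 = 0"
        using field_quadratic_root[OF False] by blast
      then have f0: "ev (\<lambda>c. c) f (cpt \<xi> y) = 0"
        by (simp add: quadric_at)
      then have "?e a + ?e b * y = 0"
        using reduce_at[OF 1 f0] zero[OF f0 False] by simp
      then have ea: "?e a = - (?e b * y)"
        by (simp add: eq_neg_iff_add_eq_0)
      have "?e N = (?e b)\<^sup>2 * (?e q0 + ?e q1 * y + ?e q2 * y\<^sup>2)"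
        unfolding N_def e.hom_add e.hom_minus e.hom_mult e.hom_power ea by (simp add: power2_eq_square algebra_simps)
      then show ?thesis
        unfolding y e.hom_mult by simp
    qed (simp add: e.hom_mult)
  qed
  then have "q2 * N = 0"
    by (rule mpoly_identity)
  then have "N = 0"
    using q2_nonzero by simp
  then have "em N = 0"
    by simp
  have "em q0 = - (em q1 * w + em q2 * w\<^sup>2)"
    unfolding eq_neg_iff_add_eq_0 using w_root by (simp only: add.assoc)
  note q = this
  \<comment> \<open>The second factor is \<open>em q2\<close> times the conjugate of the first,
    since the two roots of the quadratic add up to minus \<open>q1\<close> divided by
    \<open>q2\<close>.\<close>
  have "em N = (em a + em b * w) * (em (q2 * a - q1 * b) + em (- (q2 * b)) * w)"
    unfolding N_def em.hom_add em.hom_minus em.hom_mult em.hom_power em.hom_uminus q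
    by (simp add: power2_eq_square algebra_simps)
  then consider "em a + em b * w = 0" | "em (q2 * a - q1 * b) + em (- (q2 * b)) * w = 0"
    using \<open>em N = 0\<close> by auto
  then have "em a + em b * w = 0"
  proof cases
    case 2
    then have "q2 * a - q1 * b = 0" "- (q2 * b) = 0"
      using generic_irreducible by blast+
    then show ?thesis
      using q2_nonzero by simp
  qed
  then have "z ^ k * (em q2 ^ k * gev G) = 0"
    using 2 by simp
  moreover have "z ^ k * (em q2 ^ k * gev G) = (em q2 * z) ^ k * gev G"
    by (simp add: power_mult_distrib mult_ac)
  ultimately show ?thesis
    by (simp add: z_inverse)
qed

end

section \<open>No rational curve joins the generic point to a fixed point\<close>

lemma ev_mconst:
  assumes "comm_ring_hom \<iota>"
  shows "ev \<iota> (mconst c) v = \<iota> c"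
proof -
  interpret comm_ring_hom \<iota> by fact
  show ?thesis
    by (simp add: mconst_def)
qed

lemma mconst_eq_0: "mconst c = 0 \<longleftrightarrow> c = 0"
  unfolding mconst_def by (metis lookup_single_eq lookup_zero single_zero)

lemma deriv_mpoly_mconst: "deriv_mpoly i (mconst c) = 0"
  by (rule poly_mapping_eqI) (simp add: lookup_deriv_mpoly mconst_def lookup_single when_def)

lemma deriv_mpoly_mvar: "deriv_mpoly i (mvar j) = (if i = j then mvar j else 0)"
  by (rule poly_mapping_eqI) (auto simp: lookup_deriv_mpoly mvar_def lookup_single when_def)

lemma deriv_fps_linear:
  assumes "derivation D"
  shows "deriv_fps D (fps_const a * fps_X) = fps_const (D a) * fps_X" "deriv_fps D (fps_const a) = fps_const (D a)"
  using derivation.D_0[OF assms] by (simp_all add: deriv_fps_def fps_eq_iff fps_mult_fps_X_commute)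

text \<open>The shift of the index skips X_0, which belongs to \<open>y0\<close>; the other
  variables belong to the coordinates \<open>x\<close>.\<close>

definition gder :: "nat \<Rightarrow> ((nat \<Rightarrow>\<^sub>0 nat) \<Rightarrow>\<^sub>0 'k::field) fps fract \<Rightarrow> 'k gpoly fps fract" where
  "gder k = deriv_fract (deriv_fps (deriv_mpoly (Suc k)))"

lemma gder: "field_derivation (gder k)"
  unfolding gder_def by (intro derivation_fract derivation_fps derivation_mpoly)

lemma gder_to_fract: "gder k (to_fract a) = to_fract (deriv_fps (deriv_mpoly (Suc k)) a)"
  unfolding gder_def by (intro deriv_fract_to_fract derivation_fps derivation_mpoly)

context conic_params
begin

text \<open>Each coordinate depends on its own variable only, so the matrix is diagonal with the
  nonzero entries X_i t / (1 + X_i t), where t is the series variable.\<close>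

lemma val_generic: "val n gder (\<lambda>i. to_fract (em (xgen i :: (nat \<Rightarrow>\<^sub>0 nat) \<Rightarrow>\<^sub>0 'k::field))) \<noteq> 0"
proof -
  interpret em: comm_ring_hom "em :: 'k gpoly \<Rightarrow> _"
    by (rule em_hom)
  let ?x = "\<lambda>i. to_fract (em (xgen i :: 'k gpoly))"
  have x0: "?x 0 = 1"
    by (simp add: xgen_def)
  have xS: "em (xgen (Suc i) :: 'k gpoly) = fps_const (mconst 1) + fps_const (mvar (Suc i)) * fps_X" for i
    by (simp add: xgen_def em.hom_add em_mvar)
  have nz: "em (xgen i :: 'k gpoly) \<noteq> 0" for i
  proof
    assume "em (xgen i :: 'k gpoly) = 0"
    then have "fps_nth (em (xgen i :: 'k gpoly)) 0 = 0"
      by simp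
    moreover have "fps_nth (em (xgen i :: 'k gpoly)) 0 = 1"
      by (simp add: em_nth_0 ev_xgen[OF comm_ring_hom_id])
    ultimately show False
      by simp
  qed
  have d: "gder k (?x (Suc i)) = (if i = k then to_fract (fps_const (mvar (Suc i)) * fps_X) else 0)" for i k
  proof -
    have der: "derivation (deriv_mpoly (Suc k) :: 'k gpoly \<Rightarrow> _)"
      by (rule derivation_mpoly)
    show ?thesis
      unfolding gder_to_fract xS derivation.D_add[OF derivation_fps[OF der]] deriv_fps_linear[OF der]
        deriv_mpoly_mconst deriv_mpoly_mvar by auto
  qed
  let ?A = "logmat n gder ?x"
  have A: "?A \<in> carrier_mat (n - 1) (n - 1)"
    by (simp add: logmat_def)
  have entry: "?A $$ (i, k) = (if i = k then to_fract (fps_const (mvar (Suc i)) * fps_X) / ?x (Suc i) else 0)"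
    if "i < n - 1" "k < n - 1" for i k
    using that by (simp add: logmat_def x0 dlog_def d)
  have "upper_triangular ?A"
    unfolding upper_triangular_def using A entry by auto
  then have "det ?A = prod_list (diag_mat ?A)"
    using A by (rule det_upper_triangular)
  moreover have "mvar i \<noteq> (0 :: 'k gpoly)" for i
    unfolding mvar_def by (metis lookup_single_eq lookup_zero zero_neq_one)
  then have "0 \<notin> set (diag_mat ?A)"
    using A entry nz by (auto simp: diag_mat_def)
  ultimately have "det ?A \<noteq> 0"
    by (simp add: prod_list_zero_iff)
  then show ?thesis
    using nz by (simp add: val_def)
qed

lemma val_constant:
  fixes c :: "nat \<Rightarrow> 'k::field"
  shows "val n gder (\<lambda>i. to_fract (fps_const (mconst (c i)))) = 0"
proof -
  let ?x = "\<lambda>i. to_fract (fps_const (mconst (c i))) :: 'k gpoly fps fract"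
  have zero: "gder k (?x i) = 0" for i k
    unfolding gder_to_fract deriv_fps_linear[OF derivation_mpoly] deriv_mpoly_mconst by simp
  have "det (logmat n gder ?x) = 0" if nz: "\<forall>i<n. ?x i \<noteq> 0"
  proof -
    have "dlog (gder k) (?x (Suc i) / ?x 0) = 0" if "i < n - 1" for i k
    proof -
      interpret field_derivation "gder k :: 'k gpoly fps fract \<Rightarrow> _"
        by (rule gder)
      have "?x (Suc i) \<noteq> 0" "?x 0 \<noteq> 0"
        using nz that n_ge by auto
      then have "dlog (gder k) (?x (Suc i) / ?x 0) = dlog (gder k) (?x (Suc i)) - dlog (gder k) (?x 0)"
        by (rule dlog_divide)
      also have "\<dots> = 0"
        unfolding dlog_def zero by simp
      finally show ?thesis .
    qed
    then have "logmat n gder ?x = 0\<^sub>m (n - 1) (n - 1)"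
      unfolding logmat_def by (intro eq_matI) auto
    then show ?thesis
      using n_ge by simp
  qed
  then show ?thesis
    by (simp add: val_def)
qed

end

context conic_degeneration
begin

text \<open>Reduction of power series followed by inclusion into the fraction field, because
  \<open>val_chain\<close> needs a field as target.\<close>

definition redn :: "complex gpoly fps \<Rightarrow> 'k gpoly fps fract \<Rightarrow> bool" where
  "redn a b \<longleftrightarrow> (\<exists>b'. b = to_fract b' \<and> Rs a b')"

lemma redn_rel: "ring_rel redn"
proof -
  interpret S: ring_rel "Rs :: complex gpoly fps \<Rightarrow> 'k gpoly fps \<Rightarrow> bool"
    by (rule rel_Rs)
  show ?thesis
  proof unfold_locales
    show "redn 0 0"
      unfolding redn_def by (rule exI[of _ 0]) (use S.rel_zero in simp)
    show "redn 1 1"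
      unfolding redn_def by (rule exI[of _ 1], rule conjI[OF _ S.rel_one]) simp
    fix a a' b b'
    assume "redn a a'"
    then obtain x where x: "a' = to_fract x" "Rs a x"
      unfolding redn_def by (elim exE conjE)
    show "redn (- a) (- a')"
      unfolding redn_def by (rule exI[of _ "- x"], rule conjI[OF _ S.rel_uminus[OF x(2)]]) (simp add: x(1))
    assume "redn b b'"
    then obtain y where y: "b' = to_fract y" "Rs b y"
      unfolding redn_def by (elim exE conjE)
    show "redn (a + b) (a' + b')"
      unfolding redn_def by (rule exI[of _ "x + y"], rule conjI[OF _ S.rel_add[OF x(2) y(2)]]) (simp add: x(1) y(1))
    show "redn (a * b) (a' * b')"
      unfolding redn_def by (rule exI[of _ "x * y"], rule conjI[OF _ S.rel_mult[OF x(2) y(2)]]) (simp add: x(1) y(1))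
  qed
qed

lemma redn_0: "redn 0 b \<Longrightarrow> b = 0"
  unfolding redn_def using Rs_0 by fastforce

lemma redn_unique: "redn a b \<Longrightarrow> redn a b' \<Longrightarrow> b = b'"
  using ring_rel.rel_diff[OF redn_rel, of a b a b'] redn_0[of "b - b'"] by simp

lemma redn_const: "a \<in> Ov \<Longrightarrow> redn (fps_const (mconst a)) (to_fract (fps_const (mconst (h a))))"
proof -
  assume a: "a \<in> Ov"
  have "Rm (mconst a :: complex gpoly) (mconst (h a))"
    by (rule Rm_mconst) (use a in simp)
  then have "Rs (fps_const (mconst a :: complex gpoly)) (fps_const (mconst (h a)))"
    using zero_O by simp
  then show ?thesis
    unfolding redn_def by blast
qed

lemma redn_xgen: "redn (em (xgen i)) (to_fract (em (xgen i)))"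
  unfolding redn_def by (rule exI, rule conjI[OF refl Rs_em[OF Rm_gen(1)]])

text \<open>The vanishing of \<open>f\<close> on the curve survives the substitution of
  \<open>\<rho>\<close> times the parameter and, by multihomogeneity, the separate scaling of the
  two blocks. The rescaled equation is then reduced coefficient by coefficient.\<close>

lemma curve_reduction:
  fixes g :: "bool \<Rightarrow> nat \<Rightarrow> complex gpoly fps poly"
  assumes vanish: "ev (\<lambda>c. [:fps_const (mconst c):]) f (pt (g True) (g False)) = 0"
    and red: "\<And>b i k. i < (if b then n else 3) \<Longrightarrow>
      redn (fps_const (mconst (u b * \<rho> ^ k)) * coeff (g b i) k) (coeff (Z b i) k)"
  shows "special (Z True) (Z False 0) (Z False 1) (Z False 2) = 0"
proof -
  interpret c: comm_ring_hom "\<lambda>c::complex. fps_const (mconst c) :: complex gpoly fps"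
    by (rule fconst_hom)
  let ?\<iota> = "\<lambda>c::complex. [:fps_const (mconst c):] :: complex gpoly fps poly"
  let ?q = "[:0, fps_const (mconst \<rho>):] :: complex gpoly fps poly"
  define g' where "g' = pt (\<lambda>i. pcompose (g True i) ?q) (\<lambda>i. pcompose (g False i) ?q)"
  let ?u = "\<lambda>b::unit + unit. ?\<iota> (u (case b of Inl _ \<Rightarrow> True | Inr _ \<Rightarrow> False))"
  have J: "finite (case_sum (PP (n - 1)) (PP 2) b)" for b
    by (cases b) (auto simp: PP_def)
  have "ev ?\<iota> f g' = pcompose (ev ?\<iota> f (pt (g True) (g False))) ?q"
    unfolding comm_ring_hom.ev_commute[OF pcompose_hom] g'_def by (simp add: pt_comp[of "\<lambda>p. pcompose p ?q"])
  then have g'0: "ev ?\<iota> f g' = 0"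
    unfolding vanish by simp
  have v': "ev ?\<iota> f (\<lambda>i. ?u (fst i) * g' i) = 0"
    unfolding ev_scale[OF f[unfolded multihom_def] J, of ?\<iota> ?u g'] g'0 by (rule mult_zero_right)
  define lim where "lim b = (if b then n else 3)" for b :: bool
  define G where "G b i = [:fps_const (mconst (u b)):] * pcompose (g b i) ?q" for b i
  \<comment> \<open>Reductions are given only for indices inside the blocks, while
    \<open>rel_ev\<close> relates all variables. The others are set to 0; neither \<open>f\<close>
    nor \<open>special\<close> sees them.\<close>
  define cutG where "cutG b i = (if i < lim b then G b i else 0)" for b i
  define cutZ where "cutZ b i = (if i < lim b then Z b i else 0)" for b i
  have "ev ?\<iota> f (pt (cutG True) (cutG False)) = ev ?\<iota> f (\<lambda>i. ?u (fst i) * g' i)"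
  proof (rule ev_cong)
    fix i m assume m: "m \<in> Poly_Mapping.keys f" "i \<in> Poly_Mapping.keys m"
    then have "i \<in> Sigma UNIV (case_sum (PP (n - 1)) (PP 2))"
      using f by (auto simp: multihom_def monomials_def)
    moreover obtain b j where "i = (b, j)"
      by (cases i)
    ultimately show "pt (cutG True) (cutG False) i = ?u (fst i) * g' i"
      using n_ge by (cases b) (auto simp: cutG_def lim_def G_def g'_def PP_def)
  qed
  then have v: "ev ?\<iota> f (pt (cutG True) (cutG False)) = 0"
    using v' by simp
  interpret P: ring_rel "\<lambda>p q. \<forall>k. redn (coeff p k) (coeff q k)"
    by (rule ring_rel.rel_poly[OF redn_rel])
  have "\<forall>k. redn (coeff (ev ?\<iota> f (pt (cutG True) (cutG False))) k)
      (coeff (ev of_int special_poly (pt (cutZ True) (cutZ False))) k)"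
  proof (rule P.rel_ev)
    show "\<forall>k. redn (coeff (?\<iota> (Poly_Mapping.lookup f m)) k)
        (coeff (of_int (Poly_Mapping.lookup special_poly m) :: 'k gpoly fps fract poly) k)" for m
    proof -
      have eq: "of_int (Poly_Mapping.lookup special_poly m)
          = [:to_fract (fps_const (mconst (of_int (Poly_Mapping.lookup special_poly m) :: 'k)
            :: 'k gpoly)):]"
        by (rule hom_of_int[OF comm_ring_hom_comp[OF pCons_hom comm_ring_hom_comp[OF to_fract_hom fconst_hom]], symmetric])
      have "redn (fps_const (mconst (Poly_Mapping.lookup f m)))
          (to_fract (fps_const (mconst (of_int (Poly_Mapping.lookup special_poly m)))))"
        using redn_const[of "Poly_Mapping.lookup f m"] conic_degeneration_axioms
        by (simp add: conic_degeneration_def conic_degeneration_axioms_def)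
      then show ?thesis
        unfolding eq using ring_rel.rel_zero[OF redn_rel] by (simp add: coeff_pCons split: nat.split)
    qed
    show "\<forall>k. redn (coeff (pt (cutG True) (cutG False) i) k) (coeff (pt (cutZ True) (cutZ False) i) k)" for i
    proof -
      have "\<forall>k. redn (coeff (cutG b j) k) (coeff (cutZ b j) k)" for b j
      proof (cases "j < lim b")
        case True
        have "coeff (G b j) k = fps_const (mconst (u b * \<rho> ^ k)) * coeff (g b j) k" for k
          by (simp add: G_def coeff_pcompose_linear c.hom_mult c.hom_power mult.assoc del: fps_const_mult)
        then show ?thesis
          using True red[of j b] by (simp add: cutG_def cutZ_def lim_def)
      qed (simp add: cutG_def cutZ_def ring_rel.rel_zero[OF redn_rel])
      then show ?thesis
        by (cases i; cases "fst i") auto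
    qed
  qed simp_all
  then have "ev of_int special_poly (pt (cutZ True) (cutZ False)) = 0"
    unfolding v by (intro poly_eqI) (simp add: redn_0)
  then have "special (cutZ True) (cutZ False 0) (cutZ False 1) (cutZ False 2) = 0"
    unfolding ev_special_poly by simp
  moreover have "special (cutZ True) = special (Z True)"
    by (intro ext special_cong) (simp add: cutZ_def lim_def)
  ultimately show ?thesis
    by (simp add: cutZ_def lim_def)
qed

text \<open>\<open>val_chain\<close> equates the values at the reduced lowest and highest
  coefficient vectors. The former is proportional to the reduced generic point and has nonzero value
  by \<open>val_generic\<close>, the latter to a constant vector and has value 0 by
  \<open>val_constant\<close>.\<close>

theorem no_curve:
  fixes \<Gamma> :: "bool \<Rightarrow> nat \<Rightarrow> ((unit + unit) \<times> nat) mpoly poly"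
  assumes vanish: "ev (\<lambda>c. [:fps_const (mconst c):]) f (pt (\<lambda>i. map_poly gev (\<Gamma> True i)) (\<lambda>i. map_poly gev (\<Gamma> False i))) = 0"
    and bottom: "a \<noteq> 0" "\<And>i. i < n \<Longrightarrow> gev (coeff (\<Gamma> True i) 0) = a * em (xgen i)"
    and y: "i0 < 3" "map_poly gev (\<Gamma> False i0) \<noteq> 0"
    and top: "\<And>i k. i < n \<Longrightarrow> e < k \<Longrightarrow> coeff (\<Gamma> True i) k = 0" "\<And>i. i < n \<Longrightarrow> coeff (\<Gamma> True i) e = mconst (x1 i)"
      "\<exists>i<n. x1 i \<noteq> 0"
  shows False
proof -
  interpret gev: comm_ring_hom gev
    by (rule gev_hom)
  interpret R: ring_rel redn
    by (rule redn_rel)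
  let ?\<iota> = "\<lambda>c::complex. fps_const (mconst c) :: complex gpoly fps"
  let ?\<kappa> = "\<lambda>c::'k. to_fract (fps_const (mconst c) :: 'k gpoly fps)"
  define g where "g b i = map_poly gev (\<Gamma> b i)" for b i
  have cg: "coeff (g b i) k = gev (coeff (\<Gamma> b i) k)" for b i k
    by (simp add: g_def coeff_map_poly)
  define N where "N = (\<lambda>b. if b then n else 3::nat)"
  define J where "J = (\<lambda>b. {k. \<exists>i<N b. coeff (g b i) k \<noteq> 0})"
  have "\<forall>b k. \<exists>c B. k \<in> J b \<longrightarrow> c \<noteq> 0 \<and> (\<forall>i\<in>{..<N b}. redn (?\<iota> c * coeff (g b i) k) (B i)) \<and> (\<exists>i\<in>{..<N b}. B i \<noteq> 0)"
  proof (intro allI)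
    fix b k
    show "\<exists>c B. k \<in> J b \<longrightarrow> c \<noteq> 0 \<and> (\<forall>i\<in>{..<N b}. redn (?\<iota> c * coeff (g b i) k) (B i)) \<and> (\<exists>i\<in>{..<N b}. B i \<noteq> 0)"
    proof (cases "k \<in> J b")
      case True
      have "\<exists>c B. c \<noteq> 0 \<and> (\<forall>i\<in>{..<N b}. redn (?\<iota> c * coeff (g b i) k) (B i)) \<and> (\<exists>i\<in>{..<N b}. B i \<noteq> 0)"
      proof (rule vec_scale[OF redn_rel fconst_hom redn_const])
        show "\<exists>i\<in>{..<N b}. coeff (g b i) k \<noteq> 0"
          using True by (auto simp: J_def)
        show "\<exists>c B. c \<noteq> 0 \<and> B \<noteq> 0 \<and> redn (?\<iota> c * coeff (g b i) k) B" if nz: "coeff (g b i) k \<noteq> 0" for i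
        proof -
          from gev_scale[OF nz[unfolded cg]]
          obtain c B where c: "c \<noteq> 0" "B \<noteq> 0" "Rs (?\<iota> c * gev (coeff (\<Gamma> b i) k)) B"
            by (elim exE conjE) (rule that)
          have "redn (?\<iota> c * coeff (g b i) k) (to_fract B)"
            unfolding redn_def by (rule exI, rule conjI[OF refl c(3)[folded cg]])
          then show ?thesis
            using c(1,2) by (intro exI[of _ c] exI[of _ "to_fract B"] conjI) simp_all
        qed
      qed simp_all
      then show ?thesis
        by blast
    qed simp
  qed
  then obtain c B where cB: "\<And>b k. k \<in> J b \<Longrightarrow> c b k \<noteq> 0 \<and> (\<forall>i\<in>{..<N b}. redn (?\<iota> (c b k) * coeff (g b i) k) (B b k i)) \<and> (\<exists>i\<in>{..<N b}. B b k i \<noteq> 0)"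
    by metis
  have bot: "coeff (g True i) 0 = a * em (xgen i)" if "i < n" for i
    using bottom(2)[OF that] by (simp add: cg)
  have n0: "0 < n"
    using n_ge by simp
  have x0: "em (xgen 0 :: complex gpoly) = 1"
  proof -
    interpret em: comm_ring_hom "em :: complex gpoly \<Rightarrow> _"
      by (rule em_hom)
    show ?thesis
      by (simp add: xgen_def)
  qed
  have g0: "coeff (g True 0) 0 = a"
    using bot[OF n0] x0 by simp
  have J0: "0 \<in> J True"
    unfolding J_def N_def using g0 bottom(1) n0 by auto
  have tp: "coeff (g True i) e = ?\<iota> (x1 i)" if "i < n" for i
    using top(2)[OF that] by (simp add: cg gev_def ev_mconst[OF fconst_hom])
  have Je: "e \<in> J True"
  proof -
    obtain i where "i < n" "x1 i \<noteq> 0"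
      using top(3) by blast
    then show ?thesis
      using tp[of i] by (auto simp: J_def N_def mconst_eq_0)
  qed
  have Jle: "k \<le> e" if "k \<in> J True" for k
  proof (rule ccontr)
    assume "\<not> k \<le> e"
    then have "coeff (g True i) k = 0" if "i < n" for i
      using top(1)[OF that, of k] by (simp add: cg)
    then show False
      using that by (auto simp: J_def N_def)
  qed
  have fin: "finite (J True)"
    by (rule finite_subset[of _ "{..e}"]) (use Jle in auto)
  have min: "Min (J True) = 0"
    by (rule Min_eqI) (use fin J0 in auto)
  have max: "Max (J True) = e"
    by (rule Max_eqI) (use fin Je Jle in auto)
  have ne: "J b \<noteq> {}" for b
  proof (cases b)
    case True
    then have "b = True"
      by simp
    then show ?thesis
      using J0 by (simp only: ex_in_conv[symmetric]) (rule exI)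
  next
    case False
    have "coeff (g False i0) (degree (g False i0)) \<noteq> 0"
      using y(2) unfolding g_def[symmetric] leading_coeff_0_iff .
    then have "degree (g False i0) \<in> J False"
      using y(1) unfolding J_def N_def by (intro CollectI exI[of _ i0]) simp
    then show ?thesis
      using False by auto
  qed
  have char2': "(1 :: 'k gpoly fps fract) + 1 = 0"
  proof -
    interpret k: comm_ring_hom ?\<kappa>
      by (rule comm_ring_hom_comp[OF to_fract_hom fconst_hom])
    have "?\<kappa> (1 + 1) = 1 + 1"
      by (simp only: k.hom_add k.hom_one)
    then show ?thesis
      unfolding char2 k.hom_zero by (rule sym)
  qed
  have "val n gder (B True (Min (J True))) = val n gder (B True (Max (J True)))"
    unfolding J_def N_def
  proof (rule val_chain[OF place_axioms redn_rel fconst_hom comm_ring_hom_comp[OF to_fract_hom fconst_hom] redn_const,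
      where c = c and g = g])
    show "\<exists>w. w ^ m = z" if "0 < m" for z :: complex and m
    proof -
      have "exp (Ln z / of_nat m) ^ m = z" if "z \<noteq> 0"
        using that \<open>0 < m\<close> by (simp flip: exp_of_nat_mult)
      then show ?thesis
        using that by (cases "z = 0") (auto intro: exI[of _ 0])
    qed
    show "{k. \<exists>i<if b then n else 3. coeff (g b i) k \<noteq> 0} \<noteq> {}" for b
      using ne[of b] by (simp add: J_def N_def)
    show "c b k \<noteq> 0 \<and> (\<exists>i<if b then n else 3. B b k i \<noteq> 0)"
      if "k \<in> {k. \<exists>i<if b then n else 3. coeff (g b i) k \<noteq> 0}" for b k
      using cB[of k b] that by (auto simp: J_def N_def)
    show "redn (?\<iota> (c b k) * coeff (g b i) k) (B b k i)"
      if "k \<in> {k. \<exists>i<if b then n else 3. coeff (g b i) k \<noteq> 0}" "i < (if b then n else 3)" for b k i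
      using cB[of k b] that by (auto simp: J_def N_def)
    show "special (Z True) (Z False 0) (Z False 1) (Z False 2) = 0"
      if "\<And>b i k. i < (if b then n else 3) \<Longrightarrow> redn (?\<iota> (u b * \<rho> ^ k) * coeff (g b i) k) (coeff (Z b i) k)"
      for Z u \<rho>
      using curve_reduction[of g u \<rho> Z] that vanish by (simp add: g_def[abs_def])
  qed (use gder char2' in auto)
  then have val: "val n gder (B True 0) = val n gder (B True e)"
    unfolding min max .
  \<comment> \<open>The reduced vector was only chosen to exist. Uniqueness of reductions identifies
    it as a multiple of the generic point.\<close>
  have B0: "B True 0 i = B True 0 0 * to_fract (em (xgen i))" if "i < n" for i
  proof (rule redn_unique)
    show "redn (?\<iota> (c True 0) * coeff (g True i) 0) (B True 0 i)"
      using cB[OF J0] that by (simp add: N_def)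
    have "?\<iota> (c True 0) * coeff (g True i) 0 = ?\<iota> (c True 0) * coeff (g True 0) 0 * em (xgen i)"
      using bot[OF that] bot[OF n0] x0 by (simp add: mult.assoc)
    moreover have "redn (?\<iota> (c True 0) * coeff (g True 0) 0 * em (xgen i)) (B True 0 0 * to_fract (em (xgen i)))"
      using cB[OF J0] n0 by (intro R.rel_mult redn_xgen) (simp add: N_def)
    ultimately show "redn (?\<iota> (c True 0) * coeff (g True i) 0) (B True 0 0 * to_fract (em (xgen i)))"
      by (simp only:)
  qed
  have B00: "B True 0 0 \<noteq> 0"
  proof
    assume "B True 0 0 = 0"
    then have "B True 0 i = 0" if "i < n" for i
      using B0[OF that] by simp
    then show False
      using cB[OF J0] by (auto simp: N_def)
  qed
  have "val n gder (B True 0) = val n gder (\<lambda>i. B True 0 0 * to_fract (em (xgen i)))"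
    by (rule val_cong[OF B0 n0])
  also have "\<dots> \<noteq> 0"
    unfolding val_scale[OF B00] by (rule val_generic)
  finally have "val n gder (B True e) \<noteq> 0"
    unfolding val .
  \<comment> \<open>Division by the largest entry makes the constant vector integral.\<close>
  obtain s where s: "s < n" "x1 s \<noteq> 0" "\<And>t. t < n \<Longrightarrow> x1 t / x1 s \<in> Ov"
  proof -
    have "\<exists>s\<in>{i. i < n \<and> x1 i \<noteq> 0}. \<forall>t\<in>{i. i < n \<and> x1 i \<noteq> 0}. inverse (x1 s) / inverse (x1 t) \<in> Ov"
      using top(3) by (intro ex_divisor_on_finite) auto
    then obtain s where "s < n" "x1 s \<noteq> 0" "\<And>t. t < n \<Longrightarrow> x1 t \<noteq> 0 \<Longrightarrow> x1 t / x1 s \<in> Ov"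
      by (auto simp: divide_inverse mult.commute)
    moreover from this have "x1 t / x1 s \<in> Ov" if "t < n" for t
      using that zero_O by (cases "x1 t = 0") auto
    ultimately show thesis
      using that by blast
  qed
  have Be: "B True e i = B True e s * ?\<kappa> (h (x1 i / x1 s))" if "i < n" for i
  proof (rule redn_unique)
    interpret c: comm_ring_hom ?\<iota>
      by (rule fconst_hom)
    show "redn (?\<iota> (c True e) * coeff (g True i) e) (B True e i)"
      using cB[OF Je] that by (simp add: N_def)
    have "?\<iota> (c True e) * coeff (g True i) e = ?\<iota> (c True e) * coeff (g True s) e * ?\<iota> (x1 i / x1 s)"
      using s(2) unfolding tp[OF that] tp[OF s(1)] by (simp add: mult.assoc flip: c.hom_mult del: fps_const_mult)
    moreover have "redn (?\<iota> (c True e) * coeff (g True s) e * ?\<iota> (x1 i / x1 s)) (B True e s * ?\<kappa> (h (x1 i / x1 s)))"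
      using cB[OF Je] s(1) s(3)[OF that] by (intro R.rel_mult redn_const) (simp_all add: N_def)
    ultimately show "redn (?\<iota> (c True e) * coeff (g True i) e) (B True e s * ?\<kappa> (h (x1 i / x1 s)))"
      by (simp only:)
  qed
  have Bs: "B True e s \<noteq> 0"
  proof
    assume "B True e s = 0"
    then have "B True e i = 0" if "i < n" for i
      using Be[OF that] by simp
    then show False
      using cB[OF Je] by (auto simp: N_def)
  qed
  have "val n gder (B True e) = val n gder (\<lambda>i. B True e s * ?\<kappa> (h (x1 i / x1 s)))"
    by (rule val_cong[OF Be n0])
  also have "\<dots> = 0"
    unfolding val_scale[OF Bs] by (rule val_constant)
  finally show False
    using \<open>val n gder (B True e) \<noteq> 0\<close> by contradiction
qed

end

section \<open>Birational maps in coordinates\<close>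

lemma multihom_mult:
  assumes "multihom J \<delta> p" "multihom J \<epsilon> q" 
  shows "multihom J (\<lambda>b. \<delta> b + \<epsilon> b) (p * q)"
  unfolding multihom_def
proof
  fix m assume "m \<in> Poly_Mapping.keys (p * q)"
  then obtain a b where m: "m = a + b" "a \<in> monomials J \<delta>" "b \<in> monomials J \<epsilon>"
    using keys_mult[of p q] assms unfolding multihom_def by blast
  have "Poly_Mapping.keys m \<subseteq> Poly_Mapping.keys a \<union> Poly_Mapping.keys b"
    unfolding m by (rule keys_add)
  then show "m \<in> monomials J (\<lambda>b. \<delta> b + \<epsilon> b)"
    using m by (auto simp: monomials_def lookup_add sum.distrib)
qed

lemma multihom_mvar:
  assumes "j \<in> J b" "finite (J b)"
  shows "multihom J (\<lambda>b'. if b' = b then 1 else 0) (mvar (b, j))"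
proof -
  have "(\<Sum>j'\<in>J b'. Poly_Mapping.lookup (Poly_Mapping.single (b, j) (1::nat)) (b', j')) = (if b' = b then 1 else 0)" for b'
    using assms by (auto simp: lookup_single when_def sum.If_cases if_distrib sum.delta' cong: if_cong)
  then show ?thesis
    using assms by (auto simp: multihom_def monomials_def mvar_def)
qed

lemma eval_mult: "Defs.eval (p * q) x = Defs.eval p x * Defs.eval q x"
  unfolding eval_eq_ev by (rule comm_ring_hom.ev_mult[OF comm_ring_hom_id])

lemma eval_mvar: "Defs.eval (mvar (b, j)) x = x b j"
  unfolding eval_eq_ev ev_mvar_val[OF comm_ring_hom_id] by simp

lemma eval_scale:
  fixes p :: "('b::finite \<times> 'j) mpoly"
  assumes "multihom J \<delta> p" "\<And>b. finite (J b)"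
  shows "Defs.eval p (\<lambda>b j. c b * x b j) = (\<Prod>b\<in>UNIV. c b ^ \<delta> b) * Defs.eval p x"
proof -
  have "(\<lambda>(b, j). c b * x b j) = (\<lambda>i. c (fst i) * (case i of (b, j) \<Rightarrow> x b j))"
    by auto
  then show ?thesis
    unfolding eval_eq_ev using ev_scale[OF assms(1)[unfolded multihom_def] assms(2)] by simp
qed

lemma eval_cong:
  assumes "multihom J \<delta> p" "\<And>b j. j \<in> J b \<Longrightarrow> x b j = x' b j"
  shows "Defs.eval p x = Defs.eval p x'"
  unfolding eval_eq_ev
proof (rule ev_cong)
  fix i m assume "m \<in> Poly_Mapping.keys p" "i \<in> Poly_Mapping.keys m"
  then have "i \<in> Sigma UNIV J"
    using assms(1) by (auto simp: multihom_def monomials_def)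
  then show "(case i of (b, j) \<Rightarrow> x b j) = (case i of (b, j) \<Rightarrow> x' b j)"
    using assms(2) by auto
qed

lemma proj_point_self: "x \<in> proj_point x"
  unfolding proj_point_def by (rule CollectI, rule exI[of _ "\<lambda>_. 1"]) simp

lemma proj_pointE:
  assumes "x' \<in> proj_point x"
  obtains c where "\<And>b. c b \<noteq> 0" "x' = (\<lambda>b j. c b * x b j)"
  using assms unfolding proj_point_def by blast

lemma proj_point_scale:
  assumes "\<And>b. c b \<noteq> 0"
  shows "proj_point (\<lambda>b j. c b * x b j) = proj_point x"
proof (intro equalityI subsetI)
  fix y assume "y \<in> proj_point (\<lambda>b j. c b * x b j)"
  then obtain a where a: "\<And>b. a b \<noteq> 0" "y = (\<lambda>b j. a b * (c b * x b j))"
    by (rule proj_pointE) blast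
  then show "y \<in> proj_point x"
    using assms unfolding proj_point_def by (intro CollectI exI[of _ "\<lambda>b. a b * c b"]) (auto simp: mult.assoc)
next
  fix y assume "y \<in> proj_point x"
  then obtain a where a: "\<And>b. a b \<noteq> 0" "y = (\<lambda>b j. a b * x b j)"
    by (rule proj_pointE) blast
  then show "y \<in> proj_point (\<lambda>b j. c b * x b j)"
    using assms unfolding proj_point_def by (intro CollectI exI[of _ "\<lambda>b. a b / c b"]) auto
qed

lemma proj_point_eq: "x' \<in> proj_point x \<Longrightarrow> proj_point x' = proj_point x"
  using proj_point_scale by (elim proj_pointE) auto

lemma hom_vectors_scale:
  "x \<in> hom_vectors J \<Longrightarrow> x' \<in> proj_point x \<Longrightarrow> x' \<in> hom_vectors J"
  by (elim proj_pointE) (auto simp: hom_vectors_def)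

lemma multiproj_memD:
  assumes "P \<in> multiproj J" "x \<in> P"
  shows "x \<in> hom_vectors J" "P = proj_point x"
proof -
  obtain v where v: "P = proj_point v" "v \<in> hom_vectors J"
    using assms(1) by (auto simp: multiproj_def)
  show "x \<in> hom_vectors J" "P = proj_point x"
    using v assms(2) hom_vectors_scale proj_point_eq by blast+
qed

lemma nonvanishing:
  fixes p :: "('b::finite \<times> 'j) mpoly"
  assumes p: "multihom J \<delta> p" and J: "\<And>b. finite (J b)" and x: "x' \<in> proj_point x" "Defs.eval p x \<noteq> 0"
  shows "Defs.eval p x' \<noteq> 0"
proof -
  obtain c where c: "\<And>b. c b \<noteq> 0" "x' = (\<lambda>b j. c b * x b j)"
    using x(1) by (rule proj_pointE) blast
  then show ?thesis
    using x(2) by (simp add: eval_scale[OF p J])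
qed

lemma nonvanishing_iff:
  fixes p :: "('b::finite \<times> 'j) mpoly"
  assumes p: "multihom J \<delta> p" and J: "\<And>b. finite (J b)" and P: "P \<in> multiproj J"
  shows "P \<in> multiproj J - hypersurface J p \<longleftrightarrow> (\<forall>x\<in>P. Defs.eval p x \<noteq> 0)"
proof
  assume "P \<in> multiproj J - hypersurface J p"
  then obtain x where x: "x \<in> P" "Defs.eval p x \<noteq> 0"
    by (auto simp: hypersurface_def)
  then show "\<forall>x\<in>P. Defs.eval p x \<noteq> 0"
    using nonvanishing[OF p J _ x(2)] multiproj_memD(2)[OF P x(1)] by blast
next
  obtain v where "P = proj_point v"
    using P by (auto simp: multiproj_def)
  then have "v \<in> P"
    using proj_point_self by blast
  moreover assume "\<forall>x\<in>P. Defs.eval p x \<noteq> 0"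
  ultimately show "P \<in> multiproj J - hypersurface J p"
    using P by (auto simp: hypersurface_def)
qed

text \<open>Nonvanishing loci of forms are stable under finite intersection by taking products, so
  they are a base of the generated topology; the induction follows its generation.\<close>

lemma zariski_basic:
  fixes J :: "'b::finite \<Rightarrow> 'j set"
  assumes J: "\<And>b. finite (J b)" and W: "openin (zariski J) W" "P \<in> W"
  shows "P \<in> multiproj J \<and> (\<exists>p \<delta>. multihom J \<delta> p \<and> (\<forall>x\<in>P. Defs.eval p x \<noteq> 0) \<and>
    (\<forall>Q\<in>multiproj J. (\<forall>x\<in>Q. Defs.eval p x \<noteq> 0) \<longrightarrow> Q \<in> W))"
proof -
  have "generate_topology_on {multiproj J - hypersurface J f | f \<delta>. multihom J \<delta> f} W"
    using W(1) by (simp add: zariski_def openin_topology_generated_by_iff)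
  then show ?thesis
    using W(2)
  proof (induction arbitrary: P rule: generate_topology_on.induct)
    case Empty
    then show ?case
      by simp
  next
    case (Int A B)
    obtain p \<delta> where p: "multihom J \<delta> p" "\<forall>x\<in>P. Defs.eval p x \<noteq> 0"
      "\<forall>Q\<in>multiproj J. (\<forall>x\<in>Q. Defs.eval p x \<noteq> 0) \<longrightarrow> Q \<in> A"
      using Int.IH(1)[of P] Int.prems by blast
    obtain q \<epsilon> where q: "multihom J \<epsilon> q" "\<forall>x\<in>P. Defs.eval q x \<noteq> 0"
      "\<forall>Q\<in>multiproj J. (\<forall>x\<in>Q. Defs.eval q x \<noteq> 0) \<longrightarrow> Q \<in> B"
      using Int.IH(2)[of P] Int.prems by blast
    show ?case
    proof (intro conjI exI)
      show "P \<in> multiproj J"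
        using Int.IH(1)[of P] Int.prems by blast
      show "multihom J (\<lambda>b. \<delta> b + \<epsilon> b) (p * q)"
        by (rule multihom_mult[OF p(1) q(1)])
      show "\<forall>x\<in>P. Defs.eval (p * q) x \<noteq> 0"
        using p(2) q(2) by (simp add: eval_mult)
      show "\<forall>Q\<in>multiproj J. (\<forall>x\<in>Q. Defs.eval (p * q) x \<noteq> 0) \<longrightarrow> Q \<in> A \<inter> B"
        using p(3) q(3) by (simp add: eval_mult)
    qed
  next
    case (UN K)
    then obtain A where A: "A \<in> K" "P \<in> A"
      by blast
    from UN.IH[OF A] show ?case
      using A(1) by blast
  next
    case (Basis s)
    then obtain p \<delta> where p: "s = multiproj J - hypersurface J p" "multihom J \<delta> p"
      by blast
    have P: "P \<in> multiproj J"
      using Basis p by blast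
    show ?case
    proof (intro conjI exI)
      show "P \<in> multiproj J"
        by (rule P)
      show "multihom J \<delta> p"
        by (rule p(2))
      show "\<forall>x\<in>P. Defs.eval p x \<noteq> 0"
        using nonvanishing_iff[OF p(2) J P] Basis p(1) by blast
      show "\<forall>Q\<in>multiproj J. (\<forall>x\<in>Q. Defs.eval p x \<noteq> 0) \<longrightarrow> Q \<in> s"
        unfolding p(1) using nonvanishing_iff[OF p(2) J] by blast
    qed
  qed
qed

lemma zariski_basic_openin:
  fixes p :: "('b::finite \<times> 'j) mpoly"
  assumes "multihom J \<delta> p"
  shows "openin (zariski J) (multiproj J - hypersurface J p)"
  unfolding zariski_def by (rule topology_generated_by_Basis) (use assms in blast)

definition coords :: "('c \<Rightarrow> 'k set) \<Rightarrow> ('c \<Rightarrow> 'k \<Rightarrow> ('b \<times> 'j) mpoly) \<Rightarrow> ('b \<Rightarrow> 'j \<Rightarrow> complex) \<Rightarrow> 'c \<Rightarrow> 'k \<Rightarrow> complex" where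
  "coords K \<Phi> x = (\<lambda>c k. if k \<in> K c then Defs.eval (\<Phi> c k) x else 0)"

lemma regular_on_coords:
  "regular_on J U K \<phi> \<longleftrightarrow> (\<forall>P\<in>U. \<exists>W f \<delta>.
     openin (subtopology (zariski J) U) W \<and> P \<in> W \<and>
     (\<forall>c. \<forall>k\<in>K c. multihom J (\<delta> c) (f c k)) \<and>
     (\<forall>Q\<in>W. \<forall>x\<in>Q. coords K f x \<in> hom_vectors K \<and> \<phi> Q = proj_point (coords K f x)))"
  unfolding regular_on_def coords_def Let_def ..

text \<open>Around a point both maps are given by forms, and the neighbourhoods are shrunk to the
  loci where \<open>p\<close> and \<open>q\<close> do not vanish. The condition \<open>p0\<close>
  can be imposed on the point too, since a dense set meets the open set around \<open>R\<close>
  where \<open>p0\<close> does not vanish.\<close>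

lemma birational_coordinates:
  fixes J :: "'b::finite \<Rightarrow> 'j set" and K :: "'c::finite \<Rightarrow> 'k set"
  assumes J: "\<And>b. finite (J b)" and K: "\<And>c. finite (K c)"
    and Xs: "Xs \<subseteq> multiproj J" and bir: "birational J Xs K (multiproj K)"
    and p0: "multihom J \<delta>0 p0" "R \<in> Xs" "\<forall>x\<in>R. Defs.eval p0 x \<noteq> 0"
  obtains P \<Phi> \<Psi> \<delta> \<epsilon> p q \<delta>p \<delta>q where
    "P \<in> Xs" "\<forall>x\<in>P. Defs.eval p0 x \<noteq> 0" "\<forall>x\<in>P. Defs.eval p x \<noteq> 0" "\<forall>x\<in>P. Defs.eval q (coords K \<Phi> x) \<noteq> 0"
    "multihom J \<delta>p p" "multihom K \<delta>q q"
    "\<And>c k. k \<in> K c \<Longrightarrow> multihom J (\<delta> c) (\<Phi> c k)" "\<And>b j. j \<in> J b \<Longrightarrow> multihom K (\<epsilon> b) (\<Psi> b j)"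
    "\<And>Q x. Q \<in> Xs \<Longrightarrow> x \<in> Q \<Longrightarrow> Defs.eval p x \<noteq> 0 \<Longrightarrow> coords K \<Phi> x \<in> hom_vectors K"
    "\<And>Q x. Q \<in> Xs \<Longrightarrow> x \<in> Q \<Longrightarrow> Defs.eval p x \<noteq> 0 \<Longrightarrow> Defs.eval q (coords K \<Phi> x) \<noteq> 0 \<Longrightarrow>
      x \<in> proj_point (coords J \<Psi> (coords K \<Phi> x))"
    "\<And>z. z \<in> hom_vectors K \<Longrightarrow> Defs.eval q z \<noteq> 0 \<Longrightarrow> proj_point (coords J \<Psi> z) \<in> Xs"
proof -
  obtain U V \<phi> \<psi> where U: "openin (subtopology (zariski J) Xs) U" "subtopology (zariski J) Xs closure_of U = Xs"
    and V: "openin (subtopology (zariski K) (multiproj K)) V"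
    and reg: "regular_on J U K \<phi>" "regular_on K V J \<psi>"
    and im: "\<phi> ` U \<subseteq> V" "\<psi> ` V \<subseteq> U" and inv: "\<forall>P\<in>U. \<psi> (\<phi> P) = P"
    using bir unfolding birational_def dense_open_def isomorphic_sets_def by (elim exE conjE) (rule that)
  have UX: "U \<subseteq> Xs"
    using openin_subset[OF U(1)] by auto
  have VY: "V \<subseteq> multiproj K"
    using openin_subset[OF V] by auto
  have sub: "\<exists>p \<delta>. multihom L \<delta> p \<and> (\<forall>x\<in>P. Defs.eval p x \<noteq> 0) \<and>
      (\<forall>Q\<in>S. (\<forall>x\<in>Q. Defs.eval p x \<noteq> 0) \<longrightarrow> Q \<in> W)"
    if L: "\<And>b. finite (L b)" "S \<subseteq> multiproj L" "openin (subtopology (zariski L) S) W" "P \<in> W"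
    for L :: "'d::finite \<Rightarrow> 'l set" and S W P
  proof -
    obtain T where T: "openin (zariski L) T" "W = T \<inter> S"
      using L(3) by (auto simp: openin_subtopology)
    have "P \<in> T"
      using T(2) L(4) by blast
    from zariski_basic[OF L(1) T(1) this] obtain p \<delta> where "multihom L \<delta> p" "\<forall>x\<in>P. Defs.eval p x \<noteq> 0"
        "\<forall>Q\<in>multiproj L. (\<forall>x\<in>Q. Defs.eval p x \<noteq> 0) \<longrightarrow> Q \<in> T"
      by blast
    then show ?thesis
      using L(2) T(2) by blast
  qed
  obtain P where P: "P \<in> U" "\<forall>x\<in>P. Defs.eval p0 x \<noteq> 0"
  proof -
    let ?T = "(multiproj J - hypersurface J p0) \<inter> Xs"
    have T: "openin (subtopology (zariski J) Xs) ?T"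
      using zariski_basic_openin[OF p0(1)] by (auto simp: openin_subtopology)
    have R: "R \<in> ?T"
      using nonvanishing_iff[OF p0(1) J] p0(2,3) Xs by blast
    have "R \<in> subtopology (zariski J) Xs closure_of U"
      unfolding U(2) by (rule p0(2))
    then obtain P where P: "P \<in> U" "P \<in> ?T"
      using in_closure_of[THEN iffD1, THEN conjunct2, THEN spec, THEN mp, OF _ conjI[OF R T]] by blast
    then have "P \<in> multiproj J - hypersurface J p0" "P \<in> multiproj J"
      by simp_all
    then have "\<forall>x\<in>P. Defs.eval p0 x \<noteq> 0"
      using nonvanishing_iff[OF p0(1) J] by blast
    with P(1) show thesis
      by (rule that)
  qed
  obtain W \<Phi> \<delta> where W: "openin (subtopology (zariski J) U) W" "P \<in> W"
    and \<Phi>: "\<forall>c. \<forall>k\<in>K c. multihom J (\<delta> c) (\<Phi> c k)"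
      "\<forall>Q\<in>W. \<forall>x\<in>Q. coords K \<Phi> x \<in> hom_vectors K \<and> \<phi> Q = proj_point (coords K \<Phi> x)"
    using bspec[OF reg(1)[unfolded regular_on_coords] P(1)] by (elim exE conjE) (rule that)
  have \<phi>P: "\<phi> P \<in> V"
    using im(1) P(1) by blast
  obtain W' \<Psi> \<epsilon> where W': "openin (subtopology (zariski K) V) W'" "\<phi> P \<in> W'"
    and \<Psi>: "\<forall>b. \<forall>j\<in>J b. multihom K (\<epsilon> b) (\<Psi> b j)"
      "\<forall>Q\<in>W'. \<forall>x\<in>Q. coords J \<Psi> x \<in> hom_vectors J \<and> \<psi> Q = proj_point (coords J \<Psi> x)"
    using bspec[OF reg(2)[unfolded regular_on_coords] \<phi>P] by (elim exE conjE) (rule that)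
  have WU: "W \<subseteq> U" and WV: "W' \<subseteq> V"
    using openin_subset[OF W(1)] openin_subset[OF W'(1)] by auto
  have oW: "openin (subtopology (zariski J) Xs) W"
    using W(1) U(1) UX by (metis openin_trans_full subtopology_subtopology inf.absorb_iff2)
  have oW': "openin (subtopology (zariski K) (multiproj K)) W'"
    using W'(1) V VY by (metis openin_trans_full subtopology_subtopology inf.absorb_iff2)
  obtain p \<delta>p where p: "multihom J \<delta>p p" "\<forall>x\<in>P. Defs.eval p x \<noteq> 0"
      "\<forall>Q\<in>Xs. (\<forall>x\<in>Q. Defs.eval p x \<noteq> 0) \<longrightarrow> Q \<in> W"
    using sub[OF J Xs oW W(2)] by blast
  obtain q \<delta>q where q: "multihom K \<delta>q q" "\<forall>x\<in>\<phi> P. Defs.eval q x \<noteq> 0"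
      "\<forall>Q\<in>multiproj K. (\<forall>x\<in>Q. Defs.eval q x \<noteq> 0) \<longrightarrow> Q \<in> W'"
    using sub[OF K subset_refl oW' W'(2)] by blast
  have inW: "Q \<in> W" if "Q \<in> Xs" "x \<in> Q" "Defs.eval p x \<noteq> 0" for Q x
  proof -
    have "Q = proj_point x"
      using multiproj_memD(2) Xs that by blast
    then have "\<forall>x\<in>Q. Defs.eval p x \<noteq> 0"
      using nonvanishing[OF p(1) J _ that(3)] by blast
    then show ?thesis
      using p(3) that(1) by blast
  qed
  have inW': "proj_point z \<in> W'" if "z \<in> hom_vectors K" "Defs.eval q z \<noteq> 0" for z
  proof -
    have "\<forall>x\<in>proj_point z. Defs.eval q x \<noteq> 0"
      using nonvanishing[OF q(1) K _ that(2)] by blast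
    moreover have "proj_point z \<in> multiproj K"
      using that(1) by (auto simp: multiproj_def)
    ultimately show ?thesis
      using q(3) by blast
  qed
  show thesis
  proof (rule that[of P p q \<Phi> \<delta>p \<delta>q \<delta> \<epsilon> \<Psi>])
    show "P \<in> Xs"
      using P(1) UX by blast
    show "\<forall>x\<in>P. Defs.eval q (coords K \<Phi> x) \<noteq> 0"
    proof
      fix x assume "x \<in> P"
      then have "coords K \<Phi> x \<in> \<phi> P"
        using \<Phi>(2) W(2) proj_point_self[of "coords K \<Phi> x"] by simp
      then show "Defs.eval q (coords K \<Phi> x) \<noteq> 0"
        using q(2) by blast
    qed
    show "coords K \<Phi> x \<in> hom_vectors K" if "Q \<in> Xs" "x \<in> Q" "Defs.eval p x \<noteq> 0" for Q x
      using \<Phi>(2) inW[OF that] that(2) by blast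
    show "x \<in> proj_point (coords J \<Psi> (coords K \<Phi> x))"
      if "Q \<in> Xs" "x \<in> Q" "Defs.eval p x \<noteq> 0" "Defs.eval q (coords K \<Phi> x) \<noteq> 0" for Q x
    proof -
      let ?y = "coords K \<Phi> x"
      have Q: "Q \<in> W"
        using inW[OF that(1-3)] .
      then have y: "?y \<in> hom_vectors K" "\<phi> Q = proj_point ?y"
        using \<Phi>(2) that(2) by blast+
      have "\<phi> Q \<in> W'"
        unfolding y(2) using inW'[OF y(1) that(4)] .
      moreover have "?y \<in> \<phi> Q"
        unfolding y(2) by (rule proj_point_self)
      ultimately have "\<psi> (\<phi> Q) = proj_point (coords J \<Psi> ?y)"
        using \<Psi>(2) by blast
      moreover have "\<psi> (\<phi> Q) = Q"
        using inv Q WU by blast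
      ultimately show ?thesis
        using that(2) by simp
    qed
    show "proj_point (coords J \<Psi> z) \<in> Xs" if "z \<in> hom_vectors K" "Defs.eval q z \<noteq> 0" for z
    proof -
      have z: "proj_point z \<in> W'"
        using inW'[OF that] .
      then have "\<psi> (proj_point z) = proj_point (coords J \<Psi> z)"
        using \<Psi>(2) proj_point_self[of z] by blast
      moreover have "\<psi> (proj_point z) \<in> Xs"
        using z WV im(2) UX by blast
      ultimately show ?thesis
        by simp
    qed
    show "\<forall>x\<in>P. Defs.eval p0 x \<noteq> 0" "\<forall>x\<in>P. Defs.eval p x \<noteq> 0" "multihom J \<delta>p p" "multihom K \<delta>q q"
      by (rule P p q)+
    show "multihom J (\<delta> c) (\<Phi> c k)" if "k \<in> K c" for c k
      using \<Phi>(1) that by blast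
    show "multihom K (\<epsilon> b) (\<Psi> b j)" if "j \<in> J b" for b j
      using \<Psi>(1) that by blast
  qed
qed

lemma proj_prod_memI:
  fixes J :: "'b::finite \<Rightarrow> 'j set"
  assumes f: "multihom J \<delta> f" and J: "\<And>b. finite (J b)"
    and v: "v \<in> hom_vectors (case_sum J K)" "Defs.eval f (\<lambda>b. v (Inl b)) = 0"
  shows "proj_point v \<in> proj_prod (hypersurface J f) (multiproj K)"
proof -
  let ?x = "\<lambda>b. v (Inl b)" and ?y = "\<lambda>c. v (Inr c)"
  have xy: "(\<exists>j\<in>case_sum J K b. v b j \<noteq> 0) \<and> (\<forall>j. j \<notin> case_sum J K b \<longrightarrow> v b j = 0)" for b
    using v(1) by (simp add: hom_vectors_def)
  have x: "?x \<in> hom_vectors J" and y: "?y \<in> hom_vectors K"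
    using xy[of "Inl _"] xy[of "Inr _"] by (simp_all add: hom_vectors_def)
  have "proj_point ?x \<in> hypersurface J f"
    unfolding hypersurface_def
  proof (intro CollectI conjI ballI)
    show "proj_point ?x \<in> multiproj J"
      using x by (auto simp: multiproj_def)
    show "Defs.eval f x' = 0" if "x' \<in> proj_point ?x" for x'
      using that v(2) by (elim proj_pointE) (simp add: eval_scale[OF f J])
  qed
  moreover have "proj_point ?y \<in> multiproj K"
    using y by (auto simp: multiproj_def)
  ultimately have U: "?x \<in> \<Union>(hypersurface J f)" "?y \<in> \<Union>(multiproj K)"
    using proj_point_self by blast+
  have "v = case_sum ?x ?y"
    by (auto simp: fun_eq_iff split: sum.split)
  then have "proj_point v = proj_point (case_sum ?x ?y)"
    by (rule arg_cong)
  then show ?thesis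
    unfolding proj_prod_def using U by (intro CollectI exI conjI)
qed

lemma proj_prod_memD:
  fixes J :: "'b::finite \<Rightarrow> 'j set"
  assumes f: "multihom J \<delta> f" and J: "\<And>b. finite (J b)"
    and Q: "Q \<in> proj_prod (hypersurface J f) (multiproj K)" and v: "v \<in> Q"
  shows "v \<in> hom_vectors (case_sum J K)" "Defs.eval f (\<lambda>b. v (Inl b)) = 0" "Q = proj_point v"
proof -
  obtain x y where xy: "Q = proj_point (case_sum x y)" "x \<in> \<Union>(hypersurface J f)" "y \<in> \<Union>(multiproj K)"
    using Q unfolding proj_prod_def by blast
  have x: "x \<in> hom_vectors J" "Defs.eval f x = 0"
    using xy(2) multiproj_memD(1)[of _ J x] by (auto simp: hypersurface_def)
  have y: "y \<in> hom_vectors K"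
    using xy(3) multiproj_memD(1)[of _ K y] by auto
  have "case_sum x y \<in> hom_vectors (case_sum J K)"
    unfolding hom_vectors_def
  proof (intro CollectI allI)
    show "(\<exists>j\<in>case_sum J K b. case_sum x y b j \<noteq> 0) \<and> (\<forall>j. j \<notin> case_sum J K b \<longrightarrow> case_sum x y b j = 0)" for b
      using x(1) y by (cases b) (simp_all add: hom_vectors_def)
  qed
  then show "v \<in> hom_vectors (case_sum J K)"
    using hom_vectors_scale v xy(1) by blast
  obtain c where "\<And>b. c b \<noteq> 0" "v = (\<lambda>b j. c b * case_sum x y b j)"
    using v unfolding xy(1) by (rule proj_pointE) blast
  then have "(\<lambda>b. v (Inl b)) = (\<lambda>b j. c (Inl b) * x b j)"
    by simp
  then show "Defs.eval f (\<lambda>b. v (Inl b)) = 0"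
    by (simp add: eval_scale[OF f J] x(2))
  show "Q = proj_point v"
    using proj_point_eq v xy(1) by blast
qed

lemma proj_prod_subset:
  fixes J :: "'b::finite \<Rightarrow> 'j set"
  assumes "multihom J \<delta> f" "\<And>b. finite (J b)"
  shows "proj_prod (hypersurface J f) (multiproj K) \<subseteq> multiproj (case_sum J K)"
proof
  fix Q assume Q: "Q \<in> proj_prod (hypersurface J f) (multiproj K)"
  then obtain v where "v \<in> Q"
    unfolding proj_prod_def using proj_point_self by blast
  then show "Q \<in> multiproj (case_sum J K)"
    using proj_prod_memD[OF assms Q] by (auto simp: multiproj_def)
qed

lemma multihom_sum:
  assumes "\<And>i. i \<in> I \<Longrightarrow> multihom J \<delta> (p i)"
  shows "multihom J \<delta> (sum p I)"
  using assms
proof (induction I rule: infinite_finite_induct)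
  case (insert i I)
  then show ?case
    using keys_add[of "p i" "sum p I"] by (auto simp: multihom_def)
qed (auto simp: multihom_def)

lemma multihom_mconst: "multihom J (\<lambda>_. 0) (mconst c)"
  by (auto simp: multihom_def monomials_def mconst_def)

lemma multihom_prod:
  assumes "\<And>i. i \<in> I \<Longrightarrow> multihom J (E i) (p i)"
  shows "multihom J (\<lambda>b. \<Sum>i\<in>I. E i b) (prod p I)"
  using assms
proof (induction I rule: infinite_finite_induct)
  case (insert i I)
  then show ?case
    using multihom_mult[of J "E i" "p i"] by simp
qed (use multihom_mconst[of J 1] in simp_all)

lemma multihom_power: "multihom J \<delta> p \<Longrightarrow> multihom J (\<lambda>b. k * \<delta> b) (p ^ k)"
  using multihom_prod[of "{..<k}" J "\<lambda>_. \<delta>" "\<lambda>_. p"] by simp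

definition extend_blocks :: "('b \<times> 'j) mpoly \<Rightarrow> (('b + 'c) \<times> 'j) mpoly" where
  "extend_blocks p = ev mconst p (\<lambda>(b, j). mvar (Inl b, j))"

lemma eval_extend_blocks: "Defs.eval (extend_blocks p) x = Defs.eval p (\<lambda>b. x (Inl b))"
proof -
  have "ev (\<lambda>c. c) (extend_blocks p) y = ev (\<lambda>c. c) p (\<lambda>(b, j). y (Inl b, j))" for y
    unfolding extend_blocks_def comm_ring_hom.ev_commute[OF comm_ring_hom.ev_hom[OF comm_ring_hom_id]]
      ev_mconst[OF comm_ring_hom_id] by (simp add: case_prod_unfold ev_mvar_val[OF comm_ring_hom_id])
  from this[of "\<lambda>(b, j). x b j"] show ?thesis
    by (simp add: eval_eq_ev)
qed

lemma multihom_extend_blocks: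
  fixes J :: "'b::finite \<Rightarrow> 'j set"
  assumes p: "multihom J \<delta> p" and J: "\<And>b. finite (J b)"
  shows "multihom (case_sum J K) (\<lambda>b'. \<Sum>b\<in>UNIV. \<delta> b * (if b' = Inl b then 1 else 0)) (extend_blocks p)"
  unfolding extend_blocks_def ev_def
proof (rule multihom_sum)
  fix m assume "m \<in> Poly_Mapping.keys p"
  then have m: "m \<in> monomials J \<delta>"
    using p by (auto simp: multihom_def)
  have S: "finite (Sigma UNIV J)" "Poly_Mapping.keys m \<subseteq> Sigma UNIV J"
    using J m by (auto simp: monomials_def)
  have *: "multihom (case_sum J K) (\<lambda>b'. \<Sum>i\<in>Sigma UNIV J. Poly_Mapping.lookup m i * (if b' = Inl (fst i) then 1 else 0))
      (monom_val (\<lambda>(b, j). mvar (Inl b, j)) m)"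
    unfolding monom_val_superset[OF S]
  proof (intro multihom_prod multihom_power)
    fix i assume "i \<in> Sigma UNIV J"
    then show "multihom (case_sum J K) (\<lambda>b'. if b' = Inl (fst i) then 1 else 0) (case i of (b, j) \<Rightarrow> mvar (Inl b, j))"
      using multihom_mvar[of "snd i" "case_sum J K" "Inl (fst i)"] J by (auto simp: case_prod_beta)
  qed
  have eq: "(\<Sum>i\<in>Sigma UNIV J. Poly_Mapping.lookup m i * (if b' = Inl (fst i) then 1 else 0))
      = (\<Sum>b\<in>UNIV. \<delta> b * (if b' = Inl b then 1 else 0))" for b' :: "'b + 'c"
  proof -
    have "(\<Sum>i\<in>Sigma UNIV J. Poly_Mapping.lookup m i * (if b' = Inl (fst i) then 1 else 0))
        = (\<Sum>b\<in>UNIV. \<Sum>j\<in>J b. Poly_Mapping.lookup m (b, j) * (if b' = Inl b then 1 else 0))"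
      by (subst sum.Sigma) (use J in \<open>auto intro!: sum.cong\<close>)
    also have "\<dots> = (\<Sum>b\<in>UNIV. \<delta> b * (if b' = Inl b then 1 else 0))"
      using m by (intro sum.cong refl) (simp add: monomials_def flip: sum_distrib_right)
    finally show ?thesis .
  qed
  have "multihom (case_sum J K) (\<lambda>b'. 0 + (\<Sum>b\<in>UNIV. \<delta> b * (if b' = Inl b then 1 else 0)))
      (mconst (Poly_Mapping.lookup p m) * monom_val (\<lambda>(b, j). mvar (Inl b, j)) m)"
    by (rule multihom_mult[OF multihom_mconst *[unfolded eq]])
  then show "multihom (case_sum J K) (\<lambda>b'. \<Sum>b\<in>UNIV. \<delta> b * (if b' = Inl b then 1 else 0))
      (mconst (Poly_Mapping.lookup p m) * monom_val (\<lambda>(b, j). mvar (Inl b, j)) m)"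
    by simp
qed

text \<open>\<open>e\<close> is only a bound for the degree and \<open>a\<close> may be 0, so sums
  and products need no hypothesis against cancellation.\<close>

definition top_coeff :: "nat \<Rightarrow> 'a::comm_ring_1 poly \<Rightarrow> 'a \<Rightarrow> bool" where
  "top_coeff e p a \<longleftrightarrow> (\<forall>k>e. coeff p k = 0) \<and> coeff p e = a"

lemma top_coeff_mult:
  assumes "top_coeff e p a" "top_coeff e' q b"
  shows "top_coeff (e + e') (p * q) (a * b)"
proof -
  have "coeff p i * coeff q (k - i) = (if k = e + e' \<and> i = e then a * b else 0)" if "i \<le> k" "e + e' \<le> k" for i k
  proof (cases "i = e \<and> k = e + e'")
    case False
    then have "e < i \<or> e' < k - i"
      using that by auto
    then show ?thesis
      using assms False by (auto simp: top_coeff_def)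
  qed (use assms in \<open>auto simp: top_coeff_def\<close>)
  then have "coeff (p * q) k = (\<Sum>i\<le>k. if k = e + e' \<and> i = e then a * b else 0)" if "e + e' \<le> k" for k
    unfolding coeff_mult using that by (intro sum.cong) auto
  then show ?thesis
    by (simp add: top_coeff_def)
qed

lemma top_coeff_sum:
  "(\<And>i. i \<in> I \<Longrightarrow> top_coeff e (p i) (a i)) \<Longrightarrow> top_coeff e (sum p I) (sum a I)"
  by (simp add: top_coeff_def coeff_sum)

lemma top_coeff_prod:
  "(\<And>i. i \<in> I \<Longrightarrow> top_coeff (e i) (p i) (a i)) \<Longrightarrow> top_coeff (sum e I) (prod p I) (prod a I)"
proof (induction I rule: infinite_finite_induct)
  case (insert i I)
  then show ?case
    using top_coeff_mult[of "e i" "p i" "a i"] by simp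
qed (simp_all add: top_coeff_def coeff_1)

lemma top_coeff_power: "top_coeff e p a \<Longrightarrow> top_coeff (e * k) (p ^ k) (a ^ k)"
  using top_coeff_prod[of "{..<k}" "\<lambda>_. e" "\<lambda>_. p" "\<lambda>_. a"] by (simp add: mult.commute)

text \<open>On the line through \<open>A\<close> with direction \<open>B\<close> a form of total
  degree e takes at infinity its value at \<open>B\<close>.\<close>

lemma top_coeff_line:
  fixes K :: "'c::finite \<Rightarrow> 'j set" and A :: "'c \<times> 'j \<Rightarrow> 'a::comm_ring_1"
  assumes p: "multihom K \<epsilon> p" and K: "\<And>c. finite (K c)"
  shows "top_coeff (\<Sum>c\<in>UNIV. \<epsilon> c) (ev (\<lambda>c. [:\<iota> c:]) p (\<lambda>i. [:A i, B i:])) (ev \<iota> p B)"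
  unfolding ev_def
proof (rule top_coeff_sum)
  fix m assume "m \<in> Poly_Mapping.keys p"
  then have m: "m \<in> monomials K \<epsilon>"
    using p by (auto simp: multihom_def)
  have S: "finite (Sigma UNIV K)" "Poly_Mapping.keys m \<subseteq> Sigma UNIV K"
    using K m by (auto simp: monomials_def)
  have "top_coeff (\<Sum>i\<in>Sigma UNIV K. 1 * Poly_Mapping.lookup m i) (monom_val (\<lambda>i. [:A i, B i:]) m) (monom_val B m)"
    unfolding monom_val_superset[OF S]
    by (intro top_coeff_prod top_coeff_power) (auto simp: top_coeff_def coeff_pCons split: nat.split)
  moreover have "(\<Sum>i\<in>Sigma UNIV K. 1 * Poly_Mapping.lookup m i) = (\<Sum>c\<in>UNIV. \<epsilon> c)"
  proof -
    have "(\<Sum>i\<in>Sigma UNIV K. 1 * Poly_Mapping.lookup m i) = (\<Sum>c\<in>UNIV. \<Sum>j\<in>K c. Poly_Mapping.lookup m (c, j))"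
      by (subst sum.Sigma) (use K in \<open>auto intro!: sum.cong\<close>)
    then show ?thesis
      using m by (simp add: monomials_def)
  qed
  moreover have "top_coeff 0 [:\<iota> (Poly_Mapping.lookup p m):] (\<iota> (Poly_Mapping.lookup p m))"
    by (auto simp: top_coeff_def coeff_pCons split: nat.split)
  ultimately show "top_coeff (\<Sum>c\<in>UNIV. \<epsilon> c) ([:\<iota> (Poly_Mapping.lookup p m):] * monom_val (\<lambda>i. [:A i, B i:]) m)
      (\<iota> (Poly_Mapping.lookup p m) * monom_val B m)"
    using top_coeff_mult[of 0] by fastforce
qed

section \<open>Degenerating conic bundles are not stably rational\<close>

lemma prod_monom: "(\<Prod>i\<in>I. monom (a i) (k i)) = monom (\<Prod>i\<in>I. a i :: 'a::comm_ring_1) (\<Sum>i\<in>I. k i)"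
  by (induction I rule: infinite_finite_induct) (simp_all add: mult_monom monom_0 one_pCons)

context conic_degeneration
begin

abbreviation (input) idx :: "unit + unit \<Rightarrow> nat set" where
  "idx \<equiv> case_sum (PP (n - 1)) (PP 2)"

lemma finite_idx: "finite (idx b)"
  by (cases b) (auto simp: PP_def)

text \<open>The terms of \<open>f\<close> divisible by \<open>y\<^sub>2\<^sup>2\<close>. Unlike \<open>q2\<close> this is a form, so that its nonvanishing is an open condition.\<close>

definition lead :: "((unit + unit) \<times> nat) mpoly" where
  "lead = (\<Sum>m\<in>{m \<in> Poly_Mapping.keys f. Poly_Mapping.lookup m (Inr (), 2) = 2}. Poly_Mapping.single m (Poly_Mapping.lookup f m))"

lemma lookup_lead: "Poly_Mapping.lookup lead m = (if Poly_Mapping.lookup m (Inr (), 2) = 2 then Poly_Mapping.lookup f m else 0)"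
  by (auto simp: lead_def lookup_sum lookup_single when_def in_keys_iff)

lemma keys_lead: "Poly_Mapping.keys lead \<subseteq> Poly_Mapping.keys f"
  by (auto simp: in_keys_iff lookup_lead split: if_splits)

lemma multihom_lead: "multihom idx (case_sum (\<lambda>_. d) (\<lambda>_. 2)) lead"
  using f keys_lead by (auto simp: multihom_def)

text \<open>In generic coordinates a monomial becomes a power of the polynomial variable, with the
  exponent of \<open>y2\<close>. Selecting the monomials with exponent 2 therefore selects
  \<open>q2\<close>.\<close>

lemma pgen_lead: "pgen lead = monom q2 2"
proof -
  let ?v = "pt (\<lambda>i. [:xgen i:]) (yvec [:ygen:] [:0, 1:]) :: _ \<Rightarrow> complex gpoly poly"
  let ?y2 = "(Inr (), 2) :: (unit + unit) \<times> nat"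
  have "\<exists>a. monom_val ?v m = monom a (Poly_Mapping.lookup m ?y2)" if m: "m \<in> Poly_Mapping.keys f" for m
  proof -
    have S: "finite (Sigma UNIV idx)" "Poly_Mapping.keys m \<subseteq> Sigma UNIV idx"
    proof -
      show "finite (Sigma UNIV idx)"
        by (rule finite_SigmaI[OF finite finite_idx])
      show "Poly_Mapping.keys m \<subseteq> Sigma UNIV idx"
        using f m by (auto simp: multihom_def monomials_def)
    qed
    have "\<exists>s. ?v i = monom s (if i = ?y2 then 1 else 0)" if "i \<in> Sigma UNIV idx" for i
    proof -
      obtain b j where i: "i = (b, j)"
        by (cases i)
      show ?thesis
      proof (cases b)
        case (Inl u)
        then show ?thesis
          unfolding i by (intro exI[of _ "xgen j"]) (simp add: monom_0)
      next
        case (Inr u)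
        then have "j = 0 \<or> j = 1 \<or> j = 2"
          using that unfolding i by (auto simp: PP_def)
        then show ?thesis
          unfolding i Inr
          by (elim disjE) (auto simp: yvec_def monom_0 monom_Suc one_pCons intro: exI[of _ 1] exI[of _ ygen])
      qed
    qed
    then obtain s where s: "\<And>i. i \<in> Sigma UNIV idx \<Longrightarrow> ?v i = monom (s i) (if i = ?y2 then 1 else 0)"
      by metis
    have "monom_val ?v m = (\<Prod>i\<in>Sigma UNIV idx. monom (s i ^ Poly_Mapping.lookup m i)
        (if i = ?y2 then Poly_Mapping.lookup m i else 0))"
      unfolding monom_val_superset[OF S] by (intro prod.cong refl) (simp add: s monom_power)
    also have "\<dots> = monom (\<Prod>i\<in>Sigma UNIV idx. s i ^ Poly_Mapping.lookup m i) (Poly_Mapping.lookup m ?y2)"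
      using S(1) by (simp add: prod_monom sum.delta PP_def)
    finally show ?thesis
      by blast
  qed
  then obtain a where a: "\<And>m. m \<in> Poly_Mapping.keys f \<Longrightarrow> monom_val ?v m = monom (a m) (Poly_Mapping.lookup m ?y2)"
    by metis
  have "pgen G = (\<Sum>m\<in>Poly_Mapping.keys f. monom (mconst (Poly_Mapping.lookup G m) * a m) (Poly_Mapping.lookup m ?y2))"
    if "Poly_Mapping.keys G \<subseteq> Poly_Mapping.keys f" for G
    unfolding pgen_def using that
    by (subst ev_superset[of "Poly_Mapping.keys f"]) (auto simp: a smult_monom intro!: sum.cong)
  note pgen = this
  show ?thesis
  proof (rule poly_eqI)
    fix i
    have "coeff (pgen lead) i = (\<Sum>m\<in>Poly_Mapping.keys f. if i = 2 then coeff (monom (mconst (Poly_Mapping.lookup f m) * a m) (Poly_Mapping.lookup m ?y2)) 2 else 0)"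
      unfolding pgen[OF keys_lead] coeff_sum by (intro sum.cong refl) (auto simp: lookup_lead)
    also have "\<dots> = coeff (monom q2 2) i"
      by (simp add: q2_def pgen[OF subset_refl] coeff_sum)
    finally show "coeff (pgen lead) i = coeff (monom q2 2) i" .
  qed
qed

lemma lead_at: "ev (\<lambda>c. c) lead (cpt \<xi> y) = ev (\<lambda>c. c) q2 \<xi> * y\<^sup>2"
proof -
  interpret e: comm_ring_hom "\<lambda>p. ev (\<lambda>c::complex. c) p \<xi>"
    by (rule comm_ring_hom.ev_hom[OF comm_ring_hom_id])
  show ?thesis
    unfolding pgen_at[symmetric] pgen_lead by (simp add: map_poly_monom poly_monom)
qed

text \<open>Supplies the point of the open locus required by \<open>birational_coordinates\<close>.
  A nonzero \<open>y\<close> exists even if \<open>c0\<close> is 0, since the other root is minus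
  \<open>c1\<close> divided by \<open>c2\<close>.\<close>

lemma ex_special_point: "\<exists>y. y \<noteq> 0 \<and> ev (\<lambda>c. c) f (cpt (\<lambda>_. 0) y) = 0 \<and> ev (\<lambda>c. c) lead (cpt (\<lambda>_. 0) y) \<noteq> 0"
proof -
  have c1: "c1 \<noteq> 0"
    using c_red zero_O by auto
  have "\<exists>y. y \<noteq> 0 \<and> c0 + c1 * y + c2 * y\<^sup>2 = 0"
  proof (cases "c0 = 0")
    case True
    then show ?thesis
      using c1 c2_nonzero by (intro exI[of _ "- c1 / c2"]) (simp add: power2_eq_square)
  next
    case False
    obtain y where y: "c0 + c1 * y + c2 * y\<^sup>2 = 0"
      using field_quadratic_root[OF c2_nonzero] by blast
    then have "y \<noteq> 0"
      using False by auto
    with y show ?thesis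
      by blast
  qed
  then obtain y where y: "y \<noteq> 0" "c0 + c1 * y + c2 * y\<^sup>2 = 0"
    by blast
  then have "c2 * y\<^sup>2 \<noteq> 0"
    using c2_nonzero by simp
  with y show ?thesis
    unfolding quadric_at lead_at c0_def[symmetric] c1_def[symmetric] c2_def[symmetric] by (intro exI[of _ y] conjI)
qed

lemma gev_mconst: "gev (mconst c) = fps_const (mconst c)"
  unfolding gev_def by (rule ev_mconst[OF fconst_hom])

lemma gev_mvar: "gev (mvar (Inl (), i)) = em (xgen i)"
  unfolding gev_def ev_mvar_val[OF fconst_hom] by simp

definition fullpt :: "(nat \<Rightarrow> complex) \<Rightarrow> ((unit + unit) \<times> nat \<Rightarrow> complex) \<Rightarrow> (unit + unit) + unit \<Rightarrow> nat \<Rightarrow> complex" where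
  "fullpt zz v = case_sum (\<lambda>b j. if j \<in> idx b then v (b, j) else 0) (\<lambda>_. zz)"

lemma eval_f_fullpt: "Defs.eval f (\<lambda>b. fullpt zz v (Inl b)) = ev (\<lambda>c. c) f v"
proof -
  have "Defs.eval f (\<lambda>b. fullpt zz v (Inl b)) = Defs.eval f (\<lambda>b j. v (b, j))"
    by (rule eval_cong[OF f]) (simp add: fullpt_def)
  then show ?thesis
    by (simp add: eval_eq_ev)
qed

lemma fullpt_cpt_hom_vectors:
  assumes "\<And>j. j \<notin> PP l () \<Longrightarrow> zz j = 0" "\<exists>j\<in>PP l (). zz j \<noteq> 0"
  shows "fullpt zz (cpt \<xi> y) \<in> hom_vectors (case_sum idx (PP l))"
  unfolding hom_vectors_def
proof (intro CollectI allI)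
  fix b :: "(unit + unit) + unit"
  show "(\<exists>j\<in>case_sum idx (PP l) b. fullpt zz (cpt \<xi> y) b j \<noteq> 0) \<and>
      (\<forall>j. j \<notin> case_sum idx (PP l) b \<longrightarrow> fullpt zz (cpt \<xi> y) b j = 0)"
  proof (cases b)
    case (Inl b')
    show ?thesis
    proof (cases b')
      case (Inl u)
      then show ?thesis
        unfolding \<open>b = Inl b'\<close> by (auto simp: fullpt_def cpt_def PP_def intro!: bexI[of _ 0])
    next
      case (Inr u)
      then show ?thesis
        unfolding \<open>b = Inl b'\<close> by (auto simp: fullpt_def cpt_def PP_def yvec_def intro!: bexI[of _ 1])
    qed
  next
    case (Inr u)
    then show ?thesis
      using assms by (auto simp: fullpt_def)
  qed
qed

text \<open>The forbidden curve is the image, under the inverse map, of a line in the target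
  projective space: the line joining the images of the generic point and of one fixed point. The
  auxiliary factor is frozen at the coordinates of the fixed point.\<close>

theorem not_birational:
  "\<not> birational (case_sum idx (PP l)) (proj_prod (hypersurface idx f) (multiproj (PP l))) (PP N) (multiproj (PP N))"
proof
  let ?J = "case_sum idx (PP l)" and ?K = "PP N"
  let ?X = "proj_prod (hypersurface idx f) (multiproj (PP l))"
  assume bir: "birational ?J ?X ?K (multiproj ?K)"

  \<comment> \<open>A fixed point in the domain of the birational map\<close>
  have J: "finite (?J b)" for b
    by (cases b) (auto simp: finite_idx PP_def)
  have K: "finite (?K c)" for c
    by (simp add: PP_def)
  let ?x0 = "(Inl (), 0) :: (unit + unit) \<times> nat" and ?y1 = "(Inr (), 1) :: (unit + unit) \<times> nat"
  \<comment> \<open>The two variables put the fixed point into the chart of \<open>cpt\<close>;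
    \<open>lead\<close> ensures that \<open>q2\<close> does not vanish there, as
    \<open>gev_zero_at\<close> requires.\<close>
  define p0 where "p0 = (extend_blocks (mvar ?x0 * (mvar ?y1 * lead)) :: (((unit + unit) + unit) \<times> nat) mpoly)"
  have mv: "multihom idx (\<lambda>b. if b = Inl () then 1 else 0) (mvar ?x0)" "multihom idx (\<lambda>b. if b = Inr () then 1 else 0) (mvar ?y1)"
    by (rule multihom_mvar; simp add: PP_def)+
  obtain \<delta>0 where \<delta>0: "multihom ?J \<delta>0 p0"
    unfolding p0_def
    using multihom_extend_blocks[OF multihom_mult[OF mv(1) multihom_mult[OF mv(2) multihom_lead]] finite_idx, of "PP l"] by blast
  have eval_p0: "Defs.eval p0 v = v (Inl (Inl ())) 0 * (v (Inl (Inr ())) 1 * Defs.eval lead (\<lambda>b. v (Inl b)))" for v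
    unfolding p0_def eval_extend_blocks eval_mult eval_mvar ..
  have eval_lead: "Defs.eval lead (\<lambda>b. fullpt zz v (Inl b)) = ev (\<lambda>c. c) lead v" for zz v
  proof -
    have "Defs.eval lead (\<lambda>b. fullpt zz v (Inl b)) = Defs.eval lead (\<lambda>b j. v (b, j))"
      by (rule eval_cong[OF multihom_lead]) (simp add: fullpt_def)
    then show ?thesis
      by (simp add: eval_eq_ev)
  qed
  obtain R where R: "R \<in> ?X" "\<forall>x\<in>R. Defs.eval p0 x \<noteq> 0"
  proof -
    obtain y where y: "y \<noteq> 0" "ev (\<lambda>c. c) f (cpt (\<lambda>_. 0) y) = 0" "ev (\<lambda>c. c) lead (cpt (\<lambda>_. 0) y) \<noteq> 0"
      using ex_special_point by blast
    let ?z = "\<lambda>j::nat. if j \<le> l then 1 else 0 :: complex"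
    let ?v = "fullpt ?z (cpt (\<lambda>_. 0) y)"
    have "?v \<in> hom_vectors ?J"
      by (rule fullpt_cpt_hom_vectors) (auto simp: PP_def)
    then have 1: "proj_point ?v \<in> ?X"
      by (rule proj_prod_memI[OF f finite_idx]) (simp add: eval_f_fullpt y(2))
    have "Defs.eval p0 ?v \<noteq> 0"
      unfolding eval_p0 eval_lead using y(3) by (simp add: fullpt_def cpt_def PP_def yvec_def)
    then have "\<forall>x\<in>proj_point ?v. Defs.eval p0 x \<noteq> 0"
      using nonvanishing[OF \<delta>0 J] by blast
    with 1 show thesis
      by (rule that)
  qed
  obtain P p q \<Phi> \<delta>p \<delta>q \<delta> \<epsilon> \<Psi> where
    P: "P \<in> ?X" "\<forall>x\<in>P. Defs.eval p0 x \<noteq> 0" "\<forall>x\<in>P. Defs.eval p x \<noteq> 0" "\<forall>x\<in>P. Defs.eval q (coords ?K \<Phi> x) \<noteq> 0"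
    and pq: "multihom ?J \<delta>p p" "multihom ?K \<delta>q q"
    and \<Phi>: "\<And>c k. k \<in> ?K c \<Longrightarrow> multihom ?J (\<delta> c) (\<Phi> c k)" and \<Psi>: "\<And>b j. j \<in> ?J b \<Longrightarrow> multihom ?K (\<epsilon> b) (\<Psi> b j)"
    and \<Phi>_K: "\<And>Q x. Q \<in> ?X \<Longrightarrow> x \<in> Q \<Longrightarrow> Defs.eval p x \<noteq> 0 \<Longrightarrow> coords ?K \<Phi> x \<in> hom_vectors ?K"
    and inv: "\<And>Q x. Q \<in> ?X \<Longrightarrow> x \<in> Q \<Longrightarrow> Defs.eval p x \<noteq> 0 \<Longrightarrow> Defs.eval q (coords ?K \<Phi> x) \<noteq> 0 \<Longrightarrow>
      x \<in> proj_point (coords ?J \<Psi> (coords ?K \<Phi> x))"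
    and \<Psi>_X: "\<And>zz. zz \<in> hom_vectors ?K \<Longrightarrow> Defs.eval q zz \<noteq> 0 \<Longrightarrow> proj_point (coords ?J \<Psi> zz) \<in> ?X"
    by (rule birational_coordinates[OF J K proj_prod_subset[OF f finite_idx] bir \<delta>0 R]) (rule that; assumption)
  obtain v1 where v1: "v1 \<in> P"
  proof -
    have "P \<in> multiproj ?J"
      using P(1) proj_prod_subset[OF f finite_idx] by blast
    then obtain v where "P = proj_point v"
      by (auto simp: multiproj_def)
    then show thesis
      using that proj_point_self[of v] by simp
  qed
  have v1_nz: "v1 (Inl (Inl ())) 0 \<noteq> 0" "v1 (Inl (Inr ())) 1 \<noteq> 0"
    using bspec[OF P(2) v1] unfolding eval_p0 by simp_all
  define c where "c b = (case b of Inl (Inl _) \<Rightarrow> inverse (v1 (Inl (Inl ())) 0) | Inl (Inr _) \<Rightarrow> inverse (v1 (Inl (Inr ())) 1) | Inr _ \<Rightarrow> 1)"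
    for b :: "(unit + unit) + unit"
  define v0 where "v0 = (\<lambda>b j. c b * v1 b j)"
  have "v0 \<in> proj_point v1"
    unfolding proj_point_def v0_def
  proof (intro CollectI exI conjI allI)
    show "c b \<noteq> 0" for b
      using v1_nz by (auto simp: c_def split: sum.split)
  qed simp
  then have v0P: "v0 \<in> P"
    using proj_prod_memD(3)[OF f finite_idx P(1) v1] by simp
  have v0: "v0 \<in> hom_vectors ?J" "Defs.eval f (\<lambda>b. v0 (Inl b)) = 0"
    using proj_prod_memD(1,2)[OF f finite_idx P(1) v0P] .
  have v0_1: "v0 (Inl (Inl ())) 0 = 1" "v0 (Inl (Inr ())) 1 = 1"
    using v1_nz by (simp_all add: v0_def c_def)
  define zz where "zz = v0 (Inr ())"
  define \<xi>0 where "\<xi>0 i = (if i = 0 then v0 (Inl (Inr ())) 0 else v0 (Inl (Inl ())) i) - 1" for i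
  define u0 where "u0 = cpt \<xi>0 (v0 (Inl (Inr ())) 2)"
  have v0_hv: "(\<exists>j\<in>?J b. v0 b j \<noteq> 0) \<and> (\<forall>j. j \<notin> ?J b \<longrightarrow> v0 b j = 0)" for b
    by (rule CollectD[OF v0(1)[unfolded hom_vectors_def], THEN spec])
  have zz: "\<And>j. j \<notin> PP l () \<Longrightarrow> zz j = 0" "\<exists>j\<in>PP l (). zz j \<noteq> 0"
    using v0_hv[of "Inr ()"] by (simp_all add: zz_def)
  have full_u0: "fullpt zz u0 = v0"
  proof (intro ext)
    fix b :: "(unit + unit) + unit" and j
    show "fullpt zz u0 b j = v0 b j"
    proof (cases b)
      case (Inr u)
      then show ?thesis
        by (simp add: fullpt_def zz_def)
    next
      case (Inl b')
      have out: "v0 (Inl b') j = 0" if "j \<notin> idx b'"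
        using v0_hv[of "Inl b'"] that by simp
      have "u0 (b', j) = v0 (Inl b') j" if "j \<in> idx b'"
      proof (cases b')
        case (Inl u)
        then show ?thesis
          using v0_1 by (simp add: u0_def cpt_def \<xi>0_def)
      next
        case (Inr u)
        then have "j = 0 \<or> j = 1 \<or> j = 2"
          using that by (auto simp: PP_def)
        then show ?thesis
          using v0_1 Inr by (auto simp: u0_def cpt_def \<xi>0_def yvec_def)
      qed
      then show ?thesis
        using out by (auto simp: Inl fullpt_def)
    qed
  qed
  have f_u0: "ev (\<lambda>c. c) f u0 = 0"
    using v0(2) eval_f_fullpt[of zz u0] by (simp add: full_u0)
  have q2_u0: "ev (\<lambda>c. c) q2 \<xi>0 \<noteq> 0"
  proof -
    have "ev (\<lambda>c. c) lead u0 \<noteq> 0"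
      using bspec[OF P(2) v0P] eval_lead[of zz u0] unfolding eval_p0 full_u0 by simp
    then show ?thesis
      unfolding u0_def lead_at by simp
  qed
  have gev_nz: "gev G \<noteq> 0" if "ev (\<lambda>c. c) G u0 \<noteq> 0" for G
    using gev_zero_at[of G \<xi>0] f_u0 q2_u0 that unfolding u0_def by blast

  \<comment> \<open>Restriction of the map to a slice of the product\<close>
  define fix_z where "fix_z G = ev mconst G (\<lambda>(b, j). case b of Inl b' \<Rightarrow> mvar (b', j) | Inr _ \<Rightarrow> mconst (zz j))"
    for G :: "(((unit + unit) + unit) \<times> nat) mpoly"
  have ev_fix_z: "ev (\<lambda>c. c) (fix_z G) v = Defs.eval G (fullpt zz v)" if "multihom ?J \<eta> G" for G \<eta> v
  proof -
    have "ev (\<lambda>c. c) (fix_z G) v = ev (\<lambda>c. c) G (\<lambda>(b, j). case b of Inl b' \<Rightarrow> v (b', j) | Inr _ \<Rightarrow> zz j)"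
      unfolding fix_z_def comm_ring_hom.ev_commute[OF comm_ring_hom.ev_hom[OF comm_ring_hom_id]] ev_mconst[OF comm_ring_hom_id]
      by (intro arg_cong[where f = "ev (\<lambda>c. c) G"] ext)
        (auto simp: ev_mconst[OF comm_ring_hom_id] ev_mvar_val[OF comm_ring_hom_id] split: sum.split)
    also have "\<dots> = Defs.eval G (\<lambda>b j. case b of Inl b' \<Rightarrow> v (b', j) | Inr _ \<Rightarrow> zz j)"
      by (simp add: eval_eq_ev)
    also have "\<dots> = Defs.eval G (fullpt zz v)"
      by (rule eval_cong[OF that]) (auto simp: fullpt_def split: sum.split)
    finally show ?thesis .
  qed
  define \<phi> where "\<phi> k = (if k \<in> ?K () then fix_z (\<Phi> () k) else 0)" for k
  have ev_\<phi>: "ev (\<lambda>c. c) (\<phi> k) v = coords ?K \<Phi> (fullpt zz v) () k" for k v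
    using ev_fix_z[OF \<Phi>[of k "()"]] by (simp add: \<phi>_def coords_def)
  define sub where "sub G = ev mconst G (\<lambda>(_, k). \<phi> k)" for G :: "(unit \<times> nat) mpoly"
  have ev_sub: "ev (\<lambda>c. c) (sub G) v = Defs.eval G (coords ?K \<Phi> (fullpt zz v))" for G v
    unfolding sub_def comm_ring_hom.ev_commute[OF comm_ring_hom.ev_hom[OF comm_ring_hom_id]] ev_mconst[OF comm_ring_hom_id] eval_eq_ev
    by (simp add: case_prod_unfold ev_\<phi>)
  define w0 where "w0 = coords ?K \<Phi> v0"
  have w0: "w0 \<in> hom_vectors ?K" "Defs.eval q w0 \<noteq> 0"
    unfolding w0_def using \<Phi>_K[OF P(1) v0P] P(3,4) v0P by blast+
  have ev_sub_u0: "ev (\<lambda>c. c) (sub G) u0 = Defs.eval G w0" for G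
    unfolding ev_sub full_u0 w0_def ..
  \<comment> \<open>On the locus of nonvanishing \<open>T\<close> the two maps are defined and
    compose to the identity. As a factor it confines identities at closed points to this locus, and
    it cancels at the generic point.\<close>
  define T where "T = fix_z p * sub q"
  have ev_T: "ev (\<lambda>c. c) T v = Defs.eval p (fullpt zz v) * Defs.eval q (coords ?K \<Phi> (fullpt zz v))" for v
    unfolding T_def comm_ring_hom.ev_mult[OF comm_ring_hom_id] ev_fix_z[OF pq(1)] ev_sub ..
  have gev_T: "gev T \<noteq> 0"
    by (rule gev_nz) (use P(3,4) v0P in \<open>simp add: ev_T full_u0\<close>)
  have point: "\<exists>c. \<forall>b j. fullpt zz (cpt \<xi> y) b j = c b * coords ?J \<Psi> (coords ?K \<Phi> (fullpt zz (cpt \<xi> y))) b j"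
    if "ev (\<lambda>c. c) f (cpt \<xi> y) = 0" "ev (\<lambda>c. c) T (cpt \<xi> y) \<noteq> 0" for \<xi> y
  proof -
    let ?v = "fullpt zz (cpt \<xi> y)"
    have "?v \<in> hom_vectors ?J"
      by (rule fullpt_cpt_hom_vectors[OF zz])
    then have "proj_point ?v \<in> ?X"
      by (rule proj_prod_memI[OF f finite_idx]) (simp add: eval_f_fullpt that(1))
    moreover have "Defs.eval p ?v \<noteq> 0" "Defs.eval q (coords ?K \<Phi> ?v) \<noteq> 0"
      using that(2) unfolding ev_T by simp_all
    ultimately have "?v \<in> proj_point (coords ?J \<Psi> (coords ?K \<Phi> ?v))"
      using inv proj_point_self by blast
    then obtain c where "?v = (\<lambda>b j. c b * coords ?J \<Psi> (coords ?K \<Phi> ?v) b j)"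
      by (rule proj_pointE)
    then have "\<forall>b j. ?v b j = c b * coords ?J \<Psi> (coords ?K \<Phi> ?v) b j"
      by (metis (no_types, lifting))
    then show ?thesis
      by blast
  qed

  \<comment> \<open>The composite of the two maps at the generic point\<close>
  let ?bx = "Inl (Inl ()) :: (unit + unit) + unit" and ?by = "Inl (Inr ()) :: (unit + unit) + unit"
  have bottom: "gev (sub (\<Psi> ?bx i)) = gev (sub (\<Psi> ?bx 0)) * em (xgen i)" if i: "i < n" for i
  proof -
    interpret gev: comm_ring_hom gev
      by (rule gev_hom)
    \<comment> \<open>Proportionality of the composite to the original point, cross-multiplied with
      the coordinate at 0, which is 1 on the chart.\<close>
    let ?G = "(sub (\<Psi> ?bx i) - mvar (Inl (), i) * sub (\<Psi> ?bx 0)) * T"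
    interpret id: comm_ring_hom "\<lambda>p :: ((unit + unit) \<times> nat) mpoly. ev (\<lambda>c. c) p v" for v
      by (rule comm_ring_hom.ev_hom[OF comm_ring_hom_id])
    have "gev ?G = 0"
    proof (rule gev_zero_if)
      fix \<xi> y
      assume *: "ev (\<lambda>c. c) f (cpt \<xi> y) = 0"
      show "ev (\<lambda>c. c) ?G (cpt \<xi> y) = 0"
      proof (cases "ev (\<lambda>c. c) T (cpt \<xi> y) = 0")
        case False
        from point[OF * False] obtain c where c: "\<And>b j. fullpt zz (cpt \<xi> y) b j = c b * coords ?J \<Psi> (coords ?K \<Phi> (fullpt zz (cpt \<xi> y))) b j"
          by blast
        have co: "coords ?J \<Psi> w ?bx j = Defs.eval (\<Psi> ?bx j) w" if "j < n" for j w
          using that by (simp add: coords_def PP_def)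
        have full: "fullpt zz (cpt \<xi> y) ?bx j = cpt \<xi> y (Inl (), j)" if "j < n" for j
          using that by (simp add: fullpt_def PP_def)
        have "cpt \<xi> y (Inl (), 0) = 1"
          by (simp add: cpt_def)
        then have 0: "c ?bx * ev (\<lambda>c. c) (sub (\<Psi> ?bx 0)) (cpt \<xi> y) = 1"
          using c[of ?bx 0] n_ge by (simp add: ev_sub co full del: One_nat_def)
        have 1: "cpt \<xi> y (Inl (), i) = c ?bx * ev (\<lambda>c. c) (sub (\<Psi> ?bx i)) (cpt \<xi> y)"
          using c[of ?bx i] i by (simp add: ev_sub co full del: One_nat_def)
        have "ev (\<lambda>c. c) (sub (\<Psi> ?bx i)) (cpt \<xi> y) = cpt \<xi> y (Inl (), i) * ev (\<lambda>c. c) (sub (\<Psi> ?bx 0)) (cpt \<xi> y)"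
          unfolding 1 using 0 by (simp add: mult.commute mult.left_commute)
        then show ?thesis
          by (simp add: id.hom_mult id.hom_minus ev_mvar_val[OF comm_ring_hom_id])
      qed (simp add: id.hom_mult)
    qed
    then have "gev (sub (\<Psi> ?bx i)) - em (xgen i) * gev (sub (\<Psi> ?bx 0)) = 0"
      using gev_T by (simp add: gev.hom_mult gev.hom_minus gev_mvar)
    then show ?thesis
      by (simp add: mult.commute)
  qed
  have \<Psi>_nz: "Defs.eval (\<Psi> ?bx 0) w0 \<noteq> 0" "Defs.eval (\<Psi> ?by 1) w0 \<noteq> 0"
  proof -
    have "v0 \<in> proj_point (coords ?J \<Psi> w0)"
      using inv[OF P(1) v0P] P(3,4) v0P unfolding w0_def by blast
    then obtain c where "v0 = (\<lambda>b j. c b * coords ?J \<Psi> w0 b j)"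
      by (rule proj_pointE)
    then have "v0 ?bx 0 = c ?bx * coords ?J \<Psi> w0 ?bx 0" "v0 ?by 1 = c ?by * coords ?J \<Psi> w0 ?by 1"
      by (metis (no_types, lifting))+
    then show "Defs.eval (\<Psi> ?bx 0) w0 \<noteq> 0" "Defs.eval (\<Psi> ?by 1) w0 \<noteq> 0"
      using v0_1 by (auto simp: coords_def PP_def)
  qed

  \<comment> \<open>The line in the target and its image curve\<close>
  define blk where "blk b = (Inl (if b then Inl () else Inr ()) :: (unit + unit) + unit)" for b
  \<comment> \<open>The line passes through the image of the generic point at parameter 0 and
    through \<open>w0\<close> at infinity.\<close>
  define \<Gamma> where "\<Gamma> b i = ev (\<lambda>c. [:mconst c:]) (\<Psi> (blk b) i) (\<lambda>(_, k). [:\<phi> k, mconst (w0 () k):])" for b i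
  have \<Gamma>_0: "coeff (\<Gamma> b i) 0 = sub (\<Psi> (blk b) i)" for b i
  proof -
    have "poly (\<Gamma> b i) 0 = sub (\<Psi> (blk b) i)"
      unfolding \<Gamma>_def sub_def comm_ring_hom.ev_commute[OF poly_hom] by (simp add: case_prod_unfold)
    then show ?thesis
      by (simp add: poly_0_coeff_0)
  qed
  have \<Gamma>_top: "top_coeff (\<epsilon> ?bx ()) (\<Gamma> True i) (mconst (Defs.eval (\<Psi> ?bx i) w0))" if "i < n" for i
  proof -
    have "multihom ?K (\<epsilon> ?bx) (\<Psi> ?bx i)"
      using \<Psi>[of i ?bx] that by (simp add: PP_def)
    from top_coeff_line[OF this K, of mconst "\<lambda>(_, k). \<phi> k" "\<lambda>(_, k). mconst (w0 () k)"]
    moreover have "(\<Sum>c\<in>(UNIV :: unit set). \<epsilon> ?bx c) = \<epsilon> ?bx ()"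
      by (simp add: UNIV_unit)
    ultimately have "top_coeff (\<epsilon> ?bx ()) (\<Gamma> True i) (ev mconst (\<Psi> ?bx i) (\<lambda>(_, k). mconst (w0 () k)))"
      by (simp only: \<Gamma>_def blk_def if_True case_prod_unfold)
    moreover have "ev mconst (\<Psi> ?bx i) (\<lambda>(_, k). mconst (w0 () k)) = (mconst (Defs.eval (\<Psi> ?bx i) w0) :: ((unit + unit) \<times> nat) mpoly)"
      unfolding eval_eq_ev comm_ring_hom.ev_commute[OF mconst_hom] by (simp add: case_prod_unfold)
    ultimately show ?thesis
      by (simp only:)
  qed
  let ?\<iota> = "\<lambda>c::complex. [:fps_const (mconst c):] :: complex gpoly fps poly"
  have \<iota>: "comm_ring_hom ?\<iota>"
    by (rule comm_ring_hom_comp[OF pCons_hom fconst_hom])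
  define Z where "Z = (\<lambda>(_::unit, k). [:gev (\<phi> k), fps_const (mconst (w0 () k)):])"
  have \<Gamma>_gev: "map_poly gev (\<Gamma> b i) = ev ?\<iota> (\<Psi> (blk b) i) Z" for b i
    unfolding \<Gamma>_def comm_ring_hom.ev_commute[OF map_poly_hom[OF gev_hom]]
    by (simp add: case_prod_unfold map_poly_simps[OF gev_hom] gev_mconst Z_def)
  have vanish: "ev ?\<iota> f (pt (\<lambda>i. map_poly gev (\<Gamma> True i)) (\<lambda>i. map_poly gev (\<Gamma> False i))) = 0"
  proof -
    obtain k0 where k0: "k0 \<in> ?K ()" "w0 () k0 \<noteq> 0"
      using w0(1) by (auto simp: hom_vectors_def)
    define \<psi> where "\<psi> = (\<lambda>(b, j). if j \<in> idx b then \<Psi> (Inl b) j else 0)"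
    \<comment> \<open>The inverse map lands in the hypersurface wherever \<open>q\<close> is
      nonzero, and the variable at \<open>k0\<close> keeps the argument away from the zero vector.
      Multiplied by both, this is a polynomial identity and can be specialised to the line.\<close>
    have comp: "mvar ((), k0) * (q * ev mconst f \<psi>) = 0"
    proof (rule mpoly_identity)
      fix x :: "unit \<times> nat \<Rightarrow> complex"
      interpret id: comm_ring_hom "\<lambda>p :: (unit \<times> nat) mpoly. ev (\<lambda>c. c) p x"
        by (rule comm_ring_hom.ev_hom[OF comm_ring_hom_id])
      let ?z = "\<lambda>c k. if k \<in> ?K c then x (c, k) else 0"
      have cut: "ev (\<lambda>c. c) G x = Defs.eval G ?z" if "multihom ?K \<eta> G" for G \<eta>
      proof -
        have "Defs.eval G ?z = Defs.eval G (\<lambda>c k. x (c, k))"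
          by (rule eval_cong[OF that]) simp
        moreover have "(\<lambda>(c, k). x (c, k)) = x"
          by auto
        ultimately show ?thesis
          unfolding eval_eq_ev by (simp only:)
      qed
      have "ev (\<lambda>c. c) (ev mconst f \<psi>) x = 0" if "x ((), k0) \<noteq> 0" "ev (\<lambda>c. c) q x \<noteq> 0"
      proof -
        have "?z \<in> hom_vectors ?K"
          using that(1) k0(1) by (auto simp: hom_vectors_def)
        then have "proj_point (coords ?J \<Psi> ?z) \<in> ?X"
          using \<Psi>_X that(2) cut[OF pq(2)] by simp
        from proj_prod_memD(2)[OF f finite_idx this proj_point_self]
        have "Defs.eval f (\<lambda>b. coords ?J \<Psi> ?z (Inl b)) = 0" .
        moreover have "(\<lambda>i. ev (\<lambda>c. c) (\<psi> i) x) = (\<lambda>(b, j). coords ?J \<Psi> ?z (Inl b) j)"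
        proof
          fix i :: "(unit + unit) \<times> nat"
          obtain b j where i: "i = (b, j)"
            by (cases i)
          have "ev (\<lambda>c. c) (\<Psi> (Inl b) j) x = Defs.eval (\<Psi> (Inl b) j) ?z" if "j \<in> idx b"
            using cut[OF \<Psi>[of j "Inl b"]] that by simp
          then show "ev (\<lambda>c. c) (\<psi> i) x = (case i of (b, j) \<Rightarrow> coords ?J \<Psi> ?z (Inl b) j)"
            by (auto simp: i \<psi>_def coords_def simp del: One_nat_def)
        qed
        ultimately show ?thesis
          unfolding comm_ring_hom.ev_commute[OF id.comm_ring_hom_axioms] ev_mconst[OF comm_ring_hom_id] eval_eq_ev
          by simp
      qed
      then show "ev (\<lambda>c. c) (mvar ((), k0) * (q * ev mconst f \<psi>)) x = 0"
        by (auto simp: id.hom_mult ev_mvar_val[OF comm_ring_hom_id])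
    qed
    interpret \<theta>: comm_ring_hom "\<lambda>p :: (unit \<times> nat) mpoly. ev ?\<iota> p Z"
      by (rule comm_ring_hom.ev_hom[OF \<iota>])
    have "Z ((), k0) * (ev ?\<iota> q Z * ev ?\<iota> (ev mconst f \<psi>) Z) = 0"
      using arg_cong[OF comp, of "\<lambda>p. ev ?\<iota> p Z"]
      by (simp only: \<theta>.hom_mult \<theta>.hom_zero ev_mvar_val[OF \<iota>])
    moreover have "Z ((), k0) \<noteq> 0"
    proof -
      have "gev (\<phi> k0) \<noteq> 0"
        by (rule gev_nz) (use k0(2) in \<open>simp add: ev_\<phi> full_u0 w0_def\<close>)
      then show ?thesis
        by (simp add: Z_def)
    qed
    moreover have "ev ?\<iota> q Z \<noteq> 0"
    proof -
      have "poly (ev ?\<iota> q Z) 0 = gev (sub q)"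
        unfolding sub_def comm_ring_hom.ev_commute[OF poly_hom] comm_ring_hom.ev_commute[OF gev_hom]
        by (simp add: case_prod_unfold Z_def gev_mconst)
      moreover have "gev (sub q) \<noteq> 0"
        by (rule gev_nz) (simp add: ev_sub_u0 w0(2))
      ultimately show ?thesis
        by auto
    qed
    ultimately have "ev ?\<iota> (ev mconst f \<psi>) Z = 0"
      by simp
    then have "ev ?\<iota> f (\<lambda>i. ev ?\<iota> (\<psi> i) Z) = 0"
      unfolding comm_ring_hom.ev_commute[OF \<theta>.comm_ring_hom_axioms] ev_mconst[OF \<iota>] .
    moreover have "ev ?\<iota> f (pt (\<lambda>i. map_poly gev (\<Gamma> True i)) (\<lambda>i. map_poly gev (\<Gamma> False i))) = ev ?\<iota> f (\<lambda>i. ev ?\<iota> (\<psi> i) Z)"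
    proof (rule ev_cong)
      fix i m assume m: "m \<in> Poly_Mapping.keys f" "i \<in> Poly_Mapping.keys m"
      then have "i \<in> Sigma UNIV idx"
        using f by (auto simp: multihom_def monomials_def)
      moreover obtain b j where "i = (b, j)"
        by (cases i)
      ultimately show "pt (\<lambda>i. map_poly gev (\<Gamma> True i)) (\<lambda>i. map_poly gev (\<Gamma> False i)) i = ev ?\<iota> (\<psi> i) Z"
        by (cases b) (simp_all add: \<Gamma>_gev blk_def \<psi>_def)
    qed
    ultimately show ?thesis
      by simp
  qed

  \<comment> \<open>The curve joins the generic point to a constant point\<close>
  show False
  proof (rule no_curve[OF vanish, where a = "gev (sub (\<Psi> ?bx 0))" and ?i0.0 = 1 and e = "\<epsilon> ?bx ()"
        and ?x1.0 = "\<lambda>i. Defs.eval (\<Psi> ?bx i) w0"])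
    show "gev (sub (\<Psi> ?bx 0)) \<noteq> 0"
      by (rule gev_nz) (simp add: ev_sub_u0 \<Psi>_nz)
    show "gev (coeff (\<Gamma> True i) 0) = gev (sub (\<Psi> ?bx 0)) * em (xgen i)" if "i < n" for i
      unfolding \<Gamma>_0 using bottom[OF that] by (simp add: blk_def)
    show "map_poly gev (\<Gamma> False 1) \<noteq> 0"
    proof -
      have "gev (sub (\<Psi> ?by 1)) \<noteq> 0"
        by (rule gev_nz) (use \<Psi>_nz in \<open>simp add: ev_sub_u0\<close>)
      moreover have "coeff (map_poly gev (\<Gamma> False 1)) 0 = gev (sub (\<Psi> ?by 1))"
      proof -
        interpret gev: comm_ring_hom gev
          by (rule gev_hom)
        show ?thesis
          by (simp add: coeff_map_poly \<Gamma>_0 blk_def del: One_nat_def)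
      qed
      ultimately show ?thesis
        by auto
    qed
    show "coeff (\<Gamma> True i) k = 0" if "i < n" "\<epsilon> ?bx () < k" for i k
      using \<Gamma>_top[OF that(1)] that(2) by (simp add: top_coeff_def)
    show "coeff (\<Gamma> True i) (\<epsilon> ?bx ()) = mconst (Defs.eval (\<Psi> ?bx i) w0)" if "i < n" for i
      using \<Gamma>_top[OF that] by (simp add: top_coeff_def)
    show "\<exists>i<n. Defs.eval (\<Psi> ?bx i) w0 \<noteq> 0"
      using \<Psi>_nz n_ge by (intro exI[of _ 0]) simp
  qed simp
qed

corollary not_stably_rational: "\<not> stably_rational idx (hypersurface idx f)"
  unfolding stably_rational_def using not_birational by blast

end

section \<open>The very general hypersurface\<close>

text \<open>Makes the integer forms in the coefficients countable: a finitely supported map is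
  determined by its finite graph.\<close>

instance poly_mapping :: (countable, "{zero, countable}") countable
proof
  let ?g = "\<lambda>p::'a \<Rightarrow>\<^sub>0 'b. (\<lambda>k. (k, Poly_Mapping.lookup p k)) ` Poly_Mapping.keys p"
  have "inj ?g"
  proof (rule injI, rule poly_mapping_eqI)
    fix p q :: "'a \<Rightarrow>\<^sub>0 'b" and k
    assume eq: "?g p = ?g q"
    have mem: "(k, v) \<in> ?g r \<longleftrightarrow> v \<noteq> 0 \<and> v = Poly_Mapping.lookup r k" for r v
      by (auto simp: in_keys_iff)
    have "v \<noteq> 0 \<and> v = Poly_Mapping.lookup p k \<longleftrightarrow> v \<noteq> 0 \<and> v = Poly_Mapping.lookup q k" for v
      unfolding mem[of v p, symmetric] mem[of v q, symmetric] eq ..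
    then show "Poly_Mapping.lookup p k = Poly_Mapping.lookup q k"
      by metis
  qed
  moreover have "countable (range ?g)"
    by (rule countable_subset[OF _ countable_Collect_finite]) auto
  ultimately have "countable (UNIV :: ('a \<Rightarrow>\<^sub>0 'b) set)"
    using countable_image_inj_on by blast
  then show "\<exists>to_nat::('a \<Rightarrow>\<^sub>0 'b) \<Rightarrow> nat. inj to_nat"
    by (rule countableE) (rule exI)
qed

lemma finite_monomials:
  fixes J :: "'b::finite \<Rightarrow> 'j set"
  assumes J: "\<And>b. finite (J b)"
  shows "finite (monomials J \<delta>)"
proof (rule finite_imageD)
  have le: "Poly_Mapping.lookup m (b, j) \<le> (\<Sum>b\<in>UNIV. \<delta> b)" if m: "m \<in> monomials J \<delta>" for m b j
  proof (cases "j \<in> J b")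
    case True
    then have "Poly_Mapping.lookup m (b, j) \<le> (\<Sum>j\<in>J b. Poly_Mapping.lookup m (b, j))"
      using J by (intro member_le_sum) auto
    also have "\<dots> = \<delta> b"
      using m by (simp add: monomials_def)
    also have "\<dots> \<le> (\<Sum>b\<in>UNIV. \<delta> b)"
      by (rule member_le_sum) auto
    finally show ?thesis .
  next
    case False
    then have "(b, j) \<notin> Poly_Mapping.keys m"
      using m by (auto simp: monomials_def)
    then show ?thesis
      by (simp add: in_keys_iff)
  qed
  have "Poly_Mapping.lookup ` monomials J \<delta>
      \<subseteq> {g. \<forall>i. (i \<in> Sigma UNIV J \<longrightarrow> g i \<in> {..\<Sum>b\<in>UNIV. \<delta> b}) \<and> (i \<notin> Sigma UNIV J \<longrightarrow> g i = 0)}"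
  proof (intro subsetI CollectI allI conjI impI)
    fix g i assume "g \<in> Poly_Mapping.lookup ` monomials J \<delta>"
    then obtain m where m: "m \<in> monomials J \<delta>" "g = Poly_Mapping.lookup m"
      by blast
    show "g i \<in> {..\<Sum>b\<in>UNIV. \<delta> b}"
      using le[OF m(1)] by (cases i) (simp add: m(2))
    show "g i = 0" if "i \<notin> Sigma UNIV J"
    proof -
      have "i \<notin> Poly_Mapping.keys m"
        using m(1) that by (auto simp: monomials_def)
      then show ?thesis
        by (simp add: m(2) in_keys_iff)
    qed
  qed
  then show "finite (Poly_Mapping.lookup ` monomials J \<delta>)"
    by (rule finite_subset) (intro finite_set_of_finite_funs finite_SigmaI J finite finite_atMost)
  show "inj_on Poly_Mapping.lookup (monomials J \<delta>)"
    by (rule inj_onI) (simp add: poly_mapping.lookup_inject)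
qed

lemma multihom_add: "multihom J \<delta> p \<Longrightarrow> multihom J \<delta> q \<Longrightarrow> multihom J \<delta> (p + q)"
  using keys_add[of p q] by (auto simp: multihom_def)

text \<open>The complex form with the same integer coefficients, since \<open>multihom\<close> and
  \<open>eval\<close> are only defined over the complex numbers.\<close>

definition cpoly :: "(('v \<Rightarrow>\<^sub>0 nat) \<Rightarrow>\<^sub>0 int) \<Rightarrow> 'v mpoly" where
  "cpoly p = ev of_int p mvar"

lemma cpoly_hom: "comm_ring_hom cpoly"
  unfolding cpoly_def by (rule comm_ring_hom.ev_hom[OF of_int_hom])

lemma lookup_cpoly: "Poly_Mapping.lookup (cpoly p) m = of_int (Poly_Mapping.lookup p m)"
proof -
  have "of_int c * monom_val mvar k = Poly_Mapping.single k (of_int c :: complex)" for c and k :: "'a \<Rightarrow>\<^sub>0 nat"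
    unfolding hom_of_int[OF mconst_hom, symmetric] monom_val_mvar mconst_def mult_single by simp
  then have "cpoly p = (\<Sum>k\<in>Poly_Mapping.keys p. Poly_Mapping.single k (of_int (Poly_Mapping.lookup p k)))"
    by (simp add: cpoly_def ev_def)
  then show ?thesis
    by (simp add: lookup_sum lookup_single when_def in_keys_iff)
qed

lemma cpoly_mvar: "cpoly (mvar i) = mvar i"
  unfolding cpoly_def by (rule ev_mvar_val[OF of_int_hom])

lemma eval_cpoly: "Defs.eval (cpoly p) x = ev of_int p (\<lambda>(b, j). x b j)"
  unfolding eval_eq_ev cpoly_def comm_ring_hom.ev_commute[OF comm_ring_hom.ev_hom[OF comm_ring_hom_id]]
    hom_of_int[OF comm_ring_hom.ev_hom[OF comm_ring_hom_id]] ev_mvar_val[OF comm_ring_hom_id] ..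

lemma topspace_zariski: "topspace (zariski J) = multiproj J"
proof -
  have "multihom J (\<lambda>_. 0) (mconst 1)"
    by (rule multihom_mconst)
  moreover have "hypersurface J (mconst 1) = {}"
  proof -
    have "False" if P: "P \<in> multiproj J" "\<forall>x\<in>P. Defs.eval (mconst 1) x = 0" for P
    proof -
      obtain v where "P = proj_point v"
        using P(1) by (auto simp: multiproj_def)
      then have "Defs.eval (mconst 1) v = 0"
        using P(2) proj_point_self by blast
      then show False
        unfolding eval_eq_ev ev_mconst[OF comm_ring_hom_id] by simp
    qed
    then show ?thesis
      by (auto simp: hypersurface_def)
  qed
  ultimately have "multiproj J \<in> {multiproj J - hypersurface J f | f \<delta>. multihom J \<delta> f}"
    by (intro CollectI exI[of _ "mconst 1"] exI[of _ "\<lambda>_. 0"]) simp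
  then show ?thesis
    unfolding zariski_def topology_generated_by_topspace by blast
qed

lemma closedin_hypersurface:
  fixes p :: "('b::finite \<times> 'j) mpoly"
  assumes "multihom J \<delta> p"
  shows "closedin (zariski J) (hypersurface J p)"
  unfolding closedin_def topspace_zariski
  using zariski_basic_openin[OF assms] by (auto simp: hypersurface_def)

type_synonym ac2 = "bit alg_closure"

lemma char2_ac2: "(1 :: ac2) + 1 = 0"
proof -
  have "to_ac (1 + 1 :: bit) = 1 + 1"
    by (simp only: to_ac_add to_ac_1)
  moreover have "(1 + 1 :: bit) = 0"
    by simp
  ultimately show ?thesis
    by (metis to_ac_0)
qed

lemma of_int_char2:
  assumes "(1 :: 'a::comm_ring_1) + 1 = 0"
  shows "of_int i = (if even i then 0 else 1 :: 'a)"
proof -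
  have two: "of_int (2 * k) = (0 :: 'a)" for k
  proof -
    have "of_int (2 * k) = of_int k * (1 + 1 :: 'a)"
      by (simp only: mult_2 distrib_left mult_1_right of_int_add)
    then show ?thesis
      unfolding assms by simp
  qed
  show ?thesis
  proof (cases "even i")
    case True
    then obtain k where "i = 2 * k"
      by (rule evenE)
    then show ?thesis
      using two by simp
  next
    case False
    then obtain k where "i = 2 * k + 1"
      by (rule oddE)
    then show ?thesis
      using two[of k] by simp
  qed
qed

context conic_params
begin

lemma multihom_special_poly:
  "multihom (case_sum (PP (n - 1)) (PP 2)) (case_sum (\<lambda>_. d) (\<lambda>_. 2)) (cpoly special_poly)"
proof -
  let ?J = "case_sum (PP (n - 1)) (PP 2)" and ?\<delta> = "case_sum (\<lambda>_. d) (\<lambda>_. 2)"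
  let ?x = "\<lambda>i. (mvar (Inl (), i) :: ((unit + unit) \<times> nat) mpoly)" and ?y = "\<lambda>j. (mvar (Inr (), j) :: ((unit + unit) \<times> nat) mpoly)"
  let ?l = "\<lambda>b::unit + unit. (if b = Inl () then 1 else 0 :: nat)" and ?r = "\<lambda>b::unit + unit. (if b = Inr () then 1 else 0 :: nat)"
  have x: "multihom ?J ?l (?x i)" if "i < n" for i
    by (rule multihom_mvar) (use that in \<open>auto simp: PP_def\<close>)
  have y: "multihom ?J ?r (?y j)" if "j \<le> 2" for j
    by (rule multihom_mvar) (use that in \<open>auto simp: PP_def\<close>)
  have cong: "multihom ?J ?\<delta> p" if "multihom ?J \<epsilon> p" "\<epsilon> (Inl ()) = d" "\<epsilon> (Inr ()) = 2" for \<epsilon> p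
  proof -
    have "\<epsilon> = ?\<delta>"
      using that(2,3) by (auto simp: fun_eq_iff split: sum.split)
    then show ?thesis
      using that(1) by simp
  qed
  have cls: "multihom ?J (\<lambda>b. \<Sum>i\<in>cls j. ?l b) (\<Prod>i\<in>cls j. ?x i)" if "j < n" for j
    using cls_sub[OF that] by (intro multihom_prod x) auto
  have trm: "multihom ?J ?\<delta> ((\<Prod>i\<in>cls j. ?x i) * (?x i ^ (2 * rad j) * ?y k ^ 2))"
    if "j < n" "i < n" "k \<le> 2" for i j k
    using multihom_mult[OF cls[OF that(1)] multihom_mult[OF multihom_power[OF x[OF that(2)]] multihom_power[OF y[OF that(3)]]]]
    by (rule cong) (use deg_rad[OF that(1)] in simp_all)
  have xg: "multihom ?J (\<lambda>b. \<Sum>i<n. gam i * ?l b) (xgam ?x)"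
    unfolding xgam_def by (intro multihom_prod multihom_power x) simp
  have 1: "multihom ?J ?\<delta> (xgam ?x * (?y 1 * ?y 2))"
    using multihom_mult[OF xg multihom_mult[OF y[of 1] y[of 2]]] by (rule cong) (use sum_gam in simp_all)
  have 2: "multihom ?J ?\<delta> (xgam ?x * ?y 2 ^ 2)"
    using multihom_mult[OF xg multihom_power[OF y[of 2]]] by (rule cong) (use sum_gam in simp_all)
  have "cpoly special_poly = special ?x (?y 0) (?y 1) (?y 2)"
    unfolding cpoly_def ev_special_poly ..
  moreover have "multihom ?J ?\<delta> (special ?x (?y 0) (?y 1) (?y 2))"
    unfolding special_def distrib_left
    by (intro multihom_add multihom_sum 1 2 trm) (auto simp: cyc_suc_less)
  ultimately show ?thesis
    by simp
qed

text \<open>With all \<open>x\<close> equal to 1 and \<open>y\<close> equal to (0,0,1), the special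
  form has the value 1, which is nonzero modulo 2.\<close>

lemma ex_odd_coefficient: "\<exists>m. odd (Poly_Mapping.lookup special_poly m)"
proof (rule ccontr)
  assume "\<not> ?thesis"
  then have "of_int (Poly_Mapping.lookup special_poly m) = (0 :: ac2)" for m
    by (simp add: of_int_char2[OF char2_ac2])
  then have "ev of_int special_poly v = (0 :: ac2)" for v
    by (simp add: ev_def)
  then have "special (\<lambda>_. 1) 0 0 (1 :: ac2) = 0"
    using ev_special_poly[of "\<lambda>(b, j). case b of Inl _ \<Rightarrow> 1 | Inr _ \<Rightarrow> (if j = 2 then 1 else 0 :: ac2)"] by simp
  then show False
    by (simp add: special_def xgam_def)
qed

text \<open>Outside the zero loci of the forms in \<open>good\<close>, an integer form that vanishes
  at the coefficients of \<open>f\<close> also vanishes modulo 2 at the special ones. So ratios of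
  coefficients have a well-defined partial reduction, which \<open>ex_place\<close> extends to all
  complex numbers.\<close>

theorem very_general_not_stably_rational:
  "for_very_general_hypersurface (case_sum (PP (n - 1)) (PP 2)) (case_sum (\<lambda>_. d) (\<lambda>_. 2))
     (\<lambda>X. \<not> stably_rational (case_sum (PP (n - 1)) (PP 2)) X)"
proof -
  let ?J = "case_sum (PP (n - 1)) (PP 2) :: unit + unit \<Rightarrow> nat set" and ?\<delta> = "case_sum (\<lambda>_. d) (\<lambda>_. 2) :: unit + unit \<Rightarrow> nat"
  let ?K = "coeff_space ?J ?\<delta>"
  have J: "finite (?J b)" for b
    by (cases b) (auto simp: PP_def)
  have K: "finite (?K c)" for c
    unfolding coeff_space_def by (rule finite_monomials[OF J])
  obtain m0 where m0: "odd (Poly_Mapping.lookup special_poly m0)"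
    using ex_odd_coefficient by blast
  have special_keys: "m \<in> monomials ?J ?\<delta>" if "Poly_Mapping.lookup special_poly m \<noteq> 0" for m
  proof -
    have "m \<in> Poly_Mapping.keys (cpoly special_poly)"
      using that by (simp add: in_keys_iff lookup_cpoly)
    then show ?thesis
      using multihom_special_poly by (auto simp: multihom_def)
  qed
  have m0K: "m0 \<in> ?K ()"
  proof -
    have "Poly_Mapping.lookup special_poly m0 \<noteq> 0"
      using m0 by auto
    then show ?thesis
      unfolding coeff_space_def by (rule special_keys)
  qed
  define sp where "sp = (\<lambda>(_::unit, m). (of_int (Poly_Mapping.lookup special_poly m) :: ac2))"
  have sp0: "sp ((), m0) = 1"
    using m0 by (simp add: sp_def of_int_char2[OF char2_ac2])
  define good where "good = {\<Phi>. (\<exists>e. multihom ?K (\<lambda>_. e) (cpoly \<Phi>)) \<and> ev of_int \<Phi> sp \<noteq> 0}"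
  define \<Z> where "\<Z> = (\<lambda>\<Phi>. hypersurface ?K (cpoly \<Phi>)) ` good"
  show ?thesis
    unfolding for_very_general_hypersurface_def
  proof (intro exI[of _ \<Z>] conjI ballI allI impI)
    show "countable \<Z>"
      unfolding \<Z>_def by (rule countable_image) (rule countableI_type)
    fix Z assume "Z \<in> \<Z>"
    then obtain \<Phi> e where \<Phi>: "Z = hypersurface ?K (cpoly \<Phi>)" "multihom ?K (\<lambda>_. e) (cpoly \<Phi>)" "ev of_int \<Phi> sp \<noteq> 0"
      by (auto simp: \<Z>_def good_def)
    show "closedin (zariski ?K) Z"
      unfolding \<Phi>(1) by (rule closedin_hypersurface[OF \<Phi>(2)])
    \<comment> \<open>The special form itself, read over the complex numbers, shows that the closed
      set is proper: the integer value there is nonzero because its residue is.\<close>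
    let ?x = "\<lambda>(_::unit) m. complex_of_int (Poly_Mapping.lookup special_poly m)"
    have "?x \<in> hom_vectors ?K"
      using m0 m0K special_keys by (auto simp: hom_vectors_def coeff_space_def intro!: bexI[of _ m0])
    then have P: "proj_point ?x \<in> multiproj ?K"
      by (auto simp: multiproj_def)
    have "Defs.eval (cpoly \<Phi>) ?x \<noteq> 0"
    proof
      let ?i = "\<lambda>(_::unit, m). Poly_Mapping.lookup special_poly m"
      assume "Defs.eval (cpoly \<Phi>) ?x = 0"
      then have "of_int (ev (\<lambda>c. c) \<Phi> ?i) = (0 :: complex)"
        unfolding eval_cpoly comm_ring_hom.ev_commute[OF of_int_hom] by (simp add: case_prod_unfold)
      then have "ev (\<lambda>c. c) \<Phi> ?i = 0"
        by simp
      then have "of_int (ev (\<lambda>c. c) \<Phi> ?i) = (0 :: ac2)"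
        by simp
      then show False
        using \<Phi>(3) unfolding comm_ring_hom.ev_commute[OF of_int_hom] sp_def by (simp add: case_prod_unfold)
    qed
    then have "proj_point ?x \<notin> Z"
      unfolding \<Phi>(1) hypersurface_def using proj_point_self[of ?x] by blast
    then show "Z \<noteq> multiproj ?K"
      using P by blast
  next
    fix f :: "((unit + unit) \<times> nat) mpoly"
    assume f: "multihom ?J ?\<delta> f \<and> f \<noteq> 0 \<and> param_point f \<notin> \<Union>\<Z>"
    let ?c = "\<lambda>(_::unit, m). Poly_Mapping.lookup f m"
    have f_out: "Poly_Mapping.lookup f m = 0" if "m \<notin> monomials ?J ?\<delta>" for m
      using f that by (auto simp: multihom_def in_keys_iff)
    have "(\<lambda>_. Poly_Mapping.lookup f) \<in> hom_vectors ?K"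
    proof -
      obtain m where "Poly_Mapping.lookup f m \<noteq> 0"
        using f by (metis poly_mapping_eqI lookup_zero)
      then show ?thesis
        using f_out by (auto simp: hom_vectors_def coeff_space_def intro!: bexI[of _ m])
    qed
    then have P: "param_point f \<in> multiproj ?K"
      by (auto simp: multiproj_def param_point_def)
    have nz: "ev of_int \<Phi> ?c \<noteq> 0" if \<Phi>: "\<Phi> \<in> good" for \<Phi>
    proof -
      obtain e where e: "multihom ?K (\<lambda>_. e) (cpoly \<Phi>)"
        using \<Phi> by (auto simp: good_def)
      have "param_point f \<notin> hypersurface ?K (cpoly \<Phi>)"
        using f \<Phi> by (auto simp: \<Z>_def)
      then have "Defs.eval (cpoly \<Phi>) (\<lambda>_. Poly_Mapping.lookup f) \<noteq> 0"
        using nonvanishing_iff[OF e K P] P proj_point_self by (auto simp: param_point_def)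
      then show ?thesis
        by (simp add: eval_cpoly)
    qed
    have cm: "multihom ?K (\<lambda>_. 1) (cpoly (mvar ((), m)))" if "m \<in> monomials ?J ?\<delta>" for m
      using multihom_mvar[of m ?K "()"] that K unfolding cpoly_mvar by (simp add: coeff_space_def)
    define t where "t = Poly_Mapping.lookup f m0"
    have t: "t \<noteq> 0"
    proof -
      have "mvar ((), m0) \<in> good"
        using cm[of m0] m0K sp0 by (auto simp: good_def coeff_space_def ev_mvar_val[OF of_int_hom])
      from nz[OF this] show ?thesis
        by (simp add: t_def ev_mvar_val[OF of_int_hom])
    qed
    \<comment> \<open>Quotients of degree zero with a power of \<open>t\<close> as denominator. The
      coefficient \<open>t\<close> belongs to a monomial with special value 1, so bringing fractions
      to a common denominator does not affect the reduction.\<close>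
    define R where "R a b \<longleftrightarrow> (\<exists>\<Phi> e. multihom ?K (\<lambda>_. e) (cpoly \<Phi>) \<and> a = ev of_int \<Phi> ?c / t ^ e \<and> b = ev of_int \<Phi> sp)"
      for a b
    interpret cp: comm_ring_hom "cpoly :: ((unit \<times> ((unit + unit) \<times> nat \<Rightarrow>\<^sub>0 nat) \<Rightarrow>\<^sub>0 nat) \<Rightarrow>\<^sub>0 int) \<Rightarrow> _"
      by (rule cpoly_hom)
    interpret C: comm_ring_hom "\<lambda>\<Phi>. ev of_int \<Phi> ?c"
      by (rule comm_ring_hom.ev_hom[OF of_int_hom])
    interpret B: comm_ring_hom "\<lambda>\<Phi>. ev of_int \<Phi> sp"
      by (rule comm_ring_hom.ev_hom[OF of_int_hom])
    have RI: "R (ev of_int \<Phi> ?c / t ^ e) (ev of_int \<Phi> sp)" if "multihom ?K (\<lambda>_. e) (cpoly \<Phi>)" for \<Phi> e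
      unfolding R_def using that by blast
    have RE: "\<exists>\<Phi> e. multihom ?K (\<lambda>_. e) (cpoly \<Phi>) \<and> a = ev of_int \<Phi> ?c / t ^ e \<and> b = ev of_int \<Phi> sp" if "R a b" for a b
      using that unfolding R_def .
    have "partial_hom R"
    proof unfold_locales
      show "R 0 0"
        using RI[of 0 0] by (simp add: multihom_def)
      show "R 1 1"
        using RI[of 0 1] multihom_mconst[of ?K 1] by simp
      fix a a' assume "R a a'"
      then obtain \<Phi> e where \<Phi>: "multihom ?K (\<lambda>_. e) (cpoly \<Phi>)" "a = ev of_int \<Phi> ?c / t ^ e" "a' = ev of_int \<Phi> sp"
        using RE by blast
      have "multihom ?K (\<lambda>_. e) (cpoly (- \<Phi>))"
        using \<Phi>(1) by (simp add: multihom_def cp.hom_uminus)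
      from RI[OF this] show "R (- a) (- a')"
        by (simp add: \<Phi> C.hom_uminus B.hom_uminus)
      fix b b' assume "R b b'"
      then obtain \<Psi> e' where \<Psi>: "multihom ?K (\<lambda>_. e') (cpoly \<Psi>)" "b = ev of_int \<Psi> ?c / t ^ e'" "b' = ev of_int \<Psi> sp"
        using RE by blast
      have "multihom ?K (\<lambda>_. e + e') (cpoly (\<Phi> * \<Psi>))"
        using multihom_mult[OF \<Phi>(1) \<Psi>(1)] by (simp add: cp.hom_mult)
      from RI[OF this] show "R (a * b) (a' * b')"
        by (simp add: \<Phi> \<Psi> C.hom_mult B.hom_mult power_add)
      have pw: "multihom ?K (\<lambda>_. k) (cpoly (mvar ((), m0) ^ k))" for k
        using multihom_power[OF cm[of m0], of k] m0K by (simp add: cp.hom_power coeff_space_def)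
      have 1: "multihom ?K (\<lambda>_. e + e') (cpoly \<Phi> * cpoly (mvar ((), m0) ^ e'))"
        by (rule multihom_mult[OF \<Phi>(1) pw])
      have 2: "multihom ?K (\<lambda>_. e + e') (cpoly \<Psi> * cpoly (mvar ((), m0) ^ e))"
        unfolding add.commute[of e e'] by (rule multihom_mult[OF \<Psi>(1) pw])
      have "multihom ?K (\<lambda>_. e + e') (cpoly (\<Phi> * mvar ((), m0) ^ e' + \<Psi> * mvar ((), m0) ^ e))"
        unfolding cp.hom_add cp.hom_mult by (rule multihom_add[OF 1 2])
      from RI[OF this] have "R ((ev of_int \<Phi> ?c * t ^ e' + ev of_int \<Psi> ?c * t ^ e) / t ^ (e + e')) (a' + b')"
        by (simp add: \<Phi>(3) \<Psi>(3) C.hom_add C.hom_mult C.hom_power B.hom_add B.hom_mult B.hom_power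
          ev_mvar_val[OF of_int_hom] sp0 t_def)
      moreover have "(ev of_int \<Phi> ?c * t ^ e' + ev of_int \<Psi> ?c * t ^ e) / t ^ (e + e') = a + b"
        unfolding \<Phi>(2) \<Psi>(2) power_add by (rule add_frac_eq[symmetric]) (simp_all add: t)
      ultimately show "R (a + b) (a' + b')"
        by simp
    next
      fix b assume "R 0 b"
      then obtain \<Phi> e where \<Phi>: "multihom ?K (\<lambda>_. e) (cpoly \<Phi>)" "0 = ev of_int \<Phi> ?c / t ^ e" "b = ev of_int \<Phi> sp"
        using RE by blast
      then have "ev of_int \<Phi> ?c = 0"
        using t by simp
      then show "b = 0"
        using nz[of \<Phi>] \<Phi> by (auto simp: good_def)
    qed
    from ex_place[OF this] obtain Ov h where "place Ov h" and h: "\<And>a b. R a b \<Longrightarrow> a \<in> Ov \<and> h a = b"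
      by blast
    interpret place Ov h
      by fact
    \<comment> \<open>Division by \<open>t\<close> leaves the hypersurface unchanged and moves all
      coefficients into the valuation ring, with the special coefficients as residues.\<close>
    let ?f = "mconst (inverse t) * f"
    have lookup: "Poly_Mapping.lookup ?f m = inverse t * Poly_Mapping.lookup f m" for m
      by (rule lookup_mconst_mult)
    interpret conic_degeneration n d Ov h ?f
    proof unfold_locales
      show "(1 :: ac2) + 1 = 0"
        by (rule char2_ac2)
      show "Poly_Mapping.lookup ?f m \<in> Ov \<and> h (Poly_Mapping.lookup ?f m) = of_int (Poly_Mapping.lookup special_poly m)" for m
      proof (cases "m \<in> monomials ?J ?\<delta>")
        case True
        have "R (Poly_Mapping.lookup f m / t) (of_int (Poly_Mapping.lookup special_poly m))"
          using RI[OF cm[OF True]] by (simp add: ev_mvar_val[OF of_int_hom] sp_def)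
        from h[OF this] show ?thesis
          unfolding lookup divide_inverse mult.commute[of "inverse t"] .
      next
        case False
        then have "Poly_Mapping.lookup special_poly m = 0"
          using special_keys by blast
        then show ?thesis
          using f_out[OF False] zero_O by (simp add: lookup)
      qed
      show "multihom ?J ?\<delta> ?f"
        using multihom_mult[OF multihom_mconst, of ?J ?\<delta> f] f by simp
    qed
    have "hypersurface ?J ?f = hypersurface ?J f"
      using t by (simp add: hypersurface_def eval_mult) (simp add: eval_eq_ev ev_mconst[OF comm_ring_hom_id])
    then show "\<not> stably_rational ?J (hypersurface ?J f)"
      using not_stably_rational by simp
  qed
qed

end

theorem corollary1p2:
  fixes n d :: nat
  assumes "d \<ge> n" and "n \<ge> 3"
  shows "for_very_general_hypersurface
           (case_sum (PP (n - 1)) (PP 2)) (case_sum (\<lambda>_. d) (\<lambda>_. 2))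
           (\<lambda>X. \<not> stably_rational (case_sum (PP (n - 1)) (PP 2)) X)"
  using conic_params.very_general_not_stably_rational[of n d] assms by (simp add: conic_params_def)

end
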